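(* Let $n\ge2$, let $(\mathbf x^\circ,\mathbf b^\circ)\in\mathcal Z_n$ and $u_n^\circ(x)=\frac1n\sum_{i=1}^nb_i^\circ H(x-x_i^\circ)$. Then the viscosity solution $v$ of (HJ$_\varepsilon$) with $\varepsilon=\frac1n$ which satisfies $v^*(0,\cdot)=(u_n^\circ)^*$ and $v_*(0,\cdot)=(u_n^\circ)_*$ is unique; that is, such a viscosity solution exists, and any two of them have the same upper semicontinuous envelope and the same lower semicontinuous envelope on $Q$.
   Context: $H$ is the Heaviside function with $H(0)=1$. $\mathcal Z_n:=\{(\mathbf x,\mathbf b)\in\mathbb R^n\times\{-1,0,+1\}^n:\ i>j,\ b_ib_j\ne0\Rightarrow x_i>x_j\}$. $Q=(0,\infty)\times\mathbb R$, $B_\rho=(-\rho,\rho)$. For $\varepsilon>0$ let $E_\varepsilon(\alpha)=\varepsilon(\lfloor\alpha/\varepsilon\rfloor+\frac12)$; its upper and lower semicontinuous envelopes are $E_\varepsilon^*=E_\varepsilon$ and $E_{\varepsilon,*}(\alpha)=\varepsilon\lceil\alpha/\varepsilon\rceil-\frac\varepsilon2$. $\mathrm{pv}\int_{B_\rho}$ means $\lim_{r\to0}\int_{B_\rho\setminus B_r}$. (HJ$_\varepsilon$) is formally $u_t=\mathcal M_\varepsilon[u]\,|u_x|$ with $\mathcal M_\varepsilon[w](x)=\int_{\mathbb R}E_\varepsilon[w(x+z)-w(x)]\frac{dz}{z^2}$. For $\rho>0$, $u$ bounded, $\phi\in C^2(Q)$ with $\phi_x(t,x)\ne0$, set $$\overline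 H_{\rho,\varepsilon}[\phi,u](t,x)=|\phi_x(t,x)|\Big(\mathrm{pv}\!\int_{B_\rho}E^*_\varepsilon[\phi(t,x+z)-\phi(t,x)]\tfrac{dz}{z^2}+\int_{\mathbb R\setminus B_\rho}E^*_\varepsilon[u(t,x+z)-u(t,x)]\tfrac{dz}{z^2}\Big),$$ and $\underline H_{\rho,\varepsilon}[\phi,u]$ by the same formula with $E_{\varepsilon,*}$ in place of $E^*_\varepsilon$. A bounded upper semicontinuous $u:Q\to\mathbb R$ is a subsolution of (HJ$_\varepsilon$) if, whenever $\phi\in C^2(Q)$ and $u-\phi$ has a global maximum at $(\bar t,\bar x)\in Q$: if $\phi_x(\bar t,\bar x)\ne0$ then $\phi_t(\bar t,\bar x)\le\overline H_{\rho,\varepsilon}[\phi,u](\bar t,\bar x)$; if $\phi(t,x)=c|x-\bar x|^4+g(t)$ for some $c\in\mathbb R$ and some $g$, then $\phi_t(\bar t,\bar x)\le0$; otherwise no condition. A bounded lower semicontinuous $v:Q\to\mathbb R$ is a supersolution if, whenever $\psi\in C^2(Q)$ and $v-\psi$ has a global minimum at $(\bar t,\bar x)\in Q$: if $\psi_x(\bar t,\bar x)\ne0$ then $\psi_t(\bar t,\bar x)\ge\underline H_{\rho,\varepsilon}[\psi,v](\bar t,\bar x)$; if $\psi(t,x)=c|x-\bar x|^4+g(t)$ then $\psi_t(\bar t,\bar x)\ge0$; otherwise no condition. These notions do not depend on the choice of $\rho>0$. $u^*$ and $u_*$ denote the upper and lower semicontinuous envelopes in all variables; for $u$ on $Q$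 they are extended to $t=0$ by $u^*(0,x)=\limsup_{(s,y)\to(0,x)}u(s,y)$, $u_*(0,x)=\liminf_{(s,y)\to(0,x)}u(s,y)$. A function $u$ is a viscosity solution of (HJ$_\varepsilon$) if $u^*$ is a subsolution and $u_*$ is a supersolution. *)

theory Defs
  imports "HOL-Analysis.Analysis"
begin

definition heaviside :: "real \<Rightarrow> real" where
  "heaviside x = (if x \<ge> 0 then 1 else 0)"

text \<open>Vectors indexed by \<open>1, \<dots>, n\<close> are functions on \<open>nat\<close> of which only the entries with
  index in \<open>{1..n}\<close> are ever read.\<close>

definition state_space :: "nat \<Rightarrow> ((nat \<Rightarrow> real) \<times> (nat \<Rightarrow> int)) set" where
  "state_space n = {(x, b). b \<in> {1..n} \<rightarrow> {-1, 0, 1} \<and>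
     (\<forall>i\<in>{1..n}. \<forall>j\<in>{1..n}. i > j \<and> b i * b j \<noteq> 0 \<longrightarrow> x i > x j)}"

definition initial_datum :: "nat \<Rightarrow> (nat \<Rightarrow> real) \<Rightarrow> (nat \<Rightarrow> int) \<Rightarrow> real \<Rightarrow> real" where
  "initial_datum n x b y = 1 / real n * (\<Sum>i=1..n. real_of_int (b i) * heaviside (y - x i))"

definition Q :: "(real \<times> real) set" where
  "Q = {0<..} \<times> UNIV"

text \<open>Semicontinuous envelopes of a function on \<open>S\<close>, evaluated at an arbitrary point \<open>p\<close>. The filter
  \<open>inf (nhds p) (principal S)\<close> does not remove \<open>p\<close> when \<open>p \<in> S\<close>, which gives the usual envelopes on
  \<open>S\<close>; at a boundary point \<open>p \<notin> S\<close> they are the limsup and liminf along \<open>S\<close>. The values are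
  extended reals since the function need not be locally bounded.\<close>

definition usc_envelope :: "'a::topological_space set \<Rightarrow> ('a \<Rightarrow> real) \<Rightarrow> 'a \<Rightarrow> ereal" where
  "usc_envelope S u p = Limsup (inf (nhds p) (principal S)) (\<lambda>q. ereal (u q))"

definition lsc_envelope :: "'a::topological_space set \<Rightarrow> ('a \<Rightarrow> real) \<Rightarrow> 'a \<Rightarrow> ereal" where
  "lsc_envelope S u p = Liminf (inf (nhds p) (principal S)) (\<lambda>q. ereal (u q))"

definition usc_on :: "'a::topological_space set \<Rightarrow> ('a \<Rightarrow> real) \<Rightarrow> bool" where
  "usc_on S u \<longleftrightarrow> (\<forall>a. openin (top_of_set S) {p \<in> S. u p < a})"

definition lsc_on :: "'a::topological_space set \<Rightarrow> ('a \<Rightarrow> real) \<Rightarrow> bool" where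
  "lsc_on S u \<longleftrightarrow> (\<forall>a. openin (top_of_set S) {p \<in> S. u p > a})"

text \<open>Twice continuously differentiable, for an open set \<open>S\<close>.\<close>

definition C2_on :: "'a::real_normed_vector set \<Rightarrow> ('a \<Rightarrow> real) \<Rightarrow> bool" where
  "C2_on S f \<longleftrightarrow> (\<exists>(f' :: 'a \<Rightarrow> 'a \<Rightarrow>\<^sub>L real) (f'' :: 'a \<Rightarrow> 'a \<Rightarrow>\<^sub>L 'a \<Rightarrow>\<^sub>L real).
     (\<forall>p\<in>S. (f has_derivative blinfun_apply (f' p)) (at p)) \<and>
     (\<forall>p\<in>S. (f' has_derivative blinfun_apply (f'' p)) (at p)) \<and>
     continuous_on S f'')"

definition d_t :: "(real \<times> real \<Rightarrow> real) \<Rightarrow> real \<Rightarrow> real \<Rightarrow> real" where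
  "d_t \<phi> t x = deriv (\<lambda>s. \<phi> (s, x)) t"

definition d_x :: "(real \<times> real \<Rightarrow> real) \<Rightarrow> real \<Rightarrow> real \<Rightarrow> real" where
  "d_x \<phi> t x = deriv (\<lambda>y. \<phi> (t, y)) x"

text \<open>The staircase \<open>E\<^sub>\<epsilon>\<close>, which is its own upper semicontinuous envelope, and its lower
  semicontinuous envelope.\<close>

definition E_upper :: "real \<Rightarrow> real \<Rightarrow> real" where
  "E_upper \<epsilon> \<alpha> = \<epsilon> * (of_int \<lfloor>\<alpha> / \<epsilon>\<rfloor> + 1 / 2)"

definition E_lower :: "real \<Rightarrow> real \<Rightarrow> real" where
  "E_lower \<epsilon> \<alpha> = \<epsilon> * of_int \<lceil>\<alpha> / \<epsilon>\<rceil> - \<epsilon> / 2"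

definition pv_integral :: "real \<Rightarrow> (real \<Rightarrow> real) \<Rightarrow> real" where
  "pv_integral \<rho> f = Lim (at_right 0) (\<lambda>r. LBINT z:{-\<rho><..<\<rho>} - {-r<..<r}. f z)"

text \<open>\<open>hamiltonian (E_upper \<epsilon>)\<close> and \<open>hamiltonian (E_lower \<epsilon>)\<close> are the upper and the lower
  Hamiltonian.\<close>

definition hamiltonian ::
  "(real \<Rightarrow> real) \<Rightarrow> real \<Rightarrow> (real \<times> real \<Rightarrow> real) \<Rightarrow> (real \<times> real \<Rightarrow> real) \<Rightarrow> real \<Rightarrow> real \<Rightarrow> real" where
  "hamiltonian e \<rho> \<phi> u t x = \<bar>d_x \<phi> t x\<bar> *
     (pv_integral \<rho> (\<lambda>z. e (\<phi> (t, x + z) - \<phi> (t, x)) / z\<^sup>2) +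
      (LBINT z:- {-\<rho><..<\<rho>}. e (u (t, x + z) - u (t, x)) / z\<^sup>2))"

definition subsolution :: "real \<Rightarrow> real \<Rightarrow> (real \<times> real \<Rightarrow> real) \<Rightarrow> bool" where
  "subsolution \<rho> \<epsilon> u \<longleftrightarrow>
     bounded (u ` Q) \<and> usc_on Q u \<and>
     (\<forall>\<phi> t x. C2_on Q \<phi> \<and> (t, x) \<in> Q \<and> (\<forall>q\<in>Q. u q - \<phi> q \<le> u (t, x) - \<phi> (t, x)) \<longrightarrow>
        (d_x \<phi> t x \<noteq> 0 \<longrightarrow> d_t \<phi> t x \<le> hamiltonian (E_upper \<epsilon>) \<rho> \<phi> u t x) \<and>
        ((\<exists>c g. \<forall>(s, y)\<in>Q. \<phi> (s, y) = c * \<bar>y - x\<bar> ^ 4 + g s) \<longrightarrow> d_t \<phi> t x \<le> 0))"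

definition supersolution :: "real \<Rightarrow> real \<Rightarrow> (real \<times> real \<Rightarrow> real) \<Rightarrow> bool" where
  "supersolution \<rho> \<epsilon> v \<longleftrightarrow>
     bounded (v ` Q) \<and> lsc_on Q v \<and>
     (\<forall>\<psi> t x. C2_on Q \<psi> \<and> (t, x) \<in> Q \<and> (\<forall>q\<in>Q. v (t, x) - \<psi> (t, x) \<le> v q - \<psi> q) \<longrightarrow>
        (d_x \<psi> t x \<noteq> 0 \<longrightarrow> d_t \<psi> t x \<ge> hamiltonian (E_lower \<epsilon>) \<rho> \<psi> v t x) \<and>
        ((\<exists>c g. \<forall>(s, y)\<in>Q. \<psi> (s, y) = c * \<bar>y - x\<bar> ^ 4 + g s) \<longrightarrow> d_t \<psi> t x \<ge> 0))"

text \<open>The functions \<open>U\<close> and \<open>L\<close> are the envelopes of \<open>u\<close> on \<open>Q\<close> as real-valued functions; their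
  existence says that the envelopes are finite.\<close>

definition viscosity_solution :: "real \<Rightarrow> real \<Rightarrow> (real \<times> real \<Rightarrow> real) \<Rightarrow> bool" where
  "viscosity_solution \<rho> \<epsilon> u \<longleftrightarrow>
     (\<exists>U. (\<forall>p\<in>Q. usc_envelope Q u p = ereal (U p)) \<and> subsolution \<rho> \<epsilon> U) \<and>
     (\<exists>L. (\<forall>p\<in>Q. lsc_envelope Q u p = ereal (L p)) \<and> supersolution \<rho> \<epsilon> L)"

definition has_initial_datum :: "(real \<times> real \<Rightarrow> real) \<Rightarrow> (real \<Rightarrow> real) \<Rightarrow> bool" where
  "has_initial_datum u u0 \<longleftrightarrow>
     (\<forall>x. usc_envelope Q u (0, x) = usc_envelope UNIV u0 x \<and>
          lsc_envelope Q u (0, x) = lsc_envelope UNIV u0 x)"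

end

theory Submission
  imports Defs
begin

text \<open>Up to the principal value, a subsolution is characterized by the parabolas touching it from above, and
  in this form suprema of subsolutions, increasing changes of the unknown that commute with the translation
  by \<open>eps\<close>, and Perron's method are available. Changes of the unknown show that the maximal subsolution
  \<open>U\<close> below the datum and, dually, the minimal supersolution \<open>W\<close> above it take values in the multiples of
  \<open>eps\<close>, and the bump construction gives \<open>W <= U\<close>. Since a plateau of an integer-valued sub- or
  supersolution persists for a short time, \<open>U = W\<close> away from the jumps of the datum just after the initial
  time, and a doubling of variables in which only one side of a jump is penalized shows that near each jump
  \<open>U (t, x) <= W (t, x')\<close> whenever \<open>x'\<close> lies on the correct side of \<open>x\<close>. So \<open>U\<close> and \<open>W\<close> have the same
  envelopes. This continues through times of annihilation, because the variation does not increase and spikes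
  at a single point disappear at once. Every solution lies between \<open>W\<close> and \<open>U\<close>.\<close>

section \<open>Truncated singular integrals\<close>

text \<open>The usual comparison principle \<open>U <= W\<close> is out of reach: at a jump of the
  datum the two envelopes differ already at time 0, and they keep differing along each moving jump.
  What can hold is that values of \<open>U\<close> are bounded by values of \<open>W\<close> at
  nearby points, and this is what uniqueness of the envelopes needs. The discontinuity of the
  staircase is tamed by integrality: for multiples of \<open>eps\<close> one has
  \<open>E_upper eps a = a + eps / 2\<close>, so at a maximal gap \<open>m\<close> of the doubled
  problem the two nonlocal terms add up to the integral of (gap at the shifted points)
  \<open>- m + eps\<close>. A gap smaller than \<open>m\<close> is at most \<open>m - eps\<close>,
  which makes the integrand nonpositive, and equality is confined to a countable set. Jumps of
  opposite sign would have to be shifted in opposite directions, which leaves an error linear in the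
  shift. The time steps obtained in this way depend on the distance between jumps and shrink towards
  a collision, so a bound on the number of jumps that survives the limit is carried along.\<close>

definition kint :: "real => (real => real) => real" where
  "kint r f = (LBINT z:{z. r <= abs z}. f z / z^2)"

lemma kernel_half_line:
  fixes r :: real
  assumes "0 < r"
  shows "set_integrable lborel {r..} (%z. 1 / z^2)" "(LBINT z:{r..}. 1 / z^2) = 1 / r"
proof -
  have "(\<integral>\<^sup>+x. ennreal (1 / x^2) * indicator {r..} x \<partial>lborel) = ennreal (0 - (- 1 / r))"
  proof (rule nn_integral_FTC_atLeast)
    show "((%x. - 1 / x :: real) \<longlongrightarrow> 0) at_top"
      by (intro tendsto_divide_0[OF tendsto_const] filterlim_at_top_imp_at_infinity filterlim_ident)
    show "DERIV (%x. - 1 / x) x :> 1 / x^2" if "r <= x" for x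
      using that assms by (auto intro!: derivative_eq_intros simp: power2_eq_square)
  qed auto
  also have "(%x. ennreal (1 / x^2) * indicator {r..} x) = (%x. ennreal (indicator {r..} x *\<^sub>R (1 / x^2)))"
    by (auto simp: fun_eq_iff indicator_def)
  finally have nn: "(\<integral>\<^sup>+x. ennreal (indicator {r..} x *\<^sub>R (1 / x^2)) \<partial>lborel) = ennreal (1 / r)"
    by simp
  have "has_bochner_integral lborel (%x. indicator {r..} x *\<^sub>R (1 / x^2)) (1 / r)"
    by (rule has_bochner_integral_nn_integral[OF _ _ _ nn]) (use assms in auto)
  then show "set_integrable lborel {r..} (%z. 1 / z^2)" "(LBINT z:{r..}. 1 / z^2) = 1 / r"
    unfolding set_integrable_def set_lebesgue_integral_def
    by (auto simp: has_bochner_integral_iff)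
qed

lemma kernel_integrable:
  assumes "0 < r"
  shows "set_integrable lborel {z. r <= abs z} (%z. 1 / z^2)" "kint r (%_. 1) = 2 / r"
proof -
  have i: "set_integrable lborel {..-r} (%z. 1 / z^2)" "(LBINT z:{..-r}. 1 / z^2) = 1 / r"
  proof -
    have ind: "indicator {r..} (0 + (-1) * x) = (indicator {..-r} x :: real)" for x :: real
      by (auto simp: indicator_def)
    have "integrable lborel (%x. indicator {r..} (0 + (-1) * x) *\<^sub>R (1 / (0 + (-1) * x)^2))"
      by (rule lborel_integrable_real_affine)
         (use kernel_half_line[OF assms] in \<open>simp_all add: set_integrable_def\<close>)
    then show "set_integrable lborel {..-r} (%z. 1 / z^2)"
      unfolding set_integrable_def ind by simp
    have "(LBINT z:{r..}. 1 / z^2) = abs (-1) *\<^sub>R (\<integral>x. indicator {r..} (0 + (-1) * x) *\<^sub>R (1 / (0 + (-1) * x)^2) \<partial>lborel)"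
      unfolding set_lebesgue_integral_def by (rule lborel_integral_real_affine) simp
    then show "(LBINT z:{..-r}. 1 / z^2) = 1 / r"
      using kernel_half_line[OF assms] unfolding ind by (simp add: set_lebesgue_integral_def)
  qed
  have s: "{z. r <= abs z} = {..-r} \<union> {r..}" by auto
  show "set_integrable lborel {z. r <= abs z} (%z. 1 / z^2)"
    unfolding s using i kernel_half_line[OF assms] by (intro set_integrable_Un) auto
  show "kint r (%_. 1) = 2 / r"
    unfolding kint_def s using i kernel_half_line[OF assms] assms
    by (subst set_integral_Un) auto
qed

lemma kint_integrable:
  fixes f :: "real => real"
  assumes "0 < r" "f \<in> borel_measurable borel" "!!z. r <= abs z ==> abs (f z) <= B"
  shows "set_integrable lborel {z. r <= abs z} (%z. f z / z^2)"
proof -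
  have "set_integrable lborel {z. r <= abs z} (%z. B * (1 / z^2))"
    by (rule set_integrable_mult_right) (rule kernel_integrable[OF assms(1)])
  then show ?thesis
    unfolding set_integrable_def
  proof (rule Bochner_Integration.integrable_bound)
    show "(%x. indicat_real {z. r <= abs z} x *\<^sub>R (f x / x^2)) \<in> borel_measurable lborel"
      using assms(2) by measurable
    show "AE x in lborel. norm (indicat_real {z. r <= abs z} x *\<^sub>R (f x / x^2))
        <= norm (indicat_real {z. r <= abs z} x *\<^sub>R (B * (1 / x^2)))"
    proof (rule AE_I2)
      fix x
      have "abs (f x) <= abs B" if "r <= abs x" using assms(3)[OF that] by linarith
      then show "norm (indicat_real {z. r <= abs z} x *\<^sub>R (f x / x^2))
        <= norm (indicat_real {z. r <= abs z} x *\<^sub>R (B * (1 / x^2)))"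
        by (auto simp: indicator_def abs_mult divide_right_mono)
    qed
  qed
qed

lemma kint_mono_AE:
  assumes "0 < r" "f \<in> borel_measurable borel" "!!z. r <= abs z ==> abs (f z) <= B"
    and "g \<in> borel_measurable borel" "!!z. r <= abs z ==> abs (g z) <= B'"
    and "AE z in lborel. r <= abs z --> f z <= g z"
  shows "kint r f <= kint r g"
  unfolding kint_def set_lebesgue_integral_def
proof (rule integral_mono_AE)
  show "integrable lborel (%x. indicat_real {z. r <= abs z} x *\<^sub>R (f x / x^2))"
    "integrable lborel (%x. indicat_real {z. r <= abs z} x *\<^sub>R (g x / x^2))"
    using kint_integrable[OF assms(1-3)] kint_integrable[OF assms(1,4,5)]
    unfolding set_integrable_def by auto
  show "AE x in lborel. indicat_real {z. r <= abs z} x *\<^sub>R (f x / x^2)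
      <= indicat_real {z. r <= abs z} x *\<^sub>R (g x / x^2)"
    using assms(6) by eventually_elim (auto simp: indicator_def divide_right_mono)
qed

lemma kint_mono:
  assumes "0 < r" "f \<in> borel_measurable borel" "!!z. r <= abs z ==> abs (f z) <= B"
    and "g \<in> borel_measurable borel" "!!z. r <= abs z ==> abs (g z) <= B'"
    and "!!z. r <= abs z ==> f z <= g z"
  shows "kint r f <= kint r g"
  by (rule kint_mono_AE[OF assms(1-5)]) (use assms(6) in auto)

lemma kint_add:
  assumes "0 < r" "f \<in> borel_measurable borel" "!!z. r <= abs z ==> abs (f z) <= B"
    and "g \<in> borel_measurable borel" "!!z. r <= abs z ==> abs (g z) <= B'"
  shows "kint r (%z. f z + g z) = kint r f + kint r g"
  unfolding kint_def
  using set_integral_add(2)[OF kint_integrable[OF assms(1-3)] kint_integrable[OF assms(1,4,5)]]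
  by (simp add: add_divide_distrib)

lemma kint_cmult: "kint r (%z. c * f z) = c * kint r f"
  unfolding kint_def set_integral_mult_right[symmetric] by (simp add: mult.assoc)

lemma kint_uminus: "kint r (%z. - f z) = - kint r f"
  using kint_cmult[of r "-1" f] by simp

lemma kint_const: "0 < r ==> kint r (%_. c) = c * (2 / r)"
  using kint_cmult[of r c "%_. 1"] kernel_integrable(2)[of r] by simp

lemma kint_cong: "(!!z. r <= abs z ==> f z = g z) ==> kint r f = kint r g"
  unfolding kint_def by (intro set_lebesgue_integral_cong) auto

lemma kint_odd:
  assumes "!!z. f (- z) = - f z"
  shows "kint r f = 0"
proof -
  have ind: "indicator {z. r <= abs z} (0 + (-1) * x) = (indicator {z. r <= abs z} x :: real)" for x :: real
    by (auto simp: indicator_def)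
  have "kint r f = abs (-1) *\<^sub>R (\<integral>x. indicator {z. r <= abs z} (0 + (-1) * x) *\<^sub>R (f (0 + (-1) * x) / (0 + (-1) * x)^2) \<partial>lborel)"
    unfolding kint_def set_lebesgue_integral_def by (rule lborel_integral_real_affine) simp
  also have "\<dots> = - kint r f"
    unfolding kint_def set_lebesgue_integral_def ind by (simp add: assms)
  finally show ?thesis by simp
qed

lemma kint_restrict:
  assumes "r' <= r"
  shows "kint r f = kint r' (%z. if r <= abs z then f z else 0)"
  unfolding kint_def set_lebesgue_integral_def
  by (rule Bochner_Integration.integral_cong) (use assms in \<open>auto simp: indicator_def\<close>)

lemma kint_diff_radius:
  assumes "0 < r'" "r' <= r" "f \<in> borel_measurable borel" "!!z. r' <= abs z ==> abs (f z) <= B"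
  shows "kint r' f = kint r f + kint r' (%z. if abs z < r then f z else 0)"
proof -
  have B: "0 <= B" using assms(4)[of r'] assms(1) by (auto intro: order_trans[OF abs_ge_zero])
  have "kint r' f = kint r' (%z. (if r <= abs z then f z else 0) + (if abs z < r then f z else 0))"
    by (rule kint_cong) auto
  also have "\<dots> = kint r' (%z. if r <= abs z then f z else 0) + kint r' (%z. if abs z < r then f z else 0)"
    using assms B by (intro kint_add[where B = B and B' = B]) auto
  finally show ?thesis using kint_restrict[OF assms(2), of f] by simp
qed

text \<open>An odd function has integral zero over the annulus between the two radii, so an odd
  majorant there means that the annulus contributes nothing positive. This replaces every use of a
  principal value.\<close>

lemma kint_sgn_le:
  assumes "0 < r'" "r' <= r" "f \<in> borel_measurable borel" "!!z. r' <= abs z ==> abs (f z) <= B"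
    and "!!z. r' <= abs z ==> abs z < r ==> f z <= c * sgn (p * z)"
  shows "kint r' f <= kint r f"
proof -
  have "kint r' (%z. if abs z < r then f z else 0) <= kint r' (%z. if abs z < r then c * sgn (p * z) else 0)"
  proof (rule kint_mono[where B = "abs B" and B' = "abs c"])
    show "abs (if abs z < r then f z else 0) <= abs B" if "r' <= abs z" for z
      using assms(4)[OF that] by auto
    show "abs (if abs z < r then c * sgn (p * z) else 0) <= abs c" for z
      by (auto simp: abs_mult sgn_if)
  qed (use assms in auto)
  also have "\<dots> = 0" by (rule kint_odd) auto
  finally show ?thesis using kint_diff_radius[OF assms(1-4)] by simp
qed

lemma kint_sgn_ge:
  assumes "0 < r'" "r' <= r" "f \<in> borel_measurable borel" "!!z. r' <= abs z ==> abs (f z) <= B"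
    and "!!z. r' <= abs z ==> abs z < r ==> c * sgn (p * z) <= f z"
  shows "kint r f <= kint r' f"
proof -
  have "kint r' (%z. - f z) <= kint r (%z. - f z)"
    by (rule kint_sgn_le[where B = B and c = c and p = "-p"]) (use assms in auto)
  then show ?thesis by (simp add: kint_uminus)
qed

lemma kint_sgn_bound:
  assumes "0 < r" "r < z0" "f \<in> borel_measurable borel" "!!z. abs (f z) <= B"
    and "!!z. z ~= 0 ==> abs z < z0 ==> f z <= c * sgn (p * z)"
    and "!!z. f z <= F"
  shows "kint r f <= 2 * F / z0"
proof -
  have "kint r f <= kint z0 f"
    by (rule kint_sgn_le[where B = B and c = c and p = p]) (use assms in auto)
  also have "\<dots> <= kint z0 (%_. F)"
    using assms by (intro kint_mono[where B = B and B' = "abs F"]) auto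
  finally show ?thesis using assms by (simp add: kint_const mult.commute)
qed

text \<open>A Fatou-type bound in which only an upper limit is known pointwise, as is natural for
  semicontinuous integrands. The sphere \<open>abs z = r\<close> may be left out because it is a
  null set.\<close>

lemma kint_limsup:
  fixes f :: "nat => real => real"
  assumes "0 < r" "!!n. f n \<in> borel_measurable borel" "!!n z. r <= abs z ==> abs (f n z) <= B"
    and g: "g \<in> borel_measurable borel" "!!z. r <= abs z ==> abs (g z) <= B"
    and lim: "!!z e. r < abs z ==> 0 < e ==> eventually (%n. f n z <= g z + e) sequentially"
    and "0 < e"
  shows "eventually (%n. kint r (f n) <= kint r g + e) sequentially"
proof -
  \<comment> \<open>Taking the maximum with \<open>g\<close> turns the one-sided bound into
    convergence, so dominated convergence applies.\<close>
  define h where "h n z = max (f n z) (g z)" for n z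
  have hB: "abs (h n z) <= B" if "r <= abs z" for n z
    using assms(3)[OF that, of n] g(2)[OF that] by (auto simp: h_def max_def)
  have hm: "h n \<in> borel_measurable borel" for n
    unfolding h_def using assms(2) g(1) by measurable
  have hlim: "(%n. h n z) \<longlonglongrightarrow> g z" if "r < abs z" for z
  proof (rule tendstoI)
    fix e :: real assume "0 < e"
    with lim[OF that, of "e/2"] have "eventually (%n. f n z <= g z + e / 2) sequentially" by simp
    then show "eventually (%n. dist (h n z) (g z) < e) sequentially"
      by eventually_elim (use \<open>0 < e\<close> in \<open>auto simp: h_def dist_real_def max_def\<close>)
  qed
  have "(%n. kint r (h n)) \<longlonglongrightarrow> kint r g"
    unfolding kint_def set_lebesgue_integral_def
  proof (rule integral_dominated_convergence)
    show "integrable lborel (%x. indicator {z. r <= abs z} x *\<^sub>R (B * (1 / x^2)))"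
      using set_integrable_mult_right[of B lborel "{z. r <= abs z}" "%z. 1 / z^2"] kernel_integrable[OF assms(1)]
      unfolding set_integrable_def by simp
    have "AE x in lborel. x ~= r & x ~= -r"
      by (auto intro: AE_lborel_singleton)
    then show "AE x in lborel. (%i. indicat_real {z. r <= abs z} x *\<^sub>R (h i x / x^2))
         \<longlonglongrightarrow> indicat_real {z. r <= abs z} x *\<^sub>R (g x / x^2)"
    proof eventually_elim
      case (elim x)
      show ?case
      proof (cases "r < abs x")
        case True
        then show ?thesis
          using \<open>0 < r\<close> by (intro tendsto_intros hlim) auto
      next
        case False
        then have "~ r <= abs x" using elim by (auto simp: abs_if split: if_splits)
        then show ?thesis by simp
      qed
    qed
    show "AE x in lborel. norm (indicat_real {z. r <= abs z} x *\<^sub>R (h i x / x^2))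
         <= indicat_real {z. r <= abs z} x *\<^sub>R (B * (1 / x^2))" for i
      using hB[of _ i] by (auto simp: indicator_def divide_right_mono)
  qed (use g(1) hm in measurable)
  then have "eventually (%n. dist (kint r (h n)) (kint r g) < e) sequentially"
    using \<open>0 < e\<close> by (rule tendstoD)
  then show ?thesis
  proof eventually_elim
    case (elim n)
    have "kint r (f n) <= kint r (h n)"
      by (rule kint_mono[where B = B and B' = B]) (use assms hB hm in \<open>auto simp: h_def\<close>)
    then show ?case using elim by (auto simp: dist_real_def)
  qed
qed

section \<open>Subsolutions in terms of jets\<close>

lemma E_upper_ge_iff:
  assumes "0 < eps"
  shows "eps * (of_int k + 1 / 2) <= E_upper eps a \<longleftrightarrow> eps * of_int k <= a"
proof -
  have "eps * (of_int k + 1 / 2) <= E_upper eps a \<longleftrightarrow> k <= \<lfloor>a / eps\<rfloor>"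
    using assms by (simp add: E_upper_def)
  also have "\<dots> \<longleftrightarrow> eps * of_int k <= a"
    using assms by (simp add: le_floor_iff field_simps)
  finally show ?thesis .
qed

lemma E_upper_mono: "0 < eps ==> a <= b ==> E_upper eps a <= E_upper eps b"
  by (simp add: E_upper_def floor_mono divide_right_mono)

lemma E_upper_bounds:
  assumes "0 < eps"
  shows "E_upper eps a <= a + eps / 2" "a - eps / 2 < E_upper eps a" "abs (E_upper eps a) <= abs a + eps / 2"
proof -
  have "of_int \<lfloor>a / eps\<rfloor> <= a / eps" "a / eps < of_int \<lfloor>a / eps\<rfloor> + 1" by linarith+
  then have "of_int \<lfloor>a / eps\<rfloor> * eps <= a" "a < (of_int \<lfloor>a / eps\<rfloor> + 1) * eps"
    using pos_le_divide_eq[OF assms] pos_divide_less_eq[OF assms] by blast+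
  then show "E_upper eps a <= a + eps / 2" "a - eps / 2 < E_upper eps a" "abs (E_upper eps a) <= abs a + eps / 2"
    by (auto simp: E_upper_def algebra_simps)
qed

lemma E_upper_less:
  assumes "0 < eps" "a < eps * of_int k"
  shows "E_upper eps a <= eps * (of_int k - 1 / 2)"
proof -
  have "\<lfloor>a / eps\<rfloor> < k" using assms by (simp add: floor_less_iff field_simps)
  then have "of_int \<lfloor>a / eps\<rfloor> <= (of_int k - 1 :: real)" by linarith
  then have "of_int \<lfloor>a / eps\<rfloor> + 1/2 <= (of_int k - 1/2 :: real)" by linarith
  then show ?thesis using assms by (simp add: E_upper_def)
qed

lemma E_upper_signs:
  assumes "0 < eps"
  shows "a < eps ==> E_upper eps a <= eps / 2" "a < 0 ==> E_upper eps a <= - eps / 2"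
    "0 <= a ==> eps / 2 <= E_upper eps a" "- eps <= a ==> - eps / 2 <= E_upper eps a"
  using E_upper_less[OF assms, of a 1] E_upper_less[OF assms, of a 0]
    E_upper_ge_iff[OF assms, of 0 a] E_upper_ge_iff[OF assms, of "-1" a]
  by (auto simp: algebra_simps)

text \<open>The next discontinuity of the staircase lies strictly above \<open>a\<close>. Below it
  monotonicity gives upper semicontinuity without any loss in the value.\<close>

lemma E_upper_usc:
  assumes "0 < eps"
  obtains eta where "0 < eta" "!!b. b < a + eta ==> E_upper eps b <= E_upper eps a"
proof
  define k where "k = \<lfloor>a / eps\<rfloor>"
  have "a / eps < of_int k + 1" unfolding k_def by linarith
  then show "0 < eps * (of_int k + 1) - a" using assms by (simp add: field_simps)
  show "E_upper eps b <= E_upper eps a" if "b < a + (eps * (of_int k + 1) - a)" for b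
    using E_upper_less[OF assms, of b "k + 1"] that assms
    by (simp add: E_upper_def k_def algebra_simps)
qed

lemma E_upper_int: "0 < eps ==> a / eps \<in> \<int> ==> E_upper eps a = a + eps / 2"
  by (auto simp: E_upper_def algebra_simps elim!: Ints_cases)

lemma E_upper_measurable [measurable]: "E_upper eps \<in> borel_measurable borel"
  unfolding E_upper_def[abs_def] by measurable

lemma E_lower_uminus:
  shows "E_lower eps a = - E_upper eps (- a)"
  by (simp add: E_lower_def E_upper_def ceiling_def algebra_simps)

text \<open>If every value were exceeded at some \<open>n q\<close>, semicontinuity would give a
  ball around each \<open>q\<close> on which \<open>F\<close> stays below \<open>F (n q)\<close>; in
  a finite subcover the largest of these bounds contradicts itself.\<close>

lemma usc_attains:
  fixes F :: "'a::metric_space => real"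
  assumes "compact K" "K ~= {}"
    and usc: "!!q c. q \<in> K ==> F q < c ==> EX d>0. \<forall>q'\<in>K. dist q' q < d --> F q' < c"
  shows "\<exists>q\<in>K. \<forall>q'\<in>K. F q' <= F q"
proof (rule ccontr)
  assume "~ ?thesis"
  then have "\<forall>q\<in>K. \<exists>q'\<in>K. F q < F q'" by (auto simp: not_le)
  then obtain n where n: "!!q. q \<in> K ==> n q \<in> K" "!!q. q \<in> K ==> F q < F (n q)" by metis
  have "\<forall>q\<in>K. EX d>0. \<forall>q'\<in>K. dist q' q < d --> F q' < F (n q)"
    using usc n by blast
  then obtain d where d: "!!q. q \<in> K ==> 0 < d q"
    "!!q q'. q \<in> K ==> q' \<in> K ==> dist q' q < d q ==> F q' < F (n q)" by metis
  have "K \<subseteq> (\<Union>q\<in>K. ball q (d q))" using d(1) by fastforce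
  with \<open>compact K\<close> obtain C where C: "C \<subseteq> K" "finite C" "K \<subseteq> (\<Union>q\<in>C. ball q (d q))"
    by (elim compactE_image[where C = K and f = "%q. ball q (d q)"]) auto
  then have "C ~= {}" using assms(2) by auto
  have fin: "finite ((%q. F (n q)) ` C)" "(%q. F (n q)) ` C ~= {}" using C(2) \<open>C ~= {}\<close> by auto
  obtain q where q: "q \<in> C" "F (n q) = Max ((%q. F (n q)) ` C)"
    using Max_in[OF fin] by auto
  obtain q' where q': "q' \<in> C" "n q \<in> ball q' (d q')"
    using C n(1)[of q] q(1) by blast
  have "F (n q) < F (n q')"
    using d(2)[of q' "n q"] q' q(1) C(1) n(1) by (auto simp: dist_commute)
  moreover have "F (n q') <= F (n q)" unfolding q(2) using fin q'(1) by auto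
  ultimately show False by simp
qed

section \<open>Upper semicontinuous functions on the half plane\<close>

lemma usc_on_Q_iff:
  "usc_on Q v \<longleftrightarrow> (ALL t x c. 0 < t --> v (t, x) < c -->
     (EX d>0. ALL s y. 0 < s --> abs (s - t) < d --> abs (y - x) < d --> v (s, y) < c))" (is "_ \<longleftrightarrow> ?R")
proof
  assume u: "usc_on Q v"
  show ?R
  proof (intro allI impI)
    fix t x c :: real assume "0 < t" "v (t, x) < c"
    then have "(t, x) \<in> {p \<in> Q. v p < c}" by (simp add: Q_def)
    moreover have "openin (top_of_set Q) {p \<in> Q. v p < c}" using u by (simp add: usc_on_def)
    ultimately obtain e where e: "0 < e" "ball (t, x) e \<inter> Q \<subseteq> {p \<in> Q. v p < c}"
      unfolding openin_contains_ball by blast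
    show "EX d>0. ALL s y. 0 < s --> abs (s - t) < d --> abs (y - x) < d --> v (s, y) < c"
    proof (intro exI[of _ "e/2"] conjI allI impI)
      fix s y assume "0 < s" "abs (s - t) < e/2" "abs (y - x) < e/2"
      moreover have "sqrt ((t - s)^2 + (x - y)^2) <= abs (t - s) + abs (x - y)"
        by (rule sqrt_sum_squares_le_sum_abs)
      ultimately have "(s, y) \<in> ball (t, x) e \<inter> Q"
        by (simp add: Q_def dist_Pair_Pair dist_real_def) (simp add: abs_minus_commute)
      then show "v (s, y) < c" using e(2) by blast
    qed (use e in auto)
  qed
next
  assume r: ?R
  show "usc_on Q v"
    unfolding usc_on_def openin_contains_ball
  proof (intro allI conjI ballI)
    fix c p assume "p \<in> {p \<in> Q. v p < c}"
    then obtain t x where p: "p = (t, x)" "0 < t" "v (t, x) < c" by (cases p) (auto simp: Q_def)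
    then obtain d where d: "d > 0" "!!s y. 0 < s ==> abs (s - t) < d ==> abs (y - x) < d ==> v (s, y) < c"
      using r by meson
    have "ball p d \<inter> Q \<subseteq> {p \<in> Q. v p < c}"
    proof
      fix q assume "q \<in> ball p d \<inter> Q"
      then obtain s y where q: "q = (s, y)" "dist (t, x) (s, y) < d" "0 < s" by (cases q) (auto simp: Q_def p)
      have "abs (s - t) < d" "abs (y - x) < d"
        using q(2) dist_fst_le[of "(t, x)" "(s, y)"] dist_snd_le[of "(t, x)" "(s, y)"]
        by (auto simp: dist_real_def)
      then show "q \<in> {p \<in> Q. v p < c}" using d q by (auto simp: Q_def)
    qed
    then show "EX e>0. ball p e \<inter> Q \<subseteq> {p \<in> Q. v p < c}" using d by blast
  qed auto
qed

lemma usc_onD: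
  assumes "usc_on Q v" "0 < t" "v (t, x) < c"
  obtains d where "0 < d" "!!s y. 0 < s ==> abs (s - t) < d ==> abs (y - x) < d ==> v (s, y) < c"
  using assms unfolding usc_on_Q_iff by meson

lemma usc_on_slice_measurable:
  assumes "usc_on Q v" "0 < t"
  shows "(%y. v (t, y)) \<in> borel_measurable borel"
  unfolding borel_measurable_iff_less
proof
  fix a
  have "open {y. v (t, y) < a}"
    unfolding open_contains_ball
  proof
    fix y assume "y \<in> {y. v (t, y) < a}"
    then obtain d where "0 < d" "!!s z. 0 < s ==> abs (s - t) < d ==> abs (z - y) < d ==> v (s, z) < a"
      using usc_onD[OF assms] by auto
    then show "EX e>0. ball y e \<subseteq> {y. v (t, y) < a}"
      using assms(2) by (intro exI[of _ d]) (auto simp: dist_real_def abs_minus_commute)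
  qed
  then show "{w \<in> space borel. v (t, w) < a} \<in> sets borel" by simp
qed

lemma usc_on_box_attains:
  assumes "usc_on Q v" "0 < t1" "t1 <= t2" "x1 <= x2"
    and g: "continuous_on ({t1..t2} \<times> {x1..x2}) g"
  obtains t x where "t1 <= t" "t <= t2" "x1 <= x" "x <= x2"
    "!!s y. t1 <= s ==> s <= t2 ==> x1 <= y ==> y <= x2 ==> v (s, y) - g (s, y) <= v (t, x) - g (t, x)"
proof -
  let ?K = "{t1..t2} \<times> {x1..x2}"
  have "\<exists>q\<in>?K. \<forall>q'\<in>?K. v q' - g q' <= v q - g q"
  proof (rule usc_attains)
    show "compact ?K" by (intro compact_Times compact_Icc)
    show "?K ~= {}" using assms by auto
    fix q c assume q: "q \<in> ?K" "v q - g q < c"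
    obtain t x where [simp]: "q = (t, x)" by (cases q)
    define e where "e = (c - (v q - g q)) / 2"
    have e: "0 < e" using q by (simp add: e_def)
    have "0 < t" using q assms by auto
    then obtain d where d: "0 < d" "!!s y. 0 < s ==> abs (s - t) < d ==> abs (y - x) < d ==> v (s, y) < v q + e"
      using usc_onD[OF assms(1), of t x "v q + e"] e by auto
    obtain d' where d': "0 < d'" "!!q'. q' \<in> ?K ==> dist q' q < d' ==> dist (g q') (g q) < e"
      using g q(1) e unfolding continuous_on_iff by metis
    show "EX d>0. \<forall>q'\<in>?K. dist q' q < d --> v q' - g q' < c"
    proof (intro exI[of _ "min d d'"] conjI ballI impI)
      fix q' assume q': "q' \<in> ?K" "dist q' q < min d d'"
      obtain s y where [simp]: "q' = (s, y)" by (cases q')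
      have "abs (s - t) < d" "abs (y - x) < d"
        using q'(2) dist_fst_le[of q' q] dist_snd_le[of q' q] by (auto simp: dist_real_def)
      then have "v q' < v q + e" using d q'(1) assms(2) by auto
      moreover have "dist (g q') (g q) < e" using d'(2)[of q'] q' by auto
      ultimately have "v q' - g q' < v q + e - (g q - e)" by (simp add: dist_real_def)
      then show "v q' - g q' < c" by (simp add: e_def field_simps)
    qed (use d d' in auto)
  qed
  then show thesis using that by force
qed

section \<open>Contact from above by parabolas and quartics\<close>

definition jump :: "real => (real \<times> real => real) => real => real => real => real" where
  "jump eps v t x z = E_upper eps (v (t, x + z) - v (t, x))"

text \<open>Contact is only local and the constant \<open>C\<close> is arbitrary, so that changes of
  the unknown and limits of contact points stay in the same class of tests; \<open>alpha\<close> and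
  \<open>p\<close> play the time and space derivatives.\<close>

definition touch :: "(real \<times> real => real) => real => real => real => real => real => real => bool" where
  "touch v t x alpha p C delta \<longleftrightarrow> (ALL s y. 0 < s --> abs (s - t) < delta --> abs (y - x) < delta -->
     v (s, y) <= v (t, x) + alpha * (s - t) + p * (y - x) + C * ((s - t)^2 + (y - x)^2))"

text \<open>The tests for vanishing gradient. The space dependence is quartic to match the
  admissible functions \<open>c * abs (y - x) ^ 4 + g s\<close>.\<close>

definition touch4 :: "(real \<times> real => real) => real => real => real => real => real => bool" where
  "touch4 v t x alpha C delta \<longleftrightarrow> (ALL s y. 0 < s --> abs (s - t) < delta --> abs (y - x) < delta -->
     v (s, y) <= v (t, x) + alpha * (s - t) + C * ((s - t)^2 + (y - x) ^ 4))"

text \<open>Subsolutions in terms of local jets. The integral over \<open>r <= abs z\<close> decreases as \<open>r\<close> decreases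
  near \<open>0\<close>, so it does not matter for which small radii the inequality is required.\<close>

definition jsub :: "real => (real \<times> real => real) => bool" where
  "jsub eps v \<longleftrightarrow> bounded (v ` Q) & usc_on Q v &
     (ALL t x alpha p C delta r0. 0 < t --> p ~= 0 --> 0 < delta --> 0 < r0 --> touch v t x alpha p C delta -->
        (EX r. 0 < r & r < r0 & alpha <= abs p * kint r (jump eps v t x))) &
     (ALL t x alpha C delta. 0 < t --> 0 < delta --> touch4 v t x alpha C delta --> alpha <= 0)"

lemma jump_measurable:
  assumes "usc_on Q v" "0 < t"
  shows "jump eps v t x \<in> borel_measurable borel"
proof -
  note [measurable] = usc_on_slice_measurable[OF assms]
  show ?thesis unfolding jump_def[abs_def] by measurable
qed

lemma bounded_QE:
  assumes "bounded (v ` Q)"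
  obtains A :: real where "0 < A" "!!t x. 0 < t ==> abs (v (t, x)) <= A"
proof -
  obtain A where "0 < A" "\<forall>q\<in>v ` Q. norm q <= A" using assms unfolding bounded_pos by auto
  then show thesis by (intro that[of A]) (auto simp: Q_def)
qed

lemma bounded_QI:
  assumes "!!t x. 0 < t ==> abs (v (t, x)) <= (A::real)"
  shows "bounded (v ` Q)"
  unfolding bounded_iff using assms by (intro exI[of _ A]) (auto simp: Q_def)

lemma jump_bound:
  assumes "0 < eps" "!!t x. 0 < t ==> abs (v (t, x)) <= A" "0 < t"
  shows "abs (jump eps v t x z) <= 2 * A + eps / 2"
proof -
  have "abs (v (t, x + z) - v (t, x)) <= 2 * A"
    using assms(2)[OF assms(3), of x] assms(2)[OF assms(3), of "x + z"] by linarith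
  then show ?thesis using E_upper_bounds(3)[OF assms(1)] unfolding jump_def by (meson add_right_mono order_trans)
qed

text \<open>By \<open>C * delta <= abs p\<close> the linear term beats the quadratic one, so
  downhill increments are negative; the other smallness condition keeps uphill increments below
  \<open>eps\<close>. The staircase then only sees the sign of \<open>p * z\<close>.\<close>

lemma touch_jump_sgn:
  assumes "0 < eps" "0 < t" "touch v t x alpha p C delta" "p ~= 0" "0 <= C" "C * delta <= abs p"
    "abs p * delta + C * delta^2 <= eps" "z ~= 0" "abs z < delta"
  shows "jump eps v t x z <= eps / 2 * sgn (p * z)"
proof -
  have le: "v (t, x + z) - v (t, x) <= p * z + C * z^2"
    using assms(3)[unfolded touch_def, rule_format, of t "x + z"] assms(2,8,9) by force
  have Cz: "C * abs z < abs p"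
  proof (cases "C = 0")
    case False
    then have "C * abs z < C * delta" using assms by (intro mult_strict_left_mono) auto
    then show ?thesis using assms(6) by linarith
  qed (use assms in auto)
  have z2: "C * z^2 = C * abs z * abs z" by (simp add: power2_eq_square)
  have lt: "C * z^2 < abs (p * z)"
    unfolding z2 abs_mult using Cz assms(8) by (intro mult_strict_right_mono) auto
  show ?thesis
  proof (cases "p * z < 0")
    case True
    then have "v (t, x + z) - v (t, x) < 0" using le lt by linarith
    then show ?thesis using E_upper_signs(2)[OF assms(1)] True by (simp add: jump_def)
  next
    case False
    then have pos: "0 < p * z" using assms(4,8) by (simp add: less_eq_real_def not_less)
    have "p * z <= abs p * abs z" by (simp add: abs_mult[symmetric])
    also have "\<dots> < abs p * delta" using assms by simp
    finally have "p * z < abs p * delta" .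
    moreover have "C * z^2 <= C * delta^2"
      using assms by (intro mult_left_mono) (auto simp: abs_le_square_iff[symmetric])
    ultimately have "v (t, x + z) - v (t, x) < eps" using le assms(7) by linarith
    then show ?thesis using E_upper_signs(1)[OF assms(1)] pos by (simp add: jump_def)
  qed
qed

lemma touch_mono: "touch v t x alpha p C delta ==> delta' <= delta ==> C <= C' ==> touch v t x alpha p C' delta'"
  unfolding touch_def
  by (meson add_left_mono mult_right_mono order_trans less_le_trans sum_power2_ge_zero)

lemma jsub_bounded: "jsub eps v ==> bounded (v ` Q)"
  and jsub_usc: "jsub eps v ==> usc_on Q v"
  by (auto simp: jsub_def)

lemma jsub_weak:
  assumes "jsub eps v" "0 < t" "p ~= 0" "0 < delta" "0 < r0" "touch v t x alpha p C delta"
  obtains r where "0 < r" "r < r0" "alpha <= abs p * kint r (jump eps v t x)"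
  using assms unfolding jsub_def by meson

lemma jsub_flat:
  assumes "jsub eps v" "0 < t" "0 < delta" "touch4 v t x alpha C delta"
  shows "alpha <= 0"
  using assms unfolding jsub_def by meson

text \<open>The weak form supplies some radius below \<open>r\<close>, and by the odd majorant from
  \<open>touch_jump_sgn\<close> enlarging it only increases the integral. Having the inequality at a
  prescribed radius is what permits limits of contact points later.\<close>

lemma jsub_strong:
  assumes v: "jsub eps v" and "0 < eps" "0 < t" "touch v t x alpha p C delta" "p ~= 0" "0 <= C" "C * delta <= abs p"
    "abs p * delta + C * delta^2 <= eps" "0 < r" "r < delta"
  shows "alpha <= abs p * kint r (jump eps v t x)"
proof -
  obtain A where A: "0 < A" "!!t x. 0 < t ==> abs (v (t, x)) <= A"
    using bounded_QE[OF jsub_bounded[OF v]] by metis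
  obtain r' where r': "0 < r'" "r' < r" "alpha <= abs p * kint r' (jump eps v t x)"
    using jsub_weak[OF v assms(3,5) _ assms(9) assms(4)] assms(9,10) by auto
  have "kint r' (jump eps v t x) <= kint r (jump eps v t x)"
  proof (rule kint_sgn_le)
    show "jump eps v t x \<in> borel_measurable borel" by (rule jump_measurable[OF jsub_usc[OF v] assms(3)])
    show "abs (jump eps v t x z) <= 2 * A + eps / 2" for z by (rule jump_bound) (use assms A in auto)
    show "jump eps v t x z <= eps / 2 * sgn (p * z)" if "r' <= abs z" "abs z < r" for z
      using that r' assms by (intro touch_jump_sgn[OF assms(2,3,4)]) auto
  qed (use r' in auto)
  then have "abs p * kint r' (jump eps v t x) <= abs p * kint r (jump eps v t x)"
    by (intro mult_left_mono) auto
  then show ?thesis using r'(3) by linarith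
qed

lemma small_radius:
  fixes p C :: real
  assumes "0 < eps" "p ~= 0" "0 < delta"
  obtains delta' where "0 < delta'" "delta' <= delta" "abs C * delta' <= abs p" "abs p * delta' + abs C * delta'^2 <= eps"
proof
  define d where "d = Min {delta, 1, abs p / (abs C + 1), eps / (abs p + abs C)}"
  have p: "0 < abs p" "0 < abs p + abs C" using assms(2) by auto
  show "0 < d" using assms p by (auto simp: d_def)
  show "d <= delta" by (simp add: d_def)
  have "d <= abs p / (abs C + 1)" "d <= eps / (abs p + abs C)" "d <= 1"
    unfolding d_def by (rule Min_le; simp)+
  then have *: "d * (abs C + 1) <= abs p" "d * (abs p + abs C) <= eps" "d <= 1"
    using p by (simp_all add: pos_le_divide_eq)
  show "abs C * d <= abs p" using *(1) \<open>0 < d\<close> by (simp add: algebra_simps)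
  have "d^2 <= d" using \<open>0 < d\<close> *(3) by (simp add: power2_eq_square mult_left_le)
  then have "abs C * d^2 <= abs C * d" by (intro mult_left_mono) auto
  then show "abs p * d + abs C * d^2 <= eps" using *(2) by (simp add: algebra_simps)
qed

lemma jsub_strong_ex:
  assumes v: "jsub eps v" and "0 < eps" "0 < t" "touch v t x alpha p C delta" "p ~= 0" "0 < delta"
  obtains r0 where "0 < r0" "!!r. 0 < r ==> r < r0 ==> alpha <= abs p * kint r (jump eps v t x)"
proof -
  obtain delta' where d: "0 < delta'" "delta' <= delta" "abs C * delta' <= abs p" "abs p * delta' + abs C * delta'^2 <= eps"
    using small_radius[OF assms(2,5,6)] by metis
  have "touch v t x alpha p (abs C) delta'" using touch_mono[OF assms(4)] d(2) by auto
  then show thesis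
    using jsub_strong[OF v assms(2,3) _ assms(5) _ d(3,4)] d(1) by (intro that[of delta']) auto
qed

text \<open>The sign hypotheses on \<open>f\<close> are those satisfied by \<open>E_upper eps\<close> of the increments of a function
  touched from above by the quartic \<open>beta * (x - p) ^ 4\<close> at a point at distance \<open>abs y\<close> from \<open>p\<close>.\<close>

lemma quartic_estimate:
  fixes y :: real
  assumes "0 < eps" "0 < beta" "y ~= 0" "beta * y ^ 4 <= B" "0 <= F"
    and f: "f \<in> borel_measurable borel" "!!z. abs (f z) <= Bd" "!!z. f z <= F"
    and s1: "!!z. abs z <= abs y ==> beta * ((y + z) ^ 4 - y ^ 4) < eps ==> f z <= eps / 2"
    and s2: "!!z. abs z <= abs y ==> beta * ((y + z) ^ 4 - y ^ 4) < 0 ==> f z <= - eps / 2"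
  obtains r0 where "0 < r0" "!!r. 0 < r ==> r < r0 ==>
      4 * beta * abs y ^ 3 * kint r f <= 8 * F * beta * y^2 * (1 + 15 * B / eps)"
proof
  \<comment> \<open>For \<open>abs z <= abs y\<close> the increment of the fourth power is at most
    \<open>15 * abs z * abs y ^ 3\<close>, where \<open>15 = 4 + 6 + 4 + 1\<close>. Below
    \<open>z0\<close> the quartic therefore rises by less than \<open>eps\<close>.\<close>
  define z0 where "z0 = min (abs y) (eps / (15 * beta * abs y ^ 3))"
  have y: "0 < abs y" using assms(3) by simp
  show z0: "0 < z0" using assms y by (simp add: z0_def)
  fix r assume r: "0 < r" "r < z0"
  \<comment> \<open>Inside \<open>z0\<close> the integrand has an odd majorant; outside, the crude
    bound \<open>F\<close> meets the kernel mass \<open>2 / z0\<close>.\<close>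
  have "kint r f <= 2 * F / z0"
  proof (rule kint_sgn_bound[OF r f(1,2) _ f(3)])
    fix z assume z: "z ~= 0" "abs z < z0"
    then have zy: "abs z < abs y" and ze: "abs z < eps / (15 * beta * abs y ^ 3)" by (auto simp: z0_def)
    show "f z <= eps / 2 * sgn (y * z)"
    proof (cases "y * z < 0")
      case True
      then have "abs (y + z) < abs y" using zy by (auto simp: mult_less_0_iff)
      then have "abs (y + z) ^ 4 < abs y ^ 4" by (intro power_strict_mono) auto
      then have "(y + z) ^ 4 < y ^ 4" by simp
      then have "beta * ((y + z) ^ 4 - y ^ 4) < 0" using assms(2) by (simp add: mult_less_0_iff)
      then show ?thesis using s2[of z] zy True by simp
    next
      case False
      then have pos: "0 < y * z" using assms(3) z(1) by (simp add: less_eq_real_def not_less)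
      have "(y + z) ^ 4 - y ^ 4 = z * (4 * y ^ 3 + 6 * y^2 * z + 4 * y * z^2 + z ^ 3)"
        by (simp add: algebra_simps power4_eq_xxxx power3_eq_cube power2_eq_square)
      also have "\<dots> <= abs z * abs (4 * y ^ 3 + 6 * y^2 * z + 4 * y * z^2 + z ^ 3)"
        by (simp add: abs_mult[symmetric])
      also have "\<dots> <= abs z * (15 * abs y ^ 3)"
      proof (rule mult_left_mono)
        have "abs (6 * y^2 * z) <= 6 * (abs y^2 * abs y)" unfolding abs_mult using zy
          by (auto intro!: mult_left_mono)
        moreover have "abs (4 * y * z^2) <= 4 * (abs y * abs y^2)" unfolding abs_mult using zy
          by (auto intro!: mult_left_mono simp: abs_le_square_iff[symmetric])
        moreover have "abs (z ^ 3) <= abs y ^ 3" unfolding power_abs using zy by (intro power_mono) auto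
        moreover have "abs (4 * y ^ 3) = 4 * abs y ^ 3" by (simp add: abs_mult power_abs)
        moreover have "abs y^2 * abs y = abs y ^ 3" "abs y * abs y^2 = abs y ^ 3"
          by (simp_all only: power2_eq_square power3_eq_cube mult.assoc)
        moreover have "abs (a + b + c + d) <= abs a + abs b + abs c + abs d" for a b c d :: real by linarith
        ultimately show "abs (4 * y ^ 3 + 6 * y^2 * z + 4 * y * z^2 + z ^ 3) <= 15 * abs y ^ 3"
          by (smt (verit))
      qed auto
      finally have "beta * ((y + z) ^ 4 - y ^ 4) <= beta * (abs z * (15 * abs y ^ 3))"
        using assms(2) by (intro mult_left_mono) auto
      also have "\<dots> < eps" using ze assms(2) y by (simp add: pos_less_divide_eq algebra_simps)
      finally show ?thesis using s1[of z] zy pos by simp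
    qed
  qed
  also have "2 * F / z0 <= 2 * F * (1 / abs y + 15 * beta * abs y ^ 3 / eps)"
  proof -
    have "1 / z0 <= 1 / abs y + 15 * beta * abs y ^ 3 / eps"
    proof (cases "z0 = abs y")
      case True
      then show ?thesis using assms by simp
    next
      case False
      then have "z0 = eps / (15 * beta * abs y ^ 3)" by (auto simp: z0_def min_def split: if_splits)
      then show ?thesis using assms y by simp
    qed
    then show ?thesis using mult_left_mono[of "1 / z0" _ "2 * F"] assms(5) by simp
  qed
  finally have "4 * beta * abs y ^ 3 * kint r f <= 4 * beta * abs y ^ 3 * (2 * F * (1 / abs y + 15 * beta * abs y ^ 3 / eps))"
    using assms(2) by (intro mult_left_mono) auto
  also have "\<dots> = 8 * F * beta * y^2 * (1 + 15 * (beta * y ^ 4) / eps)"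
  proof -
    have a: "abs y ^ 3 * (1 / abs y) = y^2" using y by (simp add: power3_eq_cube power2_eq_square)
    have b: "abs y ^ 3 * abs y ^ 3 = y^2 * y ^ 4"
      by (simp add: power_add[symmetric] power_abs[symmetric] abs_if)
    have "4 * beta * a * (2 * F * (1 / abs y + 15 * beta * a / eps))
        = 8 * F * beta * (a * (1 / abs y)) + 8 * F * beta * (15 * beta * (a * a) / eps)" for a
      by (simp add: algebra_simps)
    from this[of "abs y ^ 3"] show ?thesis unfolding a b by (simp add: algebra_simps)
  qed
  also have "\<dots> <= 8 * F * beta * y^2 * (1 + 15 * B / eps)"
    using assms by (intro mult_left_mono add_left_mono divide_right_mono) auto
  finally show "4 * beta * abs y ^ 3 * kint r f <= 8 * F * beta * y^2 * (1 + 15 * B / eps)" .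
qed

section \<open>Finite speed of propagation for plateaus\<close>

lemma pos_part_square_le:
  fixes a b :: real
  shows "(max 0 b)^2 <= (max 0 a)^2 + 2 * max 0 a * (b - a) + (b - a)^2"
proof -
  have "(max 0 a)^2 + 2 * max 0 a * (b - a) + (b - a)^2 = (max 0 a + (b - a))^2"
    by (simp add: power2_eq_square algebra_simps)
  moreover have "(max 0 b)^2 <= (max 0 a + (b - a))^2"
  proof (cases "0 <= b")
    case True
    then show ?thesis by (intro power_mono) auto
  qed auto
  ultimately show ?thesis by simp
qed

lemma fourth_power_le:
  fixes Y h :: real
  assumes "abs h <= 1"
  shows "(Y + h) ^ 4 <= Y ^ 4 + 4 * Y ^ 3 * h + (6 * Y^2 + 4 * abs Y + 1) * h^2"
proof -
  have "(Y + h) ^ 4 = Y ^ 4 + 4 * Y ^ 3 * h + (6 * Y^2 + 4 * (Y * h) + h^2) * h^2"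
    by (simp add: algebra_simps power4_eq_xxxx power3_eq_cube power2_eq_square)
  also have "\<dots> <= Y ^ 4 + 4 * Y ^ 3 * h + (6 * Y^2 + 4 * abs Y + 1) * h^2"
  proof (intro add_left_mono mult_right_mono)
    have "Y * h <= abs Y * abs h" by (simp add: abs_mult[symmetric])
    also have "\<dots> <= abs Y" using assms by (simp add: mult_left_le)
    finally have "Y * h <= abs Y" .
    moreover have "h^2 <= 1" using assms by (simp add: abs_square_le_1)
    ultimately show "6 * Y^2 + 4 * (Y * h) + h^2 <= 6 * Y^2 + 4 * abs Y + 1" by linarith
  qed auto
  finally show ?thesis .
qed

text \<open>\<open>Y\<close> is the offset of the contact point from the centre of the quartic. For
  \<open>Y = 0\<close> the flat test applies, otherwise the gradient is
  \<open>4 * beta * Y ^ 3\<close>. The point of the quartic is that both cases obey one bound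
  proportional to \<open>Y^2\<close>, so nothing is lost where the gradient degenerates.\<close>

lemma quartic_contact:
  assumes v: "jsub eps v" and "0 < eps" and A: "!!t x. 0 < t ==> abs (v (t, x)) <= A"
    and "0 < t" "0 < beta" "beta * Y ^ 4 <= B" "0 < delta"
    and near: "!!s y. abs (s - t) < delta ==> abs (y - x) < delta ==>
      v (s, y) <= v (t, x) + alpha * (s - t) + M * (s - t)^2 + beta * ((Y + (y - x)) ^ 4 - Y ^ 4)"
    and le: "!!z. abs z <= abs Y ==> v (t, x + z) - v (t, x) <= beta * ((Y + z) ^ 4 - Y ^ 4)"
  shows "alpha <= 8 * (2 * A + eps / 2) * beta * Y^2 * (1 + 15 * B / eps)"
proof (cases "Y = 0")
  case True
  have "touch4 v t x alpha (max beta M) delta"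
    unfolding touch4_def
  proof (intro allI impI)
    fix s y assume "abs (s - t) < delta" "abs (y - x) < delta"
    note near[OF this]
    moreover have "M * (s - t)^2 <= max beta M * (s - t)^2" "beta * (y - x) ^ 4 <= max beta M * (y - x) ^ 4"
      by (intro mult_right_mono; simp)+
    ultimately show "v (s, y) <= v (t, x) + alpha * (s - t) + max beta M * ((s - t)^2 + (y - x) ^ 4)"
      using True by (simp add: algebra_simps)
  qed
  from jsub_flat[OF v assms(4,7) this] show ?thesis using True by simp
next
  case False
  define D where "D = max M (beta * (6 * Y^2 + 4 * abs Y + 1))"
  define d where "d = min delta 1"
  have d: "0 < d" "d <= delta" "d <= 1" using assms(7) by (auto simp: d_def)
  have A0: "0 <= A" using A[of 1 0] by (meson abs_ge_zero order_trans zero_less_one)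
  have "touch v t x alpha (4 * beta * Y ^ 3) D d"
    unfolding touch_def
  proof (intro allI impI)
    fix s y assume h: "abs (s - t) < d" "abs (y - x) < d"
    have "beta * (Y + (y - x)) ^ 4 <= beta * (Y ^ 4 + 4 * Y ^ 3 * (y - x) + (6 * Y^2 + 4 * abs Y + 1) * (y - x)^2)"
      using fourth_power_le[of "y - x" Y] h d assms(5) by (intro mult_left_mono) auto
    moreover have "M * (s - t)^2 <= D * (s - t)^2"
      "beta * (6 * Y^2 + 4 * abs Y + 1) * (y - x)^2 <= D * (y - x)^2"
      unfolding D_def by (intro mult_right_mono; simp)+
    ultimately show "v (s, y) <= v (t, x) + alpha * (s - t) + 4 * beta * Y ^ 3 * (y - x) + D * ((s - t)^2 + (y - x)^2)"
      using near[of s y] h d by (simp add: algebra_simps)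
  qed
  moreover have "4 * beta * Y ^ 3 ~= 0" using False assms(5) by simp
  ultimately obtain r1 where r1: "0 < r1"
    "!!r. 0 < r ==> r < r1 ==> alpha <= abs (4 * beta * Y ^ 3) * kint r (jump eps v t x)"
    using jsub_strong_ex[OF v assms(2,4) _ _ d(1)] by metis
  have F: "0 <= 2 * A + eps / 2" using A0 assms by simp
  obtain r2 where r2: "0 < r2" "!!r. 0 < r ==> r < r2 ==>
    4 * beta * abs Y ^ 3 * kint r (jump eps v t x) <= 8 * (2 * A + eps / 2) * beta * Y^2 * (1 + 15 * B / eps)"
  proof (rule quartic_estimate[OF assms(2,5) False assms(6) F jump_measurable[OF jsub_usc[OF v] assms(4)]])
    show "abs (jump eps v t x z) <= 2 * A + eps / 2" for z by (rule jump_bound) (use assms in auto)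
    then show "jump eps v t x z <= 2 * A + eps / 2" for z by (meson abs_le_D1)
    show "jump eps v t x z <= eps / 2" if "abs z <= abs Y" "beta * ((Y + z) ^ 4 - Y ^ 4) < eps" for z
      using le[OF that(1)] that(2) unfolding jump_def by (intro E_upper_signs[OF assms(2)]) auto
    show "jump eps v t x z <= - eps / 2" if "abs z <= abs Y" "beta * ((Y + z) ^ 4 - Y ^ 4) < 0" for z
      using le[OF that(1)] that(2) unfolding jump_def by (intro E_upper_signs[OF assms(2)]) auto
  qed blast
  define r where "r = min r1 r2 / 2"
  have r: "0 < r" "r < r1" "r < r2" using r1 r2 by (auto simp: r_def min_def)
  have "abs (4 * beta * Y ^ 3) = 4 * beta * abs Y ^ 3" using assms(5) by (simp add: abs_mult power_abs)
  then show ?thesis using r1(2)[OF r(1,2)] r2(2)[OF r(1,3)] by simp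
qed

text \<open>The bound of \<open>quartic_contact\<close> for
  \<open>beta = (2 * A + 1) / R ^ 4\<close> and \<open>abs Y <= R\<close>, multiplied by
  \<open>R^2\<close>. The final \<open>+ 1\<close> makes later comparisons strict.\<close>

definition plateau_speed :: "real => real => real" where
  "plateau_speed eps A = 8 * (2 * A + eps / 2) * (2 * A + 1) * (1 + 15 * (2 * A + 1) / eps) + 1"

lemma plateau_speed_pos: "0 < eps ==> 0 <= A ==> 0 < plateau_speed eps A"
  unfolding plateau_speed_def by (intro add_nonneg_pos mult_nonneg_nonneg) auto

lemma quartic_speed_bound:
  fixes Y R :: real
  assumes "0 < eps" "0 <= A" "0 < R" "abs Y <= R"
  shows "8 * (2 * A + eps / 2) * ((2 * A + 1) / R ^ 4) * Y^2 * (1 + 15 * (2 * A + 1) / eps)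
    < plateau_speed eps A / R^2"
proof -
  define c where "c = 8 * (2 * A + eps / 2) * (2 * A + 1) * (1 + 15 * (2 * A + 1) / eps)"
  have c: "0 <= c" unfolding c_def using assms by (intro mult_nonneg_nonneg) auto
  have "Y^2 <= R^2" using assms by (simp add: abs_le_square_iff[symmetric])
  then have "Y^2 / R ^ 4 <= R^2 / R ^ 4" by (intro divide_right_mono) auto
  also have "\<dots> = 1 / R^2" using assms by (simp add: field_simps power2_eq_square power4_eq_xxxx)
  finally have "c * (Y^2 / R ^ 4) <= c * (1 / R^2)" using c by (rule mult_left_mono)
  also have "\<dots> < (c + 1) / R^2" using assms by (simp add: divide_strict_right_mono)
  finally have "c * (Y^2 / R ^ 4) < (c + 1) / R^2" .
  moreover have "8 * (2 * A + eps / 2) * ((2 * A + 1) / R ^ 4) * Y^2 * (1 + 15 * (2 * A + 1) / eps) = c * (Y^2 / R ^ 4)"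
    unfolding c_def by simp
  moreover have "c + 1 = plateau_speed eps A" unfolding c_def plateau_speed_def by simp
  ultimately show ?thesis by (simp only:)
qed

text \<open>If the bound failed, a quartic well rising at speed \<open>C\<close> would touch
  \<open>v\<close> from above with time slope at least \<open>C\<close>, more than
  \<open>quartic_contact\<close> allows. The speed scales like \<open>1 / R^2\<close> because the
  gradient of the well and the kernel mass at scale \<open>R\<close> are both of order
  \<open>1 / R\<close>.\<close>

lemma jsub_plateau:
  assumes v: "jsub eps v" and "0 < eps" and A: "!!t x. 0 < t ==> abs (v (t, x)) <= A" and "0 <= t0" "0 < h" "0 < R"
    and init: "!!t x. t0 < t ==> t < t0 + h ==> abs (x - p) <= R ==> v (t, x) <= a"
    and "t0 < t1"
  shows "v (t1, p) <= a + plateau_speed eps A / R^2 * (t1 - t0)"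
proof (rule ccontr)
  assume neg: "~ ?thesis"
  define C B beta where "C = plateau_speed eps A / R^2" and "B = 2 * A + 1" and "beta = B / R ^ 4"
  have A0: "0 <= A" using A[of 1 0] by (meson abs_ge_zero order_trans zero_less_one)
  have C: "0 < C" using plateau_speed_pos[OF assms(2) A0] assms by (simp add: C_def)
  have B: "0 < B" using A0 by (simp add: B_def)
  have beta: "0 < beta" using B assms by (simp add: beta_def)
  have gt: "a + C * (t1 - t0) < v (t1, p)" using neg by (simp add: C_def)
  have "0 <= C * (t1 - t0)" using C assms by simp
  have t1h: "t0 + h <= t1"
  proof (rule ccontr)
    assume "~ t0 + h <= t1"
    then have "v (t1, p) <= a" using assms by (intro init) auto
    then show False using gt \<open>0 <= C * (t1 - t0)\<close> by linarith
  qed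
  have a: "- A <= a"
  proof -
    have "v (t0 + h/2, p) <= a" using assms by (intro init) auto
    moreover have "abs (v (t0 + h/2, p)) <= A" using assms by (intro A) auto
    ultimately show ?thesis by linarith
  qed
  \<comment> \<open>\<open>B = 2 * A + 1\<close> lifts the well above all values of \<open>v\<close>
    where \<open>abs (x - p)\<close> is at least \<open>R\<close>, and the last term does so at time
    \<open>t1 + 1\<close>. The maximum of \<open>v - g\<close> is therefore interior.\<close>
  define g where "g = (%(t, x). a + beta * (x - p) ^ 4 + C * (t - t0) + B * (max 0 (t - t1))^2)"
  have gc: "continuous_on S g" for S
    unfolding g_def case_prod_beta by (intro continuous_intros)
  obtain t x where tx: "t0 + h/2 <= t" "t <= t1 + 1" "p - R <= x" "x <= p + R"
    and mx: "!!s y. t0 + h/2 <= s ==> s <= t1 + 1 ==> p - R <= y ==> y <= p + R ==>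
      v (s, y) - g (s, y) <= v (t, x) - g (t, x)"
    by (rule usc_on_box_attains[OF jsub_usc[OF v] _ _ _ gc, of "t0 + h/2" "t1 + 1" "p - R" "p + R"])
       (use assms t1h in auto)
  have gge: "a + beta * (y - p) ^ 4 <= g (s, y)" "a + B * (max 0 (s - t1))^2 <= g (s, y)"
    if "t0 <= s" for s y
    using that C B beta by (auto simp: g_def)
  have pos: "0 < v (t, x) - g (t, x)"
    using mx[of t1 p] gt t1h assms by (auto simp: g_def)
  have t0t: "t0 <= t" "0 < t" using tx assms by auto
  have R4: "B <= beta * (y - p) ^ 4" if "R <= abs (y - p)" for y
  proof -
    have "R ^ 4 <= abs (y - p) ^ 4" using that assms by (intro power_mono) auto
    then have "beta * R ^ 4 <= beta * (y - p) ^ 4" using beta by simp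
    then show ?thesis using assms by (simp add: beta_def)
  qed
  have t_ge: "t0 + h <= t"
  proof (rule ccontr)
    assume "~ t0 + h <= t"
    then have "v (t, x) <= a" using tx assms by (intro init) auto
    moreover have "a <= g (t, x)" using gge(1)[OF t0t(1), of x] beta by (smt (verit) mult_nonneg_nonneg zero_le_even_power even_numeral)
    ultimately show False using pos by simp
  qed
  have vA: "v (t, y) <= a + B - 1" for y
    using A[OF t0t(2), of y] a by (auto simp: B_def abs_le_iff)
  have x_lt: "abs (x - p) < R"
    using R4[of x] gge(1)[OF t0t(1), of x] vA[of x] pos by force
  have t_lt: "t < t1 + 1"
  proof (rule ccontr)
    assume "~ t < t1 + 1"
    then have "t = t1 + 1" using tx by simp
    then show False using gge(2)[OF t0t(1), of x] vA[of x] pos by simp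
  qed
  define Y M where "Y = x - p" and "M = max 0 (t - t1)"
  define alpha where "alpha = C + 2 * B * M"
  have alpha: "C <= alpha" using B by (simp add: alpha_def M_def)
  define delta where "delta = Min {t - t0 - h/2, t1 + 1 - t, R - abs (x - p), 1}"
  have delta: "0 < delta" using t_ge t_lt x_lt assms(5) by (simp add: delta_def)
  have deltale: "delta <= t - t0 - h/2" "delta <= t1 + 1 - t" "delta <= R - abs (x - p)" "delta <= 1"
    unfolding delta_def by (rule Min_le; simp)+
  have near: "v (s, y) <= v (t, x) + alpha * (s - t) + B * (s - t)^2 + beta * ((Y + (y - x)) ^ 4 - Y ^ 4)"
    if "abs (s - t) < delta" "abs (y - x) < delta" for s y
  proof -
    have "v (s, y) - g (s, y) <= v (t, x) - g (t, x)"
      using that deltale by (intro mx) (auto simp: abs_if split: if_splits)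
    moreover have "B * (max 0 (s - t1))^2 <= B * (M^2 + 2 * M * (s - t) + (s - t)^2)"
      using pos_part_square_le[of "s - t1" "t - t1"] B unfolding M_def by (intro mult_left_mono) auto
    ultimately show ?thesis by (simp add: g_def alpha_def M_def Y_def algebra_simps)
  qed
  have YR: "abs Y <= R" using x_lt by (simp add: Y_def)
  have "beta * Y ^ 4 <= beta * R ^ 4"
    using power_mono[OF YR, of 4] beta by simp
  then have Y4: "beta * Y ^ 4 <= B" using assms by (simp add: beta_def)
  have le: "v (t, x + z) - v (t, x) <= beta * ((Y + z) ^ 4 - Y ^ 4)" for z
  proof -
    have "v (t, x + z) - g (t, x + z) <= v (t, x) - g (t, x)"
    proof (cases "abs (x + z - p) <= R")
      case True
      then show ?thesis using tx by (intro mx) auto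
    next
      case False
      then have "B <= beta * (x + z - p) ^ 4" by (intro R4) auto
      then show ?thesis using gge(1)[OF t0t(1), of "x + z"] vA[of "x + z"] pos by linarith
    qed
    then show ?thesis by (simp add: g_def Y_def algebra_simps)
  qed
  have "alpha <= 8 * (2 * A + eps / 2) * beta * Y^2 * (1 + 15 * B / eps)"
    by (rule quartic_contact[OF v assms(2) A t0t(2) beta Y4 delta near le])
  also have "\<dots> < C"
    using quartic_speed_bound[OF assms(2) A0 assms(6) YR] by (simp add: C_def beta_def B_def)
  finally show False using alpha by simp
qed

lemma linear_le_quadratic:
  fixes a :: real
  assumes "0 < delta" "!!h. abs h < delta ==> a * h <= c * h^2"
  shows "a = 0"
proof (rule ccontr)
  assume "a ~= 0"
  define h where "h = min (delta / 2) (abs a / (2 * (abs c + 1)))"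
  have "h <= delta / 2" unfolding h_def by (rule min.cobounded1)
  then have h: "0 < h" "h < delta" using assms(1) \<open>a ~= 0\<close> by (simp_all add: h_def)
  have "h <= abs a / (2 * (abs c + 1))" by (simp add: h_def)
  then have "2 * (abs c + 1) * h <= abs a" by (simp add: pos_le_divide_eq mult.commute)
  moreover have "abs c * h < 2 * (abs c + 1) * h" using h by (intro mult_strict_right_mono) auto
  ultimately have lt: "abs c * h < abs a" by simp
  have "a * (sgn a * h) <= c * (sgn a * h)^2" using h by (intro assms(2)) (simp add: abs_mult abs_sgn_eq)
  moreover have "a * (sgn a * h) = abs a * h" by (simp add: abs_sgn mult.assoc)
  moreover have "(sgn a * h)^2 = h^2" using \<open>a ~= 0\<close> by (simp add: power_mult_distrib sgn_if)
  ultimately have "abs a * h <= c * h^2" by (simp only:)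
  then have "abs a * h <= c * h * h" by (simp add: power2_eq_square)
  also have "\<dots> <= abs c * h * h" using h by (intro mult_right_mono) auto
  finally have "abs a <= abs c * h" using h by simp
  then show False using lt by simp
qed

lemma touch_gradient_unique:
  assumes "0 < delta" "!!s y. abs s < delta ==> abs y < delta ==>
      alpha' * s + p' * y - C' * (s^2 + y^2) <= alpha * s + p * y + C * (s^2 + y^2 :: real)"
  shows "alpha = alpha'" "p = p'"
proof -
  have "alpha' - alpha = 0"
    by (rule linear_le_quadratic[OF assms(1), of _ "C + C'"]) (use assms(2)[of _ 0] assms(1) in \<open>auto simp: algebra_simps\<close>)
  then show "alpha = alpha'" by simp
  have "p' - p = 0"
    by (rule linear_le_quadratic[OF assms(1), of _ "C + C'"]) (use assms(2)[of 0] assms(1) in \<open>auto simp: algebra_simps\<close>)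
  then show "p = p'" by simp
qed

section \<open>Barriers and changes of the unknown\<close>

lemma continuous_usc_on:
  assumes "continuous_on UNIV (b :: real \<times> real => real)"
  shows "usc_on Q b"
  unfolding usc_on_def
proof
  fix a
  have "open {p. b p < a}" by (intro open_Collect_less assms continuous_on_const)
  then have "openin (top_of_set Q) (Q \<inter> {p. b p < a})" by (rule openin_open_Int)
  then show "openin (top_of_set Q) {p \<in> Q. b p < a}" by (simp add: Int_def)
qed

lemma one_sided_slope:
  fixes alpha :: real
  assumes "0 < delta" "!!h. 0 < h ==> h < delta ==> alpha * h <= C * h^2"
  shows "alpha <= 0"
proof (rule ccontr)
  assume "~ alpha <= 0"
  define h where "h = min (delta / 2) (alpha / (2 * (abs C + 1)))"
  have "h <= delta / 2" "h <= alpha / (2 * (abs C + 1))" unfolding h_def by (rule min.cobounded1, rule min.cobounded2)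
  moreover have "0 < h" using assms(1) \<open>~ alpha <= 0\<close> by (simp add: h_def)
  ultimately have h: "0 < h" "h < delta" "2 * (abs C + 1) * h <= alpha"
    using assms(1) by (auto simp: pos_le_divide_eq mult.commute)
  have "alpha * h <= C * h * h" using assms(2)[OF h(1,2)] by (simp add: power2_eq_square)
  then have "alpha <= C * h" using h by simp
  also have "\<dots> <= abs C * h" using h by (intro mult_right_mono) auto
  also have "\<dots> < 2 * (abs C + 1) * h" using h by (intro mult_strict_right_mono) auto
  finally show False using h by simp
qed

text \<open>A downward quartic bump sinking at the plateau speed, cut off at \<open>- A\<close>: the
  mirror image of the well in \<open>jsub_plateau\<close>. As an explicit subsolution it makes the
  Perron class nonempty and later bounds the maximal subsolution from below at the initial
  time.\<close>

definition barrier :: "real => real => real => real => real => real \<times> real => real" where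
  "barrier eps A R p a = (%(t, x).
     max (- A) (a - (2 * A + 1) / R ^ 4 * (x - p) ^ 4 - plateau_speed eps A / R^2 * t))"

lemma continuous_barrier: "continuous_on S (barrier eps A R p a)"
  unfolding barrier_def case_prod_beta by (intro continuous_intros)

lemma barrier_bounds:
  assumes "0 < eps" "abs a <= A" "0 < R" "0 <= t"
  shows "abs (barrier eps A R p a (t, x)) <= A" "barrier eps A R p a (t, x) <= a"
    "R <= abs (x - p) ==> barrier eps A R p a (t, x) = - A"
proof -
  have A: "0 <= A" using assms by linarith
  have 1: "0 <= (2 * A + 1) / R ^ 4 * (x - p) ^ 4" using A by simp
  have 2: "0 <= plateau_speed eps A / R^2 * t" using plateau_speed_pos[OF assms(1) A] assms by simp
  show "abs (barrier eps A R p a (t, x)) <= A" "barrier eps A R p a (t, x) <= a"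
  proof -
    have "abs (max (- A) (a - u - w)) <= A & max (- A) (a - u - w) <= a" if "0 <= u" "0 <= w" for u w
      using that assms(2) A by (auto simp: abs_le_iff max_def)
    from this[OF 1 2] show "abs (barrier eps A R p a (t, x)) <= A" "barrier eps A R p a (t, x) <= a"
      by (simp_all add: barrier_def)
  qed
  assume "R <= abs (x - p)"
  then have "R ^ 4 <= abs (x - p) ^ 4" using assms by (intro power_mono) auto
  then have "(2 * A + 1) / R ^ 4 * R ^ 4 <= (2 * A + 1) / R ^ 4 * (x - p) ^ 4"
    using A assms by (intro mult_left_mono) auto
  then have "2 * A + 1 <= (2 * A + 1) / R ^ 4 * (x - p) ^ 4" using assms by simp
  then show "barrier eps A R p a (t, x) = - A" using 2 assms unfolding barrier_def by auto
qed

text \<open>Above the floor the bump is smooth and sinks at rate \<open>C0\<close>, while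
  \<open>quartic_estimate\<close> applied to the negated jumps shows that the nonlocal term stays
  above \<open>- C0\<close>. Tests with vanishing gradient are settled by monotonicity in
  time.\<close>

lemma jsub_barrier:
  assumes "0 < eps" "abs a <= A" "0 < R"
  shows "jsub eps (barrier eps A R p a)"
  unfolding jsub_def
proof (intro conjI allI impI)
  let ?b = "barrier eps A R p a"
  define B beta C0 where "B = 2 * A + 1" and "beta = B / R ^ 4" and "C0 = plateau_speed eps A / R^2"
  define q where "q t x = a - beta * (x - p) ^ 4 - C0 * t" for t x
  have b: "?b (t, x) = max (- A) (q t x)" for t x
    by (simp add: barrier_def q_def beta_def B_def C0_def)
  have A: "0 <= A" using assms by linarith
  have C0: "0 < C0" using plateau_speed_pos[OF assms(1) A] assms by (simp add: C0_def)
  have B: "0 < B" using A by (simp add: B_def)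
  have beta: "0 < beta" using B assms by (simp add: beta_def)
  have bA: "abs (?b (t, x)) <= A" if "0 < t" for t x using barrier_bounds(1)[OF assms] that by simp
  show "bounded (?b ` Q)" using bA by (rule bounded_QI)
  show usc: "usc_on Q ?b" by (rule continuous_usc_on[OF continuous_barrier])
  { fix t x alpha C delta assume t: "0 < t" "0 < delta" "touch4 ?b t x alpha C delta"
    show "alpha <= 0"
    proof (rule one_sided_slope[of "min delta t" alpha C])
      fix h assume h: "0 < h" "h < min delta t"
      have "?b (t - h, x) <= ?b (t, x) + alpha * (t - h - t) + C * ((t - h - t)^2 + (x - x) ^ 4)"
        using t h unfolding touch4_def by (intro t(3)[unfolded touch4_def, rule_format]) auto
      moreover have "?b (t, x) <= ?b (t - h, x)"
        unfolding b q_def using C0 h by (intro max.mono) (auto simp: mult_left_mono)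
      ultimately show "alpha * h <= C * h^2" by simp
    qed (use t in auto) }
  fix t x alpha p' C delta and r0 :: real
  assume t: "0 < t" and p': "p' ~= 0" and delta: "0 < delta" and r0: "0 < r0" and tch: "touch ?b t x alpha p' C delta"
  define d where "d = Min {delta, t, 1}"
  have d: "0 < d" using delta t by (simp add: d_def)
  have dle: "d <= delta" "d <= t" "d <= 1" unfolding d_def by (rule Min_le; simp)+
  have tch': "?b (t + s, x + y) <= ?b (t, x) + alpha * s + p' * y + C * (s^2 + y^2)"
    if "abs s < d" "abs y < d" for s y
    using tch[unfolded touch_def, rule_format, of "t + s" "x + y"] that dle by auto
  \<comment> \<open>On the floor the barrier attains its minimum, so a test touching it there has
    zero gradient, against \<open>p' ~= 0\<close>.\<close>
  have "- A < q t x"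
  proof (rule ccontr)
    assume "~ - A < q t x"
    then have "?b (t, x) = - A" by (simp add: b)
    then have "0 <= alpha * s + p' * y + C * (s^2 + y^2)" if "abs s < d" "abs y < d" for s y
      using tch'[OF that] by (simp add: b)
    then have "p' = 0" by (intro touch_gradient_unique(2)[of d 0 0 0 alpha p' C] d) auto
    then show False using p' by simp
  qed
  then have bq: "?b (t, x) = q t x" by (simp add: b)
  define Y where "Y = x - p"
  have Yeq: "x + y - p = Y + y" for y by (simp add: Y_def)
  define D where "D = beta * (6 * Y^2 + 4 * abs Y + 1)"
  have grad: "- C0 * s + (- 4 * beta * Y ^ 3) * y - D * (s^2 + y^2) <= alpha * s + p' * y + C * (s^2 + y^2)"
    if sy: "abs s < d" "abs y < d" for s y
  proof -
    have "q (t + s) (x + y) <= ?b (t + s, x + y)" by (simp add: b)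
    then have "q (t + s) (x + y) <= q t x + alpha * s + p' * y + C * (s^2 + y^2)"
      using tch'[OF sy] bq by linarith
    moreover have "beta * (Y + y) ^ 4 <= beta * (Y ^ 4 + 4 * Y ^ 3 * y + (6 * Y^2 + 4 * abs Y + 1) * y^2)"
      using fourth_power_le[of y Y] sy dle beta by (intro mult_left_mono) auto
    moreover have "0 <= D * s^2" using beta by (simp add: D_def)
    ultimately show ?thesis unfolding q_def Yeq Y_def[symmetric] D_def by (simp add: algebra_simps)
  qed
  have alpha: "alpha = - C0" and p'eq: "p' = - 4 * beta * Y ^ 3"
    using touch_gradient_unique[OF d grad] by auto
  have Y: "Y ~= 0" using p' p'eq by auto
  have "0 < C0 * t" using C0 t by simp
  then have "beta * Y ^ 4 < a + A" using \<open>- A < q t x\<close> by (simp add: q_def Y_def)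
  then have Y4: "beta * Y ^ 4 <= B" using assms by (simp add: B_def)
  have YR: "abs Y <= R"
  proof (rule ccontr)
    assume "~ abs Y <= R"
    then have "R ^ 4 <= abs Y ^ 4" using assms by (intro power_mono) auto
    then have "beta * R ^ 4 <= beta * Y ^ 4" using beta by simp
    then have "B <= beta * Y ^ 4" using assms by (simp add: beta_def)
    then show False using \<open>beta * Y ^ 4 < a + A\<close> assms by (simp add: B_def)
  qed
  have F: "0 <= 2 * A + eps / 2" using A assms by simp
  have le: "- beta * ((Y + z) ^ 4 - Y ^ 4) <= ?b (t, x + z) - ?b (t, x)" for z
    using bq b[of t "x + z"] unfolding q_def Yeq Y_def[symmetric] by (simp add: algebra_simps)
  have jm: "jump eps ?b t x \<in> borel_measurable borel" by (rule jump_measurable[OF usc t])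
  have jb: "abs (jump eps ?b t x z) <= 2 * A + eps / 2" for z by (rule jump_bound) (use assms bA t in auto)
  obtain r2 where r2: "0 < r2" "!!r. 0 < r ==> r < r2 ==>
      4 * beta * abs Y ^ 3 * kint r (%z. - jump eps ?b t x z) <= 8 * (2 * A + eps / 2) * beta * Y^2 * (1 + 15 * B / eps)"
  proof (rule quartic_estimate[OF assms(1) beta Y Y4 F])
    show "(%z. - jump eps ?b t x z) \<in> borel_measurable borel" using jm by measurable
    show "abs (- jump eps ?b t x z) <= 2 * A + eps / 2" for z using jb by simp
    show "- jump eps ?b t x z <= 2 * A + eps / 2" for z using jb[of z] by linarith
    show "- jump eps ?b t x z <= eps / 2" if "beta * ((Y + z) ^ 4 - Y ^ 4) < eps" for z
      using le[of z] that E_upper_signs(4)[OF assms(1), of "?b (t, x + z) - ?b (t, x)"] unfolding jump_def by auto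
    show "- jump eps ?b t x z <= - eps / 2" if "beta * ((Y + z) ^ 4 - Y ^ 4) < 0" for z
      using le[of z] that E_upper_signs(3)[OF assms(1), of "?b (t, x + z) - ?b (t, x)"] unfolding jump_def by auto
  qed blast
  define r where "r = min r0 r2 / 2"
  have r: "0 < r" "r < r0" "r < r2" using r0 r2 by (auto simp: r_def min_def)
  have "abs p' = 4 * beta * abs Y ^ 3" using beta by (simp add: p'eq abs_mult power_abs)
  then have "- (abs p' * kint r (jump eps ?b t x)) <= 8 * (2 * A + eps / 2) * beta * Y^2 * (1 + 15 * B / eps)"
    using r2(2)[OF r(1,3)] by (simp add: kint_uminus)
  also have "\<dots> < C0"
    using quartic_speed_bound[OF assms(1) A assms(3) YR] by (simp add: C0_def beta_def B_def)
  finally show "EX r>0. r < r0 & alpha <= abs p' * kint r (jump eps ?b t x)"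
    using r alpha by (intro exI[of _ r]) auto
qed

lemma deriv_lipschitz_quadratic:
  fixes g :: "real => real"
  assumes "!!x. DERIV g x :> g' x" "!!x y. abs (g' x - g' y) <= L * abs (x - y)" "0 <= L"
  shows "g (b + X) <= g b + g' b * X + L * X^2"
proof -
  have "EX xi. abs (xi - b) <= abs X & g (b + X) - g b = X * g' xi"
  proof (cases X "0 :: real" rule: linorder_cases)
    case less
    then obtain xi where "b + X < xi" "xi < b" "g b - g (b + X) = (b - (b + X)) * g' xi"
      using MVT2[of "b + X" b g g'] assms(1) by auto
    then show ?thesis by (intro exI[of _ xi]) (auto simp: algebra_simps)
  next
    case equal
    then show ?thesis by (intro exI[of _ b]) auto
  next
    case greater
    then obtain xi where "b < xi" "xi < b + X" "g (b + X) - g b = (b + X - b) * g' xi"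
      using MVT2[of b "b + X" g g'] assms(1) by auto
    then show ?thesis by (intro exI[of _ xi]) (auto simp: algebra_simps)
  qed
  then obtain xi where xi: "abs (xi - b) <= abs X" "g (b + X) - g b = X * g' xi" by blast
  have "X * (g' xi - g' b) <= abs X * abs (g' xi - g' b)" by (simp add: abs_mult[symmetric])
  also have "\<dots> <= abs X * (L * abs X)"
    using assms(2)[of xi b] mult_left_mono[OF xi(1) assms(3)] by (intro mult_left_mono) auto
  also have "\<dots> = L * X^2" by (simp add: power2_eq_square)
  finally show ?thesis using xi(2) by (simp add: algebra_simps)
qed

text \<open>The equation is invariant under increasing changes of the unknown which commute with the
  translation by \<open>eps\<close>. The inverse of \<open>bend eps\<close> is such a change; it fixes the multiples of \<open>eps\<close>
  and increases all other values.\<close>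

definition bend :: "real => real => real" where
  "bend eps s = s - eps / (4 * pi) * (1 - cos (2 * pi * s / eps))"

definition bend' :: "real => real => real" where
  "bend' eps s = 1 - sin (2 * pi * s / eps) / 2"

lemma DERIV_bend: "0 < eps ==> DERIV (bend eps) s :> bend' eps s"
  unfolding bend_def[abs_def] bend'_def
  by (auto intro!: derivative_eq_intros simp: field_simps)

lemma bend'_pos: "0 < bend' eps s"
  using sin_le_one[of "2 * pi * s / eps"] unfolding bend'_def by linarith

lemma bend'_lipschitz:
  assumes "0 < eps"
  shows "abs (bend' eps x - bend' eps y) <= pi / eps * abs (x - y)"
proof -
  have aux: "abs (bend' eps x - bend' eps y) <= pi / eps * abs (x - y)" if lt: "x < y" for x y
  proof -
    have "DERIV (bend' eps) s :> - (pi / eps) * cos (2 * pi * s / eps)" for s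
      unfolding bend'_def[abs_def] using assms by (auto intro!: derivative_eq_intros simp: field_simps)
    then obtain xi where "bend' eps y - bend' eps x = (y - x) * (- (pi / eps) * cos (2 * pi * xi / eps))"
      using MVT2[OF lt, of "bend' eps" "%s. - (pi / eps) * cos (2 * pi * s / eps)"] by auto
    then have "abs (bend' eps y - bend' eps x) = abs (y - x) * (pi / eps) * abs (cos (2 * pi * xi / eps))"
      using assms by (simp add: abs_mult)
    also have "\<dots> <= abs (y - x) * (pi / eps) * 1"
      using assms by (intro mult_left_mono abs_cos_le_one) auto
    finally show ?thesis by (simp add: abs_minus_commute mult.commute)
  qed
  show ?thesis
    using aux[of x y] aux[of y x] by (cases x y rule: linorder_cases) (auto simp: abs_minus_commute)
qed

lemma bend_shift: "0 < eps ==> bend eps (s + eps * of_int k) = bend eps s + eps * of_int k"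
proof -
  assume "0 < eps"
  then have "2 * pi * (s + eps * of_int k) / eps = 2 * pi * s / eps + of_int k * (2 * pi)"
    by (simp add: field_simps)
  moreover have "cos (y + of_int k * (2 * pi)) = cos y" for y
    by (simp add: cos_add mult.commute[of _ "2 * pi"] cos_int_2pin sin_int_2pin)
  ultimately show ?thesis unfolding bend_def by simp
qed

lemma bend_strict_mono: "0 < eps ==> x < y ==> bend eps x < bend eps y"
  using DERIV_pos_imp_increasing[of x y "bend eps"] DERIV_bend bend'_pos by blast

lemma bend_le: "0 < eps ==> bend eps s <= s"
  unfolding bend_def using cos_le_one[of "2 * pi * s / eps"] by simp

lemma bend_eq_iff:
  assumes "0 < eps"
  shows "bend eps s = s \<longleftrightarrow> s / eps \<in> \<int>"
proof -
  have "bend eps s = s \<longleftrightarrow> cos (2 * pi * s / eps) = 1" using assms by (auto simp: bend_def)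
  also have "\<dots> \<longleftrightarrow> (EX n::int. 2 * pi * s / eps = of_int n * 2 * pi)" by (rule cos_one_2pi_int)
  also have "\<dots> \<longleftrightarrow> (EX n::int. s / eps = of_int n)" using assms by (simp add: field_simps)
  also have "\<dots> \<longleftrightarrow> s / eps \<in> \<int>" by (auto elim: Ints_cases)
  finally show ?thesis .
qed

lemma bend_bij:
  assumes "0 < eps"
  shows "bij (bend eps)"
proof (rule bijI)
  show "inj (bend eps)"
    using bend_strict_mono[OF assms] by (intro injI) (metis less_irrefl linorder_cases)
  show "surj (bend eps)"
    unfolding surj_def
  proof
    fix y
    have "eps / (4 * pi) * (1 - cos (2 * pi * (y + eps) / eps)) <= eps / (4 * pi) * 2"
      using assms cos_ge_minus_one[of "2 * pi * (y + eps) / eps"] by (intro mult_left_mono) auto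
    also have "\<dots> <= eps" using assms pi_gt3 by (simp add: field_simps)
    finally have "y <= bend eps (y + eps)" unfolding bend_def by simp
    moreover have "bend eps y <= y" by (rule bend_le[OF assms])
    ultimately obtain x where "bend eps x = y"
      using IVT'[of "bend eps" y y "y + eps"] assms DERIV_bend[OF assms]
      by (metis DERIV_isCont continuous_at_imp_continuous_on less_add_same_cancel1 less_eq_real_def)
    then show "EX x. y = bend eps x" by blast
  qed
qed

definition unbend :: "real => real => real" where
  "unbend eps = inv (bend eps)"

lemma bend_unbend: "0 < eps ==> bend eps (unbend eps y) = y"
  unfolding unbend_def using bend_bij by (simp add: bij_is_surj surj_f_inv_f)

lemma unbend_bend: "0 < eps ==> unbend eps (bend eps y) = y"
  unfolding unbend_def using bend_bij by (simp add: bij_is_inj)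

lemma unbend_less_iff: "0 < eps ==> unbend eps y < c \<longleftrightarrow> y < bend eps c"
  by (metis bend_strict_mono bend_unbend linorder_neq_iff order_less_imp_not_less)

lemma unbend_le_iff: "0 < eps ==> c <= unbend eps y \<longleftrightarrow> bend eps c <= y"
  using unbend_less_iff[of eps y c] by linarith

lemma unbend_shift: "0 < eps ==> unbend eps (s + eps * of_int k) = unbend eps s + eps * of_int k"
  by (metis bend_shift bend_unbend unbend_bend)

lemma unbend_ge: "0 < eps ==> y <= unbend eps y"
  using bend_le unbend_le_iff by blast

lemma unbend_le: 
  assumes "0 < eps" shows "unbend eps y <= y + eps"
proof -
  obtain k where k: "y <= eps * of_int k" "eps * of_int k <= y + eps"
  proof
    show "y <= eps * of_int \<lceil>y / eps\<rceil>" using le_of_int_ceiling[of "y / eps"] pos_divide_le_eq[OF assms] by (metis mult.commute)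
    have "of_int \<lceil>y / eps\<rceil> <= y / eps + 1" by linarith
    then have "eps * of_int \<lceil>y / eps\<rceil> <= eps * (y / eps + 1)" using assms by (intro mult_left_mono) auto
    then show "eps * of_int \<lceil>y / eps\<rceil> <= y + eps" using assms by (simp add: algebra_simps)
  qed
  have "(eps * of_int k) / eps \<in> \<int>" using assms by simp
  then have "bend eps (eps * of_int k) = eps * of_int k" using bend_eq_iff[OF assms] by blast
  then have "unbend eps y <= eps * of_int k"
    using k(1) by (metis assms bend_strict_mono bend_unbend linorder_not_less)
  then show ?thesis using k(2) by linarith
qed

lemma unbend_eq_iff:
  assumes "0 < eps"
  shows "unbend eps y = y \<longleftrightarrow> y / eps \<in> \<int>"
  using bend_eq_iff[OF assms] bend_unbend[OF assms] unbend_bend[OF assms] by metis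

text \<open>\<open>unbend\<close> preserves the order and commutes with translations by multiples of
  \<open>eps\<close>. So each inequality \<open>eps * k <= a - b\<close> survives, and these
  inequalities determine the staircase.\<close>

lemma E_upper_unbend:
  assumes "0 < eps"
  shows "E_upper eps (unbend eps a - unbend eps b) = E_upper eps (a - b)"
proof -
  have iff: "eps * of_int k <= unbend eps a - unbend eps b \<longleftrightarrow> eps * of_int k <= a - b" for k
  proof -
    have "eps * of_int k <= unbend eps a - unbend eps b \<longleftrightarrow> unbend eps (b + eps * of_int k) <= unbend eps a"
      unfolding unbend_shift[OF assms] by linarith
    also have "\<dots> \<longleftrightarrow> b + eps * of_int k <= a"
      unfolding unbend_le_iff[OF assms] bend_unbend[OF assms] ..
    finally show ?thesis by linarith
  qed
  have "k <= \<lfloor>(unbend eps a - unbend eps b) / eps\<rfloor> \<longleftrightarrow> k <= \<lfloor>(a - b) / eps\<rfloor>" for k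
    using iff[of k] assms by (simp add: le_floor_iff pos_le_divide_eq mult.commute)
  then have "\<lfloor>(unbend eps a - unbend eps b) / eps\<rfloor> = \<lfloor>(a - b) / eps\<rfloor>" by (metis order_antisym order_refl)
  then show ?thesis by (simp add: E_upper_def)
qed

text \<open>Tests for the new unknown are composed with \<open>bend\<close>, which multiplies
  \<open>alpha\<close> and \<open>p\<close> by the same positive factor. The jumps are unchanged and
  the equation is homogeneous of degree one in the two slopes; the Taylor remainder only enlarges
  the constant of the test.\<close>

lemma jsub_unbend:
  assumes v: "jsub eps v" and "0 < eps"
  shows "jsub eps (%q. unbend eps (v q))"
  unfolding jsub_def
proof (intro conjI allI impI)
  let ?u = "%q. unbend eps (v q)"
  obtain A where A: "0 < A" "!!t x. 0 < t ==> abs (v (t, x)) <= A"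
    using bounded_QE[OF jsub_bounded[OF v]] by metis
  show "bounded (?u ` Q)"
  proof (rule bounded_QI)
    show "abs (?u (t, x)) <= A + eps" if "0 < t" for t x
      using A(2)[OF that, of x] unbend_ge[OF assms(2), of "v (t, x)"] unbend_le[OF assms(2), of "v (t, x)"]
        assms(2) by linarith
  qed
  show "usc_on Q ?u"
    using jsub_usc[OF v] unfolding usc_on_def unbend_less_iff[OF assms(2)] by blast
  have tay: "v (s, y) <= v (t, x) + bend' eps (?u (t, x)) * X + pi / eps * X^2"
    if "?u (s, y) <= ?u (t, x) + X" for s y t x X
  proof -
    have "v (s, y) = bend eps (?u (s, y))" by (simp add: bend_unbend[OF assms(2)])
    also have "\<dots> <= bend eps (?u (t, x) + X)"
      using that bend_strict_mono[OF assms(2), of "?u (s, y)" "?u (t, x) + X"]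
      by (cases "?u (s, y) = ?u (t, x) + X") auto
    also have "\<dots> <= bend eps (?u (t, x)) + bend' eps (?u (t, x)) * X + pi / eps * X^2"
      by (rule deriv_lipschitz_quadratic[OF DERIV_bend bend'_lipschitz]) (use assms(2) in auto)
    finally show ?thesis by (simp add: bend_unbend[OF assms(2)])
  qed
  { fix t x alpha p C delta and r0 :: real
    assume t: "0 < t" and p: "p ~= 0" and delta: "0 < delta" and r0: "0 < r0" and tch: "touch ?u t x alpha p C delta"
    define g where "g = bend' eps (?u (t, x))"
    define L where "L = pi / eps"
    define C' where "C' = g * C + L * (3 * (alpha^2 + p^2 + 2 * C^2))"
    have g: "0 < g" by (simp add: g_def bend'_pos)
    have L: "0 < L" using assms(2) by (simp add: L_def)
    have tv: "touch v t x (g * alpha) (g * p) C' (min delta 1)"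
      unfolding touch_def
    proof (intro allI impI)
      fix s y assume s: "0 < s" "abs (s - t) < min delta 1" "abs (y - x) < min delta 1"
      define a b where "a = s - t" and "b = y - x"
      define X where "X = alpha * a + p * b + C * (a^2 + b^2)"
      have "?u (s, y) <= ?u (t, x) + X"
        using tch[unfolded touch_def, rule_format, of s y] s by (simp add: X_def a_def b_def algebra_simps)
      from tay[OF this] have le: "v (s, y) <= v (t, x) + g * X + L * X^2" by (simp add: g_def L_def)
      have ab: "a^2 <= 1" "b^2 <= 1" using s by (auto simp: a_def b_def abs_square_le_1)
      have "X^2 <= 3 * ((alpha * a)^2 + (p * b)^2 + (C * (a^2 + b^2))^2)"
      proof -
        have "(u + v + w)^2 <= 3 * (u^2 + v^2 + w^2)" for u v w :: real
          using sum_squares_ge_zero[of "u - v" 0] sum_squares_ge_zero[of "v - w" 0] sum_squares_ge_zero[of "u - w" 0]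
          by (simp add: power2_eq_square algebra_simps)
        then show ?thesis unfolding X_def by blast
      qed
      also have "\<dots> <= 3 * (alpha^2 + p^2 + 2 * C^2) * (a^2 + b^2)"
      proof -
        define S where "S = a^2 + b^2"
        have "S^2 <= 2 * S"
          using ab mult_right_mono[of S 2 S] by (simp add: S_def power2_eq_square)
        then have "C^2 * S^2 <= C^2 * (2 * S)" by (intro mult_left_mono) auto
        moreover have "alpha^2 * a^2 <= alpha^2 * S" "p^2 * b^2 <= p^2 * S"
          by (intro mult_left_mono; simp add: S_def)+
        ultimately show ?thesis unfolding S_def[symmetric] by (simp add: power_mult_distrib algebra_simps)
      qed
      finally have "L * X^2 <= L * (3 * (alpha^2 + p^2 + 2 * C^2) * (a^2 + b^2))" using L by simp
      then show "v (s, y) <= v (t, x) + g * alpha * (s - t) + g * p * (y - x) + C' * ((s - t)^2 + (y - x)^2)"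
        using le unfolding C'_def X_def a_def[symmetric] b_def[symmetric] by (simp add: algebra_simps)
    qed
    have "g * p ~= 0" "0 < min delta 1" using g p delta by auto
    then obtain r where r: "0 < r" "r < r0" "g * alpha <= abs (g * p) * kint r (jump eps v t x)"
      using jsub_weak[OF v t _ _ r0 tv] by blast
    have "jump eps ?u t x = jump eps v t x"
      by (simp add: fun_eq_iff jump_def E_upper_unbend[OF assms(2)])
    moreover have "g * alpha <= g * (abs p * kint r (jump eps v t x))" using r(3) g by (simp add: abs_mult mult.assoc)
    ultimately show "EX r>0. r < r0 & alpha <= abs p * kint r (jump eps ?u t x)"
      using r g by (intro exI[of _ r]) auto }
  { fix t x alpha C delta assume t: "0 < t" "0 < delta" "touch4 ?u t x alpha C delta"
    define g where "g = bend' eps (?u (t, x))"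
    define L where "L = pi / eps"
    define C' where "C' = g * C + L * (2 * (alpha^2 + 2 * C^2))"
    have g: "0 < g" by (simp add: g_def bend'_pos)
    have L: "0 < L" using assms(2) by (simp add: L_def)
    have "touch4 v t x (g * alpha) C' (min delta 1)"
      unfolding touch4_def
    proof (intro allI impI)
      fix s y assume s: "0 < s" "abs (s - t) < min delta 1" "abs (y - x) < min delta 1"
      define a b where "a = s - t" and "b = (y - x) ^ 4"
      define X where "X = alpha * a + C * (a^2 + b)"
      have "?u (s, y) <= ?u (t, x) + X"
        using t(3)[unfolded touch4_def, rule_format, of s y] s by (simp add: X_def a_def b_def algebra_simps)
      from tay[OF this] have le: "v (s, y) <= v (t, x) + g * X + L * X^2" by (simp add: g_def L_def)
      have ab: "a^2 <= 1" "0 <= b" using s by (auto simp: a_def b_def abs_square_le_1)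
      have "abs (y - x) ^ 4 <= 1" using s by (intro power_le_one) auto
      then have b1: "b <= 1" by (simp add: b_def)
      have "X^2 <= 2 * ((alpha * a)^2 + (C * (a^2 + b))^2)"
      proof -
        have "(u + v)^2 <= 2 * (u^2 + v^2)" for u v :: real
          using sum_squares_ge_zero[of "u - v" 0] by (simp add: power2_eq_square algebra_simps)
        then show ?thesis unfolding X_def by blast
      qed
      also have "\<dots> <= 2 * (alpha^2 + 2 * C^2) * (a^2 + b)"
      proof -
        define S where "S = a^2 + b"
        have "S^2 <= 2 * S"
          using ab b1 mult_right_mono[of S 2 S] by (simp add: S_def power2_eq_square)
        then have "C^2 * S^2 <= C^2 * (2 * S)" by (intro mult_left_mono) auto
        moreover have "alpha^2 * a^2 <= alpha^2 * S"
          using ab by (intro mult_left_mono) (auto simp: S_def)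
        ultimately show ?thesis unfolding S_def[symmetric] by (simp add: power_mult_distrib algebra_simps)
      qed
      finally have "L * X^2 <= L * (2 * (alpha^2 + 2 * C^2) * (a^2 + b))" using L by simp
      then show "v (s, y) <= v (t, x) + g * alpha * (s - t) + C' * ((s - t)^2 + (y - x) ^ 4)"
        using le unfolding C'_def X_def a_def[symmetric] b_def[symmetric] by (simp add: algebra_simps)
    qed
    then have "g * alpha <= 0" by (rule jsub_flat[OF v t(1), rotated]) (use t(2) in simp)
    then show "alpha <= 0" using g by (simp add: mult_le_0_iff) }
qed

text \<open>The subtracted term \<open>(s - t)^2 + (y - x) ^ 4\<close> makes the contact of
  \<open>U\<close> with \<open>P\<close> strict. A member of \<open>F\<close> that nearly attains
  \<open>U (t, x)\<close> therefore has its own maximum of \<open>v - P\<close> close by.\<close>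

lemma sup_contact:
  assumes F: "!!v. v \<in> F ==> usc_on Q v" "!!v s y. v \<in> F ==> 0 < s ==> v (s, y) <= U (s, y)"
    and approx: "!!eta. 0 < eta ==> \<exists>v\<in>F. EX s y. 0 < s & abs (s - t) < eta & abs (y - x) < eta & U (t, x) - eta < v (s, y)"
    and d: "0 < d" "d <= 1" "d < t"
    and P: "continuous_on UNIV P" "P (t, x) = 0"
    and U: "!!s y. abs (s - t) <= d ==> abs (y - x) <= d ==>
      U (s, y) <= U (t, x) + P (s, y) - ((s - t)^2 + (y - x) ^ 4)"
    and "0 < e"
  shows "EX v t' x'. v \<in> F & abs (t' - t) < e & abs (x' - x) < e & U (t, x) - e < v (t', x') &
    (ALL s y. abs (s - t) <= d --> abs (y - x) <= d --> v (s, y) <= v (t', x') + P (s, y) - P (t', x'))"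
proof -
  have Pc: "EX c>0. ALL s y. abs (s - t) < c --> abs (y - x) < c --> abs (P (s, y)) < a" if a: "0 < a" for a
  proof -
    obtain c where c: "0 < c" "!!q. dist q (t, x) < c ==> dist (P q) (P (t, x)) < a"
      using P(1) a unfolding continuous_on_iff by (metis UNIV_I)
    show ?thesis
    proof (intro exI[of _ "c/2"] conjI allI impI)
      fix s y assume h: "abs (s - t) < c/2" "abs (y - x) < c/2"
      have "sqrt ((s - t)^2 + (y - x)^2) <= abs (s - t) + abs (y - x)" by (rule sqrt_sum_squares_le_sum_abs)
      then have "dist (s, y) (t, x) < c" using h by (simp add: dist_Pair_Pair dist_real_def)
      then show "abs (P (s, y)) < a" using c(2) P(2) by (fastforce simp: dist_real_def)
    qed (use c in simp)
  qed
  obtain e1 where e1: "0 < e1" "!!s y. abs (s - t) < e1 ==> abs (y - x) < e1 ==> abs (P (s, y)) < e / 2"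
    using Pc[of "e/2"] assms(10) by auto
  define e2 where "e2 = Min {e, e1, d}"
  have e2: "0 < e2" using assms e1 by (simp add: e2_def)
  have e2le: "e2 <= e" "e2 <= e1" "e2 <= d" unfolding e2_def by (rule Min_le; simp)+
  \<comment> \<open>A point whose penalty is below \<open>e2 ^ 4\<close> lies within
    \<open>e2\<close> of the contact point, as \<open>e2 <= 1\<close>; the bound
    \<open>e / 2\<close> controls the loss in value.\<close>
  define m where "m = min (e2 ^ 4) (e / 2)"
  have m: "0 < m" "m <= e2 ^ 4" "m <= e / 2" using e2 assms(10) by (auto simp: m_def)
  obtain e3 where e3: "0 < e3" "!!s y. abs (s - t) < e3 ==> abs (y - x) < e3 ==> abs (P (s, y)) < m / 2"
    using Pc[of "m/2"] m by auto
  define eta where "eta = Min {e3, m / 2, d}"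
  have eta: "0 < eta" using e3 m d by (simp add: eta_def)
  have etale: "eta <= e3" "eta <= m / 2" "eta <= d" unfolding eta_def by (rule Min_le; simp)+
  obtain v s0 y0 where v: "v \<in> F" "0 < s0" "abs (s0 - t) < eta" "abs (y0 - x) < eta" "U (t, x) - eta < v (s0, y0)"
    using approx[OF eta] by blast
  obtain t' x' where tx: "t - d <= t'" "t' <= t + d" "x - d <= x'" "x' <= x + d"
    and mx: "!!s y. t - d <= s ==> s <= t + d ==> x - d <= y ==> y <= x + d ==>
      v (s, y) - P (s, y) <= v (t', x') - P (t', x')"
    by (rule usc_on_box_attains[OF F(1)[OF v(1)] _ _ _ continuous_on_subset[OF P(1)],
          of "t - d" "t + d" "x - d" "x + d"]) (use d in auto)
  have "v (s0, y0) - P (s0, y0) <= v (t', x') - P (t', x')"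
    using v etale by (intro mx) (auto simp: abs_if split: if_splits)
  moreover have "abs (P (s0, y0)) < m / 2" using v etale by (intro e3(2)) auto
  ultimately have gt: "U (t, x) - m < v (t', x') - P (t', x')" using v(5) etale by linarith
  have "v (t', x') <= U (t', x')" using tx d by (intro F(2)[OF v(1)]) auto
  also have "\<dots> <= U (t, x) + P (t', x') - ((t' - t)^2 + (x' - x) ^ 4)"
    using tx by (intro U) auto
  finally have D: "(t' - t)^2 + (x' - x) ^ 4 < e2 ^ 4" using gt m by linarith
  have e21: "e2 <= 1" using e2le d by simp
  have "(t' - t)^2 < e2 ^ 4" using D by (smt (verit) zero_le_even_power even_numeral)
  also have "e2 ^ 4 <= e2^2" using e2 e21 by (intro power_decreasing) auto
  finally have "abs (t' - t)^2 < e2^2" by simp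
  then have near1: "abs (t' - t) < e2" using e2 power_less_imp_less_base[of "abs (t' - t)" 2 e2] by simp
  have "(x' - x) ^ 4 < e2 ^ 4" using D zero_le_power2[of "t' - t"] by linarith
  then have "abs (x' - x) ^ 4 < e2 ^ 4" by simp
  then have near2: "abs (x' - x) < e2" using e2 power_less_imp_less_base[of "abs (x' - x)" 4 e2] by simp
  have "abs (P (t', x')) < e / 2" using near1 near2 e2le by (intro e1(2)) auto
  then have "U (t, x) - e < v (t', x')" using gt m by linarith
  moreover have "v (s, y) <= v (t', x') + P (s, y) - P (t', x')" if "abs (s - t) <= d" "abs (y - x) <= d" for s y
    using mx[of s y] that by (auto simp: abs_if split: if_splits)
  ultimately show ?thesis using near1 near2 e2le v(1) by (intro exI[of _ v] exI[of _ t'] exI[of _ x']) auto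
qed

text \<open>Tests of \<open>U\<close> are transferred to nearby contacts of members of
  \<open>F\<close>. With nonzero gradient all of these satisfy the inequality at one fixed radius,
  and semicontinuity passes it to the limit. With zero gradient only an estimate that is uniform in
  the gradient helps.\<close>

lemma jsub_sup:
  assumes "0 < eps"
    and F: "!!v. v \<in> F ==> jsub eps v" "!!v t x. v \<in> F ==> 0 < t ==> abs (v (t, x)) <= A"
      "!!v t x. v \<in> F ==> 0 < t ==> v (t, x) <= U (t, x)"
    and U: "usc_on Q U" "!!t x. 0 < t ==> abs (U (t, x)) <= A"
    and approx: "!!t x eta. 0 < t ==> 0 < eta ==>
      \<exists>v\<in>F. EX s y. 0 < s & abs (s - t) < eta & abs (y - x) < eta & U (t, x) - eta < v (s, y)"
  shows "jsub eps U"
  unfolding jsub_def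
proof (intro conjI allI impI)
  show "bounded (U ` Q)" using U(2) by (rule bounded_QI)
  show "usc_on Q U" by (rule U)
  have A0: "0 <= A" using U(2)[of 1 0] by (meson abs_ge_zero order_trans zero_less_one)
  have Fu: "usc_on Q v" if "v \<in> F" for v using jsub_usc[OF F(1)[OF that]] .
  { fix t x alpha C delta assume t: "0 < t" and delta: "0 < delta" and tch: "touch4 U t x alpha C delta"
    \<comment> \<open>Raising the constant by one produces the strictness required by
      \<open>sup_contact\<close>.\<close>
    define C1 where "C1 = abs C + 1"
    define d where "d = Min {delta, t, 1} / 2"
    have mle: "Min {delta, t, 1} <= delta" "Min {delta, t, 1} <= t" "Min {delta, t, 1} <= 1" by (rule Min_le; simp)+
    have mpos: "0 < Min {delta, t, 1}" using t delta by simp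
    have d: "0 < d" "d <= 1" "d < t" "d < delta" using mle mpos unfolding d_def by linarith+
    define P where "P = (%(s, y). alpha * (s - t) + C1 * ((s - t)^2 + (y - x) ^ 4))"
    have Pc: "continuous_on UNIV P"
      unfolding P_def case_prod_beta by (intro continuous_intros)
    have P0: "P (t, x) = 0" by (simp add: P_def)
    have apx: "\<exists>v\<in>F. EX s y. 0 < s & abs (s - t) < eta & abs (y - x) < eta & U (t, x) - eta < v (s, y)"
      if "0 < eta" for eta by (rule approx[OF t that])
    have UP: "U (s, y) <= U (t, x) + P (s, y) - ((s - t)^2 + (y - x) ^ 4)"
      if h: "abs (s - t) <= d" "abs (y - x) <= d" for s y
    proof -
      have "U (s, y) <= U (t, x) + alpha * (s - t) + C * ((s - t)^2 + (y - x) ^ 4)"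
        using h d by (intro tch[unfolded touch4_def, rule_format]) auto
      also have "C * ((s - t)^2 + (y - x) ^ 4) <= abs C * ((s - t)^2 + (y - x) ^ 4)"
        by (intro mult_right_mono) auto
      finally show ?thesis by (simp add: P_def C1_def algebra_simps)
    qed
    define Kq K where "Kq = 8 * (2 * A + eps / 2) * C1 * (1 + 15 * C1 / eps)" and "K = 2 * C1 + Kq"
    have C1: "0 < C1" by (simp add: C1_def)
    have K: "0 < K" unfolding K_def Kq_def using C1 A0 assms(1) by (intro add_pos_nonneg mult_nonneg_nonneg) auto
    \<comment> \<open>The members may touch at points with nonzero gradient, where the flat test
      says nothing. \<open>quartic_contact\<close> covers both cases, with a bound that tends to
      \<open>0\<close> as the contact points approach \<open>(t, x)\<close>.\<close>
    have "alpha <= K * e" if e: "0 < e" "e < d / 2" for e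
    proof -
      obtain v t' x' where v: "v \<in> F" "abs (t' - t) < e" "abs (x' - x) < e" "U (t, x) - e < v (t', x')"
        and vle: "!!s y. abs (s - t) <= d ==> abs (y - x) <= d ==> v (s, y) <= v (t', x') + P (s, y) - P (t', x')"
      proof -
        have "EX v t' x'. v \<in> F & abs (t' - t) < e & abs (x' - x) < e & U (t, x) - e < v (t', x') &
          (ALL s y. abs (s - t) <= d --> abs (y - x) <= d --> v (s, y) <= v (t', x') + P (s, y) - P (t', x'))"
          by (rule sup_contact[where U = U and t = t and x = x]; fact)
        then show thesis using that by blast
      qed
      define Y where "Y = x' - x"
      define alpha' where "alpha' = alpha + 2 * C1 * (t' - t)"
      have Y: "abs Y <= 1" "abs Y < e" using v e d by (auto simp: Y_def)
      have e1: "e <= 1" using e d by simp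
      have "abs Y ^ 4 <= 1" using Y by (intro power_le_one) auto
      then have Y4: "C1 * Y ^ 4 <= C1" using C1 by simp
      have t': "0 < t'" using v d e by linarith
      have "alpha' <= 8 * (2 * A + eps / 2) * C1 * Y^2 * (1 + 15 * C1 / eps)"
      proof (rule quartic_contact[OF F(1)[OF v(1)] assms(1) F(2)[OF v(1)] t' C1 Y4, of "d / 2" x' alpha' C1])
        show "v (s, y) <= v (t', x') + alpha' * (s - t') + C1 * (s - t')^2 + C1 * ((Y + (y - x')) ^ 4 - Y ^ 4)"
          if "abs (s - t') < d / 2" "abs (y - x') < d / 2" for s y
        proof -
          have "abs (s - t) <= d" "abs (y - x) <= d" using that v(2,3) e by linarith+
          from vle[OF this] show ?thesis
            by (simp add: P_def alpha'_def Y_def) (simp add: power2_eq_square algebra_simps)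
        qed
        show "v (t', x' + z) - v (t', x') <= C1 * ((Y + z) ^ 4 - Y ^ 4)" if "abs z <= abs Y" for z
          using vle[of t' "x' + z"] that v e Y by (simp add: P_def Y_def algebra_simps)
      qed (use d in auto)
      also have "\<dots> <= 8 * (2 * A + eps / 2) * C1 * e * (1 + 15 * C1 / eps)"
      proof (intro mult_right_mono mult_left_mono)
        have "Y^2 = abs Y * abs Y" by (simp add: power2_eq_square)
        also have "\<dots> <= abs Y" using Y by (intro mult_left_le) auto
        finally have "Y^2 <= abs Y" .
        then show "Y^2 <= e" using Y by simp
      qed (use A0 assms(1) C1 in auto)
      also have "\<dots> = Kq * e" by (simp add: Kq_def)
      finally have "alpha' <= Kq * e" .
      moreover have "- (2 * C1 * (t' - t)) <= 2 * C1 * e"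
      proof -
        have "2 * C1 * - (t' - t) <= 2 * C1 * e" using v(2) C1 by (intro mult_left_mono) auto
        then show ?thesis by (simp only: mult_minus_right)
      qed
      ultimately show ?thesis unfolding alpha'_def K_def by (simp add: algebra_simps)
    qed
    then show "alpha <= 0" using one_sided_slope[of "d / 2" alpha K] d by (simp add: power2_eq_square) }
  fix t x alpha p C delta and r0 :: real
  assume t: "0 < t" and p: "p ~= 0" and delta: "0 < delta" and r0: "0 < r0" and tch: "touch U t x alpha p C delta"
  define C1 where "C1 = abs C + 1"
  have C1: "0 < C1" "abs C1 = C1" by (simp_all add: C1_def)
  have "0 < Min {delta, t, 1}" using t delta by simp
  then obtain delta1 where delta1: "0 < delta1" "delta1 <= Min {delta, t, 1}" "C1 * delta1 <= abs p" "abs p * delta1 + C1 * delta1^2 <= eps"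
    using small_radius[OF assms(1) p, of "Min {delta, t, 1}" C1] C1 by auto
  have mle: "Min {delta, t, 1} <= delta" "Min {delta, t, 1} <= t" "Min {delta, t, 1} <= 1" by (rule Min_le; simp)+
  define d delta2 r where "d = delta1 / 2" and "delta2 = delta1 / 4" and "r = min r0 delta2 / 2"
  have d: "0 < d" "d <= 1" "d < t" "d < delta" using mle delta1 unfolding d_def by linarith+
  have delta2: "0 < delta2" using delta1 by (simp add: delta2_def)
  have r: "0 < r" "r < r0" "r < delta2" using r0 delta2 by (auto simp: r_def min_def)
  define P where "P = (%(s, y). alpha * (s - t) + p * (y - x) + C1 * ((s - t)^2 + (y - x)^2))"
  have Pc: "continuous_on UNIV P"
    unfolding P_def case_prod_beta by (intro continuous_intros)
  have P0: "P (t, x) = 0" by (simp add: P_def)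
  have apx: "\<exists>v\<in>F. EX s y. 0 < s & abs (s - t) < eta & abs (y - x) < eta & U (t, x) - eta < v (s, y)"
    if "0 < eta" for eta by (rule approx[OF t that])
  have UP: "U (s, y) <= U (t, x) + P (s, y) - ((s - t)^2 + (y - x) ^ 4)"
    if h: "abs (s - t) <= d" "abs (y - x) <= d" for s y
  proof -
    have "U (s, y) <= U (t, x) + alpha * (s - t) + p * (y - x) + C * ((s - t)^2 + (y - x)^2)"
      using h d by (intro tch[unfolded touch_def, rule_format]) auto
    also have "C * ((s - t)^2 + (y - x)^2) <= abs C * ((s - t)^2 + (y - x)^2)"
      by (intro mult_right_mono) auto
    finally have "U (s, y) <= U (t, x) + P (s, y) - ((s - t)^2 + (y - x)^2)"
      by (simp add: P_def C1_def algebra_simps)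
    moreover have "abs (y - x) ^ 4 <= abs (y - x)^2" using h d by (intro power_decreasing) auto
    ultimately show ?thesis by simp
  qed
  define e0 where "e0 = min delta2 (abs p / (4 * C1))"
  have e0: "0 < e0" using delta2 p C1 by (simp add: e0_def)
  have e0le: "e0 <= delta2" unfolding e0_def by (rule min.cobounded1)
  have "e0 <= abs p / (4 * C1)" unfolding e0_def by (rule min.cobounded2)
  then have e0p: "2 * C1 * e0 <= abs p / 2" using C1 by (simp add: pos_le_divide_eq algebra_simps)
  define en where "en n = e0 / real (Suc n)" for n
  have en: "0 < en n" "en n <= e0" for n
    using e0 by (auto simp: en_def field_simps)
  have en0: "en \<longlonglongrightarrow> 0"
    unfolding en_def using tendsto_mult_right_zero[OF LIMSEQ_inverse_real_of_nat, of e0]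
    by (simp add: divide_inverse)
  define Phi where "Phi n v t' x' \<longleftrightarrow> v \<in> F & abs (t' - t) < en n & abs (x' - x) < en n & U (t, x) - en n < v (t', x') &
    (ALL s y. abs (s - t) <= d --> abs (y - x) <= d --> v (s, y) <= v (t', x') + P (s, y) - P (t', x'))" for n v t' x'
  have "EX v t' x'. Phi n v t' x'" for n
    unfolding Phi_def by (rule sup_contact[where U = U and t = t and x = x]; fact)
  then obtain V T X where Phi: "!!n. Phi n (V n) (T n) (X n)" by metis
  have V: "V n \<in> F" "abs (T n - t) < en n" "abs (X n - x) < en n" "U (t, x) - en n < V n (T n, X n)"
    and Vle: "abs (s - t) <= d ==> abs (y - x) <= d ==> V n (s, y) <= V n (T n, X n) + P (s, y) - P (T n, X n)" for n s y
    using Phi[of n] unfolding Phi_def by blast+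
  define alphan pn where "alphan n = alpha + 2 * C1 * (T n - t)" and "pn n = p + 2 * C1 * (X n - x)" for n
  have Tlim: "T \<longlonglongrightarrow> t" and Xlim: "X \<longlonglongrightarrow> x"
  proof -
    have "(%n. T n - t) \<longlonglongrightarrow> 0" "(%n. X n - x) \<longlonglongrightarrow> 0"
      using V(2,3) by (auto intro!: Lim_null_comparison[OF _ en0] always_eventually less_imp_le)
    then show "T \<longlonglongrightarrow> t" "X \<longlonglongrightarrow> x" by (simp_all add: LIM_zero_iff)
  qed
  have Tpos: "0 < T n" for n
    using V(2)[of n] en(2)[of n] e0le d(3) delta1 unfolding delta2_def d_def by linarith
  \<comment> \<open>One radius serves all \<open>n\<close>: the gradients \<open>pn n\<close> stay
    between \<open>abs p / 2\<close> and \<open>3 / 2 * abs p\<close> in modulus, so the smallness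
    conditions of \<open>jsub_strong\<close> hold uniformly.\<close>
  have step: "alphan n <= abs (pn n) * kint r (jump eps (V n) (T n) (X n))" for n
  proof -
    have "abs (2 * C1 * (X n - x)) <= 2 * C1 * e0"
      using V(3)[of n] en(2)[of n] C1 by (simp add: abs_mult)
    then have pn: "abs p / 2 <= abs (pn n)" "abs (pn n) <= 3 / 2 * abs p"
      using e0p unfolding pn_def by linarith+
    show ?thesis
    proof (rule jsub_strong[OF F(1)[OF V(1)] assms(1) Tpos])
      show "touch (V n) (T n) (X n) (alphan n) (pn n) C1 delta2"
        unfolding touch_def
      proof (intro allI impI)
        fix s y assume h: "abs (s - T n) < delta2" "abs (y - X n) < delta2"
        have "abs (s - t) <= d" "abs (y - x) <= d"
          using h V(2,3)[of n] en(2)[of n] e0le unfolding delta2_def d_def by linarith+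
        then have "V n (s, y) <= V n (T n, X n) + P (s, y) - P (T n, X n)" by (rule Vle)
        then show "V n (s, y) <= V n (T n, X n) + alphan n * (s - T n) + pn n * (y - X n)
            + C1 * ((s - T n)^2 + (y - X n)^2)"
          by (simp add: P_def alphan_def pn_def power2_eq_square algebra_simps)
      qed
      show "pn n ~= 0" using pn p by auto
      show "C1 * delta2 <= abs (pn n)" using pn delta1(3) p by (simp add: delta2_def)
      have "abs (pn n) * delta2 <= 3 / 2 * abs p * delta2" using pn delta2 by (intro mult_right_mono) auto
      moreover have "3 / 2 * abs p * delta2 + C1 * delta2^2 <= abs p * delta1 + C1 * delta1^2"
      proof -
        have "0 <= abs p * delta1" "0 <= C1 * delta1^2" using delta1(1) C1 by simp_all
        then show ?thesis by (simp add: delta2_def power2_eq_square)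
      qed
      ultimately show "abs (pn n) * delta2 + C1 * delta2^2 <= eps" using delta1(4) by linarith
    qed (use C1 r in auto)
  qed
  \<comment> \<open>Upper semicontinuity of \<open>U\<close> at \<open>x + z\<close>, convergence of
    the contact values at \<open>x\<close>, and upper semicontinuity of the staircase bound the
    jumps pointwise in the limit.\<close>
  have ev: "eventually (%n. kint r (jump eps (V n) (T n) (X n)) <= kint r (jump eps U t x) + e) sequentially"
    if "0 < e" for e
  proof (rule kint_limsup[where B = "2 * A + eps / 2"])
    show "jump eps (V n) (T n) (X n) \<in> borel_measurable borel" for n
      by (rule jump_measurable[OF Fu[OF V(1)] Tpos])
    show "abs (jump eps (V n) (T n) (X n) z) <= 2 * A + eps / 2" for n z
      by (rule jump_bound) (use assms(1) F(2)[OF V(1)] Tpos in auto)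
    show "jump eps U t x \<in> borel_measurable borel" by (rule jump_measurable[OF U(1) t])
    show "abs (jump eps U t x z) <= 2 * A + eps / 2" for z
      by (rule jump_bound) (use assms(1) U(2) t in auto)
    fix z e' :: real assume "0 < e'"
    obtain eta where eta: "0 < eta" "!!b. b < U (t, x + z) - U (t, x) + eta ==> E_upper eps b <= jump eps U t x z"
      unfolding jump_def using E_upper_usc[OF assms(1)] by metis
    obtain d' where d': "0 < d'"
      "!!s y. 0 < s ==> abs (s - t) < d' ==> abs (y - (x + z)) < d' ==> U (s, y) < U (t, x + z) + eta / 2"
      using usc_onD[OF U(1) t, of "x + z" "U (t, x + z) + eta / 2"] eta(1) by auto
    have "eventually (%n. en n < min d' (eta / 2)) sequentially"
      using en0 d'(1) eta(1) by (intro order_tendstoD) auto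
    then show "eventually (%n. jump eps (V n) (T n) (X n) z <= jump eps U t x z + e') sequentially"
    proof eventually_elim
      case (elim n)
      have "V n (T n, X n + z) <= U (T n, X n + z)" by (rule F(3)[OF V(1) Tpos])
      also have "\<dots> < U (t, x + z) + eta / 2"
        using elim V(2,3)[of n] by (intro d'(2)[OF Tpos]) auto
      finally have "V n (T n, X n + z) - V n (T n, X n) < U (t, x + z) - U (t, x) + eta"
        using V(4)[of n] elim by simp
      from eta(2)[OF this] show ?case using \<open>0 < e'\<close> by (simp add: jump_def)
    qed
  qed (use r that in auto)
  have "alpha <= abs p * (kint r (jump eps U t x) + e)" if "0 < e" for e
  proof (rule tendsto_le[OF sequentially_bot])
    show "(%n. abs (pn n) * (kint r (jump eps U t x) + e)) \<longlonglongrightarrow> abs p * (kint r (jump eps U t x) + e)"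
    proof -
      have "(%n. abs (pn n) * (kint r (jump eps U t x) + e)) \<longlonglongrightarrow> abs (p + 2 * C1 * (x - x)) * (kint r (jump eps U t x) + e)"
        unfolding pn_def by (intro tendsto_intros Xlim)
      then show ?thesis by simp
    qed
    show "alphan \<longlonglongrightarrow> alpha"
    proof -
      have "alphan \<longlonglongrightarrow> alpha + 2 * C1 * (t - t)"
        unfolding alphan_def by (intro tendsto_intros Tlim)
      then show ?thesis by simp
    qed
    show "eventually (%n. alphan n <= abs (pn n) * (kint r (jump eps U t x) + e)) sequentially"
      using ev[OF that]
    proof eventually_elim
      case (elim n)
      then have "abs (pn n) * kint r (jump eps (V n) (T n) (X n)) <= abs (pn n) * (kint r (jump eps U t x) + e)"
        by (intro mult_left_mono) auto
      then show ?case using step[of n] by linarith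
    qed
  qed
  then have le: "alpha <= abs p * kint r (jump eps U t x) + abs p * e" if "0 < e" for e
    using that by (simp add: distrib_left)
  have "alpha <= abs p * kint r (jump eps U t x)"
  proof (rule field_le_epsilon)
    fix e :: real assume "0 < e"
    then show "alpha <= abs p * kint r (jump eps U t x) + e" using le[of "e / abs p"] p by simp
  qed
  then show "EX r>0. r < r0 & alpha <= abs p * kint r (jump eps U t x)" using r by blast
qed

section \<open>Perron's method\<close>

text \<open>The initial condition from above only. The condition from below is the same predicate
  for the negated function and the negated datum.\<close>

definition starts_below :: "(real \<times> real => real) => (real => real) => bool" where
  "starts_below v g \<longleftrightarrow> (ALL x c. g x < c -->
     (EX d>0. ALL t y. 0 < t --> t < d --> abs (y - x) < d --> v (t, y) < c))"

lemma starts_belowD: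
  assumes "starts_below v g" "g x < c"
  obtains d where "0 < d" "!!t y. 0 < t ==> t < d ==> abs (y - x) < d ==> v (t, y) < c"
  using assms unfolding starts_below_def by meson

text \<open>Compactness of the interval in the form of bisection: adjacent intervals share the
  smaller of their times.\<close>

lemma uniform_start:
  fixes a b t0 :: real
  assumes "a <= b"
    and "!!x. a <= x ==> x <= b ==> EX d>0. ALL t y. t0 < t --> t < t0 + d --> abs (y - x) < d --> P t y"
  shows "EX h>0. ALL t y. t0 < t --> t < t0 + h --> a <= y --> y <= b --> P t y"
  using assms(1)
proof (induct rule: Bolzano)
  case (trans a b c)
  then obtain h h' where "0 < h" "ALL t y. t0 < t --> t < t0 + h --> a <= y --> y <= b --> P t y"
    "0 < h'" "ALL t y. t0 < t --> t < t0 + h' --> b <= y --> y <= c --> P t y" by blast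
  then show ?case by (intro exI[of _ "min h h'"]) (force simp: linear)
next
  case (local x)
  then obtain d where d: "0 < d" "ALL t y. t0 < t --> t < t0 + d --> abs (y - x) < d --> P t y"
    using assms(2) by blast
  show ?case
  proof (rule exI[of _ d], intro conjI allI impI)
    fix u v assume uv: "u <= x & x <= v & v - u < d"
    have "P t y" if "t0 < t" "t < t0 + d" "u <= y" "y <= v" for t y
      using that uv by (intro d(2)[rule_format]) auto
    then show "EX h>0. ALL t y. t0 < t --> t < t0 + h --> u <= y --> y <= v --> P t y"
      using d(1) by blast
  qed (rule d(1))
qed

lemma starts_below_plateau:
  assumes v: "jsub eps v" and "0 < eps" and A: "!!t x. 0 < t ==> abs (v (t, x)) <= A"
    and st: "starts_below v g" and "0 < R" and g: "!!y. abs (y - p) <= R ==> g y <= a" and "0 < t"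
  shows "v (t, p) <= a + plateau_speed eps A / R^2 * t"
proof (rule field_le_epsilon)
  fix e :: real assume e: "0 < e"
  have "EX h>0. ALL t y. 0 < t --> t < 0 + h --> p - R <= y --> y <= p + R --> v (t, y) < a + e"
  proof (rule uniform_start)
    fix x assume "p - R <= x" "x <= p + R"
    then have "abs (x - p) <= R" by (simp add: abs_le_iff)
    then have "g x < a + e" using g[of x] e by simp
    then show "EX d>0. ALL t y. 0 < t --> t < 0 + d --> abs (y - x) < d --> v (t, y) < a + e"
      using st unfolding starts_below_def by simp
  qed (use \<open>0 < R\<close> in simp)
  then obtain h where h: "0 < h" "!!t y. 0 < t ==> t < h ==> p - R <= y ==> y <= p + R ==> v (t, y) < a + e"
    by auto
  have "v (t, p) <= a + e + plateau_speed eps A / R^2 * (t - 0)"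
  proof (rule jsub_plateau[OF v assms(2) A _ h(1) \<open>0 < R\<close>])
    show "v (t, x) <= a + e" if "0 < t" "t < 0 + h" "abs (x - p) <= R" for t x
      using that h(2)[of t x] by (auto simp: abs_le_iff)
  qed (use \<open>0 < t\<close> in auto)
  then show "v (t, p) <= a + plateau_speed eps A / R^2 * t + e" by simp
qed

text \<open>Under a global bound on the datum, plateaus of every radius are available, and their
  speed tends to \<open>0\<close> as the radius grows.\<close>

lemma starts_below_bound:
  assumes v: "jsub eps v" and "0 < eps" and st: "starts_below v g" and g: "!!y. g y <= G" and "0 < t"
  shows "v (t, x) <= G"
proof -
  obtain A where A: "0 < A" "!!t x. 0 < t ==> abs (v (t, x)) <= A"
    using bounded_QE[OF jsub_bounded[OF v]] by metis
  have le: "v (t, x) <= G + plateau_speed eps A / (real (Suc n))^2 * t" for n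
    by (rule starts_below_plateau[OF v assms(2) A(2) st]) (use g assms in auto)
  have "(%n. G + plateau_speed eps A * (inverse (real (Suc n)))^2 * t) \<longlonglongrightarrow> G + plateau_speed eps A * 0^2 * t"
    by (intro tendsto_intros LIMSEQ_inverse_real_of_nat)
  then have "(%n. G + plateau_speed eps A / (real (Suc n))^2 * t) \<longlonglongrightarrow> G"
    by (simp add: power_inverse divide_inverse)
  then show ?thesis by (rule LIMSEQ_le_const) (use le in auto)
qed

text \<open>The upper semicontinuous envelope on \<open>Q\<close> as a real-valued function, which
  keeps extended reals out of Perron's method. It is meaningful for bounded functions, and only such
  functions are inserted.\<close>

definition uenv :: "(real \<times> real => real) => real \<times> real => real" where
  "uenv u = (%(t, x). Inf {c. EX d>0. ALL s y. 0 < s --> abs (s - t) < d --> abs (y - x) < d --> u (s, y) <= c})"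

lemma uenv:
  assumes b: "!!t x. 0 < t ==> abs (u (t, x)) <= A"
  shows uenv_ge: "!!t x. 0 < t ==> u (t, x) <= uenv u (t, x)"
    and uenv_near: "!!t x eta. 0 < t ==> 0 < eta ==>
      EX s y. 0 < s & abs (s - t) < eta & abs (y - x) < eta & uenv u (t, x) - eta < u (s, y)"
    and uenv_le: "!!t x c d. 0 < t ==> 0 < d ==>
      (!!s y. 0 < s ==> abs (s - t) < d ==> abs (y - x) < d ==> u (s, y) <= c) ==> uenv u (t, x) <= c"
    and uenv_bound: "!!t x. 0 < t ==> abs (uenv u (t, x)) <= A"
    and uenv_usc: "usc_on Q (uenv u)"
proof -
  define S where "S t x = {c. EX d>0. ALL s y. 0 < s --> abs (s - t) < d --> abs (y - x) < d --> u (s, y) <= c}" for t x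
  have env: "uenv u (t, x) = Inf (S t x)" for t x by (simp add: uenv_def S_def)
  have lower: "u (t, x) <= c" if "0 < t" "c \<in> S t x" for t x c
    using that unfolding S_def by force
  have bdd: "bdd_below (S t x)" if "0 < t" for t x using lower[OF that] by (intro bdd_belowI)
  have AS: "A \<in> S t x" if "0 < t" for t x
    unfolding S_def using b by (auto intro!: exI[of _ 1] simp: abs_le_iff)
  show ge: "u (t, x) <= uenv u (t, x)" if "0 < t" for t x
    unfolding env using lower[OF that] AS[OF that] by (intro cInf_greatest) auto
  show near: "EX s y. 0 < s & abs (s - t) < eta & abs (y - x) < eta & uenv u (t, x) - eta < u (s, y)"
    if "0 < t" "0 < eta" for t x eta
  proof (rule ccontr)
    assume "~ ?thesis"
    then have "ALL s y. 0 < s --> abs (s - t) < eta --> abs (y - x) < eta --> u (s, y) <= uenv u (t, x) - eta"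
      by (metis not_less)
    then have "uenv u (t, x) - eta \<in> S t x" unfolding S_def using that by blast
    then have "uenv u (t, x) <= uenv u (t, x) - eta" unfolding env[of t x] using bdd[OF that(1)] by (intro cInf_lower)
    then show False using that by simp
  qed
  show le: "uenv u (t, x) <= c"
    if "0 < t" "0 < d" "!!s y. 0 < s ==> abs (s - t) < d ==> abs (y - x) < d ==> u (s, y) <= c" for t x c d
    unfolding env using that bdd[OF that(1)] by (intro cInf_lower) (auto simp: S_def)
  show "abs (uenv u (t, x)) <= A" if "0 < t" for t x
    using ge[OF that, of x] b[OF that, of x] le[OF that, of 1 x A] b by (force simp: abs_le_iff)
  show "usc_on Q (uenv u)"
    unfolding usc_on_Q_iff
  proof (intro allI impI)
    fix t x c :: real assume t: "0 < t" "uenv u (t, x) < c"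
    then obtain c' where c': "c' \<in> S t x" "c' < c"
      using cInf_lessD[of "S t x" c] AS[OF t(1)] env by auto
    then obtain d where d: "0 < d" "!!s y. 0 < s ==> abs (s - t) < d ==> abs (y - x) < d ==> u (s, y) <= c'"
      unfolding S_def by blast
    show "EX d>0. ALL s y. 0 < s --> abs (s - t) < d --> abs (y - x) < d --> uenv u (s, y) < c"
    proof (intro exI[of _ "d/2"] conjI allI impI)
      fix s y :: real assume s: "0 < s" "abs (s - t) < d/2" "abs (y - x) < d/2"
      have "uenv u (s, y) <= c'"
      proof (rule le[OF s(1), of "d/2"])
        fix s' y' :: real assume "0 < s'" "abs (s' - s) < d/2" "abs (y' - y) < d/2"
        then show "u (s', y') <= c'" using s by (intro d(2)) linarith+
      qed (use d in simp)
      then show "uenv u (s, y) < c" using c'(2) by simp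
    qed (use d in simp)
  qed
qed

text \<open>The bound by \<open>G\<close> makes the pointwise supremum finite. From above it costs
  nothing, since \<open>starts_below_bound\<close> derives it from the datum.\<close>

definition perron_class :: "real => real => (real => real) => (real \<times> real => real) set" where
  "perron_class eps G g = {v. jsub eps v & (ALL t x. 0 < t --> abs (v (t, x)) <= G) & starts_below v g}"

definition max_sub :: "real => real => (real => real) => real \<times> real => real" where
  "max_sub eps G g = uenv (%q. SUP v\<in>perron_class eps G g. v q)"

text \<open>\<open>g_usc\<close> is upper semicontinuity in the strong form that step functions
  have: near \<open>x\<close> no value exceeds \<open>g x\<close>. Every point is then the centre of
  a plateau, which yields uniform initial estimates.\<close>

locale perron =
  fixes eps G :: real and g :: "real => real"
  assumes eps: "0 < eps" and G0: "0 <= G" and G_int: "G / eps \<in> \<int>"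
    and g_bound: "!!x. abs (g x) <= G" and g_int: "!!x. g x / eps \<in> \<int>"
    and g_usc: "!!x. EX r>0. ALL y. abs (y - x) <= r --> g y <= g x"
begin

text \<open>Beyond distance \<open>R\<close> from \<open>p\<close> the barrier sits on its floor
  \<open>- G\<close>, so only the datum within \<open>R\<close> has to dominate
  \<open>a\<close>.\<close>

lemma barrier_in_class:
  assumes "abs a <= G" "0 < R" "!!y. abs (y - p) < R ==> a <= g y"
  shows "barrier eps G R p a \<in> perron_class eps G g"
  unfolding perron_class_def
proof (intro CollectI conjI allI impI)
  show "jsub eps (barrier eps G R p a)" by (rule jsub_barrier[OF eps assms(1,2)])
  show "abs (barrier eps G R p a (t, x)) <= G" if "0 < t" for t x
    using barrier_bounds(1)[OF eps assms(1,2)] that by simp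
  show "starts_below (barrier eps G R p a) g"
    unfolding starts_below_def
  proof (intro allI impI)
    fix x c assume c: "g x < c"
    have "barrier eps G R p a (0, x) <= g x"
    proof (cases "abs (x - p) < R")
      case True
      then show ?thesis using barrier_bounds(2)[OF eps assms(1,2), of 0 p x] assms(3)[OF True] by simp
    next
      case False
      then have "barrier eps G R p a (0, x) = - G" by (intro barrier_bounds(3)[OF eps assms(1,2)]) auto
      then show ?thesis using g_bound[of x] by linarith
    qed
    then have lt: "barrier eps G R p a (0, x) < c" using c by simp
    have "open {q. barrier eps G R p a q < c}"
      by (intro open_Collect_less continuous_barrier continuous_on_const)
    then obtain e where e: "0 < e" "ball (0, x) e \<subseteq> {q. barrier eps G R p a q < c}"
      using lt unfolding open_contains_ball by blast
    show "EX d>0. ALL t y. 0 < t --> t < d --> abs (y - x) < d --> barrier eps G R p a (t, y) < c"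
    proof (intro exI[of _ "e/2"] conjI allI impI)
      fix t y :: real assume h: "0 < t" "t < e/2" "abs (y - x) < e/2"
      have "sqrt ((0 - t)^2 + (x - y)^2) <= abs (0 - t) + abs (x - y)" by (rule sqrt_sum_squares_le_sum_abs)
      then have "dist (0, x) (t, y) < e" using h by (simp add: dist_Pair_Pair dist_real_def abs_minus_commute[of x y] power2_commute[of x y])
      then show "barrier eps G R p a (t, y) < c" using e(2) by auto
    qed (use e in simp)
  qed
qed

lemma psup:
  shows psup_bound: "!!t x. 0 < t ==> abs (SUP v\<in>perron_class eps G g. v (t, x)) <= G"
    and psup_upper: "!!v t x. v \<in> perron_class eps G g ==> 0 < t ==> v (t, x) <= (SUP v\<in>perron_class eps G g. v (t, x))"
    and psup_near: "!!t x eta. 0 < t ==> 0 < eta ==>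
      \<exists>v\<in>perron_class eps G g. (SUP v\<in>perron_class eps G g. v (t, x)) - eta < v (t, x)"
    and class_nonempty: "perron_class eps G g ~= {}"
proof -
  have b: "abs (v (t, x)) <= G" if "v \<in> perron_class eps G g" "0 < t" for v t x
    using that by (simp add: perron_class_def)
  have "barrier eps G 1 0 (- G) \<in> perron_class eps G g"
  proof (rule barrier_in_class)
    show "- G <= g y" for y using g_bound[of y] by linarith
  qed (use G0 in auto)
  then obtain v0 where v0: "v0 \<in> perron_class eps G g" by blast
  then show ne: "perron_class eps G g ~= {}" by blast
  have bdd: "bdd_above ((%v. v (t, x)) ` perron_class eps G g)" if "0 < t" for t x
    using b[OF _ that] by (intro bdd_aboveI2[where M = G]) (auto simp: abs_le_iff)
  show up: "v (t, x) <= (SUP v\<in>perron_class eps G g. v (t, x))" if "v \<in> perron_class eps G g" "0 < t" for v t x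
    by (rule cSUP_upper[OF that(1) bdd[OF that(2)]])
  show "abs (SUP v\<in>perron_class eps G g. v (t, x)) <= G" if "0 < t" for t x
  proof -
    have "(SUP v\<in>perron_class eps G g. v (t, x)) <= G"
      using b[OF _ that] ne by (intro cSUP_least) (auto simp: abs_le_iff)
    moreover have "- G <= (SUP v\<in>perron_class eps G g. v (t, x))"
      using up[OF v0 that, of x] b[OF v0 that, of x] by linarith
    ultimately show ?thesis by (simp add: abs_le_iff)
  qed
  show "\<exists>v\<in>perron_class eps G g. (SUP v\<in>perron_class eps G g. v (t, x)) - eta < v (t, x)" if "0 < t" "0 < eta" for t x eta
    using less_cSUP_iff[OF ne bdd[OF that(1)], of "(SUP v\<in>perron_class eps G g. v (t, x)) - eta" x] that by auto
qed

lemma max_sub_upper: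
  assumes "v \<in> perron_class eps G g" "0 < t"
  shows "v (t, x) <= max_sub eps G g (t, x)"
  using psup_upper[OF assms, of x] uenv_ge[of "%q. SUP v\<in>perron_class eps G g. v q" G t x] psup_bound assms(2)
  unfolding max_sub_def by force

text \<open>The subsolution property is stability under suprema. That the envelope still starts
  below \<open>g\<close> needs an estimate uniform over the class: near \<open>x\<close> each member
  is at most \<open>g x + K * t\<close>, by the plateau estimate.\<close>

lemma max_sub_in_class: "max_sub eps G g \<in> perron_class eps G g"
proof -
  let ?M = "max_sub eps G g" and ?S = "%q. SUP v\<in>perron_class eps G g. v q"
  have b: "abs (?S (t, x)) <= G" if "0 < t" for t x by (rule psup_bound[OF that])
  have Mb: "abs (?M (t, x)) <= G" if "0 < t" for t x
    unfolding max_sub_def by (rule uenv_bound[where u = ?S, OF b that])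
  have Mu: "usc_on Q ?M" unfolding max_sub_def by (rule uenv_usc[where u = ?S, OF b])
  have "jsub eps ?M"
  proof (rule jsub_sup[OF eps, where F = "perron_class eps G g" and A = G])
    show "\<exists>v\<in>perron_class eps G g. EX s y. 0 < s & abs (s - t) < eta & abs (y - x) < eta & ?M (t, x) - eta < v (s, y)"
      if t: "0 < t" "0 < eta" for t x eta
    proof -
      obtain s y where s: "0 < s" "abs (s - t) < eta/2" "abs (y - x) < eta/2" "?M (t, x) - eta/2 < ?S (s, y)"
        using uenv_near[where u = ?S, OF b t(1), of "eta/2" x] t(2) unfolding max_sub_def by auto
      moreover obtain v where "v \<in> perron_class eps G g" "?S (s, y) - eta/2 < v (s, y)"
        using psup_near[OF s(1), of "eta/2" y] t(2) by auto
      ultimately have "0 < s & abs (s - t) < eta & abs (y - x) < eta & ?M (t, x) - eta < v (s, y)" using t(2) by auto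
      then show ?thesis using \<open>v \<in> _\<close> by blast
    qed
  qed (use Mb Mu max_sub_upper in \<open>auto simp: perron_class_def\<close>)
  moreover have "starts_below ?M g"
    unfolding starts_below_def
  proof (intro allI impI)
    fix x c assume c: "g x < c"
    obtain r where r: "0 < r" "!!y. abs (y - x) <= r ==> g y <= g x" using g_usc by blast
    define K where "K = plateau_speed eps G / (r/2)^2"
    have K: "0 < K" using plateau_speed_pos[OF eps G0] r by (simp add: K_def)
    define d where "d = min (r/2) ((c - g x) / (2 * K))"
    have d: "0 < d" "d <= r/2" using r K c by (auto simp: d_def)
    have dK: "K * d <= (c - g x) / 2"
    proof -
      have "d <= (c - g x) / (2 * K)" unfolding d_def by (rule min.cobounded2)
      then have "K * d <= K * ((c - g x) / (2 * K))" using K by (intro mult_left_mono) auto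
      then show ?thesis using K by simp
    qed
    have S: "?S (t, y) <= (g x + c) / 2" if t: "0 < t" "t < d" "abs (y - x) < d" for t y
    proof (rule cSUP_least[OF class_nonempty])
      fix v assume v: "v \<in> perron_class eps G g"
      have "v (t, y) <= g x + K * t"
        unfolding K_def
      proof (rule starts_below_plateau[OF _ eps])
        show "g z <= g x" if "abs (z - y) <= r/2" for z using that t d by (intro r(2)) linarith
      qed (use v r t in \<open>auto simp: perron_class_def\<close>)
      also have "K * t <= K * d" using K t by (intro mult_left_mono) auto
      finally show "v (t, y) <= (g x + c) / 2" using dK by (simp add: field_simps)
    qed
    show "EX d>0. ALL t y. 0 < t --> t < d --> abs (y - x) < d --> ?M (t, y) < c"
    proof (intro exI[of _ "d/2"] conjI allI impI)
      fix t y assume t: "0 < t" "t < d/2" "abs (y - x) < d/2"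
      have "?M (t, y) <= (g x + c) / 2"
        unfolding max_sub_def
      proof (rule uenv_le[where u = ?S, OF b t(1), of "d/2"])
        show "?S (s, z) <= (g x + c) / 2" if "0 < s" "abs (s - t) < d/2" "abs (z - y) < d/2" for s z
          using that t by (intro S) linarith+
      qed (use d in auto)
      then show "?M (t, y) < c" using c by simp
    qed (use d in simp)
  qed
  ultimately show ?thesis using Mb by (simp add: perron_class_def)
qed

lemma max_sub_bound: "0 < t ==> abs (max_sub eps G g (t, x)) <= G"
  and max_sub_jsub: "jsub eps (max_sub eps G g)"
  and max_sub_starts: "starts_below (max_sub eps G g) g"
  using max_sub_in_class by (auto simp: perron_class_def)

text \<open>\<open>unbend eps\<close> of the maximal subsolution is again in the class, because
  \<open>G\<close> and the values of \<open>g\<close> are multiples of \<open>eps\<close> and hence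
  fixed. It lies above \<open>?M\<close>, so by maximality it equals \<open>?M\<close>, and the
  fixed points of \<open>unbend\<close> are the multiples of \<open>eps\<close>.\<close>

lemma max_sub_int:
  assumes "0 < t"
  shows "max_sub eps G g (t, x) / eps \<in> \<int>"
proof -
  let ?M = "max_sub eps G g" and ?u = "%q. unbend eps (max_sub eps G g q)"
  have "?u \<in> perron_class eps G g"
    unfolding perron_class_def
  proof (intro CollectI conjI allI impI)
    show "jsub eps ?u" by (rule jsub_unbend[OF max_sub_jsub eps])
    have uG: "unbend eps G = G" using unbend_eq_iff[OF eps] G_int by blast
    show "abs (?u (t, x)) <= G" if "0 < t" for t x
    proof -
      have "?u (t, x) <= G"
      proof (rule ccontr)
        assume "~ ?thesis"
        then have "unbend eps G < ?u (t, x)" using uG by simp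
        then have "G < ?M (t, x)"
          using bend_strict_mono[OF eps] bend_unbend[OF eps] by metis
        then show False using max_sub_bound[OF that, of x] by simp
      qed
      moreover have "- G <= ?u (t, x)"
        using unbend_ge[OF eps, of "?M (t, x)"] max_sub_bound[OF that, of x] by linarith
      ultimately show ?thesis by (simp add: abs_le_iff)
    qed
    show "starts_below ?u g"
      unfolding starts_below_def
    proof (intro allI impI)
      fix x c assume "g x < c"
      then have "unbend eps (g x) < c" using unbend_eq_iff[OF eps, of "g x"] g_int[of x] by simp
      then have "g x < bend eps c" by (simp add: unbend_less_iff[OF eps])
      then show "EX d>0. ALL t y. 0 < t --> t < d --> abs (y - x) < d --> ?u (t, y) < c"
        using max_sub_starts unfolding starts_below_def unbend_less_iff[OF eps] by blast
    qed
  qed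
  from max_sub_upper[OF this assms, of x] have "?u (t, x) = ?M (t, x)"
    using unbend_ge[OF eps, of "?M (t, x)"] by simp
  then show ?thesis using unbend_eq_iff[OF eps] by blast
qed

end

section \<open>The lower envelope of the maximal subsolution\<close>

lemma E_upper_uminus: "0 < eps ==> - E_upper eps a <= E_upper eps (- a)"
proof -
  assume e: "0 < eps"
  have "(-1 :: int) <= \<lfloor>a / eps\<rfloor> + \<lfloor>- a / eps\<rfloor>" by linarith
  then have "(-1 :: real) <= of_int \<lfloor>a / eps\<rfloor> + of_int \<lfloor>- a / eps\<rfloor>" by linarith
  then have "eps * (-1) <= eps * (of_int \<lfloor>a / eps\<rfloor> + of_int \<lfloor>- a / eps\<rfloor>)" using e by (intro mult_left_mono) auto
  then show ?thesis by (simp add: E_upper_def algebra_simps)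
qed

context perron
begin

abbreviation M where "M \<equiv> max_sub eps G g"

text \<open>The maximality half of Perron's method: replacing \<open>M\<close> by its maximum with
  \<open>psi\<close> in a small box would give a larger member of the class. \<open>A1\<close> and
  \<open>A2\<close> demand the subsolution conditions only where \<open>psi\<close> is strictly
  active, since elsewhere a test of \<open>U\<close> is a test of \<open>M\<close>.\<close>

lemma bump_contradiction:
  fixes psi :: "real \<times> real => real"
  assumes psi: "continuous_on UNIV psi" and d: "0 < d" "d < t0"
    and out: "!!s y. abs (s - t0) <= d ==> abs (y - x0) <= d ==> ~ (abs (s - t0) < d / 2 & abs (y - x0) < d / 2) ==>
      psi (s, y) <= M (s, y)"
    and pt: "abs (s0 - t0) < d / 2" "abs (y0 - x0) < d / 2" "M (s0, y0) < psi (s0, y0)"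
  defines "U \<equiv> %(s, y). if abs (s - t0) < d & abs (y - x0) < d then max (M (s, y)) (psi (s, y)) else M (s, y)"
  assumes A1: "!!t x alpha p C delta r0. abs (t - t0) < d / 2 ==> abs (x - x0) < d / 2 ==> M (t, x) < psi (t, x) ==> p ~= 0 ==>
      0 < delta ==> 0 < r0 ==> touch U t x alpha p C delta ==> usc_on Q U ==> bounded (U ` Q) ==> EX r>0. r < r0 & alpha <= abs p * kint r (jump eps U t x)"
    and A2: "!!t x alpha C delta. abs (t - t0) < d / 2 ==> abs (x - x0) < d / 2 ==> M (t, x) < psi (t, x) ==>
      0 < delta ==> touch4 U t x alpha C delta ==> alpha <= 0"
  shows False
proof -
  have U: "U (s, y) = (if abs (s - t0) < d & abs (y - x0) < d then max (M (s, y)) (psi (s, y)) else M (s, y))" for s y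
    by (simp add: U_def)
  have MU: "M (s, y) <= U (s, y)" for s y by (simp add: U)
  \<comment> \<open>By \<open>out\<close> the maximum takes effect only in the half-size box, so the
    border of the large box leaves no trace in \<open>U\<close>. This is what makes \<open>U\<close>
    upper semicontinuous.\<close>
  have U_cases: "U (s, y) = M (s, y) | (abs (s - t0) < d / 2 & abs (y - x0) < d / 2 & M (s, y) < psi (s, y) & U (s, y) = psi (s, y))" for s y
  proof (cases "M (s, y) < psi (s, y) & abs (s - t0) < d & abs (y - x0) < d")
    case True
    then have "abs (s - t0) < d / 2 & abs (y - x0) < d / 2" using out[of s y] by force
    then show ?thesis using True by (simp add: U)
  qed (auto simp: U max_def)
  have "compact (psi ` ({t0 - d..t0 + d} \<times> {x0 - d..x0 + d}))"
    by (intro compact_continuous_image continuous_on_subset[OF psi] compact_Times compact_Icc) auto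
  then have "bounded (psi ` ({t0 - d..t0 + d} \<times> {x0 - d..x0 + d}))" by (rule compact_imp_bounded)
  then obtain B where "\<forall>z\<in>psi ` ({t0 - d..t0 + d} \<times> {x0 - d..x0 + d}). norm z <= B"
    unfolding bounded_iff by blast
  then have B: "abs (psi (s, y)) <= B" if "t0 - d <= s" "s <= t0 + d" "x0 - d <= y" "y <= x0 + d" for s y
    using that by auto
  have Ub: "abs (U (t, x)) <= G + abs B" if "0 < t" for t x
  proof -
    have "abs (psi (t, x)) <= B" if "abs (t - t0) < d / 2" "abs (x - x0) < d / 2" using that d by (intro B) linarith+
    then show ?thesis using U_cases[of t x] max_sub_bound[OF that, of x] by fastforce
  qed
  have Ubd: "bounded (U ` Q)" using Ub by (rule bounded_QI)
  have Musc: "usc_on Q M" by (rule jsub_usc[OF max_sub_jsub])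
  have Uusc: "usc_on Q U"
    unfolding usc_on_Q_iff
  proof (intro allI impI)
    fix t x c :: real assume t: "0 < t" and c: "U (t, x) < c"
    have "M (t, x) < c" using c MU[of t x] by simp
    then obtain d1 where d1: "0 < d1" "!!s y. 0 < s ==> abs (s - t) < d1 ==> abs (y - x) < d1 ==> M (s, y) < c"
      using usc_onD[OF Musc t] by metis
    show "EX d>0. ALL s y. 0 < s --> abs (s - t) < d --> abs (y - x) < d --> U (s, y) < c"
    proof (cases "abs (t - t0) < d & abs (x - x0) < d")
      case True
      then have "psi (t, x) < c" using c by (simp add: U)
      moreover have "usc_on Q psi" by (rule continuous_usc_on[OF psi])
      ultimately obtain d2 where d2: "0 < d2" "!!s y. 0 < s ==> abs (s - t) < d2 ==> abs (y - x) < d2 ==> psi (s, y) < c"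
        using usc_onD[OF _ t] by metis
      show ?thesis
        using d1 d2 by (intro exI[of _ "min d1 d2"]) (auto simp: U)
    next
      case False
      show ?thesis
      proof (intro exI[of _ "min d1 (d/2)"] conjI allI impI)
        fix s y :: real assume s: "0 < s" "abs (s - t) < min d1 (d/2)" "abs (y - x) < min d1 (d/2)"
        have "abs (t - t0) < d & abs (x - x0) < d" if "abs (s - t0) < d / 2 & abs (y - x0) < d / 2"
          using that s(2,3) unfolding min_less_iff_conj by linarith
        then have "~ (abs (s - t0) < d / 2 & abs (y - x0) < d / 2)" using False by blast
        then have "U (s, y) = M (s, y)" using U_cases by blast
        then show "U (s, y) < c" using d1(2)[of s y] s by simp
      qed (use d d1 in simp)
    qed
  qed
  have "jsub eps U"
    unfolding jsub_def
  proof (intro conjI allI impI)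
    show "bounded (U ` Q)" using Ub by (rule bounded_QI)
    show "usc_on Q U" by (rule Uusc)
    fix t x alpha p C delta and r0 :: real
    { assume t: "0 < t" and p: "p ~= 0" and delta: "0 < delta" and r0: "0 < r0" and tch: "touch U t x alpha p C delta"
      show "EX r>0. r < r0 & alpha <= abs p * kint r (jump eps U t x)"
      proof (cases "U (t, x) = M (t, x)")
        case True
        have "touch M t x alpha p C delta"
          using tch MU unfolding touch_def True by (meson order_trans)
        then obtain r where r: "0 < r" "r < r0" "alpha <= abs p * kint r (jump eps M t x)"
          using jsub_weak[OF max_sub_jsub t p delta r0] by metis
        have "kint r (jump eps M t x) <= kint r (jump eps U t x)"
        proof (rule kint_mono[OF r(1)])
          show "jump eps M t x \<in> borel_measurable borel" "jump eps U t x \<in> borel_measurable borel"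
            by (rule jump_measurable[OF Musc t], rule jump_measurable[OF Uusc t])
          show "abs (jump eps M t x z) <= 2 * G + eps / 2" for z by (rule jump_bound) (use eps t max_sub_bound in auto)
          show "abs (jump eps U t x z) <= 2 * (G + abs B) + eps / 2" for z by (rule jump_bound) (use eps t Ub in auto)
          show "jump eps M t x z <= jump eps U t x z" for z
            unfolding jump_def True by (intro E_upper_mono[OF eps] diff_right_mono MU)
        qed
        then have "abs p * kint r (jump eps M t x) <= abs p * kint r (jump eps U t x)" by (intro mult_left_mono) auto
        then show ?thesis using r by (intro exI[of _ r]) auto
      next
        case False
        then show ?thesis using U_cases[of t x] A1[OF _ _ _ p delta r0 tch Uusc Ubd] by blast
      qed }
    { assume t: "0 < t" "0 < delta" "touch4 U t x alpha C delta"
      show "alpha <= 0"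
      proof (cases "U (t, x) = M (t, x)")
        case True
        have "touch4 M t x alpha C delta"
          using t(3) MU unfolding touch4_def True by (meson order_trans)
        then show ?thesis by (rule jsub_flat[OF max_sub_jsub t(1,2)])
      next
        case False
        then show ?thesis using U_cases[of t x] A2[OF _ _ _ t(2,3)] by blast
      qed }
  qed
  moreover have Ust: "starts_below U g"
    unfolding starts_below_def
  proof (intro allI impI)
    fix x c assume "g x < c"
    then obtain e where e: "0 < e" "!!t y. 0 < t ==> t < e ==> abs (y - x) < e ==> M (t, y) < c"
      using starts_belowD[OF max_sub_starts] by metis
    show "EX d>0. ALL t y. 0 < t --> t < d --> abs (y - x) < d --> U (t, y) < c"
    proof (intro exI[of _ "min e (t0 - d)"] conjI allI impI)
      fix t y assume t: "0 < t" "t < min e (t0 - d)" "abs (y - x) < min e (t0 - d)"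
      then have "U (t, y) = M (t, y)" by (auto simp: U)
      then show "U (t, y) < c" using e(2)[of t y] t by simp
    qed (use e d in simp)
  qed
  \<comment> \<open>Raising \<open>M\<close> might have violated the bound \<open>G\<close>; it is
    recovered afterwards, because \<open>U\<close> is itself a subsolution starting below
    \<open>g\<close>.\<close>
  ultimately have UG: "U (t, x) <= G" if "0 < t" for t x
    using g_bound abs_le_D1 by (intro starts_below_bound[OF _ eps _ _ that]) blast+
  have "abs (U (t, x)) <= G" if "0 < t" for t x
    using UG[OF that, of x] MU[of t x] max_sub_bound[OF that, of x] by linarith
  then have "U \<in> perron_class eps G g" using \<open>jsub eps U\<close> Ust by (simp add: perron_class_def)
  moreover have "0 < s0" using pt d by linarith
  ultimately have "U (s0, y0) <= M (s0, y0)" by (rule max_sub_upper)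
  moreover have "psi (s0, y0) <= U (s0, y0)" using pt d by (simp add: U)
  ultimately show False using pt by simp
qed

text \<open>\<open>- N\<close> is the lower semicontinuous envelope of \<open>M\<close>, so that
  \<open>jsub eps N\<close> expresses that this envelope is a supersolution.\<close>

abbreviation N where "N \<equiv> uenv (%q. - M q)"

lemma N_facts:
  shows N_bound: "!!t x. 0 < t ==> abs (N (t, x)) <= G"
    and N_ge: "!!t x. 0 < t ==> - M (t, x) <= N (t, x)"
    and N_near: "!!t x eta. 0 < t ==> 0 < eta ==>
      EX s y. 0 < s & abs (s - t) < eta & abs (y - x) < eta & N (t, x) - eta < - M (s, y)"
    and N_usc: "usc_on Q N"
proof -
  have b: "abs (- M (t, x)) <= G" if "0 < t" for t x using max_sub_bound[OF that] by simp
  show "abs (N (t, x)) <= G" if "0 < t" for t x using uenv_bound[where u = "%q. - M q", OF b that] .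
  show "- M (t, x) <= N (t, x)" if "0 < t" for t x using uenv_ge[where u = "%q. - M q", OF b that] .
  show "EX s y. 0 < s & abs (s - t) < eta & abs (y - x) < eta & N (t, x) - eta < - M (s, y)" if "0 < t" "0 < eta" for t x eta
    using uenv_near[where u = "%q. - M q", OF b that] .
  show "usc_on Q N" using uenv_usc[where u = "%q. - M q", OF b] .
qed

text \<open>Values of \<open>M\<close> arbitrarily close to its lower envelope occur near
  \<open>(t0, x0)\<close>, although perhaps not at that point; this is where a bump strictly above
  the envelope becomes active.\<close>

lemma bump_start:
  fixes psi :: "real \<times> real => real"
  assumes "continuous_on UNIV psi" "- N (t0, x0) < psi (t0, x0)" "0 < t0" "0 < d"
  obtains s y where "abs (s - t0) < d" "abs (y - x0) < d" "M (s, y) < psi (s, y)"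
proof -
  define a where "a = (psi (t0, x0) + N (t0, x0)) / 2"
  have a: "0 < a" using assms(2) by (simp add: a_def)
  have "usc_on Q (%q. - psi q)" by (intro continuous_usc_on continuous_intros assms)
  then obtain e where e: "0 < e"
    "!!s y. 0 < s ==> abs (s - t0) < e ==> abs (y - x0) < e ==> - psi (s, y) < - psi (t0, x0) + a"
    using usc_onD[of "%q. - psi q" t0 x0 "- psi (t0, x0) + a"] assms(3) a by auto
  obtain s y where s: "0 < s" "abs (s - t0) < Min {e, d, a}" "abs (y - x0) < Min {e, d, a}" "N (t0, x0) - Min {e, d, a} < - M (s, y)"
    using N_near[OF assms(3), of "Min {e, d, a}" x0] e a assms(4) by auto
  have m: "Min {e, d, a} <= e" "Min {e, d, a} <= d" "Min {e, d, a} <= a" by (rule Min_le; simp)+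
  have "M (s, y) < - N (t0, x0) + a" using s(4) m by linarith
  also have "\<dots> = psi (t0, x0) - a" by (simp add: a_def field_simps)
  also have "\<dots> < psi (s, y)" using e(2)[of s y] s m by linarith
  finally show thesis using s m by (intro that[of s y]) linarith+
qed

text \<open>If \<open>alpha0\<close> were positive, the reflected test lifted by
  \<open>sig^2\<close> would be an admissible bump. It is active only near \<open>(t0, x0)\<close>,
  where its gradient is so small that the nonlocal term cannot fall below its strongly negative time
  slope.\<close>

lemma N_flat:
  assumes t0: "0 < t0" "0 < delta" and tch: "touch4 N t0 x0 alpha0 C delta"
  shows "alpha0 <= 0"
proof (rule ccontr)
  assume "~ alpha0 <= 0"
  then have alpha0: "0 < alpha0" by simp
  define C1 d L0 where "C1 = abs C + 1" and "d = Min {delta, t0, 1} / 2" and "L0 = - N (t0, x0)"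
  have C1: "0 < C1" by (simp add: C1_def)
  have mle: "Min {delta, t0, 1} <= delta" "Min {delta, t0, 1} <= t0" "Min {delta, t0, 1} <= 1" by (rule Min_le; simp)+
  have mpos: "0 < Min {delta, t0, 1}" using t0 by simp
  have d: "0 < d" "d <= 1" "d < t0" "d < delta" using mle mpos unfolding d_def by linarith+
  define A' where "A' = G + abs L0 + 1 + alpha0 + 2 * C1"
  define K where "K = 8 * (2 * A' + eps / 2) * C1 * (1 + 15 * C1 / eps)"
  have A': "0 <= A'" using G0 alpha0 C1 by (simp add: A'_def)
  have K: "0 <= K" unfolding K_def using A' C1 eps by (intro mult_nonneg_nonneg) auto
  \<comment> \<open>The first bound keeps the active set in the half-size box. The second makes
    \<open>2 * C1 * sig + K * sig\<close>, the drift of the time slope plus the nonlocal term,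
    smaller than \<open>alpha0\<close>.\<close>
  define sig where "sig = min ((d / 2)^2) (alpha0 / (2 * (2 * C1 + K)))"
  have CK: "0 < 2 * C1 + K" using C1 K by simp
  have sig: "0 < sig" "sig <= (d / 2)^2" using d alpha0 CK by (auto simp: sig_def)
  have "sig <= alpha0 / (2 * (2 * C1 + K))" unfolding sig_def by (rule min.cobounded2)
  then have "sig * (2 * (2 * C1 + K)) <= alpha0" using CK by (simp add: pos_le_divide_eq)
  then have sigK: "2 * C1 * sig + K * sig < alpha0" using alpha0 by (simp add: algebra_simps)
  have sig1: "sig <= 1"
  proof -
    have "(d / 2)^2 <= 1" using d by (simp add: abs_square_le_1)
    then show ?thesis using sig by simp
  qed
  define psi where "psi = (%(s, y). L0 + sig^2 - alpha0 * (s - t0) - C1 * ((s - t0)^2 + (y - x0) ^ 4))"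
  have psi: "psi (s, y) = L0 + sig^2 - alpha0 * (s - t0) - C1 * ((s - t0)^2 + (y - x0) ^ 4)" for s y
    by (simp add: psi_def)
  have psic: "continuous_on UNIV psi" unfolding psi_def case_prod_beta by (intro continuous_intros)
  have Mpsi: "psi (s, y) - sig^2 + ((s - t0)^2 + (y - x0) ^ 4) <= M (s, y)"
    if h: "abs (s - t0) <= d" "abs (y - x0) <= d" for s y
  proof -
    have s0: "0 < s" using h d by linarith
    have "N (s, y) <= N (t0, x0) + alpha0 * (s - t0) + C * ((s - t0)^2 + (y - x0) ^ 4)"
      using h d s0 by (intro tch[unfolded touch4_def, rule_format]) auto
    also have "C * ((s - t0)^2 + (y - x0) ^ 4) <= abs C * ((s - t0)^2 + (y - x0) ^ 4)"
      by (intro mult_right_mono) auto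
    finally show ?thesis using N_ge[OF s0, of y] by (simp add: psi C1_def L0_def algebra_simps)
  qed
  \<comment> \<open>Activity forces \<open>(s - t0)^2 + (y - x0) ^ 4 < sig^2\<close>, so the square
    of the space distance, which is what enters the quartic estimate, is below
    \<open>sig\<close>.\<close>
  have close: "abs (s - t0) < sig" "(y - x0)^2 < sig"
    if "abs (s - t0) <= d" "abs (y - x0) <= d" "M (s, y) < psi (s, y)" for s y
  proof -
    have "(s - t0)^2 + (y - x0) ^ 4 < sig^2" using Mpsi[OF that(1,2)] that(3) by linarith
    moreover have "0 <= (s - t0)^2" "0 <= (y - x0) ^ 4" by auto
    ultimately have "(s - t0)^2 < sig^2" "(y - x0) ^ 4 < sig^2" by linarith+
    then have "abs (s - t0)^2 < sig^2" "((y - x0)^2)^2 < sig^2" by (simp_all add: power_mult[symmetric])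
    then show "abs (s - t0) < sig" "(y - x0)^2 < sig"
      using sig(1) power_less_imp_less_base[of _ 2 sig] by (auto simp del: power2_abs)
  qed
  obtain s0 y0 where s0: "abs (s0 - t0) < d / 2" "abs (y0 - x0) < d / 2" "M (s0, y0) < psi (s0, y0)"
    using bump_start[OF psic _ t0(1), of x0 "d / 2"] sig d by (auto simp: psi L0_def)
  define U where "U = (%(s, y). if abs (s - t0) < d & abs (y - x0) < d then max (M (s, y)) (psi (s, y)) else M (s, y))"
  have Upsi: "psi (s, y) <= U (s, y)" if "abs (s - t0) < d" "abs (y - x0) < d" for s y using that by (simp add: U_def)
  have Ueq: "U (t, x) = psi (t, x)" if "abs (t - t0) < d / 2" "abs (x - x0) < d / 2" "M (t, x) < psi (t, x)" for t x
    using that d by (simp add: U_def)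
  have psidiff: "psi (t + a, x + b) - psi (t, x) = (- alpha0 - 2 * C1 * (t - t0)) * a - C1 * a^2 - C1 * ((x - x0 + b) ^ 4 - (x - x0) ^ 4)"
    for t x a b
    by (simp add: psi add_diff_eq diff_add_eq) (simp add: power2_eq_square algebra_simps)
  have alphaneg: "- alpha0 - 2 * C1 * (t - t0) + K * sig < 0" if "abs (t - t0) < sig" for t
  proof -
    have "2 * C1 * - (t - t0) <= 2 * C1 * sig" using that C1 by (intro mult_left_mono) auto
    then show ?thesis using sigK unfolding mult_minus_right by linarith
  qed
  show False
  proof (rule bump_contradiction[OF psic d(1,3) _ s0])
    show "psi (s, y) <= M (s, y)"
      if "abs (s - t0) <= d" "abs (y - x0) <= d" "~ (abs (s - t0) < d / 2 & abs (y - x0) < d / 2)" for s y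
    proof (rule ccontr)
      assume "~ ?thesis"
      then have c: "abs (s - t0) < sig" "(y - x0)^2 < sig" using close[OF that(1,2)] by auto
      have "(d / 2)^2 <= d / 2" using d by (simp add: power2_eq_square mult_left_le)
      then have "abs (s - t0) < d / 2" using c(1) sig by linarith
      moreover have "abs (y - x0)^2 < (d / 2)^2" using c(2) sig by simp
      then have "abs (y - x0) < d / 2" using d power_less_imp_less_base[of "abs (y - x0)" 2 "d / 2"] by simp
      ultimately show False using that(3) by simp
    qed
  next
    fix t x alpha C' delta'
    assume t: "abs (t - t0) < d / 2" "abs (x - x0) < d / 2" "M (t, x) < psi (t, x)" and delta': "0 < delta'"
      and "touch4 (%(s, y). if abs (s - t0) < d & abs (y - x0) < d then max (M (s, y)) (psi (s, y)) else M (s, y)) t x alpha C' delta'"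
    then have tU: "touch4 U t x alpha C' delta'" by (simp add: U_def)
    have "- alpha0 - 2 * C1 * (t - t0) - alpha = 0"
    proof (rule linear_le_quadratic[of "min delta' (d / 2)" _ "C' + C1"])
      fix h assume h: "abs h < min delta' (d / 2)"
      have "psi (t + h, x) <= U (t + h, x)" using h t by (intro Upsi) linarith+
      also have "\<dots> <= U (t, x) + alpha * (t + h - t) + C' * ((t + h - t)^2 + (x - x) ^ 4)"
        using h t d delta' by (intro tU[unfolded touch4_def, rule_format]) linarith+
      finally show "(- alpha0 - 2 * C1 * (t - t0) - alpha) * h <= (C' + C1) * h^2"
        using psidiff[of t h x 0] Ueq[OF t] by (simp add: algebra_simps)
    qed (use d delta' in simp)
    moreover have "abs (t - t0) < sig" using close(1)[OF _ _ t(3)] t d by simp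
    moreover have "0 <= K * sig" using K sig(1) by simp
    ultimately show "alpha <= 0" using alphaneg[of t] by linarith
  next
    fix t x alpha p C' delta' and r0 :: real
    assume t: "abs (t - t0) < d / 2" "abs (x - x0) < d / 2" "M (t, x) < psi (t, x)" and p: "p ~= 0" and delta': "0 < delta'" and r0: "0 < r0"
      and "touch (%(s, y). if abs (s - t0) < d & abs (y - x0) < d then max (M (s, y)) (psi (s, y)) else M (s, y)) t x alpha p C' delta'"
      and "usc_on Q (%(s, y). if abs (s - t0) < d & abs (y - x0) < d then max (M (s, y)) (psi (s, y)) else M (s, y))"
    then have tU: "touch U t x alpha p C' delta'" and Uusc: "usc_on Q U" by (simp_all add: U_def)
    define Y where "Y = x - x0"
    define D where "D = max C1 (C1 * (6 * Y^2 + 4 * abs Y + 1))"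
    define e where "e = min delta' (d / 2)"
    have e: "0 < e" "e <= delta'" "e <= d / 2" using d delta' by (auto simp: e_def)
    have grad: "(- alpha0 - 2 * C1 * (t - t0)) * a + (- 4 * C1 * Y ^ 3) * b - D * (a^2 + b^2) <= alpha * a + p * b + C' * (a^2 + b^2)"
      if h: "abs a < e" "abs b < e" for a b
    proof -
      have "psi (t + a, x + b) <= U (t + a, x + b)" using h t e by (intro Upsi) linarith+
      also have "\<dots> <= U (t, x) + alpha * (t + a - t) + p * (x + b - x) + C' * ((t + a - t)^2 + (x + b - x)^2)"
        using h t d e by (intro tU[unfolded touch_def, rule_format]) linarith+
      finally have "psi (t + a, x + b) - psi (t, x) <= alpha * a + p * b + C' * (a^2 + b^2)" using Ueq[OF t] by simp
      moreover have "C1 * (Y + b) ^ 4 <= C1 * (Y ^ 4 + 4 * Y ^ 3 * b + (6 * Y^2 + 4 * abs Y + 1) * b^2)"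
        using fourth_power_le[of b Y] h e d C1 by (intro mult_left_mono) auto
      moreover have "C1 * a^2 <= D * a^2" "C1 * (6 * Y^2 + 4 * abs Y + 1) * b^2 <= D * b^2"
        unfolding D_def by (intro mult_right_mono; simp)+
      ultimately show ?thesis unfolding psidiff Y_def[symmetric] by (simp add: algebra_simps)
    qed
    have alpha: "alpha = - alpha0 - 2 * C1 * (t - t0)" and peq: "p = - 4 * C1 * Y ^ 3"
      using touch_gradient_unique[OF e(1) grad] by auto
    have Y: "Y ~= 0" using p peq by auto
    have tpos: "0 < t" using t d by linarith
    have cl: "abs (t - t0) < sig" "Y^2 < sig" using close[OF _ _ t(3)] t d by (auto simp: Y_def)
    have Y1: "abs Y <= 1" using t d by (simp add: Y_def)
    have "abs Y ^ 4 <= 1" using Y1 by (intro power_le_one) auto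
    then have Y4: "C1 * Y ^ 4 <= C1" using C1 by simp
    have Ub: "abs (U (s, y)) <= A'" if "0 < s" for s y
    proof -
      have "abs (psi (s, y)) <= abs L0 + 1 + alpha0 + 2 * C1" if h: "abs (s - t0) < d" "abs (y - x0) < d"
      proof -
        have "abs (alpha0 * (s - t0)) <= alpha0" using h d alpha0 by (simp add: abs_mult mult_left_le)
        moreover have "(s - t0)^2 <= 1" using h d by (simp add: abs_square_le_1)
        moreover have "abs (y - x0) ^ 4 <= 1" using h d by (intro power_le_one) auto
        ultimately have "abs (alpha0 * (s - t0)) <= alpha0" "C1 * ((s - t0)^2 + (y - x0) ^ 4) <= C1 * 2"
          using C1 by (auto intro!: mult_left_mono)
        moreover have "0 <= C1 * ((s - t0)^2 + (y - x0) ^ 4)" using C1 by simp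
        moreover have "sig^2 <= 1" using sig1 sig(1) by (simp add: abs_square_le_1)
        moreover have "0 <= sig^2" by simp
        ultimately show ?thesis unfolding psi by linarith
      qed
      then show ?thesis using max_sub_bound[OF that, of y] G0 alpha0 C1 by (auto simp: U_def A'_def max_def)
    qed
    have le: "- C1 * ((Y + z) ^ 4 - Y ^ 4) <= U (t, x + z) - U (t, x)" if "abs z <= abs Y" for z
    proof -
      have "psi (t, x + z) <= U (t, x + z)" using that t d unfolding Y_def by (intro Upsi) linarith+
      then show ?thesis using psidiff[of t 0 x z] Ueq[OF t] by (simp add: Y_def)
    qed
    have jm: "jump eps U t x \<in> borel_measurable borel" by (rule jump_measurable[OF Uusc tpos])
    have jb: "abs (jump eps U t x z) <= 2 * A' + eps / 2" for z by (rule jump_bound) (use eps Ub tpos in auto)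
    have F: "0 <= 2 * A' + eps / 2" using A' eps by simp
    obtain r2 where r2: "0 < r2" "!!r. 0 < r ==> r < r2 ==>
        4 * C1 * abs Y ^ 3 * kint r (%z. - jump eps U t x z) <= 8 * (2 * A' + eps / 2) * C1 * Y^2 * (1 + 15 * C1 / eps)"
    proof (rule quartic_estimate[OF eps C1 Y Y4 F])
      show "(%z. - jump eps U t x z) \<in> borel_measurable borel" using jm by measurable
      show "abs (- jump eps U t x z) <= 2 * A' + eps / 2" for z using jb by simp
      show "- jump eps U t x z <= 2 * A' + eps / 2" for z using jb[of z] by linarith
      show "- jump eps U t x z <= eps / 2" if "abs z <= abs Y" "C1 * ((Y + z) ^ 4 - Y ^ 4) < eps" for z
        using le[OF that(1)] that(2) E_upper_signs(4)[OF eps, of "U (t, x + z) - U (t, x)"] unfolding jump_def by auto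
      show "- jump eps U t x z <= - eps / 2" if "abs z <= abs Y" "C1 * ((Y + z) ^ 4 - Y ^ 4) < 0" for z
        using le[OF that(1)] that(2) E_upper_signs(3)[OF eps, of "U (t, x + z) - U (t, x)"] unfolding jump_def by auto
    qed blast
    define r where "r = min r0 r2 / 2"
    have r: "0 < r" "r < r0" "r < r2" using r0 r2 by (auto simp: r_def min_def)
    have "abs p = 4 * C1 * abs Y ^ 3" using C1 by (simp add: peq abs_mult power_abs)
    then have "- (abs p * kint r (jump eps U t x)) <= K * Y^2"
      using r2(2)[OF r(1,3)] by (simp add: kint_uminus K_def mult_ac)
    also have "K * Y^2 <= K * sig" using cl K by (intro mult_left_mono) auto
    finally have "alpha <= abs p * kint r (jump eps U t x)" using alphaneg[OF cl(1)] alpha by linarith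
    then show "EX r>0. r < r0 & alpha <= abs p * kint r (jump eps
        (%(s, y). if abs (s - t0) < d & abs (y - x0) < d then max (M (s, y)) (psi (s, y)) else M (s, y)) t x)"
      using r unfolding U_def[symmetric] by blast
  qed
qed

text \<open>If there were no such violation, the lifted parabola would satisfy the subsolution
  inequality wherever it is active and hence be an admissible bump. \<open>c\<close> is the value of
  the bump at the point. The radius \<open>r\<close> is independent of \<open>sig\<close>, so the
  violation survives the limit.\<close>

lemma N_touch_step:
  assumes t0: "0 < t0" and tch: "touch N t0 x0 alpha0 p0 C delta" and p0: "p0 ~= 0"
  defines "C1 \<equiv> abs C + 1"
  assumes delta1: "0 < delta1" "delta1 <= delta" "delta1 <= t0" "delta1 <= 1" "C1 * delta1 <= abs p0" "abs p0 * delta1 + C1 * delta1^2 <= eps"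
    and r: "0 < r" "r <= delta1 / 8"
    and sig: "0 < sig" "sig <= delta1 / 4" "2 * C1 * sig <= abs p0 / 2"
  shows "EX t x c. abs (t - t0) < sig & abs (x - x0) < sig & abs c <= G + 1 &
     abs (c + N (t0, x0)) <= sig^2 + (abs alpha0 + abs p0 + 2 * C1) * sig &
     abs (p0 + 2 * C1 * (x - x0)) * kint r (%z. E_upper eps (M (t, x + z) - c)) < - alpha0 - 2 * C1 * (t - t0)"
proof (rule ccontr)
  assume neg: "~ ?thesis"
  define d L0 where "d = delta1 / 2" and "L0 = - N (t0, x0)"
  have C1: "0 < C1" by (simp add: C1_def)
  have d: "0 < d" "d <= 1" "d < t0" "d < delta" using delta1 by (auto simp: d_def)
  define psi where "psi = (%(s, y). L0 + sig^2 - alpha0 * (s - t0) - p0 * (y - x0) - C1 * ((s - t0)^2 + (y - x0)^2))"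
  have psi: "psi (s, y) = L0 + sig^2 - alpha0 * (s - t0) - p0 * (y - x0) - C1 * ((s - t0)^2 + (y - x0)^2)" for s y
    by (simp add: psi_def)
  have psic: "continuous_on UNIV psi" unfolding psi_def case_prod_beta by (intro continuous_intros)
  have Mpsi: "psi (s, y) - sig^2 + ((s - t0)^2 + (y - x0)^2) <= M (s, y)"
    if h: "abs (s - t0) <= d" "abs (y - x0) <= d" for s y
  proof -
    have s0: "0 < s" using h d by linarith
    have "N (s, y) <= N (t0, x0) + alpha0 * (s - t0) + p0 * (y - x0) + C * ((s - t0)^2 + (y - x0)^2)"
      using h d s0 by (intro tch[unfolded touch_def, rule_format]) auto
    also have "C * ((s - t0)^2 + (y - x0)^2) <= abs C * ((s - t0)^2 + (y - x0)^2)"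
      by (intro mult_right_mono) auto
    finally show ?thesis using N_ge[OF s0, of y] by (simp add: psi C1_def L0_def algebra_simps)
  qed
  have close: "abs (s - t0) < sig" "abs (y - x0) < sig"
    if "abs (s - t0) <= d" "abs (y - x0) <= d" "M (s, y) < psi (s, y)" for s y
  proof -
    have "(s - t0)^2 + (y - x0)^2 < sig^2" using Mpsi[OF that(1,2)] that(3) by linarith
    moreover have "0 <= (s - t0)^2" "0 <= (y - x0)^2" by auto
    ultimately have "(s - t0)^2 < sig^2" "(y - x0)^2 < sig^2" by linarith+
    then have "abs (s - t0)^2 < sig^2" "abs (y - x0)^2 < sig^2" by simp_all
    then show "abs (s - t0) < sig" "abs (y - x0) < sig"
      using sig(1) power_less_imp_less_base[of _ 2 sig] by (auto simp del: power2_abs)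
  qed
  obtain s0 y0 where s0: "abs (s0 - t0) < d / 2" "abs (y0 - x0) < d / 2" "M (s0, y0) < psi (s0, y0)"
    using bump_start[OF psic _ t0(1), of x0 "d / 2"] sig d by (auto simp: psi L0_def)
  define U where "U = (%(s, y). if abs (s - t0) < d & abs (y - x0) < d then max (M (s, y)) (psi (s, y)) else M (s, y))"
  have Upsi: "psi (s, y) <= U (s, y)" if "abs (s - t0) < d" "abs (y - x0) < d" for s y using that by (simp add: U_def)
  have MU: "M (s, y) <= U (s, y)" for s y by (simp add: U_def)
  have Ueq: "U (t, x) = psi (t, x)" if "abs (t - t0) < d / 2" "abs (x - x0) < d / 2" "M (t, x) < psi (t, x)" for t x
    using that d by (simp add: U_def)
  have psidiff: "psi (t + a, x + b) - psi (t, x)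
      = (- alpha0 - 2 * C1 * (t - t0)) * a + (- p0 - 2 * C1 * (x - x0)) * b - C1 * (a^2 + b^2)"
    for t x a b
    by (simp add: psi) (simp add: power2_eq_square algebra_simps)
  have pn: "abs p0 / 2 <= abs (p0 + 2 * C1 * (x - x0))" "abs (p0 + 2 * C1 * (x - x0)) <= 3 / 2 * abs p0"
    if "abs (x - x0) < sig" for x
  proof -
    have "abs (2 * C1 * (x - x0)) <= 2 * C1 * sig" using that C1 by (simp add: abs_mult)
    then show "abs p0 / 2 <= abs (p0 + 2 * C1 * (x - x0))" "abs (p0 + 2 * C1 * (x - x0)) <= 3 / 2 * abs p0"
      using sig(3) by linarith+
  qed
  have main: "- alpha0 - 2 * C1 * (t - t0) <= abs (p0 + 2 * C1 * (x - x0)) * kint r (%z. E_upper eps (M (t, x + z) - psi (t, x)))"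
    and psib: "abs (psi (t, x)) <= G + 1"
    if t: "abs (t - t0) < d / 2" "abs (x - x0) < d / 2" "M (t, x) < psi (t, x)" for t x
  proof -
    have cl: "abs (t - t0) < sig" "abs (x - x0) < sig" using close[OF _ _ t(3)] t d by auto
    have tpos: "0 < t" using t d by linarith
    have sig1: "sig <= 1" using sig delta1 by linarith
    have "sig^2 <= 1" using sig1 sig(1) by (simp add: abs_square_le_1)
    moreover have "psi (t, x) - sig^2 <= M (t, x)"
    proof -
      have "abs (t - t0) <= d" "abs (x - x0) <= d" using t d by linarith+
      from Mpsi[OF this] show ?thesis using sum_power2_ge_zero[of "t - t0" "x - x0"] by linarith
    qed
    ultimately show b: "abs (psi (t, x)) <= G + 1"
      using max_sub_bound[OF tpos, of x] t(3) by (simp add: abs_le_iff)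
    have e: "abs (psi (t, x) + N (t0, x0)) <= sig^2 + (abs alpha0 + abs p0 + 2 * C1) * sig"
    proof -
      have sq: "a^2 <= sig" if "abs a < sig" for a
      proof -
        have "a^2 = abs a * abs a" by (simp add: power2_eq_square)
        also have "\<dots> <= abs a" using that sig1 by (intro mult_left_le) auto
        finally show ?thesis using that by simp
      qed
      have "abs (alpha0 * (t - t0)) <= abs alpha0 * sig" "abs (p0 * (x - x0)) <= abs p0 * sig"
        using cl by (auto simp: abs_mult intro!: mult_left_mono)
      moreover have "C1 * ((t - t0)^2 + (x - x0)^2) <= C1 * (2 * sig)"
        using sq[OF cl(1)] sq[OF cl(2)] C1 by (intro mult_left_mono) auto
      moreover have "0 <= C1 * ((t - t0)^2 + (x - x0)^2)" "0 <= sig^2" using C1 by auto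
      moreover have "psi (t, x) + N (t0, x0) = sig^2 - alpha0 * (t - t0) - p0 * (x - x0) - C1 * ((t - t0)^2 + (x - x0)^2)"
        by (simp add: psi L0_def)
      moreover have "(abs alpha0 + abs p0 + 2 * C1) * sig = abs alpha0 * sig + abs p0 * sig + C1 * (2 * sig)"
        by (simp add: algebra_simps)
      ultimately show ?thesis by linarith
    qed
    show "- alpha0 - 2 * C1 * (t - t0) <= abs (p0 + 2 * C1 * (x - x0)) * kint r (%z. E_upper eps (M (t, x + z) - psi (t, x)))"
      using neg cl b e by (meson not_less)
  qed
  show False
  proof (rule bump_contradiction[OF psic d(1,3) _ s0])
    show "psi (s, y) <= M (s, y)"
      if "abs (s - t0) <= d" "abs (y - x0) <= d" "~ (abs (s - t0) < d / 2 & abs (y - x0) < d / 2)" for s y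
    proof (rule ccontr)
      assume "~ ?thesis"
      then have "abs (s - t0) < sig" "abs (y - x0) < sig" using close[OF that(1,2)] by auto
      then show False using that(3) sig(2) by (simp add: d_def)
    qed
  next
    fix t x alpha C' delta'
    assume t: "abs (t - t0) < d / 2" "abs (x - x0) < d / 2" "M (t, x) < psi (t, x)" and delta': "0 < delta'"
      and "touch4 (%(s, y). if abs (s - t0) < d & abs (y - x0) < d then max (M (s, y)) (psi (s, y)) else M (s, y)) t x alpha C' delta'"
    then have tU: "touch4 U t x alpha C' delta'" by (simp add: U_def)
    have "- p0 - 2 * C1 * (x - x0) = 0"
    proof (rule linear_le_quadratic[of "min delta' (d / 2)" _ "abs C' + C1"])
      fix h assume h: "abs h < min delta' (d / 2)"
      have tp: "0 < t" using t d by linarith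
      have "psi (t, x + h) <= U (t, x + h)" using h t by (intro Upsi) linarith+
      also have "\<dots> <= U (t, x) + alpha * (t - t) + C' * ((t - t)^2 + (x + h - x) ^ 4)"
        using h t d delta' tp by (intro tU[unfolded touch4_def, rule_format]) linarith+
      also have "C' * ((t - t)^2 + (x + h - x) ^ 4) <= abs C' * h^2"
      proof -
        have "abs h ^ 4 <= abs h^2" using h d by (intro power_decreasing) auto
        then have "abs C' * h ^ 4 <= abs C' * h^2" by (intro mult_left_mono) auto
        moreover have "C' * h ^ 4 <= abs C' * h ^ 4" by (intro mult_right_mono) auto
        ultimately show ?thesis by simp
      qed
      finally show "(- p0 - 2 * C1 * (x - x0)) * h <= (abs C' + C1) * h^2"
        using psidiff[of t 0 x h] Ueq[OF t] by (simp add: algebra_simps)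
    qed (use d delta' in simp)
    moreover have "abs (x - x0) < sig" using close(2)[OF _ _ t(3)] t d by simp
    ultimately show "alpha <= 0" using pn(1)[of x] p0 by simp
  next
    fix t x alpha p C' delta' and r0 :: real
    assume t: "abs (t - t0) < d / 2" "abs (x - x0) < d / 2" "M (t, x) < psi (t, x)" and p: "p ~= 0" and delta': "0 < delta'" and r0: "0 < r0"
      and "touch (%(s, y). if abs (s - t0) < d & abs (y - x0) < d then max (M (s, y)) (psi (s, y)) else M (s, y)) t x alpha p C' delta'"
      and "usc_on Q (%(s, y). if abs (s - t0) < d & abs (y - x0) < d then max (M (s, y)) (psi (s, y)) else M (s, y))"
      and "bounded ((%(s, y). if abs (s - t0) < d & abs (y - x0) < d then max (M (s, y)) (psi (s, y)) else M (s, y)) ` Q)"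
    then have tU: "touch U t x alpha p C' delta'" and Uusc: "usc_on Q U" and "bounded (U ` Q)" by (simp_all add: U_def)
    then obtain A' where A': "0 < A'" "!!t x. 0 < t ==> abs (U (t, x)) <= A'" using bounded_QE[of U] by metis
    define e where "e = min delta' (d / 2)"
    have e: "0 < e" "e <= delta'" "e <= d / 2" using d delta' by (auto simp: e_def)
    have tpos: "0 < t" using t d by linarith
    have grad: "(- alpha0 - 2 * C1 * (t - t0)) * a + (- p0 - 2 * C1 * (x - x0)) * b - C1 * (a^2 + b^2) <= alpha * a + p * b + C' * (a^2 + b^2)"
      if h: "abs a < e" "abs b < e" for a b
    proof -
      have "psi (t + a, x + b) <= U (t + a, x + b)" using h t e by (intro Upsi) linarith+
      also have "\<dots> <= U (t, x) + alpha * (t + a - t) + p * (x + b - x) + C' * ((t + a - t)^2 + (x + b - x)^2)"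
        using h t d e by (intro tU[unfolded touch_def, rule_format]) linarith+
      finally show ?thesis using psidiff[of t a x b] Ueq[OF t] by simp
    qed
    have alpha: "alpha = - alpha0 - 2 * C1 * (t - t0)" and peq: "p = - p0 - 2 * C1 * (x - x0)"
      using touch_gradient_unique[OF e(1) grad] by auto
    have cl: "abs (t - t0) < sig" "abs (x - x0) < sig" using close[OF _ _ t(3)] t d by auto
    have pabs: "abs p = abs (p0 + 2 * C1 * (x - x0))" by (simp add: peq)
    define r' where "r' = min r r0 / 2"
    have r': "0 < r'" "r' <= r" "r' < r0" using r r0 by (auto simp: r'_def min_def)
    have jm: "jump eps U t x \<in> borel_measurable borel" by (rule jump_measurable[OF Uusc tpos])
    have jb: "abs (jump eps U t x z) <= 2 * A' + eps / 2" for z by (rule jump_bound) (use eps A' tpos in auto)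
    note [measurable] = usc_on_slice_measurable[OF jsub_usc[OF max_sub_jsub] tpos]
    have "kint r (%z. E_upper eps (M (t, x + z) - psi (t, x))) <= kint r (jump eps U t x)"
    proof (rule kint_mono[OF r(1) _ _ jm jb])
      show "(%z. E_upper eps (M (t, x + z) - psi (t, x))) \<in> borel_measurable borel" by measurable
      show "abs (E_upper eps (M (t, x + z) - psi (t, x))) <= 2 * G + 1 + eps / 2" for z
        using E_upper_bounds(3)[OF eps, of "M (t, x + z) - psi (t, x)"] max_sub_bound[OF tpos, of "x + z"] psib[OF t]
        by linarith
      show "E_upper eps (M (t, x + z) - psi (t, x)) <= jump eps U t x z" for z
        unfolding jump_def Ueq[OF t] by (intro E_upper_mono[OF eps] diff_right_mono MU)
    qed
    \<comment> \<open>Here a smooth function touches from below, so near the origin the jumps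
      dominate an odd function and shrinking the radius increases the integral.\<close>
    also have "\<dots> <= kint r' (jump eps U t x)"
    proof (rule kint_sgn_ge[OF r'(1,2) jm jb, where c = "eps / 2" and p = p])
      fix z assume z: "r' <= abs z" "abs z < r"
      have z0: "0 < abs z" using z r' by linarith
      have "psi (t, x + z) <= U (t, x + z)" using z r t delta1(1) unfolding d_def by (intro Upsi[unfolded d_def]) linarith+
      then have ge: "p * z - C1 * z^2 <= U (t, x + z) - U (t, x)"
        using psidiff[of t 0 x z] Ueq[OF t] by (simp add: peq)
      have z2: "C1 * z^2 = C1 * abs z * abs z" by (simp add: power2_eq_square)
      have "C1 * abs z <= C1 * (delta1 / 8)" using z r C1 by (intro mult_left_mono) auto
      then have Cz: "C1 * abs z < abs p" using delta1(5) pn(1)[OF cl(2)] p0 unfolding pabs by linarith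
      then have lt: "C1 * z^2 < abs (p * z)" unfolding z2 abs_mult using z0 by (intro mult_strict_right_mono)
      show "eps / 2 * sgn (p * z) <= jump eps U t x z"
      proof (cases "p * z < 0")
        case True
        have "abs (p * z) <= 3 / 2 * abs p0 * (delta1 / 8)"
          unfolding abs_mult using pn(2)[OF cl(2)] z r unfolding pabs by (intro mult_mono) auto
        moreover have "0 <= abs p0 * delta1" "0 <= C1 * delta1^2" using delta1 C1 by simp_all
        ultimately have "- eps <= p * z - C1 * z^2" using lt delta1(6) True by simp
        then show ?thesis using ge E_upper_signs(4)[OF eps, of "U (t, x + z) - U (t, x)"] True by (simp add: jump_def)
      next
        case False
        then have "0 < p * z" using p z0 by (simp add: less_eq_real_def not_less)
        then show ?thesis using ge lt E_upper_signs(3)[OF eps, of "U (t, x + z) - U (t, x)"] by (simp add: jump_def)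
      qed
    qed
    finally have "abs p * kint r (%z. E_upper eps (M (t, x + z) - psi (t, x))) <= abs p * kint r' (jump eps U t x)"
      by (intro mult_left_mono) auto
    then have "alpha <= abs p * kint r' (jump eps U t x)" using main[OF t] unfolding alpha pabs by linarith
    then show "EX r>0. r < r0 & alpha <= abs p * kint r (jump eps
        (%(s, y). if abs (s - t0) < d & abs (y - x0) < d then max (M (s, y)) (psi (s, y)) else M (s, y)) t x)"
      using r' unfolding U_def[symmetric] by blast
  qed
qed

text \<open>The violations of \<open>N_touch_step\<close> for heights tending to \<open>0\<close>
  are collected into a sequence. Their points converge to \<open>(t0, x0)\<close>, their values to
  \<open>- N (t0, x0)\<close>, and the reversed inequalities pass to the limit by
  \<open>kint_limsup\<close>.\<close>

lemma N_touch:
  assumes t0: "0 < t0" and delta: "0 < delta" and tch: "touch N t0 x0 alpha0 p0 C delta" and p0: "p0 ~= 0" and r0: "0 < r0"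
  shows "EX r>0. r < r0 & alpha0 <= abs p0 * kint r (jump eps N t0 x0)"
proof -
  define C1 where "C1 = abs C + 1"
  have C1: "0 < C1" "abs C1 = C1" by (simp_all add: C1_def)
  have mpos: "0 < Min {delta, t0, 1}" using t0 delta by simp
  have mle: "Min {delta, t0, 1} <= delta" "Min {delta, t0, 1} <= t0" "Min {delta, t0, 1} <= 1" by (rule Min_le; simp)+
  obtain delta1 where delta1: "0 < delta1" "delta1 <= Min {delta, t0, 1}" "C1 * delta1 <= abs p0" "abs p0 * delta1 + C1 * delta1^2 <= eps"
    using small_radius[OF eps p0 mpos, of C1] C1 by auto
  have delta1': "delta1 <= delta" "delta1 <= t0" "delta1 <= 1" using delta1(2) mle by linarith+
  define r where "r = min r0 (delta1 / 8) / 2"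
  have r: "0 < r" "r <= delta1 / 8" "r < r0" using r0 delta1 by (auto simp: r_def min_def)
  define e0 where "e0 = min (delta1 / 4) (abs p0 / (4 * C1))"
  have e0: "0 < e0" using delta1 p0 C1 by (simp add: e0_def)
  have e0le: "e0 <= delta1 / 4" unfolding e0_def by (rule min.cobounded1)
  have "e0 <= abs p0 / (4 * C1)" unfolding e0_def by (rule min.cobounded2)
  then have e0p: "2 * C1 * e0 <= abs p0 / 2" using C1 by (simp add: pos_le_divide_eq algebra_simps)
  define en where "en n = e0 / real (Suc n)" for n
  have en: "0 < en n" "en n <= e0" for n
    using e0 by (auto simp: en_def field_simps)
  have en0: "en \<longlonglongrightarrow> 0"
    unfolding en_def using tendsto_mult_right_zero[OF LIMSEQ_inverse_real_of_nat, of e0]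
    by (simp add: divide_inverse)
  define Phi where "Phi n t x c \<longleftrightarrow> abs (t - t0) < en n & abs (x - x0) < en n & abs c <= G + 1 &
     abs (c + N (t0, x0)) <= (en n)^2 + (abs alpha0 + abs p0 + 2 * C1) * en n &
     abs (p0 + 2 * C1 * (x - x0)) * kint r (%z. E_upper eps (M (t, x + z) - c)) < - alpha0 - 2 * C1 * (t - t0)" for n t x c
  have "EX t x c. Phi n t x c" for n
    unfolding Phi_def C1_def
  proof (rule N_touch_step[OF t0 tch p0 delta1(1) delta1' _ _ r(1,2) en(1)])
    show "en n <= delta1 / 4" using en(2)[of n] e0le by linarith
    have "2 * C1 * en n <= 2 * C1 * e0" using en(2)[of n] C1 by simp
    then show "2 * (abs C + 1) * en n <= abs p0 / 2" using e0p by (simp add: C1_def)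
  qed (use delta1 in \<open>auto simp: C1_def\<close>)
  then obtain T X c where Phi: "!!n. Phi n (T n) (X n) (c n)" by metis
  have T: "abs (T n - t0) < en n" "abs (X n - x0) < en n" "abs (c n) <= G + 1"
    "abs (c n + N (t0, x0)) <= (en n)^2 + (abs alpha0 + abs p0 + 2 * C1) * en n"
    "abs (p0 + 2 * C1 * (X n - x0)) * kint r (%z. E_upper eps (M (T n, X n + z) - c n)) < - alpha0 - 2 * C1 * (T n - t0)" for n
    using Phi[of n] unfolding Phi_def by blast+
  have Tlim: "T \<longlonglongrightarrow> t0" and Xlim: "X \<longlonglongrightarrow> x0"
  proof -
    have "(%n. T n - t0) \<longlonglongrightarrow> 0" "(%n. X n - x0) \<longlonglongrightarrow> 0"
      using T(1,2) by (auto intro!: Lim_null_comparison[OF _ en0] always_eventually less_imp_le)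
    then show "T \<longlonglongrightarrow> t0" "X \<longlonglongrightarrow> x0" by (simp_all add: LIM_zero_iff)
  qed
  have clim: "(%n. c n + N (t0, x0)) \<longlonglongrightarrow> 0"
  proof (rule Lim_null_comparison)
    show "eventually (%n. norm (c n + N (t0, x0)) <= (en n)^2 + (abs alpha0 + abs p0 + 2 * C1) * en n) sequentially"
      using T(4) by (simp add: always_eventually)
    have "(%n. (en n)^2 + (abs alpha0 + abs p0 + 2 * C1) * en n) \<longlonglongrightarrow> 0^2 + (abs alpha0 + abs p0 + 2 * C1) * 0"
      by (intro tendsto_intros en0)
    then show "(%n. (en n)^2 + (abs alpha0 + abs p0 + 2 * C1) * en n) \<longlonglongrightarrow> 0" by simp
  qed
  have Tpos: "0 < T n" for n
    using T(1)[of n] en(2)[of n] e0le delta1'(2) delta1(1) by linarith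
  define f where "f n z = - E_upper eps (M (T n, X n + z) - c n)" for n z
  have ev: "eventually (%n. kint r (f n) <= kint r (jump eps N t0 x0) + e) sequentially"
    if "0 < e" for e
  proof (rule kint_limsup[where B = "2 * G + 1 + eps / 2"])
    show "f n \<in> borel_measurable borel" for n
    proof -
      note [measurable] = usc_on_slice_measurable[OF jsub_usc[OF max_sub_jsub] Tpos]
      show ?thesis unfolding f_def by measurable
    qed
    show "abs (f n z) <= 2 * G + 1 + eps / 2" for n z
      using E_upper_bounds(3)[OF eps, of "M (T n, X n + z) - c n"] max_sub_bound[OF Tpos[of n], of "X n + z"] T(3)[of n]
      unfolding f_def by linarith
    show "jump eps N t0 x0 \<in> borel_measurable borel" by (rule jump_measurable[OF N_usc t0])
    show "abs (jump eps N t0 x0 z) <= 2 * G + 1 + eps / 2" for z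
    proof -
      have "abs (jump eps N t0 x0 z) <= 2 * G + eps / 2" by (rule jump_bound) (use eps N_bound t0 in auto)
      then show ?thesis by simp
    qed
    fix z e' :: real assume "0 < e'"
    obtain eta where eta: "0 < eta" "!!b. b < N (t0, x0 + z) - N (t0, x0) + eta ==> E_upper eps b <= jump eps N t0 x0 z"
      unfolding jump_def using E_upper_usc[OF eps] by metis
    obtain d' where d': "0 < d'"
      "!!s y. 0 < s ==> abs (s - t0) < d' ==> abs (y - (x0 + z)) < d' ==> N (s, y) < N (t0, x0 + z) + eta / 2"
      using usc_onD[OF N_usc t0, of "x0 + z" "N (t0, x0 + z) + eta / 2"] eta(1) by auto
    have "eventually (%n. en n < d') sequentially" "eventually (%n. c n + N (t0, x0) < eta / 2) sequentially"
      using order_tendstoD(2)[OF en0 d'(1)] order_tendstoD(2)[OF clim, of "eta / 2"] eta(1) by simp_all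
    then show "eventually (%n. f n z <= jump eps N t0 x0 z + e') sequentially"
    proof eventually_elim
      case (elim n)
      have "- M (T n, X n + z) <= N (T n, X n + z)" by (rule N_ge[OF Tpos])
      also have "\<dots> < N (t0, x0 + z) + eta / 2"
        using elim T(1,2)[of n] by (intro d'(2)[OF Tpos]) auto
      finally have "- (M (T n, X n + z) - c n) < N (t0, x0 + z) - N (t0, x0) + eta"
        using elim by simp
      then have "E_upper eps (- (M (T n, X n + z) - c n)) <= jump eps N t0 x0 z" by (rule eta(2))
      \<comment> \<open>Negation turns the staircase into its lower version, which lies below the
        upper one; the inequality goes in the direction needed here.\<close>
      then show ?case using \<open>0 < e'\<close> E_upper_uminus[OF eps, of "M (T n, X n + z) - c n"] by (simp add: f_def)
    qed
  qed (use r that in auto)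
  have "alpha0 <= abs p0 * (kint r (jump eps N t0 x0) + e)" if "0 < e" for e
  proof (rule tendsto_le[OF sequentially_bot])
    have "(%n. abs (p0 + 2 * C1 * (X n - x0)) * (kint r (jump eps N t0 x0) + e)) \<longlonglongrightarrow> abs (p0 + 2 * C1 * (x0 - x0)) * (kint r (jump eps N t0 x0) + e)"
      by (intro tendsto_intros Xlim)
    then show "(%n. abs (p0 + 2 * C1 * (X n - x0)) * (kint r (jump eps N t0 x0) + e)) \<longlonglongrightarrow> abs p0 * (kint r (jump eps N t0 x0) + e)"
      by simp
    have "(%n. alpha0 + 2 * C1 * (T n - t0)) \<longlonglongrightarrow> alpha0 + 2 * C1 * (t0 - t0)" by (intro tendsto_intros Tlim)
    then show "(%n. alpha0 + 2 * C1 * (T n - t0)) \<longlonglongrightarrow> alpha0" by simp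
    show "eventually (%n. alpha0 + 2 * C1 * (T n - t0) <= abs (p0 + 2 * C1 * (X n - x0)) * (kint r (jump eps N t0 x0) + e)) sequentially"
      using ev[OF that]
    proof eventually_elim
      case (elim n)
      have "kint r (f n) = - kint r (%z. E_upper eps (M (T n, X n + z) - c n))"
        unfolding f_def by (rule kint_uminus)
      then have "alpha0 + 2 * C1 * (T n - t0) < abs (p0 + 2 * C1 * (X n - x0)) * kint r (f n)" using T(5)[of n] by simp
      also have "\<dots> <= abs (p0 + 2 * C1 * (X n - x0)) * (kint r (jump eps N t0 x0) + e)"
        using elim by (intro mult_left_mono) auto
      finally show ?case by simp
    qed
  qed
  then have le: "alpha0 <= abs p0 * kint r (jump eps N t0 x0) + abs p0 * e" if "0 < e" for e
    using that by (simp add: distrib_left)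
  have "alpha0 <= abs p0 * kint r (jump eps N t0 x0)"
  proof (rule field_le_epsilon)
    fix e :: real assume "0 < e"
    then show "alpha0 <= abs p0 * kint r (jump eps N t0 x0) + e" using le[of "e / abs p0"] p0 by simp
  qed
  then show ?thesis using r by blast
qed

lemma N_jsub: "jsub eps N"
  unfolding jsub_def
  using N_bound N_usc N_touch N_flat by (auto intro: bounded_QI)

text \<open>Under each \<open>x\<close> there is a barrier of height \<open>l x\<close> in the
  class. It forces \<open>M\<close> to start near or above \<open>l x\<close>, and the bound holds
  on a full neighbourhood, hence for the envelope too.\<close>

lemma N_starts_below:
  assumes l: "!!x. abs (l x) <= G" "!!x. l x <= g x" "!!x. EX r>0. ALL y. abs (y - x) <= r --> l x <= l y"
  shows "starts_below N (%x. - l x)"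
  unfolding starts_below_def
proof (intro allI impI)
  fix x c assume c: "- l x < c"
  obtain r where r: "0 < r" "!!y. abs (y - x) <= r ==> l x <= l y" using l(3) by blast
  let ?b = "barrier eps G r x (l x)"
  have b: "?b \<in> perron_class eps G g"
  proof (rule barrier_in_class[OF l(1) r(1)])
    show "l x <= g y" if "abs (y - x) < r" for y using r(2)[of y] l(2)[of y] that by simp
  qed
  define c' where "c' = (c - l x) / 2"
  have c': "- l x < c'" "c' < c" using c by (auto simp: c'_def)
  have b0: "- c' < ?b (0, x)" using c'(1) by (simp add: barrier_def)
  have "open {q. - c' < ?b q}"
    by (intro open_Collect_less continuous_barrier continuous_on_const)
  then obtain e where e: "0 < e" "ball (0, x) e \<subseteq> {q. - c' < ?b q}"
    using b0 unfolding open_contains_ball by blast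
  have lt: "- M (t, y) <= c'" if h: "0 < t" "t < e/2" "abs (y - x) < e/2" for t y
  proof -
    have "sqrt ((0 - t)^2 + (x - y)^2) <= abs (0 - t) + abs (x - y)" by (rule sqrt_sum_squares_le_sum_abs)
    then have "dist (0, x) (t, y) < e"
      using h by (simp add: dist_Pair_Pair dist_real_def abs_minus_commute[of x y] power2_commute[of x y])
    then have "- c' < ?b (t, y)" using e(2) by auto
    then show ?thesis using max_sub_upper[OF b h(1), of y] by simp
  qed
  show "EX d>0. ALL t y. 0 < t --> t < d --> abs (y - x) < d --> N (t, y) < c"
  proof (intro exI[of _ "e/4"] conjI allI impI)
    fix t y :: real assume h: "0 < t" "t < e/4" "abs (y - x) < e/4"
    have bd: "abs (- M (s, z)) <= G" if "0 < s" for s z using max_sub_bound[OF that] by simp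
    have "N (t, y) <= c'"
    proof (rule uenv_le[where u = "%q. - M q", OF bd h(1), of "e/4"])
      show "- M (s, z) <= c'" if "0 < s" "abs (s - t) < e/4" "abs (z - y) < e/4" for s z
        using that h by (intro lt) linarith+
    qed (use e in auto)
    then show "N (t, y) < c" using c'(2) by simp
  qed (use e in simp)
qed

end

section \<open>Ordering near the jumps of a step function\<close>

lemma int_multiple_le:
  fixes x y :: real
  assumes "0 < eps" "x / eps \<in> \<int>" "y / eps \<in> \<int>" "x < y + eps"
  shows "x <= y"
proof -
  obtain m n where mn: "x / eps = of_int m" "y / eps = of_int n" using assms(2,3) by (auto elim!: Ints_cases)
  have "x / eps < y / eps + 1" using assms(1,4) by (simp add: field_simps)
  then have "m <= n" using mn by linarith
  then have "x / eps <= y / eps" using mn by simp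
  then show ?thesis using assms(1) by (simp add: divide_le_cancel)
qed

text \<open>The time in which a bound moving at the speed for \<open>R = 1\<close> rises by
  \<open>eps\<close>; by scaling, a plateau of radius \<open>R\<close> lasts for
  \<open>plateau_time eps A * R^2\<close>.\<close>

definition plateau_time :: "real => real => real" where
  "plateau_time eps A = eps / plateau_speed eps A"

text \<open>In this time the plateau estimate allows growth by less than \<open>eps\<close>, and for
  multiples of \<open>eps\<close> that means no growth at all.\<close>

lemma int_plateau:
  assumes u: "jsub eps u" and "0 < eps" and A: "!!t x. 0 < t ==> abs (u (t, x)) <= A"
    and int: "!!t x. 0 < t ==> u (t, x) / eps \<in> \<int>" "a / eps \<in> \<int>"
    and "0 <= t0" "0 < R"
    and init: "!!x. abs (x - p) <= R ==> EX h>0. ALL t y. t0 < t --> t < t0 + h --> abs (y - x) < h --> u (t, y) <= a"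
    and "t0 < t" "t < t0 + plateau_time eps A * R^2"
  shows "u (t, p) <= a"
proof -
  have A0: "0 <= A" using A[of 1 0] by (meson abs_ge_zero order_trans zero_less_one)
  have "EX h>0. ALL t y. t0 < t --> t < t0 + h --> p - R <= y --> y <= p + R --> u (t, y) <= a"
    by (rule uniform_start) (use init \<open>0 < R\<close> in \<open>auto simp: abs_le_iff\<close>)
  then obtain h where h: "0 < h" "!!t y. t0 < t ==> t < t0 + h ==> p - R <= y ==> y <= p + R ==> u (t, y) <= a" by auto
  have "u (t, p) <= a + plateau_speed eps A / R^2 * (t - t0)"
    by (rule jsub_plateau[OF u assms(2) A assms(6) h(1) assms(7)]) (use h(2) assms(9) in \<open>auto simp: abs_le_iff\<close>)
  also have "\<dots> < a + eps"
  proof -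
    have s: "0 < plateau_speed eps A" by (rule plateau_speed_pos[OF assms(2) A0])
    have "plateau_speed eps A / R^2 * (t - t0) < plateau_speed eps A / R^2 * (plateau_time eps A * R^2)"
      using s assms(7,10) by (intro mult_strict_left_mono) auto
    then show ?thesis using s assms(7) by (simp add: plateau_time_def)
  qed
  finally show ?thesis using int assms by (intro int_multiple_le[OF assms(2)]) auto
qed

text \<open>The factor 8 leaves room: a point within \<open>4 * R\<close> of one element of
  \<open>Y\<close> is at distance at least \<open>4 * R\<close> from all others.\<close>

lemma finite_separated:
  assumes "finite (Y :: real set)"
  obtains R where "0 < R" "!!y y'. y \<in> Y ==> y' \<in> Y ==> y ~= y' ==> 8 * R <= abs (y - y')"
proof -
  \<comment> \<open>Inserting \<open>8\<close> keeps \<open>Min\<close> defined when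
    \<open>Y\<close> has fewer than two elements.\<close>
  define Z where "Z = insert 8 ((%(y, y'). abs (y - y')) ` {(y, y'). y \<in> Y & y' \<in> Y & y ~= y'})"
  have "finite {(y, y'). y \<in> Y & y' \<in> Y & y ~= y'}"
    by (rule finite_subset[of _ "Y \<times> Y"]) (use assms in auto)
  then have fin: "finite Z" by (simp add: Z_def)
  have pos: "0 < Min Z" using fin by (subst Min_gr_iff) (auto simp: Z_def)
  show thesis
  proof (rule that[of "Min Z / 8"])
    show "8 * (Min Z / 8) <= abs (y - y')" if "y \<in> Y" "y' \<in> Y" "y ~= y'" for y y'
      using that fin by (auto intro!: Min_le simp: Z_def)
  qed (use pos in simp)
qed

section \<open>Tools for the doubling of variables\<close>

lemma usc_pair_attains:
  fixes v u :: "real \<times> real => real"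
  assumes v: "usc_on Q v" and u: "usc_on Q u" and "0 < a" "a <= b" "c <= d"
    and Phi: "continuous_on UNIV Phi"
  obtains t x s y where "t \<in> {a..b}" "x \<in> {c..d}" "s \<in> {a..b}" "y \<in> {c..d}"
    "!!t' x' s' y'. t' \<in> {a..b} ==> x' \<in> {c..d} ==> s' \<in> {a..b} ==> y' \<in> {c..d} ==>
      v (t', x') + u (s', y') - Phi ((t', x'), (s', y')) <= v (t, x) + u (s, y) - Phi ((t, x), (s, y))"
proof -
  let ?B = "{a..b} \<times> {c..d}"
  let ?F = "%q. v (fst q) + u (snd q) - Phi q"
  have near: "EX delta>0. \<forall>p'\<in>?B. dist p' p < delta --> w p' < w p + e"
    if w: "usc_on Q w" and p: "p \<in> ?B" and e: "0 < e" for w p and e :: real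
  proof -
    obtain t x where [simp]: "p = (t, x)" by (cases p)
    obtain delta where delta: "0 < delta" "!!s y. 0 < s ==> abs (s - t) < delta ==> abs (y - x) < delta ==> w (s, y) < w p + e"
      using usc_onD[OF w, of t x "w p + e"] p e assms(3) by auto
    show ?thesis
    proof (intro exI[of _ delta] conjI ballI impI)
      fix p' assume "p' \<in> ?B" "dist p' p < delta"
      moreover obtain s y where "p' = (s, y)" by (cases p')
      ultimately show "w p' < w p + e"
        using dist_fst_le[of p' p] dist_snd_le[of p' p] assms(3) by (auto simp: dist_real_def intro!: delta(2)[simplified])
    qed (rule delta)
  qed
  have "\<exists>q\<in>?B \<times> ?B. \<forall>q'\<in>?B \<times> ?B. ?F q' <= ?F q"
  proof (rule usc_attains)
    show "compact (?B \<times> ?B)" by (intro compact_Times compact_Icc)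
    show "?B \<times> ?B ~= {}" using assms by auto
    fix q c' assume q: "q \<in> ?B \<times> ?B" "?F q < c'"
    define e where "e = (c' - ?F q) / 3"
    have e: "0 < e" using q by (simp add: e_def)
    obtain delta1 where delta1: "0 < delta1" "!!p'. p' \<in> ?B ==> dist p' (fst q) < delta1 ==> v p' < v (fst q) + e"
      using near[OF v _ e, of "fst q"] q(1) by auto
    obtain delta2 where delta2: "0 < delta2" "!!p'. p' \<in> ?B ==> dist p' (snd q) < delta2 ==> u p' < u (snd q) + e"
      using near[OF u _ e, of "snd q"] q(1) by auto
    obtain delta3 where delta3: "0 < delta3" "!!q'. dist q' q < delta3 ==> dist (Phi q') (Phi q) < e"
      using Phi e unfolding continuous_on_iff by (metis UNIV_I)
    show "EX delta>0. \<forall>q'\<in>?B \<times> ?B. dist q' q < delta --> ?F q' < c'"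
    proof (intro exI[of _ "Min {delta1, delta2, delta3}"] conjI ballI impI)
      fix q' assume q': "q' \<in> ?B \<times> ?B" "dist q' q < Min {delta1, delta2, delta3}"
      have m: "Min {delta1, delta2, delta3} <= delta1" "Min {delta1, delta2, delta3} <= delta2" "Min {delta1, delta2, delta3} <= delta3" by (rule Min_le; simp)+
      have "v (fst q') < v (fst q) + e"
        using q' m dist_fst_le[of q' q] by (intro delta1(2)) (auto intro: le_less_trans less_le_trans)
      moreover have "u (snd q') < u (snd q) + e"
        using q' m dist_snd_le[of q' q] by (intro delta2(2)) (auto intro: le_less_trans less_le_trans)
      moreover have "dist (Phi q') (Phi q) < e" using q'(2) m by (intro delta3(2)) linarith
      ultimately have "?F q' < ?F q + 3 * e" by (simp add: dist_real_def)
      moreover have "3 * e = c' - ?F q" by (simp add: e_def)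
      ultimately show "?F q' < c'" by linarith
    qed (use delta1 delta2 delta3 in simp)
  qed
  then obtain q where q: "q \<in> ?B \<times> ?B" "!!q'. q' \<in> ?B \<times> ?B ==> ?F q' <= ?F q" by blast
  obtain t x s y where eq: "q = ((t, x), (s, y))" by (metis surj_pair)
  show thesis
  proof (rule that[of t x s y])
    show "v (t', x') + u (s', y') - Phi ((t', x'), (s', y')) <= v (t, x) + u (s, y) - Phi ((t, x), (s, y))"
      if "t' \<in> {a..b}" "x' \<in> {c..d}" "s' \<in> {a..b}" "y' \<in> {c..d}" for t' x' s' y'
      using q(2)[of "((t', x'), (s', y'))"] that by (simp add: eq)
  qed (use q(1) eq in auto)
qed

lemma inverse_square_lipschitz:
  fixes a b R :: real
  assumes "0 < R" "R <= abs a" "R <= abs b"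
  shows "abs (1 / a^2 - 1 / b^2) <= 2 / R ^ 3 * abs (a - b)"
proof -
  have a: "a ~= 0" "b ~= 0" using assms by auto
  have "1 / a^2 - 1 / b^2 = (b - a) * (1 / (a * b^2) + 1 / (a^2 * b))"
    using a by (simp add: field_simps power2_eq_square)
  then have "abs (1 / a^2 - 1 / b^2) = abs (a - b) * abs (1 / (a * b^2) + 1 / (a^2 * b))"
    by (simp add: abs_mult abs_minus_commute)
  also have "\<dots> <= abs (a - b) * (1 / R ^ 3 + 1 / R ^ 3)"
  proof (intro mult_left_mono order_trans[OF abs_triangle_ineq] add_mono)
    have "R * R^2 <= abs a * abs b^2" "R^2 * R <= abs a^2 * abs b"
      using assms by (intro mult_mono power_mono; simp)+
    then have "R ^ 3 <= abs (a * b^2)" "R ^ 3 <= abs (a^2 * b)"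
      by (simp_all add: abs_mult power3_eq_cube power2_eq_square)
    then have "1 / abs (a * b^2) <= 1 / R ^ 3" "1 / abs (a^2 * b) <= 1 / R ^ 3"
      using assms by (auto intro!: divide_left_mono simp: a)
    then show "abs (1 / (a * b^2)) <= 1 / R ^ 3" "abs (1 / (a^2 * b)) <= 1 / R ^ 3"
      by simp_all
  qed auto
  finally show ?thesis by (simp add: mult.commute)
qed

text \<open>Shifting an argument by \<open>d\<close> changes the integral over a far window by \<open>O(d)\<close>, however
  irregular \<open>g\<close> is, since the shift can be moved onto the kernel.\<close>

lemma shift_error:
  fixes g :: "real => real"
  assumes g: "g \<in> borel_measurable borel" "!!u. abs (g u) <= A" and R: "0 < R" "0 < r" "r <= R" and "c <= e"
    and far: "!!u. c <= u ==> u <= e ==> R <= abs (u - x)"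
  shows "kint r (%z. if c <= x + z & x + z <= e then g (x + z - d) - g (x + z + d) else 0)
    <= A * (abs d * (4 / R ^ 3 * (e - c + 2 * abs d) + 4 / R^2))"
proof -
  define k where "k u = indicator {c..e} u / (u - x)^2" for u
  have A0: "0 <= A" using g(2)[of 0] by linarith
  have k_le: "abs (k u) <= 1 / R^2 * indicator {c..e} u" for u
  proof (cases "u \<in> {c..e}")
    case True
    then have "R^2 <= abs (u - x)^2" using far[of u] R by (intro power_mono) auto
    moreover have "0 < R^2" using R by simp
    ultimately have "1 / (u - x)^2 <= 1 / R^2" by (simp add: frac_le)
    then show ?thesis using True by (simp add: k_def)
  qed (simp add: k_def)
  have km: "k \<in> borel_measurable borel" unfolding k_def by measurable
  have ind_int: "integrable lborel (%u. B * indicator {a..b} u :: real)" for a b B :: real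
    by (cases "a <= b") (auto intro!: integrable_mult_right simp: emeasure_lborel_Icc)
  have gk: "integrable lborel (%u. g (u + s) * k (u + s'))" for s s'
  proof (rule Bochner_Integration.integrable_bound)
    show "integrable lborel (%u. A * (1 / R^2) * indicator {c - s'..e - s'} u :: real)" by (rule ind_int)
    show "(%u. g (u + s) * k (u + s')) \<in> borel_measurable lborel" using g(1) km by measurable
    show "AE u in lborel. norm (g (u + s) * k (u + s')) <= norm (A * (1 / R^2) * indicator {c - s'..e - s'} u :: real)"
    proof (rule AE_I2)
      fix u
      have "indicator {c..e} (u + s') = (indicator {c - s'..e - s'} u :: real)" by (auto simp: indicator_def)
      moreover have "abs (g (u + s)) * abs (k (u + s')) <= A * (1 / R^2 * indicator {c..e} (u + s'))"
        using g(2)[of "u + s"] k_le[of "u + s'"] A0 by (intro mult_mono) auto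
      ultimately show "norm (g (u + s) * k (u + s')) <= norm (A * (1 / R^2) * indicator {c - s'..e - s'} u :: real)"
        using A0 by (simp add: abs_mult)
    qed
  qed
  have trans: "(\<integral>u. f u \<partial>lborel) = (\<integral>u. f (s + u) \<partial>lborel)" for f :: "real => real" and s
    using lborel_integral_real_affine[of 1 f s] by simp
  have "kint r (%z. if c <= x + z & x + z <= e then g (x + z - d) - g (x + z + d) else 0)
      = (\<integral>z. (g (x + z - d) - g (x + z + d)) * k (x + z) \<partial>lborel)"
    unfolding kint_def set_lebesgue_integral_def
  proof (rule Bochner_Integration.integral_cong)
    fix z
    have "r <= abs z" if "c <= x + z" "x + z <= e" using far[OF that] R by simp
    then show "indicat_real {z. r <= abs z} z *\<^sub>R ((if c <= x + z & x + z <= e then g (x + z - d) - g (x + z + d) else 0) / z^2)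
        = (g (x + z - d) - g (x + z + d)) * k (x + z)"
      by (auto simp: indicator_def k_def)
  qed simp
  also have "\<dots> = (\<integral>u. (g (u - d) - g (u + d)) * k u \<partial>lborel)"
    using trans[of "%u. (g (u - d) - g (u + d)) * k u" x] by simp
  also have "\<dots> = (\<integral>u. g (u - d) * k u \<partial>lborel) - (\<integral>u. g (u + d) * k u \<partial>lborel)"
    using gk[of "-d" 0] gk[of d 0] by (simp add: left_diff_distrib)
  also have "(\<integral>u. g (u - d) * k u \<partial>lborel) = (\<integral>u. g u * k (u + d) \<partial>lborel)"
    using trans[of "%u. g (u - d) * k u" d] by (simp add: add.commute)
  also have "(\<integral>u. g (u + d) * k u \<partial>lborel) = (\<integral>u. g u * k (u - d) \<partial>lborel)"
    using trans[of "%u. g (u + d) * k u" "-d"] by simp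
  also have "(\<integral>u. g u * k (u + d) \<partial>lborel) - (\<integral>u. g u * k (u - d) \<partial>lborel)
      = (\<integral>u. g u * (k (u + d) - k (u - d)) \<partial>lborel)"
    using gk[of 0 d] gk[of 0 "-d"] by (simp add: right_diff_distrib)
  \<comment> \<open>Where both shifted kernels see the window, their difference is Lipschitz with a
    constant of order \<open>1 / R ^ 3\<close>. Near the two ends only one of them may be nonzero,
    and it is at most \<open>1 / R^2\<close>; the last two indicators account for this.\<close>
  also have "\<dots> <= (\<integral>u. A * (4 / R ^ 3 * abs d * indicator {c - abs d..e + abs d} u
      + (1 / R^2 * indicator {c - abs d..c + abs d} u + 1 / R^2 * indicator {e - abs d..e + abs d} u)) \<partial>lborel)"
  proof (rule integral_mono)
    show "integrable lborel (%u. g u * (k (u + d) - k (u - d)))"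
      using gk[of 0 d] gk[of 0 "-d"] by (simp add: right_diff_distrib)
    show "integrable lborel (%u. A * (4 / R ^ 3 * abs d * indicator {c - abs d..e + abs d} u
      + (1 / R^2 * indicator {c - abs d..c + abs d} u + 1 / R^2 * indicator {e - abs d..e + abs d} u)))"
      by (intro integrable_mult_right Bochner_Integration.integrable_add ind_int)
    fix u :: real
    have nn: "0 <= 4 / R ^ 3 * abs d * indicator S u" "0 <= 1 / R^2 * (indicator S u :: real)" for S
      using R by (auto simp: indicator_def)
    have "abs (k (u + d) - k (u - d)) <= 4 / R ^ 3 * abs d * indicator {c - abs d..e + abs d} u
      + (1 / R^2 * indicator {c - abs d..c + abs d} u + 1 / R^2 * indicator {e - abs d..e + abs d} u)"
    proof (cases "u + d \<in> {c..e}"; cases "u - d \<in> {c..e}")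
      assume h: "u + d \<in> {c..e}" "u - d \<in> {c..e}"
      then have "abs (k (u + d) - k (u - d)) = abs (1 / (u + d - x)^2 - 1 / (u - d - x)^2)" by (simp add: k_def)
      also have "\<dots> <= 2 / R ^ 3 * abs ((u + d - x) - (u - d - x))"
        using far[of "u + d"] far[of "u - d"] h R by (intro inverse_square_lipschitz) auto
      also have "\<dots> = 4 / R ^ 3 * abs d * indicator {c - abs d..e + abs d} u"
        using h by (auto simp: indicator_def abs_mult)
      finally show ?thesis using nn(2) by (smt (verit))
    next
      assume h: "u + d \<in> {c..e}" "u - d \<notin> {c..e}"
      then have "abs (k (u + d) - k (u - d)) <= 1 / R^2" using k_le[of "u + d"] by (simp add: k_def)
      moreover have "u \<in> {c - abs d..c + abs d} | u \<in> {e - abs d..e + abs d}" using h by (auto simp: abs_if)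
      then have "1 / R^2 <= 1 / R^2 * indicator {c - abs d..c + abs d} u + 1 / R^2 * indicator {e - abs d..e + abs d} u"
      proof (rule disjE)
        assume i: "u \<in> {c - abs d..c + abs d}"
        show ?thesis using nn(2)[of "{e - abs d..e + abs d}"] unfolding indicator_simps(1)[OF i] by linarith
      next
        assume i: "u \<in> {e - abs d..e + abs d}"
        show ?thesis using nn(2)[of "{c - abs d..c + abs d}"] unfolding indicator_simps(1)[OF i] by linarith
      qed
      ultimately show ?thesis using nn(1)[of "{c - abs d..e + abs d}"] by linarith
    next
      assume h: "u + d \<notin> {c..e}" "u - d \<in> {c..e}"
      then have "abs (k (u + d) - k (u - d)) <= 1 / R^2" using k_le[of "u - d"] by (simp add: k_def)
      moreover have "u \<in> {c - abs d..c + abs d} | u \<in> {e - abs d..e + abs d}" using h by (auto simp: abs_if)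
      then have "1 / R^2 <= 1 / R^2 * indicator {c - abs d..c + abs d} u + 1 / R^2 * indicator {e - abs d..e + abs d} u"
      proof (rule disjE)
        assume i: "u \<in> {c - abs d..c + abs d}"
        show ?thesis using nn(2)[of "{e - abs d..e + abs d}"] unfolding indicator_simps(1)[OF i] by linarith
      next
        assume i: "u \<in> {e - abs d..e + abs d}"
        show ?thesis using nn(2)[of "{c - abs d..c + abs d}"] unfolding indicator_simps(1)[OF i] by linarith
      qed
      ultimately show ?thesis using nn(1)[of "{c - abs d..e + abs d}"] by linarith
    next
      assume h: "u + d \<notin> {c..e}" "u - d \<notin> {c..e}"
      then show ?thesis using nn by (simp add: k_def)
    qed
    then have "abs (g u) * abs (k (u + d) - k (u - d)) <= A * (4 / R ^ 3 * abs d * indicator {c - abs d..e + abs d} u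
      + (1 / R^2 * indicator {c - abs d..c + abs d} u + 1 / R^2 * indicator {e - abs d..e + abs d} u))"
      using g(2)[of u] A0 by (intro mult_mono) auto
    moreover have "g u * (k (u + d) - k (u - d)) <= abs (g u) * abs (k (u + d) - k (u - d))"
      by (simp add: abs_mult[symmetric])
    ultimately show "g u * (k (u + d) - k (u - d)) <= A * (4 / R ^ 3 * abs d * indicator {c - abs d..e + abs d} u
      + (1 / R^2 * indicator {c - abs d..c + abs d} u + 1 / R^2 * indicator {e - abs d..e + abs d} u))"
      by (rule order_trans[rotated])
  qed
  also have "\<dots> = A * (4 / R ^ 3 * abs d * (e - c + 2 * abs d) + (1 / R^2 * (2 * abs d) + 1 / R^2 * (2 * abs d)))"
  proof -
    have I: "(\<integral>u. B * indicator {a..b} u \<partial>lborel) = B * (b - a)" if "a <= b" for a b B :: real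
      using that by simp
    show ?thesis
      unfolding integral_mult_right_zero
      by (subst Bochner_Integration.integral_add[OF ind_int Bochner_Integration.integrable_add[OF ind_int ind_int]],
          subst Bochner_Integration.integral_add[OF ind_int ind_int], subst (1 2 3) I)
         (use \<open>c <= e\<close> in \<open>auto simp: algebra_simps\<close>)
  qed
  finally show ?thesis by (simp add: algebra_simps)
qed

text \<open>\<open>v\<close> stands for the maximal subsolution and \<open>w\<close> for the minimal
  supersolution. \<open>w_le_v\<close> is the direction that Perron's method yields; the aim is a
  converse up to a small displacement of the point.\<close>

locale ordered_pair =
  fixes eps A :: real and v w :: "real \<times> real => real"
  assumes eps: "0 < eps" and v_sub: "jsub eps v" and w_super: "jsub eps (%q. - w q)"
    and v_bound: "!!t x. 0 < t ==> abs (v (t, x)) <= A" and w_bound: "!!t x. 0 < t ==> abs (w (t, x)) <= A"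
    and v_int: "!!t x. 0 < t ==> v (t, x) / eps \<in> \<int>" and w_int: "!!t x. 0 < t ==> w (t, x) / eps \<in> \<int>"
    and w_le_v: "!!t x. 0 < t ==> w (t, x) <= v (t, x)"
begin

lemma A0: "0 <= A"
  using v_bound[of 1 0] by (meson abs_ge_zero order_trans zero_less_one)

lemma neg_w: "!!t x. 0 < t ==> abs (- w (t, x)) <= A" "!!t x. 0 < t ==> - w (t, x) / eps \<in> \<int>"
proof -
  show "abs (- w (t, x)) <= A" if "0 < t" for t x using w_bound[OF that] by simp
  show "- w (t, x) / eps \<in> \<int>" if "0 < t" for t x using Ints_minus[OF w_int[OF that, of x]] by simp
qed

abbreviation c0 :: real where "c0 \<equiv> plateau_time eps A"

lemma c0_pos: "0 < c0"
  unfolding plateau_time_def using plateau_speed_pos[OF eps A0] eps by simp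

lemma v_plateau:
  assumes "a / eps \<in> \<int>" "0 <= t0" "0 < R"
    and "!!x. abs (x - p) <= R ==> EX h>0. ALL t y. t0 < t --> t < t0 + h --> abs (y - x) < h --> v (t, y) <= a"
    and "t0 < t" "t < t0 + c0 * R^2"
  shows "v (t, p) <= a"
  by (rule int_plateau[OF v_sub eps _ _ assms]) (use v_bound v_int in auto)

lemma w_plateau:
  assumes "a / eps \<in> \<int>" "0 <= t0" "0 < R"
    and init: "!!x. abs (x - p) <= R ==> EX h>0. ALL t y. t0 < t --> t < t0 + h --> abs (y - x) < h --> a <= w (t, y)"
    and "t0 < t" "t < t0 + c0 * R^2"
  shows "a <= w (t, p)"
proof -
  have "- w (t, p) <= - a"
  proof (rule int_plateau[OF w_super eps _ _ _ assms(2,3) _ assms(5,6)])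
    show "abs (- w (t, x)) <= A" "- w (t, x) / eps \<in> \<int>" if "0 < t" for t x using neg_w[OF that] by auto
    show "- a / eps \<in> \<int>" using Ints_minus[OF assms(1)] by simp
    show "EX h>0. ALL t y. t0 < t --> t < t0 + h --> abs (y - x) < h --> - w (t, y) <= - a" if "abs (x - p) <= R" for x
      using init[OF that] by simp
  qed
  then show ?thesis by simp
qed

end

text \<open>\<open>regular\<close> squeezes both functions onto \<open>S\<close> off
  \<open>Y\<close>. At points of \<open>Y\<close> they are only trapped between the one-sided values
  of \<open>S\<close>, which is all that the envelopes of a step function can provide.\<close>

locale steps = ordered_pair +
  fixes t0 R :: real and Y :: "real set" and S :: "real => real"
  assumes t0: "0 <= t0" and finY: "finite Y"
    and regular: "!!x. x \<notin> Y ==> EX h>0. ALL y. abs (y - x) < h --> S y = S x &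
      (ALL t. t0 < t --> t < t0 + h --> v (t, y) <= S x & S x <= w (t, y))"
    and singular: "!!y. y \<in> Y ==> EX h>0. ALL t x x1 x2. t0 < t --> t < t0 + h --> abs (x - y) < h -->
      y - h < x1 --> x1 < y --> y < x2 --> x2 < y + h -->
      v (t, x) <= max (S x1) (S x2) & min (S x1) (S x2) <= w (t, x)"
    and R: "0 < R" and sep: "!!y y'. y \<in> Y ==> y' \<in> Y ==> y ~= y' ==> 8 * R <= abs (y - y')"
begin

section \<open>Behaviour just after the initial time\<close>

lemma S_const:
  assumes "a <= b" "!!y. y \<in> Y ==> ~ (a <= y & y <= b)"
  shows "S a = S b"
proof (rule connected_local_const[where A = "{a..b}" and f = S and a = a and b = b])
  show "\<forall>x\<in>{a..b}. eventually (%y. S x = S y) (at x within {a..b})"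
  proof
    fix x assume "x \<in> {a..b}"
    then have "x \<notin> Y" using assms(2) by auto
    then obtain h where h: "0 < h" "!!y. abs (y - x) < h ==> S y = S x" using regular[of x] by blast
    show "eventually (%y. S x = S y) (at x within {a..b})"
      unfolding eventually_at
    proof (intro exI[of _ h] conjI ballI impI)
      fix y assume "y \<in> {a..b}" "y ~= x & dist y x < h"
      then show "S x = S y" using h(2)[of y] by (simp add: dist_real_def)
    qed (rule h(1))
  qed
  show "connected {a..b}" by (rule connected_Icc)
  show "a \<in> {a..b}" "b \<in> {a..b}" using assms(1) by auto
qed

lemma regular_bounds:
  assumes "x \<notin> Y"
  shows "EX h>0. ALL t y. t0 < t --> t < t0 + h --> abs (y - x) < h --> v (t, y) <= S x & S x <= w (t, y)"
  using regular[OF assms] by blast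

lemma S_int:
  assumes "x \<notin> Y" shows "S x / eps \<in> \<int>"
proof -
  obtain h where h: "0 < h" "!!y t. abs (y - x) < h ==> t0 < t ==> t < t0 + h ==> v (t, y) <= S x & S x <= w (t, y)"
    using regular[OF assms] by blast
  have "0 < t0 + h / 2" using t0 h by simp
  moreover have "v (t0 + h / 2, x) <= S x & S x <= w (t0 + h / 2, x)" using h by (intro h(2)) auto
  ultimately have "S x = v (t0 + h / 2, x)" using w_le_v[of "t0 + h / 2" x] by linarith
  then show ?thesis using v_int \<open>0 < t0 + h / 2\<close> by simp
qed

text \<open>The bounds \<open>v <= S x\<close> and \<open>S x <= w\<close> persist on a plateau of
  radius \<open>rho\<close> for a time of order \<open>rho^2\<close>, and \<open>w <= v\<close>
  closes the squeeze.\<close>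

lemma far_from_Y:
  assumes rho: "0 < rho" "!!y. y \<in> Y ==> rho < abs (x - y)" and t: "t0 < t" "t < t0 + c0 * rho^2"
  shows "v (t, x) = S x" "w (t, x) = S x"
proof -
  have x: "x \<notin> Y" using rho by force
  have near: "EX h>0. ALL t y. t0 < t --> t < t0 + h --> abs (y - x') < h --> v (t, y) <= S x & S x <= w (t, y)"
    if x': "abs (x' - x) <= rho" for x'
  proof -
    have "S x' = S x"
    proof (cases "x' <= x")
      case True
      show ?thesis
      proof (rule S_const[OF True])
        show "~ (x' <= y & y <= x)" if "y \<in> Y" for y using rho(2)[OF that] x' by auto
      qed
    next
      case False
      have "S x = S x'"
      proof (rule S_const)
        show "~ (x <= y & y <= x')" if "y \<in> Y" for y using rho(2)[OF that] x' by auto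
      qed (use False in simp)
      then show ?thesis by simp
    qed
    moreover have "x' \<notin> Y" using rho(2)[of x'] x' by (auto simp: abs_minus_commute)
    ultimately show ?thesis using regular_bounds[of x'] by simp
  qed
  have "v (t, x) <= S x"
  proof (rule v_plateau[OF S_int[OF x] t0 rho(1) _ t])
    fix x' assume "abs (x' - x) <= rho"
    from near[OF this] show "EX h>0. ALL t y. t0 < t --> t < t0 + h --> abs (y - x') < h --> v (t, y) <= S x" by blast
  qed
  moreover have "S x <= w (t, x)"
  proof (rule w_plateau[OF S_int[OF x] t0 rho(1) _ t])
    fix x' assume "abs (x' - x) <= rho"
    from near[OF this] show "EX h>0. ALL t y. t0 < t --> t < t0 + h --> abs (y - x') < h --> S x <= w (t, y)" by blast
  qed
  moreover have "w (t, x) <= v (t, x)" using t t0 by (intro w_le_v) simp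
  ultimately show "v (t, x) = S x" "w (t, x) = S x" by auto
qed

definition l where "l y = S (y - R)"
definition rr where "rr y = S (y + R)"
text \<open>The direction of the jump at \<open>y\<close>; equal side values count as
  increasing.\<close>

definition sg :: "real => real" where "sg y = (if l y <= rr y then 1 else -1)"

lemma side_values:
  assumes "y \<in> Y"
  shows "y - 4 * R <= x ==> x < y ==> S x = l y" "y < x ==> x <= y + 4 * R ==> S x = rr y"
    and "abs (x - y) <= 4 * R ==> x ~= y ==> x \<notin> Y"
proof -
  have other: "y' = y" if "y' \<in> Y" "y - 4 * R <= y'" "y' <= y + 4 * R" for y'
  proof (rule ccontr)
    assume "y' ~= y"
    then have "8 * R <= abs (y - y')" using sep[OF assms that(1)] by simp
    then show False using that(2,3) R by linarith
  qed
  show "abs (x - y) <= 4 * R ==> x ~= y ==> x \<notin> Y" using other[of x] by (auto simp: abs_le_iff)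
  { assume x: "y - 4 * R <= x" "x < y"
    have "S x = S (y - R)" if "x <= y - R"
    proof (rule S_const[OF that])
      show "~ (x <= y' & y' <= y - R)" if "y' \<in> Y" for y' using other[OF that] x R by auto
    qed
    moreover have "S (y - R) = S x" if "y - R <= x"
    proof (rule S_const[OF that])
      show "~ (y - R <= y' & y' <= x)" if "y' \<in> Y" for y' using other[OF that] x R by auto
    qed
    ultimately show "S x = l y" unfolding l_def by (metis linorder_linear) }
  { assume x: "y < x" "x <= y + 4 * R"
    have "S x = S (y + R)" if "x <= y + R"
    proof (rule S_const[OF that])
      show "~ (x <= y' & y' <= y + R)" if "y' \<in> Y" for y' using other[OF that] x R by auto
    qed
    moreover have "S (y + R) = S x" if "y + R <= x"
    proof (rule S_const[OF that])
      show "~ (y + R <= y' & y' <= x)" if "y' \<in> Y" for y' using other[OF that] x R by auto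
    qed
    ultimately show "S x = rr y" unfolding rr_def by (metis linorder_linear) }
qed

lemma l_rr_int: "y \<in> Y ==> l y / eps \<in> \<int>" "y \<in> Y ==> rr y / eps \<in> \<int>"
  unfolding l_def rr_def using side_values(3)[of y] R by (auto intro!: S_int)

text \<open>Initially the same two bounds hold near every point of the enlarged window, by
  \<open>singular\<close> at \<open>y\<close> and by \<open>regular\<close> elsewhere. Being
  multiples of \<open>eps\<close>, they persist for the plateau time.\<close>

lemma window_bounds:
  assumes y: "y \<in> Y" and x: "abs (x - y) <= 3 * R" and t: "t0 < t" "t < t0 + c0 * R^2"
  shows "v (t, x) <= max (l y) (rr y)" "min (l y) (rr y) <= w (t, x)"
proof -
  have near: "EX h>0. ALL t u. t0 < t --> t < t0 + h --> abs (u - x') < h -->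
      v (t, u) <= max (l y) (rr y) & min (l y) (rr y) <= w (t, u)"
    if "abs (x' - x) <= R" for x'
  proof -
    have x': "abs (x' - y) <= 4 * R" using that x by linarith
    show ?thesis
    proof (cases "x' = y")
      case True
      obtain h where h: "0 < h" "!!t x x1 x2. t0 < t ==> t < t0 + h ==> abs (x - y) < h ==>
          y - h < x1 ==> x1 < y ==> y < x2 ==> x2 < y + h ==>
          v (t, x) <= max (S x1) (S x2) & min (S x1) (S x2) <= w (t, x)"
        using singular[OF y] by blast
      define q where "q = min h R / 2"
      have q: "0 < q" "q < h" "q < R" using h R by (auto simp: q_def min_def)
      have "S (y - q) = l y" "S (y + q) = rr y" using q R by (auto intro!: side_values[OF y])
      then show ?thesis using h(1) h(2)[of _ _ "y - q" "y + q"] q True by (intro exI[of _ h]) auto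
    next
      case False
      then have "x' \<notin> Y" using side_values(3)[OF y x'] by simp
      then obtain h where h: "0 < h" "!!u t. abs (u - x') < h ==> t0 < t ==> t < t0 + h ==> v (t, u) <= S x' & S x' <= w (t, u)"
        using regular[of x'] by blast
      have "S x' = l y | S x' = rr y"
        using side_values(1,2)[OF y, of x'] x' False by (cases "x' < y") (auto simp: abs_le_iff)
      then have m: "S x' <= max (l y) (rr y)" "min (l y) (rr y) <= S x'" by auto
      show ?thesis
      proof (intro exI[of _ h] conjI allI impI)
        fix t u assume a: "t0 < t" "t < t0 + h" "abs (u - x') < h"
        show "v (t, u) <= max (l y) (rr y)" "min (l y) (rr y) <= w (t, u)"
          using h(2)[OF a(3,1,2)] m by linarith+
      qed (rule h)
    qed
  qed
  show "v (t, x) <= max (l y) (rr y)"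
  proof (rule v_plateau[OF _ t0 R _ t])
    show "max (l y) (rr y) / eps \<in> \<int>" using l_rr_int[OF y] by (simp add: max_def)
    fix x' assume "abs (x' - x) <= R"
    from near[OF this] show "EX h>0. ALL t u. t0 < t --> t < t0 + h --> abs (u - x') < h --> v (t, u) <= max (l y) (rr y)" by blast
  qed
  show "min (l y) (rr y) <= w (t, x)"
  proof (rule w_plateau[OF _ t0 R _ t])
    show "min (l y) (rr y) / eps \<in> \<int>" using l_rr_int[OF y] by (simp add: min_def)
    fix x' assume "abs (x' - x) <= R"
    from near[OF this] show "EX h>0. ALL t u. t0 < t --> t < t0 + h --> abs (u - x') < h --> min (l y) (rr y) <= w (t, u)" by blast
  qed
qed

lemma window_sides:
  assumes y: "y \<in> Y" and x: "abs (x - y) <= 3 * R" and rho: "0 < rho" "rho <= R" and t: "t0 < t" "t < t0 + c0 * rho^2"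
  shows "x < y - rho ==> v (t, x) = l y & w (t, x) = l y" "y + rho < x ==> v (t, x) = rr y & w (t, x) = rr y"
proof -
  have far: "rho < abs (x - y')" if "y' \<in> Y" "rho < abs (x - y)" for y'
    using sep[OF y that(1)] that x rho R by (cases "y' = y") (auto simp: abs_if split: if_splits)
  show "v (t, x) = l y & w (t, x) = l y" if "x < y - rho"
    using far_from_Y[OF rho(1) far t] side_values(1)[OF y, of x] that x rho R by (auto simp: abs_le_iff)
  show "v (t, x) = rr y & w (t, x) = rr y" if "y + rho < x"
    using far_from_Y[OF rho(1) far t] side_values(2)[OF y, of x] that x rho R by (auto simp: abs_le_iff)
qed

lemma sg_cases: "sg y = 1 | sg y = - 1" "sg y * sg y = 1" "abs (sg y) = 1"
  by (auto simp: sg_def)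

text \<open>At an increasing jump, a point left of the transition zone has the smallest value of the
  window and one right of it the largest, so one argument outside the zone on its good side
  suffices; a decreasing jump is the mirror image.\<close>

lemma window_order:
  assumes y: "y \<in> Y" and x: "abs (x - y) <= 3 * R" "abs (x' - y) <= 3 * R" and rho: "0 < rho" "rho <= R"
    and t: "t0 < t" "t < t0 + c0 * rho^2" "t0 < s" "s < t0 + c0 * rho^2"
    and "(sg y = 1 & (x < y - rho | y + rho < x')) | (sg y = - 1 & (y + rho < x | x' < y - rho))"
  shows "v (t, x) <= w (s, x')"
proof -
  have "c0 * rho^2 <= c0 * R^2" using c0_pos rho by (intro mult_left_mono power_mono) auto
  then have tR: "t < t0 + c0 * R^2" "s < t0 + c0 * R^2" using t by linarith+
  note b = window_bounds[OF y x(1) t(1) tR(1)] window_bounds[OF y x(2) t(3) tR(2)]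
  note sx = window_sides[OF y x(1) rho t(1,2)] and sx' = window_sides[OF y x(2) rho t(3,4)]
  show ?thesis
  proof (cases "sg y = 1")
    case True
    then have "l y <= rr y" by (auto simp: sg_def split: if_splits)
    then show ?thesis using assms(10) True b sx sx' by auto
  next
    case False
    then have "rr y <= l y" by (auto simp: sg_def split: if_splits)
    then show ?thesis using assms(10) False b sx sx' by auto
  qed
qed

text \<open>At the maximal gap \<open>m\<close> the integrand is the gap at the pair shifted by
  \<open>z\<close>, minus \<open>m\<close>, plus \<open>eps\<close>. Pairs with unchanged
  penalization have gap at most \<open>m\<close>, hence at most \<open>m - eps\<close> off a
  countable set. In windows with the sign of \<open>y0\<close> these are exactly the pairs of the
  integrand. In the others the displacement is reversed and a shift of \<open>w\<close> by
  \<open>2 * d\<close> remains, whose integral is linear in \<open>d\<close>. Away from all windows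
  both functions equal \<open>S\<close> and \<open>eps <= m\<close> suffices.\<close>

lemma gap_integral:
  assumes t: "t0 < t" "t < t0 + c0 * (R / 2)^2" "t0 < s" "s < t0 + c0 * (R / 2)^2"
    and y0: "y0 \<in> Y" "abs (x - y0) < R" "abs (x' - y0) < R" and d: "d = x' - x" "abs d <= R / 2"
    and m: "m = v (t, x) - w (s, x')" "eps <= m" and kD: "0 < k" "0 < D" and r: "0 < r" "r <= R"
    and mx: "!!y z z'. y \<in> Y ==> abs (z - y) <= 2 * R ==> abs (z' - y) <= 2 * R ==>
      v (t, z) - w (s, z') - k * (max 0 (D + sg y0 * d - sg y * (z' - z))) ^ 4 <= m - k * D ^ 4"
  shows "kint r (%z. jump eps v t x z + jump eps (%q. - w q) s x' z) <= real (card Y) * (24 * A / R^2) * abs d"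
proof -
  have tp: "0 < t" "0 < s" using t t0 by auto
  define Delta where "Delta z = jump eps v t x z + jump eps (%q. - w q) s x' z" for z
  \<comment> \<open>On multiples of \<open>eps\<close> the staircase is affine, so the two jumps add
    up without loss.\<close>
  have Delta: "Delta z = v (t, x + z) - w (s, x' + z) - m + eps" for z
  proof -
    have "(v (t, x + z) - v (t, x)) / eps \<in> \<int>" "(- w (s, x' + z) - - w (s, x')) / eps \<in> \<int>"
      using v_int[OF tp(1)] neg_w(2)[OF tp(2)] by (auto simp: diff_divide_distrib simp del: minus_diff_eq intro!: Ints_diff)
    then show ?thesis unfolding Delta_def jump_def using E_upper_int[OF eps] m by simp
  qed
  \<comment> \<open>The remainder in windows of the opposite sign: the admissible pairing is
    displaced by \<open>- d\<close>, the integrand by \<open>d\<close>.\<close>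
  define H where "H y z = (if sg y ~= sg y0 & y - 3 / 2 * R <= x + z & x + z <= y + 3 / 2 * R
    then w (s, x + z - d) - w (s, x + z + d) else 0)" for y z
  have wm [measurable]: "(%u. w (s, u)) \<in> borel_measurable borel"
    using usc_on_slice_measurable[OF jsub_usc[OF w_super] tp(2)] by simp
  have Hm: "H y \<in> borel_measurable borel" for y
    unfolding H_def[abs_def] by measurable
  have Hb: "abs (H y z) <= 2 * A" for y z
    using w_bound[OF tp(2), of "x + z - d"] w_bound[OF tp(2), of "x + z + d"] A0
    by (auto simp: H_def abs_if split: if_splits)
  have mono4: "a ^ 4 < b ^ 4" if "0 <= a" "a < b" for a b :: real using that by (intro power_strict_mono) auto
  have sgs: "sg y * (sg y * sg y0 * d) = sg y0 * d" for y
    using sg_cases(2)[of y] by (simp add: mult.assoc[symmetric])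
  \<comment> \<open>This displacement makes the argument of the penalization in window
    \<open>y\<close> equal to \<open>D\<close>, its value at the maximum, so the penalties
    cancel.\<close>
  have pair: "v (t, u) - w (s, u + sg y * sg y0 * d) <= m"
    if "y \<in> Y" "abs (u - y) <= 3 / 2 * R" for u y
  proof -
    have "abs (sg y * sg y0 * d) <= R / 2" using d by (simp add: abs_mult sg_cases)
    then have "abs (u - y) <= 2 * R" "abs (u + sg y * sg y0 * d - y) <= 2 * R" using that(2) R by linarith+
    from mx[OF that(1) this]
    have "v (t, u) - w (s, u + sg y * sg y0 * d) - k * (max 0 (D + sg y0 * d - sg y * (u + sg y * sg y0 * d - u))) ^ 4 <= m - k * D ^ 4" .
    then show ?thesis using sgs[of y] kD by simp
  qed
  define E where "E y = {z. abs (x + z - y) <= 3 / 2 * R & v (t, x + z) - w (s, x + z + sg y * sg y0 * d) = m}" for y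
  \<comment> \<open>On \<open>E y\<close> the function \<open>v (t, x + z)\<close> is injective. If
    two points shared the value of \<open>v\<close>, their partners would share the value of
    \<open>w\<close>, and exchanging partners would keep the gap \<open>m\<close> while lowering one
    penalty. Since \<open>v\<close> takes countably many values, \<open>E y\<close> is countable and
    hence null.\<close>
  have E_count: "countable (E y)" if y: "y \<in> Y" for y
  proof -
    have d2: "abs (sg y * sg y0 * d) <= R / 2" using d by (simp add: abs_mult sg_cases)
    have aux: False if z: "z1 \<in> E y" "z2 \<in> E y" "z1 < z2" and eq: "v (t, x + z1) = v (t, x + z2)" for z1 z2
    proof -
      have w_eq: "w (s, x + z1 + sg y * sg y0 * d) = w (s, x + z2 + sg y * sg y0 * d)"
        using z eq by (simp add: E_def)
      have no: False if "a \<in> {x + z1, x + z2}" "b \<in> {x + z1 + sg y * sg y0 * d, x + z2 + sg y * sg y0 * d}"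
        "D + sg y0 * d - sg y * (b - a) < D" for a b
      proof -
        have "abs (x + z1 - y) <= 3 / 2 * R" "abs (x + z2 - y) <= 3 / 2 * R" using z(1,2) by (auto simp: E_def)
        then have "abs (x + z1 - y) <= 2 * R" "abs (x + z2 - y) <= 2 * R"
          "abs (x + z1 + sg y * sg y0 * d - y) <= 2 * R" "abs (x + z2 + sg y * sg y0 * d - y) <= 2 * R"
          using d2 R by linarith+
        then have "abs (a - y) <= 2 * R" "abs (b - y) <= 2 * R" using that(1,2) by blast+
        then have le: "v (t, a) - w (s, b) - k * (max 0 (D + sg y0 * d - sg y * (b - a))) ^ 4 <= m - k * D ^ 4"
          by (rule mx[OF y])
        have "v (t, a) - w (s, b) = m" using that(1,2) z eq w_eq by (auto simp: E_def)
        then have "D ^ 4 <= (max 0 (D + sg y0 * d - sg y * (b - a))) ^ 4" using le kD by simp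
        moreover have "(max 0 (D + sg y0 * d - sg y * (b - a))) ^ 4 < D ^ 4"
          using that(3) kD by (intro mono4) auto
        ultimately show False by simp
      qed
      have e: "sg y * (x + z2 + sg y * sg y0 * d - (x + z1)) = sg y * (z2 - z1) + sg y0 * d"
        "sg y * (x + z1 + sg y * sg y0 * d - (x + z2)) = - (sg y * (z2 - z1)) + sg y0 * d"
        using sgs[of y] by (simp_all add: algebra_simps)
      show False
        using no[of "x + z1" "x + z2 + sg y * sg y0 * d"] no[of "x + z2" "x + z1 + sg y * sg y0 * d"] e sg_cases(1)[of y] z(3)
        by auto
    qed
    have "inj_on (%z. v (t, x + z)) (E y)"
      using aux by (intro inj_onI) (metis linorder_neq_iff)
    moreover have "(%z. v (t, x + z)) ` E y \<subseteq> (%i::int. eps * of_int i) ` UNIV"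
    proof
      fix a assume "a \<in> (%z. v (t, x + z)) ` E y"
      then obtain z where "a = v (t, x + z)" by auto
      then obtain i where "a / eps = of_int i" using v_int[OF tp(1), of "x + z"] by (auto elim: Ints_cases)
      then have "a = eps * of_int i" using eps by (simp add: field_simps)
      then show "a \<in> (%i::int. eps * of_int i) ` UNIV" by auto
    qed
    ultimately show ?thesis
      by (meson countable_image countable_subset countableI_type countable_image_inj_on)
  qed
  have "countable (\<Union>y\<in>Y. E y)" using E_count finY by (intro countable_UN) (auto intro: countable_finite)
  then have ae: "AE z in lborel. z \<notin> (\<Union>y\<in>Y. E y)" by (intro AE_not_in countable_imp_null_set_lborel)
  have point: "Delta z <= (\<Sum>y\<in>Y. H y z)" if z: "z \<notin> (\<Union>y\<in>Y. E y)" for z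
  proof (cases "\<exists>y\<in>Y. abs (x + z - y) <= 3 / 2 * R")
    case True
    then obtain y where y: "y \<in> Y" "abs (x + z - y) <= 3 / 2 * R" by blast
    have "H y' z = 0" if "y' \<in> Y" "y' ~= y" for y'
      using sep[OF y(1) that(1)] that(2) y(2) R by (auto simp: H_def abs_if split: if_splits)
    then have sum: "(\<Sum>y\<in>Y. H y z) = H y z"
      by (subst sum.remove[OF finY y(1)]) (auto intro!: sum.neutral)
    have "v (t, x + z) - w (s, x + z + sg y * sg y0 * d) ~= m" using z y by (auto simp: E_def)
    with pair[OF y] have "v (t, x + z) - w (s, x + z + sg y * sg y0 * d) < m" by simp
    moreover have "(v (t, x + z) - w (s, x + z + sg y * sg y0 * d)) / eps \<in> \<int>" "(m - eps) / eps \<in> \<int>"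
      unfolding m using v_int[OF tp(1)] w_int[OF tp(2)] eps by (auto simp: diff_divide_distrib intro!: Ints_diff)
    ultimately have lt: "v (t, x + z) - w (s, x + z + sg y * sg y0 * d) <= m - eps"
      by (intro int_multiple_le[OF eps]) auto
    have x'z: "x' + z = x + z + d" by (simp add: d)
    show ?thesis
    proof (cases "sg y = sg y0")
      case True
      then have e: "sg y * sg y0 * d = d" using sg_cases(2)[of y0] by simp
      have "H y z = 0" using True by (simp add: H_def)
      then show ?thesis using lt[unfolded e] sum by (simp add: Delta x'z)
    next
      case False
      then have "sg y * sg y0 = - 1" using sg_cases(1)[of y] sg_cases(1)[of y0] by auto
      then have e: "sg y * sg y0 * d = - d" by simp
      have "H y z = w (s, x + z - d) - w (s, x + z + d)" using False y by (auto simp: H_def abs_if split: if_splits)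
      then show ?thesis using lt[unfolded e] sum by (simp add: Delta x'z)
    qed
  next
    case False
    then have far: "3 / 2 * R < abs (x + z - y)" if "y \<in> Y" for y using that by force
    have f1: "R / 2 < abs (x + z - y)" "R / 2 < abs (x' + z - y)" if "y \<in> Y" for y
      using far[OF that] d R by (auto simp: abs_if split: if_splits)
    have "v (t, x + z) = S (x + z)" by (rule far_from_Y(1)[OF _ f1(1) t(1,2)]) (use R in auto)
    moreover have "w (s, x' + z) = S (x' + z)" by (rule far_from_Y(2)[OF _ f1(2) t(3,4)]) (use R in auto)
    moreover have "S (x + z) = S (x' + z)"
    proof (cases "x <= x'")
      case True
      show ?thesis
      proof (rule S_const)
        show "~ (x + z <= y & y <= x' + z)" if "y \<in> Y" for y using far[OF that] d True R by (auto simp: abs_if split: if_splits)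
      qed (use True in simp)
    next
      case False
      have "S (x' + z) = S (x + z)"
      proof (rule S_const)
        show "~ (x' + z <= y & y <= x + z)" if "y \<in> Y" for y using far[OF that] d False R by (auto simp: abs_if split: if_splits)
      qed (use False in simp)
      then show ?thesis by simp
    qed
    ultimately have "Delta z <= 0" using m(2) by (simp add: Delta)
    moreover have "(\<Sum>y\<in>Y. H y z) = 0"
    proof (rule sum.neutral, rule ballI)
      fix y assume "y \<in> Y"
      from far[OF this] show "H y z = 0" by (auto simp: H_def abs_if split: if_splits)
    qed
    ultimately show ?thesis by simp
  qed
  have kH: "kint r (H y) <= 24 * A / R^2 * abs d" if y: "y \<in> Y" for y
  proof (cases "sg y = sg y0")
    case True
    then have "kint r (H y) = kint r (%_. 0)" by (intro kint_cong) (simp add: H_def)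
    also have "\<dots> = 0" using kint_const[OF r(1), of 0] by simp
    finally show ?thesis using A0 by simp
  next
    case False
    then have "y ~= y0" by auto
    then have yy: "8 * R <= abs (y - y0)" using sep[OF y y0(1)] by simp
    define wt where "wt u = w (s, u)" for u
    have "kint r (H y) = kint r (%z. if y - 3/2*R <= x + z & x + z <= y + 3/2*R then wt (x + z - d) - wt (x + z + d) else 0)"
      using False by (intro kint_cong) (simp add: H_def wt_def)
    also have "\<dots> <= A * (abs d * (4 / R ^ 3 * (y + 3/2*R - (y - 3/2*R) + 2 * abs d) + 4 / R^2))"
    proof (rule shift_error[OF _ _ R r])
      show "wt \<in> borel_measurable borel" using wm by (simp add: wt_def[abs_def])
      show "abs (wt u) <= A" for u using w_bound[OF tp(2)] by (simp add: wt_def)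
      show "R <= abs (u - x)" if "y - 3/2*R <= u" "u <= y + 3/2*R" for u
        using that yy y0(2) R by (auto simp: abs_if split: if_splits)
    qed (use R in simp)
    \<comment> \<open>\<open>3 * R + 2 * abs d <= 4 * R\<close> yields \<open>16 / R^2\<close>, the
      ends yield \<open>4 / R^2\<close>; the constant \<open>24\<close> of the statement has some
      slack.\<close>
    also have "\<dots> <= A * (abs d * (20 / R^2))"
    proof (intro mult_left_mono)
      have "4 / R ^ 3 * (y + 3/2*R - (y - 3/2*R) + 2 * abs d) <= 4 / R ^ 3 * (4 * R)"
        using d R by (intro mult_left_mono) auto
      also have "\<dots> = 16 / R^2" using R by (simp add: power2_eq_square power3_eq_cube)
      finally show "4 / R ^ 3 * (y + 3/2*R - (y - 3/2*R) + 2 * abs d) + 4 / R^2 <= 20 / R^2" by (simp add: add_divide_distrib[symmetric])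
    qed (use A0 in auto)
    also have "\<dots> <= 24 * A / R^2 * abs d"
      using A0 R by (simp add: divide_right_mono mult_right_mono)
    finally show ?thesis .
  qed
  have "kint r Delta <= kint r (%z. \<Sum>y\<in>Y. H y z)"
  proof (rule kint_mono_AE[OF r(1)])
    show "Delta \<in> borel_measurable borel"
      unfolding Delta_def[abs_def] using jump_measurable[OF jsub_usc[OF v_sub] tp(1)] jump_measurable[OF jsub_usc[OF w_super] tp(2)]
      by measurable
    show "abs (Delta z) <= 2 * A + eps / 2 + (2 * A + eps / 2)" for z
    proof -
      have "abs (jump eps v t x z) <= 2 * A + eps / 2" by (rule jump_bound) (use eps v_bound tp in auto)
      moreover have "abs (jump eps (%q. - w q) s x' z) <= 2 * A + eps / 2" by (rule jump_bound) (use eps neg_w(1) tp in auto)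
      ultimately show ?thesis unfolding Delta_def by linarith
    qed
    show "(%z. \<Sum>y\<in>Y. H y z) \<in> borel_measurable borel" using Hm by measurable
    show "abs (\<Sum>y\<in>Y. H y z) <= (\<Sum>y\<in>Y. 2 * A)" for z
      using Hb by (intro order_trans[OF sum_abs] sum_mono)
    show "AE z in lborel. r <= abs z --> Delta z <= (\<Sum>y\<in>Y. H y z)"
      using ae by eventually_elim (use point in blast)
  qed
  also have "\<dots> = (\<Sum>y\<in>Y. kint r (H y))"
    using finY
  proof (induction rule: finite_induct)
    case empty
    then show ?case using kint_const[OF r(1), of 0] by simp
  next
    case (insert y F)
    have "kint r (%z. H y z + (\<Sum>y\<in>F. H y z)) = kint r (H y) + kint r (%z. \<Sum>y\<in>F. H y z)"
    proof (rule kint_add[OF r(1) Hm Hb])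
      show "(%z. \<Sum>y\<in>F. H y z) \<in> borel_measurable borel" using Hm by measurable
      show "abs (\<Sum>y\<in>F. H y z) <= (\<Sum>y\<in>F. 2 * A)" for z
        using Hb by (intro order_trans[OF sum_abs] sum_mono)
    qed
    then show ?case using insert by simp
  qed
  also have "\<dots> <= (\<Sum>y\<in>Y. 24 * A / R^2 * abs d)" by (intro sum_mono kH)
  finally show ?thesis unfolding Delta_def by (simp add: mult.assoc)
qed

end

section \<open>The doubling argument\<close>

lemma pos_part_fourth_le:
  fixes D u :: real
  assumes "abs u <= 1"
  shows "(max 0 (D + u)) ^ 4 <= (max 0 D) ^ 4 + 4 * (max 0 D) ^ 3 * u + (6 * D^2 + 4 * abs D + 1) * u^2"
    and "D <= 0 ==> (max 0 (D + u)) ^ 4 <= u ^ 4"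
proof -
  show *: "(max 0 (D + u)) ^ 4 <= u ^ 4" if "D <= 0"
  proof -
    have "max 0 (D + u) <= abs u" using that by simp
    then have "(max 0 (D + u)) ^ 4 <= abs u ^ 4" by (intro power_mono) auto
    then show ?thesis by simp
  qed
  show "(max 0 (D + u)) ^ 4 <= (max 0 D) ^ 4 + 4 * (max 0 D) ^ 3 * u + (6 * D^2 + 4 * abs D + 1) * u^2"
  proof (cases "0 <= D")
    case True
    have "(max 0 (D + u)) ^ 4 <= (D + u) ^ 4" by (cases "0 <= D + u") (auto simp: max_def)
    also have "\<dots> <= D ^ 4 + 4 * D ^ 3 * u + (6 * D^2 + 4 * abs D + 1) * u^2" by (rule fourth_power_le[OF assms])
    finally show ?thesis using True by (simp add: max_absorb2)
  next
    case False
    have "abs u ^ 4 <= abs u^2" using assms by (intro power_decreasing) auto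
    then have "u ^ 4 <= 1 * u^2" by simp
    also have "\<dots> <= (6 * D^2 + 4 * abs D + 1) * u^2" by (intro mult_right_mono) auto
    finally show ?thesis using False * by (simp add: max_absorb1)
  qed
qed

lemma finite_argmax:
  fixes f :: "'a => real"
  assumes "finite X" "X ~= {}"
  obtains y where "y \<in> X" "!!x. x \<in> X ==> f x <= f y"
proof -
  have "Max (f ` X) \<in> f ` X" using assms by (intro Max_in) auto
  then obtain y where "y \<in> X" "f y = Max (f ` X)" by auto
  then show thesis using assms by (intro that[of y]) auto
qed

lemma square_less_cancel:
  fixes k a q :: real
  assumes "0 < k" "0 <= q" "k * a^2 < k * q^2"
  shows "abs a < q"
proof -
  have "abs a^2 < q^2" using assms by simp
  then show ?thesis using assms(2) by (rule power_less_imp_less_base)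
qed

context steps
begin

text \<open>Doubling of variables with the penalization \<open>k * (max 0 (delta t - sg y * (x' - x))) ^ 4\<close>. It vanishes
  for well-ordered arguments, so no information on the (possibly fattened) initial jump is needed, and the
  threshold \<open>delta\<close> grows fast enough to absorb the error of \<open>gap_integral\<close>, which is linear in it.\<close>

lemma window_ordered:
  "EX h>0. \<forall>y\<in>Y. ALL t x x'. t0 < t --> t < t0 + h --> abs (x - y) <= 2 * R --> abs (x' - y) <= 2 * R -->
     0 < sg y * (x' - x) --> v (t, x) <= w (t, x')"
proof -
  \<comment> \<open>\<open>K' * abs d\<close> is the error of \<open>gap_integral\<close>, and
    \<open>abs d <= 2 * delta0\<close> at the contact. The growth rate \<open>K * delta0\<close> of
    the threshold exceeds the resulting \<open>2 * K' * delta0\<close> by \<open>delta0\<close>. The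
    bound \<open>h <= 1 / K\<close> keeps the threshold below \<open>2 * delta0\<close>.\<close>
  define K' K h where "K' = real (card Y) * (24 * A / R^2)" and "K = 2 * K' + 1" and "h = min (c0 * (R / 2)^2) (1 / K)"
  have K': "0 <= K'" using A0 by (simp add: K'_def)
  have K: "0 < K" using K' by (simp add: K_def)
  have h: "0 < h" "h <= c0 * (R / 2)^2" "h <= 1 / K" using c0_pos R K by (auto simp: h_def)
  have Kh: "K * h <= 1" using h(3) K by (simp add: pos_le_divide_eq mult.commute)
  show ?thesis
  proof (intro exI[of _ h] conjI ballI allI impI, rule h(1), rule ccontr)
    fix y1 t1 x1 x1'
    assume y1: "y1 \<in> Y" and t1: "t0 < t1" "t1 < t0 + h" and x1: "abs (x1 - y1) <= 2 * R" "abs (x1' - y1) <= 2 * R"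
      and g1: "0 < sg y1 * (x1' - x1)" and viol: "~ v (t1, x1) <= w (t1, x1')"
    define delta0 where "delta0 = min (sg y1 * (x1' - x1) / 2) (R / 4)"
    have delta0: "0 < delta0" "2 * delta0 <= sg y1 * (x1' - x1)" "delta0 <= R / 4" using g1 R by (auto simp: delta0_def)
    define delta where "delta t = delta0 * (1 + K * (t - t0))" for t
    have delta: "delta0 <= delta t" "delta t <= 2 * delta0" if "t0 <= t" "t <= t0 + h" for t
    proof -
      have "K * (t - t0) <= K * h" using that K by (intro mult_left_mono) auto
      moreover have "0 <= K * (t - t0)" using that K by simp
      ultimately have "0 <= K * (t - t0)" "K * (t - t0) <= 1" using Kh by linarith+
      then show "delta0 <= delta t" "delta t <= 2 * delta0" using delta0(1) mult_left_mono[of "1 + K * (t - t0)" 2 delta0] mult_left_mono[of 1 "1 + K * (t - t0)" delta0]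
        unfolding delta_def by linarith+
    qed
    \<comment> \<open>Arguments separated by \<open>delta0 / 2 = 4 * rho\<close> in the right
      direction cannot both lie on the bad side of the \<open>rho\<close>-zone around the jump. So
      \<open>window_order\<close> settles the times up to \<open>t0 + h0\<close>.\<close>
    define rho h0 where "rho = delta0 / 8" and "h0 = c0 * rho^2"
    have rho: "0 < rho" "rho <= R" using delta0 R by (auto simp: rho_def)
    have h0: "0 < h0" using c0_pos rho by (simp add: h0_def)
    have early: "v (t, x) <= w (s, x')"
      if "y \<in> Y" "t0 < t" "t < t0 + h0" "t0 < s" "s < t0 + h0" "abs (x - y) <= 2 * R" "abs (x' - y) <= 2 * R"
        "delta0 / 2 <= sg y * (x' - x)" for y t s x x'
    proof (rule window_order[OF that(1) _ _ rho that(2) _ that(4)])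
      show "(sg y = 1 & (x < y - rho | y + rho < x')) | (sg y = - 1 & (y + rho < x | x' < y - rho))"
        using sg_cases(1)[of y] that(8) delta0(1) unfolding rho_def by auto
    qed (use that R in \<open>auto simp: h0_def\<close>)
    have late1: "t0 + h0 <= t1"
    proof (rule ccontr)
      assume "~ t0 + h0 <= t1"
      then have "v (t1, x1) <= w (t1, x1')" using y1 t1 x1 delta0 by (intro early[of y1]) auto
      then show False using viol by simp
    qed
    \<comment> \<open>\<open>Bp\<close> keeps the time of the maximum below
      \<open>t1 + omega\<close>, away from the end \<open>t2\<close> of the time interval.\<close>
    define omega t2 Bp where "omega = (t0 + h - t1) / 4" and "t2 = t1 + 2 * omega" and "Bp = (2 * A + 1) / omega^2"
    have omega: "0 < omega" "t2 < t0 + h" using t1 by (auto simp: omega_def t2_def field_simps)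
    have Bp: "0 < Bp" "Bp * omega^2 = 2 * A + 1" using omega A0 by (auto simp: Bp_def)
    \<comment> \<open>\<open>mu\<close> provides strictness. Up to \<open>t1\<close> it costs less
      than \<open>eps\<close>, whereas a violation between multiples of \<open>eps\<close> is worth
      at least \<open>eps\<close>.\<close>
    define mu where "mu = eps / (2 * h)"
    have mu: "0 < mu" "mu * (t1 - t0) < eps"
    proof -
      show l: "0 < mu" using eps h by (simp add: mu_def)
      have "mu * (t1 - t0) <= mu * h" using t1 l by (intro mult_left_mono) auto
      also have "\<dots> < eps" using h eps by (simp add: mu_def)
      finally show "mu * (t1 - t0) < eps" .
    qed
    define q where "q = min (h0 / 4) omega"
    have q: "0 < q" "q <= h0 / 4" "q <= omega" using h0 omega by (auto simp: q_def)
    \<comment> \<open>The gap never exceeds \<open>2 * A\<close>, so this \<open>k\<close> forces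
      \<open>abs (t - s) < q\<close> and \<open>D < delta0 / 4\<close> wherever the doubled
      functional is positive.\<close>
    define k where "k = (2 * A + 1) / q^2 + (2 * A + 1) / (delta0 / 4) ^ 4"
    have k: "0 < k" "2 * A + 1 <= k * q^2" "2 * A + 1 <= k * (delta0 / 4) ^ 4"
    proof -
      have a: "0 < (2 * A + 1) / q^2" "0 < (2 * A + 1) / (delta0 / 4) ^ 4" using A0 q delta0 by auto
      then show "0 < k" unfolding k_def by linarith
      have "(2 * A + 1) / q^2 * q^2 <= k * q^2" unfolding k_def using a by (intro mult_right_mono) auto
      then show "2 * A + 1 <= k * q^2" using q by simp
      have "(2 * A + 1) / (delta0 / 4) ^ 4 * (delta0 / 4) ^ 4 <= k * (delta0 / 4) ^ 4"
        unfolding k_def using a by (intro mult_right_mono) auto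
      then show "2 * A + 1 <= k * (delta0 / 4) ^ 4" using delta0 by simp
    qed
    define ta where "ta = t0 + h0 / 2"
    have ta: "t0 < ta" "0 < ta" "ta <= t1" "t1 <= t2" using h0 t0 late1 omega by (auto simp: ta_def t2_def)
    define Phi where "Phi y = (%((t, x), (s, x')). k * (max 0 (delta t - sg y * (x' - x))) ^ 4 + k * (t - s)^2
      + mu * (t - t0) + Bp * (max 0 (t - t1))^2)" for y
    have Phi: "Phi y ((t, x), (s, x')) = k * (max 0 (delta t - sg y * (x' - x))) ^ 4 + k * (t - s)^2
      + mu * (t - t0) + Bp * (max 0 (t - t1))^2" for y t x s x' by (simp add: Phi_def)
    have Phic: "continuous_on UNIV (Phi y)" for y
      unfolding Phi_def delta_def case_prod_beta by (intro continuous_intros)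
    define Theta where "Theta y t x s x' = v (t, x) - w (s, x') - Phi y ((t, x), (s, x'))" for y t x s x'
    define box where "box y t x s x' \<longleftrightarrow> ta <= t & t <= t2 & ta <= s & s <= t2 & abs (x - y) <= 2 * R & abs (x' - y) <= 2 * R"
      for y t x s x' :: real
    have "EX t x s x'. box y t x s x' & (ALL t' z s' z'. box y t' z s' z' --> Theta y t' z s' z' <= Theta y t x s x')" for y
    proof -
      obtain t x s x' where a: "t \<in> {ta..t2}" "x \<in> {y - 2 * R..y + 2 * R}" "s \<in> {ta..t2}" "x' \<in> {y - 2 * R..y + 2 * R}"
        and b: "!!t' z s' z'. t' \<in> {ta..t2} ==> z \<in> {y - 2 * R..y + 2 * R} ==> s' \<in> {ta..t2} ==> z' \<in> {y - 2 * R..y + 2 * R} ==>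
          v (t', z) + - w (s', z') - Phi y ((t', z), (s', z')) <= v (t, x) + - w (s, x') - Phi y ((t, x), (s, x'))"
        by (rule usc_pair_attains[OF jsub_usc[OF v_sub] jsub_usc[OF w_super] ta(2) _ _ Phic,
              of t2 "y - 2 * R" "y + 2 * R" y]) (use ta R in auto)
      show ?thesis
        using a b by (intro exI[of _ t] exI[of _ x] exI[of _ s] exI[of _ x']) (auto simp: box_def Theta_def abs_le_iff)
    qed
    then obtain T X S' X' where mxy: "!!y. box y (T y) (X y) (S' y) (X' y)"
      "!!y t' z s' z'. box y t' z s' z' ==> Theta y t' z s' z' <= Theta y (T y) (X y) (S' y) (X' y)" by metis
    \<comment> \<open>The maximum is taken over all windows at once, because the nonlocal terms at
      the contact see the pairs in every window.\<close>
    obtain y where y: "y \<in> Y" and ymax: "!!y'. y' \<in> Y ==> Theta y' (T y') (X y') (S' y') (X' y') <= Theta y (T y) (X y) (S' y) (X' y)"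
      using finite_argmax[OF finY, of "%y. Theta y (T y) (X y) (S' y) (X' y)"] y1 by auto
    define t x s x' where "t = T y" and "x = X y" and "s = S' y" and "x' = X' y"
    have bx: "box y t x s x'" using mxy(1) by (simp add: t_def x_def s_def x'_def)
    have mx: "Theta y' t' z s' z' <= Theta y t x s x'" if "y' \<in> Y" "box y' t' z s' z'" for y' t' z s' z'
      using mxy(2)[OF that(2)] ymax[OF that(1)] by (simp add: t_def x_def s_def x'_def)
    define D d m where "D = delta t - sg y * (x' - x)" and "d = x' - x" and "m = v (t, x) - w (s, x')"
    have tp: "0 < t" "0 < s" using bx ta by (auto simp: box_def)
    have pos: "0 < Theta y t x s x'"
    proof -
      have "box y1 t1 x1 t1 x1'" using ta x1 omega by (auto simp: box_def t2_def)
      from mx[OF y1 this] have "Theta y1 t1 x1 t1 x1' <= Theta y t x s x'" .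
      moreover have "delta t1 <= sg y1 * (x1' - x1)" using delta(2)[of t1] t1 delta0(2) by simp
      then have "Theta y1 t1 x1 t1 x1' = v (t1, x1) - w (t1, x1') - mu * (t1 - t0)" by (simp add: Theta_def Phi)
      moreover have "w (t1, x1') + eps <= v (t1, x1)"
      proof (rule ccontr)
        assume "~ ?thesis"
        then have "v (t1, x1) <= w (t1, x1')"
          using t0 t1 by (intro int_multiple_le[OF eps v_int w_int]) auto
        then show False using viol by simp
      qed
      ultimately show ?thesis using mu by simp
    qed
    have nn: "0 <= k * (max 0 D) ^ 4" "0 <= k * (t - s)^2" "0 <= mu * (t - t0)" "0 <= Bp * (max 0 (t - t1))^2"
      using k mu Bp bx ta by (auto simp: box_def)
    have sum: "k * (max 0 D) ^ 4 + k * (t - s)^2 + mu * (t - t0) + Bp * (max 0 (t - t1))^2 < m"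
      using pos by (simp add: Theta_def Phi D_def m_def)
    have m2A: "m <= 2 * A" using v_bound[OF tp(1), of x] w_bound[OF tp(2), of x'] by (simp add: m_def)
    have "0 < m" using sum nn by linarith
    have m_eps: "eps <= m"
    proof (rule ccontr)
      assume "~ ?thesis"
      then have "v (t, x) <= w (s, x')"
        using tp by (intro int_multiple_le[OF eps v_int w_int]) (auto simp: m_def)
      then show False using \<open>0 < m\<close> by (simp add: m_def)
    qed
    have "k * (t - s)^2 < k * q^2" using sum nn m2A k(2) by linarith
    then have ts: "abs (t - s) < q" using k(1) q(1) by (intro square_less_cancel[of k]) auto
    have "k * (max 0 D) ^ 4 < k * (delta0 / 4) ^ 4" using sum nn m2A k(3) by linarith
    then have "(max 0 D) ^ 4 < (delta0 / 4) ^ 4" using k(1) by simp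
    then have D: "D < delta0 / 4" using delta0(1) power_less_imp_less_base[of "max 0 D" 4 "delta0 / 4"] by simp
    have "Bp * (max 0 (t - t1))^2 < Bp * omega^2" using sum nn m2A Bp(2) by linarith
    then have "abs (max 0 (t - t1)) < omega" using Bp(1) omega(1) by (intro square_less_cancel[of Bp]) auto
    then have t_up: "t < t1 + omega" by simp
    have th: "t0 <= t" "t <= t0 + h" "t0 < s" "s < t0 + h" using bx ta omega by (auto simp: box_def)
    have gap: "delta0 / 2 <= sg y * (x' - x)" using delta(1)[OF th(1,2)] D delta0 unfolding D_def by linarith
    have t_low: "t0 + 3 / 4 * h0 <= t"
    proof (rule ccontr)
      assume "~ ?thesis"
      then have "t < t0 + h0" "s < t0 + h0" using ts q h0 by linarith+
      then have "v (t, x) <= w (s, x')"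
        using bx ta gap y by (intro early[of y]) (auto simp: box_def)
      then show False using \<open>0 < m\<close> by (simp add: m_def)
    qed
    have inner: "ta < t" "t < t2" "ta < s" "s < t2"
      using t_low t_up ts q h0 omega unfolding ta_def t2_def by linarith+
    have tR: "t0 < t" "t < t0 + c0 * (R / 2)^2" "t0 < s" "s < t0 + c0 * (R / 2)^2"
      using inner ta omega h(2) by linarith+
    \<comment> \<open>A contact with an argument beyond \<open>R / 2\<close> on its good side would
      be ordered by \<open>window_order\<close>. Hence the contact is well inside the window and
      there is room for local tests.\<close>
    have "~ ((sg y = 1 & (x < y - R/2 | y + R/2 < x')) | (sg y = - 1 & (y + R/2 < x | x' < y - R/2)))"
    proof
      assume "(sg y = 1 & (x < y - R/2 | y + R/2 < x')) | (sg y = - 1 & (y + R/2 < x | x' < y - R/2))"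
      then have "v (t, x) <= w (s, x')"
        using bx R tR by (intro window_order[OF y _ _ _ _ tR]) (auto simp: box_def)
      then show False using \<open>0 < m\<close> by (simp add: m_def)
    qed
    then have xin: "abs (x - y) < R" "abs (x' - y) < R"
      using sg_cases(1)[of y] gap delta0(1) R by (auto simp: abs_if)
    define eta where "eta = Min {t - ta, t2 - t, s - ta, t2 - s, R, 1 / (2 * (K * delta0 + 1))}"
    have Kdelta: "0 < K * delta0" using K delta0 by simp
    have eta: "0 < eta" using inner R Kdelta by (simp add: eta_def)
    have etale: "eta <= t - ta" "eta <= t2 - t" "eta <= s - ta" "eta <= t2 - s" "eta <= R" "eta <= 1 / (2 * (K * delta0 + 1))"
      unfolding eta_def by (rule Min_le; simp)+
    have etaK: "eta * (K * delta0 + 1) <= 1" "eta <= 1"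
    proof -
      have "eta * (2 * (K * delta0 + 1)) <= 1" using etale(6) Kdelta by (simp add: pos_le_divide_eq)
      then show 1: "eta * (K * delta0 + 1) <= 1" using eta Kdelta by (simp add: algebra_simps)
      have "eta * 1 <= eta * (K * delta0 + 1)" using eta Kdelta by (intro mult_left_mono) auto
      then show "eta <= 1" using 1 by simp
    qed
    define u where "u a b = K * delta0 * a + sg y * b" for a b :: real
    have u1: "abs (u a b) <= 1" if "abs a < eta" "abs b < eta" for a b
    proof -
      have "abs (u a b) <= K * delta0 * abs a + abs b" unfolding u_def using Kdelta abs_triangle_ineq[of "K * delta0 * a" "sg y * b"]
        K delta0(1) by (simp add: abs_mult sg_cases)
      also have "\<dots> <= K * delta0 * eta + eta" using that Kdelta by (intro add_mono mult_left_mono) auto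
      finally show ?thesis using etaK(1) by (simp add: algebra_simps)
    qed
    have v_near: "v (t', z) <= v (t, x) + k * ((max 0 (D + u (t' - t) (z - x))) ^ 4 - (max 0 D) ^ 4)
        + (2 * k * (t - s) + mu + 2 * Bp * max 0 (t - t1)) * (t' - t) + (k + Bp) * (t' - t)^2"
      if "abs (t' - t) < eta" "abs (z - x) < eta" for t' z
    proof -
      have "abs (z - y) <= 2 * R" using that(2) xin(1) etale(5) by linarith
      moreover have "ta <= t'" "t' <= t2" using that(1) etale by linarith+
      ultimately have "box y t' z s x'" using bx by (auto simp: box_def)
      from mx[OF y this] have "v (t', z) <= v (t, x) + Phi y ((t', z), (s, x')) - Phi y ((t, x), (s, x'))"
        by (simp add: Theta_def)
      moreover have "delta t' - sg y * (x' - z) = D + u (t' - t) (z - x)"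
        by (simp add: delta_def D_def u_def algebra_simps)
      moreover have "Bp * (max 0 (t' - t1))^2 <= Bp * ((max 0 (t - t1))^2 + 2 * max 0 (t - t1) * (t' - t) + (t' - t)^2)"
        using pos_part_square_le[of "t' - t1" "t - t1"] Bp(1) by (intro mult_left_mono) auto
      moreover have "k * (t' - s)^2 = k * (t - s)^2 + 2 * k * (t - s) * (t' - t) + k * (t' - t)^2"
        by (simp add: power2_eq_square algebra_simps)
      ultimately show ?thesis unfolding Phi D_def[symmetric] by (simp add: algebra_simps)
    qed
    have w_near: "- w (s', z) <= - w (s, x') + k * ((max 0 (D + u 0 (- (z - x')))) ^ 4 - (max 0 D) ^ 4)
        + (- 2 * k * (t - s)) * (s' - s) + k * (s' - s)^2"
      if "abs (s' - s) < eta" "abs (z - x') < eta" for s' z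
    proof -
      have "abs (z - y) <= 2 * R" using that(2) xin(2) etale(5) by linarith
      moreover have "ta <= s'" "s' <= t2" using that(1) etale by linarith+
      ultimately have "box y t x s' z" using bx by (auto simp: box_def)
      from mx[OF y this] have "- w (s', z) <= - w (s, x') + Phi y ((t, x), (s', z)) - Phi y ((t, x), (s, x'))"
        by (simp add: Theta_def)
      moreover have "delta t - sg y * (z - x) = D + u 0 (- (z - x'))"
        by (simp add: D_def u_def algebra_simps)
      moreover have "k * (t - s')^2 = k * (t - s)^2 - 2 * k * (t - s) * (s' - s) + k * (s' - s)^2"
        by (simp add: power2_eq_square algebra_simps)
      ultimately show ?thesis unfolding Phi D_def[symmetric] by (simp add: algebra_simps)
    qed
    have Bpos: "0 <= 2 * Bp * max 0 (t - t1)" using Bp by simp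
    show False
    \<comment> \<open>For \<open>D <= 0\<close> the penalization vanishes to fourth order in space,
      so both functions have flat tests; their time slopes are nonpositive yet sum to at least
      \<open>mu\<close>. For \<open>D > 0\<close> the two gradients are opposite, and the nonlocal
      terms can be added with the common factor \<open>P\<close>.\<close>
    proof (cases "D <= 0")
      case True
      then have D0: "max 0 D = 0" by simp
      define C4 where "C4 = 8 * k * ((K * delta0) ^ 4 + 1) + k + Bp"
      have "touch4 v t x (2 * k * (t - s) + mu + 2 * Bp * max 0 (t - t1)) C4 eta"
        unfolding touch4_def
      proof (intro allI impI)
        fix t' z assume h: "abs (t' - t) < eta" "abs (z - x) < eta"
        define a b where "a = t' - t" and "b = z - x"
        have ab: "abs a < eta" "abs b < eta" using h by (auto simp: a_def b_def)
        have "(max 0 (D + u a b)) ^ 4 <= (u a b) ^ 4" by (rule pos_part_fourth_le(2)[OF u1[OF ab] True])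
        also have "\<dots> <= 8 * ((K * delta0 * a) ^ 4 + (sg y * b) ^ 4)"
        proof -
          have sq: "(p + q)^2 <= 2 * (p^2 + q^2)" for p q :: real
            using sum_squares_ge_zero[of "p - q" 0] by (simp add: power2_eq_square algebra_simps)
          have "((p + q)^2)^2 <= (2 * (p^2 + q^2))^2" for p q :: real using sq[of p q] by (intro power_mono) auto
          also have "(2 * (p^2 + q^2))^2 <= 8 * ((p^2)^2 + (q^2)^2)" for p q :: real
            using sq[of "p^2" "q^2"] unfolding power_mult_distrib[of 2 "p^2 + q^2"] by simp
          finally show ?thesis unfolding u_def by (simp add: power_mult[symmetric])
        qed
        also have "\<dots> <= 8 * ((K * delta0) ^ 4 + 1) * (a^2 + b ^ 4)"
        proof -
          have "abs a ^ 4 <= abs a^2" using ab etaK by (intro power_decreasing) auto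
          define Z where "Z = (K * delta0) ^ 4"
          have Z: "0 <= Z" by (simp add: Z_def)
          have "Z * a ^ 4 <= Z * a^2" using \<open>abs a ^ 4 <= abs a^2\<close> Z by (intro mult_left_mono) auto
          moreover have "0 <= Z * b ^ 4" "0 <= a^2" using Z by auto
          moreover have e1: "(K * delta0 * a) ^ 4 = Z * a ^ 4" by (simp only: Z_def power_mult_distrib)
          moreover have e2: "(sg y * b) ^ 4 = b ^ 4" using sg_cases(1)[of y] by auto
          ultimately show ?thesis unfolding e1 e2 Z_def[symmetric] distrib_left distrib_right by linarith
        qed
        finally have "k * (max 0 (D + u a b)) ^ 4 <= k * (8 * ((K * delta0) ^ 4 + 1) * (a^2 + b ^ 4))"
          using k(1) by (intro mult_left_mono) auto
        moreover have "0 <= (k + Bp) * b ^ 4" using k Bp by simp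
        ultimately show "v (t', z) <= v (t, x) + (2 * k * (t - s) + mu + 2 * Bp * max 0 (t - t1)) * (t' - t) + C4 * ((t' - t)^2 + (z - x) ^ 4)"
          using v_near[OF h] D0 unfolding C4_def a_def[symmetric] b_def[symmetric] by (simp add: algebra_simps)
      qed
      from jsub_flat[OF v_sub tp(1) eta this] have 1: "2 * k * (t - s) + mu <= 0" using Bpos by linarith
      have "touch4 (%q. - w q) s x' (- 2 * k * (t - s)) k eta"
        unfolding touch4_def
      proof (intro allI impI)
        fix s' z assume h: "abs (s' - s) < eta" "abs (z - x') < eta"
        have "(max 0 (D + u 0 (- (z - x')))) ^ 4 <= (u 0 (- (z - x'))) ^ 4"
          using h eta by (intro pos_part_fourth_le(2)[OF u1 True]) auto
        also have "\<dots> = (z - x') ^ 4" using sg_cases(1)[of y] by (auto simp: u_def power4_eq_xxxx algebra_simps)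
        finally have "k * (max 0 (D + u 0 (- (z - x')))) ^ 4 <= k * (z - x') ^ 4" using k(1) by (intro mult_left_mono) auto
        then show "- w (s', z) <= - w (s, x') + - 2 * k * (t - s) * (s' - s) + k * ((s' - s)^2 + (z - x') ^ 4)"
          using w_near[OF h] D0 by (simp add: algebra_simps)
      qed
      from jsub_flat[OF w_super tp(2) eta this] show False using 1 mu(1) by linarith
    next
      case False
      then have Dp: "0 < D" and D0: "max 0 D = D" by auto
      define C P where "C = 6 * D^2 + 4 * abs D + 1" and "P = 4 * k * D ^ 3"
      have C: "0 < C" and P: "0 < P" using Dp k by (auto simp: C_def P_def intro!: add_nonneg_pos)
      have tv: "touch v t x (P * (K * delta0) + (2 * k * (t - s) + mu + 2 * Bp * max 0 (t - t1))) (P * sg y) (k * C * (2 * (K * delta0)^2 + 2) + k + Bp) eta"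
        unfolding touch_def
      proof (intro allI impI)
        fix t' z assume h: "abs (t' - t) < eta" "abs (z - x) < eta"
        define a b where "a = t' - t" and "b = z - x"
        have ab: "abs a < eta" "abs b < eta" using h by (auto simp: a_def b_def)
        have "(max 0 (D + u a b)) ^ 4 - D ^ 4 <= 4 * D ^ 3 * u a b + C * (u a b)^2"
          using pos_part_fourth_le(1)[OF u1[OF ab], of D] unfolding D0 C_def by simp
        also have "C * (u a b)^2 <= C * ((2 * (K * delta0)^2 + 2) * (a^2 + b^2))"
        proof (intro mult_left_mono)
          have sq: "(p + q)^2 <= 2 * (p^2 + q^2)" for p q :: real
            using sum_squares_ge_zero[of "p - q" 0] by (simp add: power2_eq_square algebra_simps)
          have "(sg y * b)^2 = b^2" using sg_cases(1)[of y] by auto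
          then have "(u a b)^2 <= 2 * ((K * delta0)^2 * a^2 + b^2)"
            using sq[of "K * delta0 * a" "sg y * b"] unfolding u_def by (simp only: power_mult_distrib[of "K * delta0" a])
          moreover have "0 <= (K * delta0)^2 * b^2" "0 <= a^2" by auto
          ultimately show "(u a b)^2 <= (2 * (K * delta0)^2 + 2) * (a^2 + b^2)" unfolding distrib_left distrib_right by linarith
        qed (use C in simp)
        finally have "k * ((max 0 (D + u a b)) ^ 4 - D ^ 4) <= k * (4 * D ^ 3 * u a b + C * ((2 * (K * delta0)^2 + 2) * (a^2 + b^2)))"
          using k(1) by (intro mult_left_mono) auto
        moreover have "k * (4 * D ^ 3 * u a b) = P * (K * delta0) * a + P * sg y * b" by (simp add: P_def u_def algebra_simps)
        moreover have "0 <= (k + Bp) * b^2" using k Bp by simp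
        ultimately show "v (t', z) <= v (t, x) + (P * (K * delta0) + (2 * k * (t - s) + mu + 2 * Bp * max 0 (t - t1))) * (t' - t) + P * sg y * (z - x) + (k * C * (2 * (K * delta0)^2 + 2) + k + Bp) * ((t' - t)^2 + (z - x)^2)"
          using v_near[OF h] D0 unfolding a_def[symmetric] b_def[symmetric] by (simp add: algebra_simps)
      qed
      have tw: "touch (%q. - w q) s x' (- 2 * k * (t - s)) (- P * sg y) (k * C + k) eta"
        unfolding touch_def
      proof (intro allI impI)
        fix s' z assume h: "abs (s' - s) < eta" "abs (z - x') < eta"
        have "(max 0 (D + u 0 (- (z - x')))) ^ 4 - D ^ 4 <= 4 * D ^ 3 * u 0 (- (z - x')) + C * (u 0 (- (z - x')))^2"
        proof -
          have "abs 0 < eta" "abs (- (z - x')) < eta" using h(2) eta by linarith+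
          from pos_part_fourth_le(1)[OF u1[OF this], of D] show ?thesis unfolding D0 C_def by simp
        qed
        moreover have "(u 0 (- (z - x')))^2 = (z - x')^2" using sg_cases(1)[of y] by (auto simp: u_def power2_eq_square algebra_simps)
        ultimately have "k * ((max 0 (D + u 0 (- (z - x')))) ^ 4 - D ^ 4) <= k * (4 * D ^ 3 * u 0 (- (z - x')) + C * (z - x')^2)"
          using k(1) by (intro mult_left_mono) auto
        moreover have "k * (4 * D ^ 3 * u 0 (- (z - x'))) = - P * sg y * (z - x')" by (simp add: P_def u_def algebra_simps)
        moreover have "0 <= k * (z - x')^2" "0 <= k * C * (s' - s)^2" using k C by simp_all
        ultimately show "- w (s', z) <= - w (s, x') + - 2 * k * (t - s) * (s' - s) + - P * sg y * (z - x') + (k * C + k) * ((s' - s)^2 + (z - x')^2)"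
          using w_near[OF h] D0 by (simp add: algebra_simps)
      qed
      have Psg: "P * sg y ~= 0" "- P * sg y ~= 0" "abs (P * sg y) = P" "abs (- P * sg y) = P"
        using P sg_cases(1)[of y] by auto
      obtain r1 where r1: "0 < r1" "!!r. 0 < r ==> r < r1 ==>
          P * (K * delta0) + (2 * k * (t - s) + mu + 2 * Bp * max 0 (t - t1)) <= P * kint r (jump eps v t x)"
        using jsub_strong_ex[OF v_sub eps tp(1) tv Psg(1) eta] unfolding Psg(3) by blast
      obtain r2 where r2: "0 < r2" "!!r. 0 < r ==> r < r2 ==>
          - 2 * k * (t - s) <= P * kint r (jump eps (%q. - w q) s x')"
        using jsub_strong_ex[OF w_super eps tp(2) tw Psg(2) eta] unfolding Psg(4) by blast
      define r where "r = Min {r1, r2, R} / 2"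
      have "Min {r1, r2, R} <= r1" "Min {r1, r2, R} <= r2" "Min {r1, r2, R} <= R" "0 < Min {r1, r2, R}"
        using r1 r2 R by auto
      then have r: "0 < r" "r < r1" "r < r2" "r <= R" unfolding r_def by linarith+
      have sgd: "sg y * d = delta t - D" by (simp add: D_def d_def)
      have "abs d = abs (sg y * d)" by (simp add: abs_mult sg_cases)
      then have dle: "abs d <= 2 * delta0" using gap delta(2)[OF th(1,2)] Dp delta0(1) sgd d_def by simp
      have "kint r (%z. jump eps v t x z + jump eps (%q. - w q) s x' z) <= real (card Y) * (24 * A / R^2) * abs d"
      proof (rule gap_integral[OF tR y xin d_def _ m_def m_eps k(1) Dp r(1,4)])
        show "abs d <= R / 2" using dle delta0(3) by simp
        fix y' z z' assume a: "y' \<in> Y" "abs (z - y') <= 2 * R" "abs (z' - y') <= 2 * R"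
        then have "box y' t z s z'" using bx by (simp add: box_def)
        from mx[OF a(1) this]
        show "v (t, z) - w (s, z') - k * max 0 (D + sg y * d - sg y' * (z' - z)) ^ 4 <= m - k * D ^ 4"
          unfolding Theta_def Phi D_def[symmetric] D0 sgd m_def by simp
      qed
      also have "\<dots> <= K' * (2 * delta0)" unfolding K'_def[symmetric] using dle K' by (intro mult_left_mono) auto
      finally have kle: "kint r (jump eps v t x) + kint r (jump eps (%q. - w q) s x') <= K' * (2 * delta0)"
      proof (subst (asm) kint_add[OF r(1)])
        show "jump eps v t x \<in> borel_measurable borel" by (rule jump_measurable[OF jsub_usc[OF v_sub] tp(1)])
        show "jump eps (%q. - w q) s x' \<in> borel_measurable borel" by (rule jump_measurable[OF jsub_usc[OF w_super] tp(2)])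
        show "abs (jump eps v t x z) <= 2 * A + eps / 2" for z by (rule jump_bound) (use eps v_bound tp in auto)
        show "abs (jump eps (%q. - w q) s x' z) <= 2 * A + eps / 2" for z by (rule jump_bound) (use eps neg_w(1) tp in auto)
      qed auto
      \<comment> \<open>The growing threshold contributes \<open>P * K * delta0\<close> to the time
        slopes. The same factor \<open>P\<close> stands in front of the integrals, so the comparison
        of \<open>K\<close> with \<open>2 * K'\<close> does not depend on the size of the
        gradient.\<close>
      have "P * (K * delta0) + mu <= P * (kint r (jump eps v t x) + kint r (jump eps (%q. - w q) s x'))"
        using r1(2)[OF r(1,2)] r2(2)[OF r(1,3)] Bpos by (simp add: distrib_left)
      also have "\<dots> <= P * (K' * (2 * delta0))" using kle P by (intro mult_left_mono) auto
      finally have "P * delta0 + mu <= 0" by (simp add: K_def algebra_simps)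
      moreover have "0 < P * delta0" using P delta0 by simp
      ultimately show False using mu(1) by linarith
    qed
  qed
qed

end

section \<open>Disappearance of spikes\<close>

text \<open>Integrality turns upper semicontinuity into a local upper bound without loss.\<close>

lemma int_usc:
  assumes "usc_on Q u" "0 < eps" "!!t x. 0 < t ==> u (t, x) / eps \<in> \<int>" "a / eps \<in> \<int>" "0 < t" "u (t, x) <= a"
  obtains h where "0 < h" "!!s y. 0 < s ==> abs (s - t) < h ==> abs (y - x) < h ==> u (s, y) <= a"
proof -
  have "u (t, x) < a + eps" using assms by simp
  then obtain h where "0 < h" "!!s y. 0 < s ==> abs (s - t) < h ==> abs (y - x) < h ==> u (s, y) < a + eps"
    using usc_onD[OF assms(1,5)] by metis
  then show ?thesis using that int_multiple_le[OF assms(2) assms(3) assms(4)] by blast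
qed

text \<open>The edge of a set \<open>{u >= b}\<close> that is confined to a short interval moves inwards with a speed
  of order \<open>eps\<close> divided by the length of the interval, so a single point disappears at once.\<close>

lemma bump_step:
  assumes u: "jsub eps u" and eps: "0 < eps" and A: "!!t x. 0 < t ==> abs (u (t, x)) <= A"
    and int: "!!t x. 0 < t ==> u (t, x) / eps \<in> \<int>"
    and tau: "0 < tau" and a: "a / eps \<in> \<int>" and k: "b = a + eps" and h: "0 < h"
    and start: "!!x. x ~= y ==> abs (x - y) < h ==> u (tau, x) <= a"
    and le: "!!t x. tau < t ==> t < tau + h ==> abs (x - y) < h ==> u (t, x) <= b"
  shows "EX h>0. ALL t x. tau < t --> t < tau + h --> abs (x - y) < h --> u (t, x) <= a"
proof -
  have A0: "0 <= A" using A[of 1 0] by (meson abs_ge_zero order_trans zero_less_one)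
  define c0 where "c0 = plateau_time eps A"
  have c0: "0 < c0" unfolding c0_def plateau_time_def using plateau_speed_pos[OF eps A0] eps by simp
  have uu: "usc_on Q u" by (rule jsub_usc[OF u])
  define H where "H = h / 8"
  \<comment> \<open>\<open>rho\<close> is small against \<open>H\<close> so that the inward pull of
    order \<open>eps / rho\<close> at the edge of the set outweighs the effect of distances beyond
    \<open>2 * H\<close>, which is at most \<open>(2 * A + eps) / H\<close>.\<close>
  define rho where "rho = min (H / 2) (eps * H / (16 * (4 * A + 2 * eps)))"
  have H: "0 < H" using h by (simp add: H_def)
  have den: "0 < 16 * (4 * A + 2 * eps)" using A0 eps by simp
  have rho: "0 < rho" "rho <= H / 2"
    using H eps den unfolding rho_def by (intro min_less_iff_conj[THEN iffD2] conjI divide_pos_pos mult_pos_pos; simp) (rule min.cobounded1)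
  have "rho <= eps * H / (16 * (4 * A + 2 * eps))" by (simp add: rho_def)
  then have rho2: "16 * (4 * A + 2 * eps) * rho <= eps * H" using den by (simp add: pos_le_divide_eq mult.commute)
  have far: "u (t, x) <= a" if "rho < abs (x - y)" "abs (x - y) <= 4 * H" "tau < t" "t < tau + c0 * (rho / 2)^2" for t x
  proof (rule int_plateau[OF u eps A int a _ _ _ that(3) that(4)[unfolded c0_def]])
    show "0 <= tau" "0 < rho / 2" using tau rho by auto
    fix z assume z: "abs (z - x) <= rho / 2"
    have "z ~= y" using z that(1) rho(1) by (intro notI, hypsubst) linarith
    moreover have "abs (z - y) < h" using z that(2) rho H unfolding H_def by linarith
    ultimately have "u (tau, z) <= a" by (rule start)
    from int_usc[OF uu eps int a tau this] obtain d where
      d: "0 < d" "!!s y. 0 < s ==> abs (s - tau) < d ==> abs (y - z) < d ==> u (s, y) <= a" by blast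
    show "EX h>0. ALL t y. tau < t --> t < tau + h --> abs (y - z) < h --> u (t, y) <= a"
      using d tau by (intro exI[of _ d]) auto
  qed auto
  define g where "g = min (min (c0 * (rho / 2)^2) h) rho"
  have g: "0 < g" "g <= c0 * (rho / 2)^2" "g <= h" "g <= rho" using c0 rho h by (auto simp: g_def)
  define c where "c = eps / (8 * rho)"
  have c: "0 < c" using eps rho by (simp add: c_def)
  have main: "u (ts, xs) <= a" if ts: "tau < ts" "ts < tau + g" and xs: "abs (xs - y) < g" for ts xs
  proof (rule ccontr)
    assume "~ u (ts, xs) <= a"
    moreover have b: "b / eps \<in> \<int>" using a k eps by (simp add: add_divide_distrib)
    ultimately have uts: "b <= u (ts, xs)" using int_multiple_le[OF eps int a, of ts xs] ts tau k by (auto simp: not_less[symmetric])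
    define s where "s = (tau + g - ts) / 2"
    have s: "0 < s" "ts + s < tau + g" using ts by (auto simp: s_def field_simps)
    define B where "B = (rho + c * (ts + s - tau)) / s^2 + 1"
    have nn: "0 <= rho + c * (ts + s - tau)" using rho c ts s by (intro add_nonneg_nonneg mult_nonneg_nonneg) auto
    have B: "0 < B" unfolding B_def using nn by (intro add_nonneg_pos divide_nonneg_nonneg) auto
    have Bs: "rho + c * (ts + s - tau) < B * s^2" unfolding B_def using s by (simp add: field_simps)
    \<comment> \<open>Maximizing the distance to \<open>y\<close> plus \<open>c\<close> times the
      elapsed time over \<open>{u >= b}\<close> follows the outermost edge of the set; a positive
      maximum says that the edge has not retreated at speed \<open>c\<close>. At time
      \<open>tau\<close> only \<open>y\<close> can belong to the set, where \<open>F = 0\<close>.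
      The last term keeps the maximum off the final time.\<close>
    define F where "F t x = abs (x - y) + c * (t - tau) - B * (max 0 (t - ts))^2" for t x
    define K where "K = {q. tau <= fst q & fst q <= ts + s & abs (snd q - y) <= rho & b <= u q}"
    have "\<exists>q\<in>K. \<forall>q'\<in>K. (%q. F (fst q) (snd q)) q' <= (%q. F (fst q) (snd q)) q"
    proof (rule continuous_attains_sup)
      show "K ~= {}" using uts xs ts s g unfolding K_def by (intro notI, elim equals0D[of _ "(ts, xs)", THEN notE]) simp
      have "closed K"
      proof -
        have "EX T. open T & q \<in> T & T \<inter> K = {}" if "q \<notin> K" for q
        proof -
          obtain t x where q: "q = (t, x)" by (cases q)
          show ?thesis
          proof (cases "tau <= t & t <= ts + s & abs (x - y) <= rho")
            case True
            then have "u (t, x) < b" "0 < t" using that tau by (auto simp: K_def q not_le)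
            then obtain d where d: "0 < d" "!!s y. 0 < s ==> abs (s - t) < d ==> abs (y - x) < d ==> u (s, y) < b"
              using usc_onD[OF uu] by metis
            have "{t - d<..<t + d} \<times> {x - d<..<x + d} \<inter> K = {}"
            proof (rule equals0I)
              fix q' assume a: "q' \<in> {t - d<..<t + d} \<times> {x - d<..<x + d} \<inter> K"
              obtain t' x' where q': "q' = (t', x')" by (cases q')
              have "0 < t'" "abs (t' - t) < d" "abs (x' - x) < d" "b <= u (t', x')"
                using a tau unfolding q' K_def by auto
              with d(2)[of t' x'] show False by simp
            qed
            moreover have "open ({t - d<..<t + d} \<times> {x - d<..<x + d})" by (intro open_Times) auto
            ultimately show ?thesis using d(1) q by (intro exI[of _ "{t - d<..<t + d} \<times> {x - d<..<x + d}"]) auto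
          next
            case False
            let ?C = "{tau..ts + s} \<times> {y - rho..y + rho}"
            have "open (- ?C)" by (intro open_Compl closed_Times) auto
            moreover have "q \<in> - ?C" using False q by (auto simp: abs_le_iff)
            moreover have "- ?C \<inter> K = {}" by (auto simp: K_def abs_le_iff)
            ultimately show ?thesis by blast
          qed
        qed
        then have "open (- K)" by (subst open_subopen) (auto simp: disjoint_eq_subset_Compl)
        then show ?thesis by (simp add: open_closed)
      qed
      moreover have "K \<subseteq> {tau..ts + s} \<times> {y - rho..y + rho}" by (auto simp: K_def abs_le_iff)
      ultimately show "compact K"
        using compact_Int_closed[OF compact_Times[OF compact_Icc compact_Icc], of K tau "ts + s" "y - rho" "y + rho"]
        by (simp add: Int_absorb1)
      show "continuous_on K (%q. F (fst q) (snd q))" unfolding F_def by (intro continuous_intros)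
    qed
    then obtain q where "q \<in> K" "\<forall>q'\<in>K. F (fst q') (snd q') <= F (fst q) (snd q)" by auto
    then obtain t x where tx: "(t, x) \<in> K" and mx: "!!t' x'. (t', x') \<in> K ==> F t' x' <= F t x"
      by (cases q) (auto simp: Ball_def)
    have t0: "tau <= t" "t <= ts + s" "abs (x - y) <= rho" "b <= u (t, x)" using tx by (auto simp: K_def)
    have "(ts, xs) \<in> K" using uts xs ts s g by (auto simp: K_def)
    from mx[OF this] have "F ts xs <= F t x" .
    moreover have "0 < c * (ts - tau)" using c ts by simp
    ultimately have Fpos: "0 < F t x" by (simp add: F_def)
    have t1: "tau < t"
    proof (rule ccontr)
      assume "~ tau < t"
      then have "t = tau" using t0 by simp
      moreover have "x = y"
      proof (rule ccontr)
        assume "x ~= y"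
        moreover have "abs (x - y) < h" using t0(3) rho(2) h unfolding H_def by linarith
        ultimately have "u (tau, x) <= a" by (rule start)
        then show False using t0(4) \<open>t = tau\<close> k eps by simp
      qed
      ultimately show False using Fpos ts by (simp add: F_def)
    qed
    have t2: "t < ts + s"
    proof (rule ccontr)
      assume "~ t < ts + s"
      then have "t = ts + s" using t0 by simp
      then have "F t x <= rho + c * (ts + s - tau) - B * s^2" using t0(3) s by (simp add: F_def)
      then show False using Fpos Bs by linarith
    qed
    have tp: "0 < t" "t < tau + g" using t1 tau t2 s by auto
    have uxb: "u (t, x) = b"
    proof -
      have "u (t, x) <= b" by (rule le) (use t1 tp g t0(3) rho(2) h in \<open>auto simp: H_def\<close>)
      then show ?thesis using t0(4) by simp
    qed
    define sig :: real where "sig = (if y <= x then 1 else - 1)"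
    have sig: "abs (x - y) = sig * (x - y)" "!!z. sig * (z - y) <= abs (z - y)" "abs sig = 1" "sig = 1 | sig = -1"
      by (auto simp: sig_def)
    obtain eta where eta: "0 < eta" "eta <= t - tau" "eta <= ts + s - t" "eta <= rho"
      and Fc: "!!t' z. abs (t' - t) < eta ==> abs (z - x) < eta ==> F t' z - F t x <= eps"
    proof -
      have "isCont (%q. F (fst q) (snd q)) (t, x)" unfolding F_def by (intro continuous_intros)
      then obtain d where d: "0 < d" "!!q. dist q (t, x) < d ==> dist (F (fst q) (snd q)) (F t x) < eps"
        using eps unfolding continuous_at_eps_delta by (metis fst_conv snd_conv)
      define eta where "eta = Min {d / 2, t - tau, ts + s - t, rho}"
      have "F t' z - F t x <= eps" if "abs (t' - t) < eta" "abs (z - x) < eta" for t' z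
      proof -
        have "eta <= d / 2" unfolding eta_def by (rule Min_le) auto
        have "dist (t', z) (t, x) <= abs (t' - t) + abs (z - x)"
          unfolding dist_prod_def using sqrt_sum_squares_le_sum_abs[of "t' - t" "z - x"] by (simp add: dist_real_def)
        also have "\<dots> < d" using that \<open>eta <= d / 2\<close> by linarith
        finally show ?thesis using d(2)[of "(t', z)"] by (simp add: dist_real_def)
      qed
      moreover have "0 < eta" using d t1 t2 rho by (simp add: eta_def)
      moreover have "eta <= t - tau" "eta <= ts + s - t" "eta <= rho" by (auto simp: eta_def)
      ultimately show ?thesis using that by blast
    qed
    \<comment> \<open>Where \<open>F\<close> exceeds its maximum over \<open>K\<close> the point has
      left the set, and by integrality \<open>u\<close> is then lower by a full \<open>eps\<close>,
      which locally outweighs the increase of \<open>F\<close>. So \<open>b\<close> minus the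
      increment of \<open>F\<close> is a majorant.\<close>
    have touch: "touch u t x (- c + 2 * B * max 0 (t - ts)) (- sig) B eta"
      unfolding touch_def
    proof (intro allI impI)
      fix t' z assume h: "0 < t'" "abs (t' - t) < eta" "abs (z - x) < eta"
      have "u (t', z) <= b - (F t' z - F t x)"
      proof (cases "F t' z <= F t x")
        case True
        have "u (t', z) <= b"
          by (rule le) (use h eta t1 tp g t0(3) rho H in \<open>auto simp: H_def abs_le_iff abs_less_iff\<close>)
        then show ?thesis using True by simp
      next
        case False
        then have nK: "(t', z) \<notin> K" using mx by force
        have "u (t', z) <= a"
        proof (cases "abs (z - y) <= rho")
          case True
          then have "u (t', z) < b" using nK h eta by (auto simp: K_def)
          then show ?thesis using int_multiple_le[OF eps int[OF h(1)] a] k by simp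
        next
          case False
          show ?thesis by (rule far) (use False h eta t0(3) rho H g s in auto)
        qed
        then show ?thesis using Fc[OF h(2,3)] k by simp
      qed
      also have "- (F t' z - F t x) <= - c * (t' - t) + B * (2 * max 0 (t - ts) * (t' - t) + (t' - t)^2) - sig * (z - x)"
      proof -
        have "B * (max 0 (t' - ts))^2 <= B * ((max 0 (t - ts))^2 + 2 * max 0 (t - ts) * (t' - t) + (t' - t)^2)"
          using pos_part_square_le[of "t' - ts" "t - ts"] B by (intro mult_left_mono) auto
        moreover have "sig * (z - y) - sig * (x - y) = sig * (z - x)" by (simp add: algebra_simps)
        ultimately show ?thesis using sig(1) sig(2)[of z] unfolding F_def by (simp add: algebra_simps)
      qed
      then have "b - (F t' z - F t x) <= b + (- c * (t' - t) + B * (2 * max 0 (t - ts) * (t' - t) + (t' - t)^2) - sig * (z - x))" by simp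
      finally show "u (t', z) <= u (t, x) + (- c + 2 * B * max 0 (t - ts)) * (t' - t) + - sig * (z - x) + B * ((t' - t)^2 + (z - x)^2)"
        unfolding uxb using mult_nonneg_nonneg[OF less_imp_le[OF B] zero_le_power2[of "z - x"]]
        unfolding distrib_left distrib_right by (simp only: minus_mult_left[symmetric] mult.assoc mult.left_commute[of B 2])
    qed
    have jm: "jump eps u t x \<in> borel_measurable borel" by (rule jump_measurable[OF uu tp(1)])
    have jb: "abs (jump eps u t x z) <= 2 * A + eps / 2" for z by (rule jump_bound) (use eps A tp in auto)
    have low: "jump eps u t x z <= - eps / 2" if "abs (x - y) < abs (x + z - y)" "abs z <= 2 * H" for z
    proof -
      have "u (t, x + z) <= a"
      proof (cases "abs (x + z - y) <= rho")
        case True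
        have "F t x < F t (x + z)" using that by (simp add: F_def)
        then have "(t, x + z) \<notin> K" using mx by force
        then have "u (t, x + z) < b" using True t1 t2 by (auto simp: K_def)
        then show ?thesis using int_multiple_le[OF eps int[OF tp(1)] a] k by simp
      next
        case False
        show ?thesis by (rule far) (use False that t0(3) rho H g t1 tp in auto)
      qed
      then show ?thesis unfolding jump_def uxb by (intro E_upper_signs(2)[OF eps]) (use k eps in simp)
    qed
    have half: "jump eps u t x z <= eps / 2" if "abs z <= 2 * H" for z
    proof -
      have "u (t, x + z) <= b" by (rule le) (use t1 tp g t0(3) rho H that in \<open>auto simp: H_def\<close>)
      then show ?thesis unfolding jump_def uxb by (intro E_upper_signs(1)[OF eps]) (use eps in simp)
    qed
    obtain r0 where r0: "0 < r0" "!!r. 0 < r ==> r < r0 ==>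
        - c + 2 * B * max 0 (t - ts) <= abs (- sig) * kint r (jump eps u t x)"
    proof -
      have "- sig ~= 0" using sig(4) by auto
      from jsub_strong_ex[OF u eps tp(1) touch this eta(1)] that show ?thesis by blast
    qed
    define r where "r = min (r0 / 2) rho"
    have r: "0 < r" "r < r0" "r <= 3 * rho" using r0 rho by (auto simp: r_def)
    have "- c <= kint r (jump eps u t x)"
    proof -
      have "- c <= - c + 2 * B * max 0 (t - ts)" using B by simp
      also have "\<dots> <= kint r (jump eps u t x)" using r0(2)[OF r(1,2)] sig(3) by simp
      finally show ?thesis .
    qed
    \<comment> \<open>Moving outwards leaves the set and costs \<open>eps\<close>, moving inwards
      does not rise above \<open>b\<close>, so the radius may be enlarged. Beyond
      \<open>3 * rho\<close> both directions lead out of the set.\<close>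
    also have "\<dots> <= kint (3 * rho) (jump eps u t x)"
    proof (rule kint_sgn_le[where p = "- sig" and c = "eps / 2", OF r(1,3) jm jb])
      fix z assume z: "r <= abs z" "abs z < 3 * rho"
      show "jump eps u t x z <= eps / 2 * sgn (- sig * z)"
      proof (cases "0 < sig * z")
        case True
        have "sig * z = abs z" using True sig(4) by auto
        have "abs (x - y) < abs (x + z - y)" using sig(1) sig(2)[of "x + z"] True by (simp add: algebra_simps)
        from low[OF this] have "jump eps u t x z <= - eps / 2" using z rho H by simp
        moreover have "sgn (- sig * z) = - 1" using True by (intro sgn_neg) simp
        ultimately show ?thesis by simp
      next
        case False
        then have "sig * z < 0" using z(1) r(1) sig(4) by (cases "sig * z = 0") auto
        then have "sgn (- sig * z) = 1" by (intro sgn_pos) simp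
        then show ?thesis using half[of z] z rho H by simp
      qed
    qed
    also have "\<dots> <= kint (3 * rho) (%z. - eps / 2 + (if 2 * H <= abs z then 2 * A + eps else 0))"
    proof (rule kint_mono[OF _ jm jb])
      show "abs (- eps / 2 + (if 2 * H <= abs z then 2 * A + eps else 0)) <= 2 * A + 2 * eps" for z using A0 eps by auto
      fix z assume z: "3 * rho <= abs z"
      show "jump eps u t x z <= - eps / 2 + (if 2 * H <= abs z then 2 * A + eps else 0)"
      proof (cases "2 * H <= abs z")
        case True then show ?thesis using jb[of z] by simp
      next
        case False
        have "abs (x - y) < abs (x + z - y)" using z t0(3) rho(1) by linarith
        then show ?thesis using low[of z] False by simp
      qed
    qed (use rho in auto)
    also have "\<dots> = - eps / 2 * (2 / (3 * rho)) + (2 * A + eps) * (2 / (2 * H))"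
    proof -
      have "kint (3 * rho) (%z. if 2 * H <= abs z then 2 * A + eps else 0) = kint (2 * H) (%_. 2 * A + eps)"
        by (rule kint_restrict[symmetric]) (use rho H in simp)
      then show ?thesis
        by (subst kint_add[where B = eps and B' = "2 * A + eps"]) (use rho H A0 eps in \<open>auto simp: kint_const\<close>)
    qed
    \<comment> \<open>With \<open>eps / (3 * rho) = 8 / 3 * c\<close> and a far contribution of at
      most \<open>c\<close>, this reads \<open>- c <= - 5 / 3 * c\<close>.\<close>
    finally have "- c <= - (eps / (3 * rho)) + (2 * A + eps) / H" by simp
    moreover have "(2 * A + eps) / H <= eps / (8 * rho)"
    proof -
      have "0 <= eps * rho" "0 <= A * rho" using eps A0 rho by auto
      then have "(2 * A + eps) * (8 * rho) <= eps * H" using rho2 by (simp add: algebra_simps)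
      then show ?thesis using H rho by (simp add: divide_le_eq pos_le_divide_eq)
    qed
    moreover have "eps / (3 * rho) = 8 / 3 * c" by (simp add: c_def)
    ultimately show False using c c_def by linarith
  qed
  show ?thesis using g(1) main by blast
qed

text \<open>\<open>bump_step\<close> removes one level of height \<open>eps\<close>. Starting from a
  level above the bound \<open>A\<close>, a downward induction removes the whole spike, each level
  using that the next higher one is already gone.\<close>

lemma bump_kill:
  assumes u: "jsub eps u" and eps: "0 < eps" and A: "!!t x. 0 < t ==> abs (u (t, x)) <= A"
    and int: "!!t x. 0 < t ==> u (t, x) / eps \<in> \<int>"
    and tau: "0 < tau" and a: "a / eps \<in> \<int>" and h: "0 < h"
    and start: "!!x. x ~= y ==> abs (x - y) < h ==> u (tau, x) <= a"
  shows "EX h>0. ALL t x. tau < t --> t < tau + h --> abs (x - y) < h --> u (t, x) <= a"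
proof -
  obtain n :: nat where "(A - a) / eps <= real n" using real_arch_simple by blast
  then have n: "A <= a + n * eps" using eps by (simp add: field_simps)
  have P: "EX h>0. ALL t x. tau < t --> t < tau + h --> abs (x - y) < h --> u (t, x) <= a + k * eps" if "k <= n" for k
    using that
  proof (induction k rule: inc_induct)
    case base
    have "u (t, x) <= a + n * eps" if "tau < t" for t x using A[of t x] that tau n by simp
    then show ?case by (intro exI[of _ 1]) simp
  next
    case (step k)
    then obtain h' where h': "0 < h'" "!!t x. tau < t ==> t < tau + h' ==> abs (x - y) < h' ==> u (t, x) <= a + Suc k * eps"
      by blast
    show ?case
    proof (rule bump_step[OF u eps A int tau, where h = "min h h'"])
      show "(a + k * eps) / eps \<in> \<int>" using a eps by (simp add: add_divide_distrib)
      show "a + Suc k * eps = a + k * eps + eps" by (simp add: algebra_simps)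
      show "0 < min h h'" using h h' by simp
      show "u (tau, x) <= a + k * eps" if "x ~= y" "abs (x - y) < min h h'" for x
        using start[of x] that mult_nonneg_nonneg[of k eps] eps by linarith
      show "u (t, x) <= a + Suc k * eps" if "tau < t" "t < tau + min h h'" "abs (x - y) < min h h'" for t x
        using h'(2) that by simp
    qed auto
  qed
  show ?thesis using P[of 0] by simp
qed

section \<open>Absence of fattening\<close>

lemma separated_count:
  fixes T :: "real => real"
  assumes "finite F" "!!y y'. y \<in> F ==> y' \<in> F ==> y < y' ==> y + r <= y' - r" "0 < r"
    and T: "mono T" "!!x. 0 <= T x" "!!y. y \<in> F ==> 1 <= T (y + r) - T (y - r)"
  shows "ALL x. (\<forall>y\<in>F. y + r <= x) --> real (card F) <= T x"
  using assms(1,2) T(3)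
proof (induction F rule: finite_linorder_max_induct)
  case empty
  then show ?case using T(2) by simp
next
  case (insert b F)
  show ?case
  proof (intro allI impI)
    fix x assume x: "\<forall>y\<in>insert b F. y + r <= x"
    have "ALL x. (\<forall>y\<in>F. y + r <= x) --> real (card F) <= T x" using insert by blast
    moreover have "\<forall>y\<in>F. y + r <= b - r" using insert by blast
    ultimately have "real (card F) <= T (b - r)" by blast
    moreover have "1 <= T (b + r) - T (b - r)" using insert by blast
    moreover have "T (b + r) <= T x" using x T(1) by (simp add: monoD)
    moreover have "b \<notin> F" using insert by blast
    ultimately show "real (card (insert b F)) <= T x" using insert(1) by simp
  qed
qed

text \<open>Small disjoint intervals around the points of \<open>F\<close> each use up one unit of
  the range \<open>[0, N]\<close>. \<open>T\<close> may depend on \<open>F\<close> and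
  \<open>r\<close>, so the counting function may come from a time chosen after the points.\<close>

lemma finite_jumps:
  fixes Y :: "real set" and N :: real
  assumes "!!F r. finite F ==> F \<subseteq> Y ==> 0 < r ==>
    EX T. mono T & (ALL x. 0 <= T x & T x <= N) & (\<forall>y\<in>F. 1 <= T (y + r) - T (y - r))"
  shows "finite Y"
proof (rule ccontr)
  assume "infinite Y"
  then obtain F where F: "finite F" "card F = Suc (nat \<lceil>N\<rceil>)" "F \<subseteq> Y"
    using infinite_arbitrarily_large by blast
  obtain r where r: "0 < r" "!!y y'. y \<in> F ==> y' \<in> F ==> y ~= y' ==> 8 * r <= abs (y - y')"
    using finite_separated[OF F(1)] by blast
  obtain T :: "real => real" where T: "mono T" "!!x. 0 <= T x" "!!x. T x <= N" "!!y. y \<in> F ==> 1 <= T (y + r) - T (y - r)"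
    using assms[OF F(1,3) r(1)] by blast
  have "y + r <= y' - r" if "y \<in> F" "y' \<in> F" "y < y'" for y y' using r(2)[OF that(1,2)] that(3) r(1) by linarith
  from separated_count[OF F(1) this r(1) T(1,2,4)]
  have "ALL x. (\<forall>y\<in>F. y + r <= x) --> real (card F) <= T x" by blast
  moreover have "\<forall>y\<in>F. y + r <= Max F + r" using F(1) by simp
  ultimately have "real (card F) <= T (Max F + r)" by blast
  then show False using T(3)[of "Max F + r"] F(2) by linarith
qed

lemma finite_avoid:
  fixes a b :: real
  assumes "finite Y" "a < b"
  obtains x where "a < x" "x < b" "x \<notin> Y"
proof -
  have "infinite {a<..<b}" using assms(2) by simp
  then have "~ {a<..<b} \<subseteq> Y" using assms(1) finite_subset by blast
  then obtain x where "x \<in> {a<..<b}" "x \<notin> Y" by blast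
  then show ?thesis using that[of x] by simp
qed

context ordered_pair
begin

text \<open>Together with \<open>singular_at\<close> this restates the assumptions of the locale
  \<open>steps\<close> as predicates, so that a configuration can be renewed from one time to the
  next.\<close>

definition regular_at :: "real => (real => real) => real => bool" where
  "regular_at t0 S x \<longleftrightarrow> (EX h>0. ALL y. abs (y - x) < h --> S y = S x &
      (ALL t. t0 < t --> t < t0 + h --> v (t, y) <= S x & S x <= w (t, y)))"

definition singular_at :: "real => (real => real) => real => bool" where
  "singular_at t0 S y \<longleftrightarrow> (EX h>0. ALL t x x1 x2. t0 < t --> t < t0 + h --> abs (x - y) < h -->
      y - h < x1 --> x1 < y --> y < x2 --> x2 < y + h -->
      v (t, x) <= max (S x1) (S x2) & min (S x1) (S x2) <= w (t, x))"

text \<open>Any monotone function with range in \<open>[0, N]\<close> may serve as a bound for the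
  variation in units of \<open>eps\<close>; unlike the exact variation it is easy to carry through
  limits. Points of \<open>Y\<close> are exempt because the values of \<open>S\<close> there are not
  controlled.\<close>

definition variation_by :: "real => real set => (real => real) => (real => real) => bool" where
  "variation_by N Y S T \<longleftrightarrow> mono T & (ALL x. 0 <= T x & T x <= N) &
     (ALL x x'. x < x' --> x \<notin> Y --> x' \<notin> Y --> abs (S x' - S x) <= eps * (T x' - T x))"

text \<open>Just after time \<open>t0\<close> both functions are given by the step function \<open>S\<close> away from the finite set \<open>Y\<close>.
  The multiples of \<open>eps\<close> counted by \<open>T\<close> keep the number of jumps bounded in the limit of an increasing
  sequence of times.\<close>

definition config :: "real => real => real set => (real => real) => bool" where
  "config N t0 Y S \<longleftrightarrow> finite Y & (ALL x. x \<notin> Y --> regular_at t0 S x) & (\<forall>y\<in>Y. singular_at t0 S y) &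
     (EX T. variation_by N Y S T)"

definition gap :: "real => real set" where
  "gap t = {x. v (t, x) ~= w (t, x)}"

text \<open>The substitute for \<open>v <= w\<close>: near each point \<open>w\<close> comes up to
  the value of \<open>v\<close>. This determines the upper envelope of any function lying between
  \<open>w\<close> and \<open>v\<close>.\<close>

definition unfattened :: "real => bool" where
  "unfattened t \<longleftrightarrow> (ALL x. ALL eta>0. EX t' x'. 0 < t' & abs (t' - t) < eta & abs (x' - x) < eta & v (t, x) <= w (t', x'))"

definition good :: "real => real => bool" where
  "good N t \<longleftrightarrow> config N t (gap t) (%x. v (t, x)) & unfattened t"

section \<open>Points where the two functions agree\<close>

lemma near_bounds:
  assumes "0 < t"
  shows "EX h>0. ALL s y. 0 < s --> abs (s - t) < h --> abs (y - x) < h --> v (s, y) <= v (t, x) & w (t, x) <= w (s, y)"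
proof -
  obtain h1 where h1: "0 < h1" "!!s y. 0 < s ==> abs (s - t) < h1 ==> abs (y - x) < h1 ==> v (s, y) <= v (t, x)"
    using int_usc[OF jsub_usc[OF v_sub] eps v_int v_int[OF assms] assms order_refl] by blast
  obtain h2 where h2: "0 < h2" "!!s y. 0 < s ==> abs (s - t) < h2 ==> abs (y - x) < h2 ==> - w (s, y) <= - w (t, x)"
    using int_usc[OF jsub_usc[OF w_super] eps neg_w(2) neg_w(2)[OF assms] assms order_refl] by blast
  have "v (s, y) <= v (t, x) & w (t, x) <= w (s, y)" if "0 < s" "abs (s - t) < min h1 h2" "abs (y - x) < min h1 h2" for s y
    using h1(2)[of s y] h2(2)[of s y] that by simp
  then show ?thesis using h1(1) h2(1) by (intro exI[of _ "min h1 h2"]) simp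
qed

lemma not_gap_near:
  assumes "0 < t" "x \<notin> gap t"
  shows "EX h>0. ALL s y. 0 < s --> abs (s - t) < h --> abs (y - x) < h --> v (s, y) = v (t, x) & w (s, y) = v (t, x)"
proof -
  obtain h where h: "0 < h" "!!s y. 0 < s ==> abs (s - t) < h ==> abs (y - x) < h ==> v (s, y) <= v (t, x) & w (t, x) <= w (s, y)"
    using near_bounds[OF assms(1)] by blast
  have "v (s, y) = v (t, x) & w (s, y) = v (t, x)" if "0 < s" "abs (s - t) < h" "abs (y - x) < h" for s y
    using h(2)[OF that] w_le_v[OF that(1), of y] assms(2) by (simp add: gap_def)
  then show ?thesis using h(1) by blast
qed

lemma regular_at_gap:
  assumes "0 < t" "x \<notin> gap t"
  shows "regular_at t (%x. v (t, x)) x"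
proof -
  obtain h where h: "0 < h" "!!s y. 0 < s ==> abs (s - t) < h ==> abs (y - x) < h ==> v (s, y) = v (t, x) & w (s, y) = v (t, x)"
    using not_gap_near[OF assms] by blast
  show ?thesis unfolding regular_at_def
  proof (intro exI[of _ h] conjI allI impI)
    fix y assume y: "abs (y - x) < h"
    show "v (t, y) = v (t, x)" using h(2)[OF assms(1) _ y] h(1) by simp
    fix s assume s: "t < s" "s < t + h"
    have "0 < s" "abs (s - t) < h" using s assms(1) by auto
    from h(2)[OF this y] show "v (s, y) <= v (t, x)" "v (t, x) <= w (s, y)" by auto
  qed (rule h(1))
qed

lemma gap_int:
  assumes "0 < t" "x \<in> gap t"
  shows "w (t, x) + eps <= v (t, x)"
proof -
  have "~ v (t, x) < w (t, x) + eps"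
    using int_multiple_le[OF eps v_int[OF assms(1)] w_int[OF assms(1)], of x x] w_le_v[OF assms(1), of x] assms(2)
    unfolding gap_def by (metis (mono_tags) mem_Collect_eq order_antisym)
  then show ?thesis by linarith
qed

lemma const_off_gap:
  assumes "0 < t" "a <= b" "!!x. a <= x ==> x <= b ==> x \<notin> gap t"
  shows "v (t, a) = v (t, b)"
proof (rule connected_local_const[where A = "{a..b}" and f = "%x. v (t, x)" and a = a and b = b])
  show "\<forall>x\<in>{a..b}. eventually (%y. v (t, x) = v (t, y)) (at x within {a..b})"
  proof
    fix x assume "x \<in> {a..b}"
    then obtain h where h: "0 < h" "!!s y. 0 < s ==> abs (s - t) < h ==> abs (y - x) < h ==> v (s, y) = v (t, x) & w (s, y) = v (t, x)"
      using not_gap_near[OF assms(1), of x] assms(3) by auto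
    show "eventually (%y. v (t, x) = v (t, y)) (at x within {a..b})"
      unfolding eventually_at
    proof (intro exI[of _ h] conjI ballI impI)
      fix y assume "y \<in> {a..b}" "y ~= x & dist y x < h"
      then show "v (t, x) = v (t, y)" using h(1) h(2)[OF assms(1), of y] by (simp add: dist_real_def)
    qed (rule h(1))
  qed
  show "connected {a..b}" by (rule connected_Icc)
  show "a \<in> {a..b}" "b \<in> {a..b}" using assms(2) by auto
qed

end

context steps
begin

text \<open>The ordering from \<open>window_ordered\<close> makes \<open>v (t, .)\<close> monotone
  inside each window with values between the two side values, so its variation does not exceed that
  of \<open>S\<close>. The configuration therefore renews itself at time \<open>t\<close> with
  \<open>gap t\<close> as jump set and the same bound \<open>N\<close>.\<close>

lemma steps_good:
  assumes "variation_by N Y S T"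
  shows "EX h>0. ALL t. t0 < t --> t < t0 + h --> good N t"
proof -
  have T: "mono T" "!!x. 0 <= T x" "!!x. T x <= N"
    and TS: "!!x x'. x < x' ==> x \<notin> Y ==> x' \<notin> Y ==> abs (S x' - S x) <= eps * (T x' - T x)"
    using assms by (auto simp: variation_by_def)
  obtain h1 where h1: "0 < h1" "!!y t x x'. y \<in> Y ==> t0 < t ==> t < t0 + h1 ==> abs (x - y) <= 2 * R ==> abs (x' - y) <= 2 * R ==>
     0 < sg y * (x' - x) ==> v (t, x) <= w (t, x')" using window_ordered by blast
  define h where "h = min h1 (c0 * R^2)"
  have h: "0 < h" "h <= h1" "h <= c0 * R^2" using h1 c0_pos R by (auto simp: h_def)
  have main: "good N t" if t: "t0 < t" "t < t0 + h" for t
  proof -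
    have tp: "0 < t" using t t0 by simp
    have tR: "t < t0 + c0 * R^2" using t h by linarith
    have ordv: "v (t, x) <= w (t, x')" if "y \<in> Y" "abs (x - y) <= 2 * R" "abs (x' - y) <= 2 * R" "0 < sg y * (x' - x)" for y x x'
      using h1(2)[OF that(1) t(1) _ that(2-4)] t h by simp
    have wv: "w (t, x) <= v (t, x)" for x by (rule w_le_v[OF tp])
    have out: "v (t, x) = S x" "w (t, x) = S x" if "!!y. y \<in> Y ==> R < abs (x - y)" for x
      using far_from_Y[OF R that t(1) tR] by auto
    have in_window: "\<exists>y\<in>Y. abs (x - y) <= R" if "x \<in> gap t" for x
      using that out[of x] by (force simp: gap_def not_le)
    have unf: "unfattened t" unfolding unfattened_def
    proof (intro allI impI)
      fix x eta :: real assume eta: "0 < eta"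
      show "EX t' x'. 0 < t' & abs (t' - t) < eta & abs (x' - x) < eta & v (t, x) <= w (t', x')"
      proof (cases "x \<in> gap t")
        case True
        then obtain y where y: "y \<in> Y" "abs (x - y) <= R" using in_window by blast
        define q where "q = min eta R / 2"
        have q: "0 < q" "q < eta" "q < R" using eta R by (auto simp: q_def min_def)
        have "abs (sg y * q) = q" using q by (simp add: abs_mult sg_cases)
        then have "abs (x + sg y * q - y) <= 2 * R" using y(2) q by linarith
        moreover have "0 < sg y * (x + sg y * q - x)" using q sg_cases(2)[of y] by (simp add: mult.assoc[symmetric])
        ultimately have "v (t, x) <= w (t, x + sg y * q)" using y R by (intro ordv[OF y(1)]) auto
        then show ?thesis using tp q \<open>abs (sg y * q) = q\<close> eta by (intro exI[of _ t] exI[of _ "x + sg y * q"]) simp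
      next
        case False
        then show ?thesis using tp eta by (intro exI[of _ t] exI[of _ x]) (simp add: gap_def)
      qed
    qed
    have win_mono: "sg y * v (t, x) <= sg y * v (t, x')" if "y \<in> Y" "abs (x - y) <= 2 * R" "abs (x' - y) <= 2 * R" "x < x'" for y x x'
    proof (cases "sg y = 1")
      case True
      then show ?thesis using ordv[OF that(1-3)] wv[of x'] that(4) by simp
    next
      case False
      then have "sg y = - 1" using sg_cases(1) by blast
      then show ?thesis using ordv[OF that(1,3,2)] wv[of x] that(4) by simp
    qed
    have uniq: "y = y'" if "y \<in> Y" "y' \<in> Y" "abs (x - y) <= 2 * R" "abs (x - y') <= 2 * R" for x y y'
      using sep[OF that(1,2)] that(3,4) R by (cases "y = y'") (auto simp: abs_le_iff abs_if split: if_splits)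
    define wn where "wn x = (\<exists>y\<in>Y. abs (x - y) <= 2 * R)" for x
    define cen where "cen x = (SOME y. y \<in> Y & abs (x - y) <= 2 * R)" for x
    have cen: "cen x \<in> Y" "abs (x - cen x) <= 2 * R" if "wn x" for x
      using someI_ex[of "%y. y \<in> Y & abs (x - y) <= 2 * R"] that unfolding wn_def cen_def by blast+
    \<comment> \<open>In a window \<open>T\<close> is replaced by its value at the left end plus the
      monotone progress of \<open>v\<close> in units of \<open>eps\<close>; the increment of
      \<open>T\<close> across the window can afford this.\<close>
    define T' where "T' x = (if wn x then T (cen x - 2 * R) + sg (cen x) * (v (t, x) - l (cen x)) / eps else T x)" for x
    define La Rb where "La x = (if wn x then cen x - 2 * R else x)" and "Rb x = (if wn x then cen x + 2 * R else x)" for x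
    have LR_all: "La x <= x & x <= Rb x & La x \<notin> Y & Rb x \<notin> Y & abs (v (t, x) - S (La x)) <= eps * (T' x - T (La x)) &
        abs (S (Rb x) - v (t, x)) <= eps * (T (Rb x) - T' x)" for x
    proof (cases "wn x")
      case True
      define y where "y = cen x"
      have y: "y \<in> Y" "abs (x - y) <= 2 * R" using cen[OF True] by (auto simp: y_def)
      have nY: "y - 2 * R \<notin> Y" "y + 2 * R \<notin> Y" using side_values(3)[OF y(1)] R by auto
      have SL: "S (y - 2 * R) = l y" "S (y + 2 * R) = rr y" using R by (auto intro!: side_values[OF y(1)])
      have "abs (x - y) <= 3 * R" using y R by linarith
      from window_bounds[OF y(1) this t(1) tR] wv[of x]
      have b: "v (t, x) <= max (l y) (rr y)" "min (l y) (rr y) <= v (t, x)" by auto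
      have s1: "abs (v (t, x) - l y) = sg y * (v (t, x) - l y)" and s2: "abs (rr y - v (t, x)) = sg y * (rr y - v (t, x))"
        and s3: "abs (rr y - l y) = sg y * (rr y - l y)"
        using b by (auto simp: sg_def max_def min_def split: if_splits)
      have i0: "abs (rr y - l y) <= eps * (T (y + 2 * R) - T (y - 2 * R))" using TS[OF _ nY] R SL by simp
      have "T' x = T (y - 2 * R) + sg y * (v (t, x) - l y) / eps" using True by (simp add: T'_def y_def)
      then have i1: "eps * (T' x - T (y - 2 * R)) = sg y * (v (t, x) - l y)" using eps by simp
      have "eps * (T (y + 2 * R) - T' x) = eps * (T (y + 2 * R) - T (y - 2 * R)) - eps * (T' x - T (y - 2 * R))"
        by (simp add: algebra_simps)
      moreover have "sg y * (rr y - l y) = sg y * (rr y - v (t, x)) + sg y * (v (t, x) - l y)" by (simp add: algebra_simps)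
      ultimately have i2: "abs (rr y - v (t, x)) <= eps * (T (y + 2 * R) - T' x)" unfolding s2 using i0 i1 s3 by linarith
      have i3: "abs (v (t, x) - l y) <= eps * (T' x - T (y - 2 * R))" by (simp only: s1 i1 order_refl)
      have e: "La x = y - 2 * R" "Rb x = y + 2 * R" using True by (auto simp: La_def Rb_def y_def)
      have "y - 2 * R <= x" "x <= y + 2 * R" using y(2) by linarith+
      then show ?thesis
        unfolding e SL using nY i2 i3 by blast
    next
      case False
      then have far: "R < abs (x - y)" if "y \<in> Y" for y using that R by (force simp: wn_def)
      have "x \<notin> Y" using far R by force
      then show ?thesis
        using False out[OF far] by (simp add: La_def Rb_def T'_def)
    qed
    have LR: "La x <= x" "x <= Rb x" "La x \<notin> Y" "Rb x \<notin> Y" "abs (v (t, x) - S (La x)) <= eps * (T' x - T (La x))"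
      "abs (S (Rb x) - v (t, x)) <= eps * (T (Rb x) - T' x)" for x
      using LR_all[of x] by blast+
    have TS': "abs (v (t, x') - v (t, x)) <= eps * (T' x' - T' x)" if "x < x'" for x x'
    proof (cases "wn x & wn x' & cen x = cen x'")
      case True
      define y where "y = cen x"
      have y: "y \<in> Y" "abs (x - y) <= 2 * R" "abs (x' - y) <= 2 * R" using cen[of x] cen[of x'] True by (auto simp: y_def)
      have "eps * (T' x' - T' x) = sg y * v (t, x') - sg y * v (t, x)"
        using True eps by (simp add: T'_def y_def[symmetric] right_diff_distrib diff_divide_distrib)
      moreover have "abs (v (t, x') - v (t, x)) = abs (sg y * v (t, x') - sg y * v (t, x))"
        using sg_cases(1)[of y] by auto
      ultimately show ?thesis using win_mono[OF y that] by simp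
    next
      case False
      \<comment> \<open>Points without a common window are compared through the ends
        \<open>Rb x\<close> and \<open>La x'\<close>, where the variation bound for \<open>S\<close>
        applies.\<close>
      have le: "Rb x <= La x'"
      proof (cases "wn x")
        case x: True
        show ?thesis
        proof (cases "wn x'")
          case x': True
          have "cen x ~= cen x'" using False x x' by simp
          with sep[OF cen(1)[OF x] cen(1)[OF x']] have "8 * R <= abs (cen x - cen x')" by simp
          then show ?thesis using cen(2)[OF x] cen(2)[OF x'] that R x x' unfolding La_def Rb_def by (simp add: abs_le_iff abs_if split: if_splits)
        next
          case x': False
          then have "~ abs (x' - cen x) <= 2 * R" using cen(1)[OF x] by (auto simp: wn_def)
          then show ?thesis using cen(2)[OF x] that x x' unfolding La_def Rb_def by (simp add: abs_le_iff)
        qed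
      next
        case x: False
        show ?thesis
        proof (cases "wn x'")
          case x': True
          then have "~ abs (x - cen x') <= 2 * R" using cen(1)[OF x'] x by (auto simp: wn_def)
          then show ?thesis using cen(2)[OF x'] that x x' unfolding La_def Rb_def by (simp add: abs_le_iff)
        next
          case x': False
          then show ?thesis using x that by (simp add: La_def Rb_def)
        qed
      qed
      have mid: "abs (S (La x') - S (Rb x)) <= eps * (T (La x') - T (Rb x))"
        using TS[OF _ LR(4) LR(3), of x x'] le by (cases "Rb x = La x'") auto
      show ?thesis using mid LR(5)[of x'] LR(6)[of x] by (simp add: algebra_simps abs_le_iff)
    qed
    have T'mono: "mono T'"
    proof (rule monoI)
      fix x x' :: real assume "x <= x'"
      show "T' x <= T' x'"
      proof (cases "x = x'")
        case False
        then have "0 <= eps * (T' x' - T' x)" using TS'[of x x'] \<open>x <= x'\<close> by (meson abs_ge_zero order_trans order_le_neq_trans)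
        then show ?thesis using eps by (simp add: zero_le_mult_iff)
      qed simp
    qed
    have T'b: "0 <= T' x" "T' x <= N" for x
    proof -
      have "0 <= eps * (T' x - T (La x))" "0 <= eps * (T (Rb x) - T' x)"
        using LR(5)[of x] LR(6)[of x] by (meson abs_ge_zero order_trans)+
      then have "T (La x) <= T' x" "T' x <= T (Rb x)" using eps by (auto simp: zero_le_mult_iff)
      then show "0 <= T' x" "T' x <= N" using T(2)[of "La x"] T(3)[of "Rb x"] by linarith+
    qed
    have var: "variation_by N (gap t) (%x. v (t, x)) T'"
      using T'mono T'b TS' by (simp add: variation_by_def)
    have jumps: "1 <= T' (z + r) - T' (z - r)" if z: "z \<in> gap t" and "0 < r" for z r
    proof -
      obtain y where y: "y \<in> Y" "abs (z - y) <= R" using in_window[OF z] by blast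
      define q where "q = min r R"
      have q: "0 < q" "q <= r" "q <= R" using that R by (auto simp: q_def)
      have win: "abs (z - q - y) <= 2 * R" "abs (z + q - y) <= 2 * R" "abs (z - y) <= 2 * R" using y q R by linarith+
      \<comment> \<open>A gap separates the sides: for an increasing jump \<open>v (t, z - q) <= w
        (t, z) <= v (t, z) - eps <= w (t, z + q) - eps\<close>.\<close>
      have "eps <= abs (v (t, z + q) - v (t, z - q))"
      proof (cases "sg y = 1")
        case True
        then have "v (t, z - q) <= w (t, z)" "v (t, z) <= w (t, z + q)"
          using ordv[OF y(1) win(1,3)] ordv[OF y(1) win(3,2)] q by auto
        then show ?thesis using gap_int[OF tp z] wv[of "z + q"] by linarith
      next
        case False
        then have "sg y = - 1" using sg_cases(1) by blast
        then have "v (t, z + q) <= w (t, z)" "v (t, z) <= w (t, z - q)"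
          using ordv[OF y(1) win(2,3)] ordv[OF y(1) win(3,1)] q by auto
        then show ?thesis using gap_int[OF tp z] wv[of "z - q"] by linarith
      qed
      also have "\<dots> <= eps * (T' (z + q) - T' (z - q))" using TS' q by simp
      finally have "1 <= T' (z + q) - T' (z - q)" using eps by simp
      moreover have "T' (z + q) <= T' (z + r)" "T' (z - r) <= T' (z - q)" using q by (auto intro!: monoD[OF T'mono])
      ultimately show ?thesis by simp
    qed
    have fin: "finite (gap t)"
    proof (rule finite_jumps[where N = N])
      show "EX T. mono T & (ALL x. 0 <= T x & T x <= N) & (\<forall>y\<in>F. 1 <= T (y + r) - T (y - r))"
        if "finite F" "F \<subseteq> gap t" "0 < r" for F r
        using T'mono T'b jumps that by (intro exI[of _ T']) auto
    qed
    have sing: "singular_at t (%x. v (t, x)) z" if z: "z \<in> gap t" for z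
    proof -
      obtain y where y: "y \<in> Y" "abs (z - y) <= R" using in_window[OF z] by blast
      obtain k where k: "0 < k" "!!s x. 0 < s ==> abs (s - t) < k ==> abs (x - z) < k ==> v (s, x) <= v (t, z) & w (t, z) <= w (s, x)"
        using near_bounds[OF tp] by blast
      show ?thesis unfolding singular_at_def
      proof (intro exI[of _ "min k R"] conjI allI impI)
        show "0 < min k R" using k R by simp
        fix s x x1 x2
        assume a: "t < s" "s < t + min k R" "abs (x - z) < min k R" "z - min k R < x1" "x1 < z" "z < x2" "x2 < z + min k R"
        have b: "v (s, x) <= v (t, z)" "w (t, z) <= w (s, x)" using k(2)[of s x] a tp by auto
        have win: "abs (x1 - y) <= 2 * R" "abs (x2 - y) <= 2 * R" "abs (z - y) <= 2 * R" using y a R by (auto simp: abs_le_iff)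
        have "v (t, z) <= max (v (t, x1)) (v (t, x2)) & min (v (t, x1)) (v (t, x2)) <= w (t, z)"
        proof (cases "sg y = 1")
          case True
          then have "v (t, x1) <= w (t, z)" "v (t, z) <= w (t, x2)"
            using ordv[OF y(1) win(1,3)] ordv[OF y(1) win(3,2)] a by auto
          then show ?thesis using wv[of x2] by linarith
        next
          case False
          then have "sg y = - 1" using sg_cases(1) by blast
          then have "v (t, x2) <= w (t, z)" "v (t, z) <= w (t, x1)"
            using ordv[OF y(1) win(2,3)] ordv[OF y(1) win(3,1)] a by auto
          then show ?thesis using wv[of x1] by linarith
        qed
        then show "v (s, x) <= max (v (t, x1)) (v (t, x2))" "min (v (t, x1)) (v (t, x2)) <= w (s, x)"
          using b by linarith+
      qed
    qed
    show "good N t" unfolding good_def config_def using fin sing var unf regular_at_gap[OF tp] by blast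
  qed
  show ?thesis using h(1) main by blast
qed

end

context ordered_pair
begin

lemma config_good:
  assumes "config N t0 Y S" "0 <= t0"
  shows "EX h>0. ALL t. t0 < t --> t < t0 + h --> good N t"
proof -
  have fin: "finite Y" using assms(1) unfolding config_def by blast
  obtain T where T: "variation_by N Y S T" using assms(1) unfolding config_def by blast
  obtain R where R: "0 < R" "!!y y'. y \<in> Y ==> y' \<in> Y ==> y ~= y' ==> 8 * R <= abs (y - y')"
    using finite_separated[OF fin] by blast
  interpret steps eps A v w t0 R Y S
  proof
    show "EX h>0. ALL y. abs (y - x) < h --> S y = S x &
      (ALL t. t0 < t --> t < t0 + h --> v (t, y) <= S x & S x <= w (t, y))" if "x \<notin> Y" for x
      using assms(1) that unfolding config_def regular_at_def by blast
    show "EX h>0. ALL t x x1 x2. t0 < t --> t < t0 + h --> abs (x - y) < h -->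
      y - h < x1 --> x1 < y --> y < x2 --> x2 < y + h -->
      v (t, x) <= max (S x1) (S x2) & min (S x1) (S x2) <= w (t, x)" if "y \<in> Y" for y
      using assms(1) that unfolding config_def singular_at_def by blast
  qed (use assms(2) fin R in auto)
  show ?thesis by (rule steps_good[OF T])
qed

end

context ordered_pair
begin

text \<open>At \<open>tau\<close> jumps may collide, so the short-time analysis cannot be started
  from earlier times. The bound \<open>N\<close> on the variation survives the limit and keeps the
  jump set finite; spikes created by the collision are removed by \<open>bump_kill\<close>.\<close>

lemma limit_good:
  assumes tau: "0 < tau" and good: "!!t. 0 < t ==> t < tau ==> good N t"
  shows "good N tau"
proof -
  have wv: "w (t, x) <= v (t, x)" if "0 < t" for t x by (rule w_le_v[OF that])
  have "\<forall>t\<in>{0<..<tau}. EX T. variation_by N (gap t) (%x. v (t, x)) T"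
    using good unfolding good_def config_def by (meson greaterThanLessThan_iff)
  then obtain T where T0: "\<forall>t\<in>{0<..<tau}. variation_by N (gap t) (%x. v (t, x)) (T t)" by metis
  have T: "mono (T t)" "!!x. 0 <= T t x" "!!x. T t x <= N"
    "!!x x'. x < x' ==> x \<notin> gap t ==> x' \<notin> gap t ==> abs (v (t, x') - v (t, x)) <= eps * (T t x' - T t x)"
    if "0 < t" "t < tau" for t
  proof -
    have "variation_by N (gap t) (%x. v (t, x)) (T t)" using T0 that by simp
    then show "mono (T t)" "!!x. 0 <= T t x" "!!x. T t x <= N"
      "!!x x'. x < x' ==> x \<notin> gap t ==> x' \<notin> gap t ==> abs (v (t, x') - v (t, x)) <= eps * (T t x' - T t x)"
      unfolding variation_by_def by blast+
  qed
  \<comment> \<open>If \<open>T t\<close> grew by less than one across the interval,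
    \<open>v (t, .)\<close> would be constant there off its gaps. The plateau estimates would carry
    both bounds to time \<open>tau\<close> and leave no gap at \<open>y\<close>.\<close>
  have jumps: "1 <= T t (y + r) - T t (y - r)"
    if y: "y \<in> gap tau" and r: "0 < r" and t: "0 < t" "tau - c0 * (r / 2)^2 < t" "t < tau" for y r t
  proof (rule ccontr)
    assume less: "~ 1 <= T t (y + r) - T t (y - r)"
    have fin: "finite (gap t)" and sing: "!!z. z \<in> gap t ==> singular_at t (%x. v (t, x)) z"
      using good[OF t(1,3)] unfolding good_def config_def by blast+
    obtain x0 where x0: "y - r < x0" "x0 < y + r" "x0 \<notin> gap t" using finite_avoid[OF fin, of "y - r" "y + r"] r by auto
    define a where "a = v (t, x0)"
    have lt: "v (t, x1) = v (t, x2)" if "y - r < x1" "x1 < x2" "x2 < y + r" "x1 \<notin> gap t" "x2 \<notin> gap t" for x1 x2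
    proof -
      have "T t x2 <= T t (y + r)" "T t (y - r) <= T t x1" using that by (auto intro!: monoD[OF T(1)[OF t(1,3)]])
      then have "T t x2 - T t x1 < 1" using less by simp
      then have "eps * (T t x2 - T t x1) < eps * 1" using eps by (intro mult_strict_left_mono) auto
      then have "abs (v (t, x2) - v (t, x1)) < eps" using T(4)[OF t(1,3) that(2,4,5)] by simp
      then have "v (t, x1) < v (t, x2) + eps" "v (t, x2) < v (t, x1) + eps" by linarith+
      then have "v (t, x1) <= v (t, x2)" "v (t, x2) <= v (t, x1)"
        using int_multiple_le[OF eps v_int[OF t(1)] v_int[OF t(1)]] by blast+
      then show ?thesis by (rule order_antisym)
    qed
    have const: "v (t, x1) = a" if "y - r < x1" "x1 < y + r" "x1 \<notin> gap t" for x1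
    proof (cases x1 x0 rule: linorder_cases)
      case less then show ?thesis unfolding a_def by (rule lt[OF that(1) _ x0(2) that(3) x0(3)])
    next
      case greater then show ?thesis unfolding a_def by (rule lt[OF x0(1) _ that(2) x0(3) that(3), symmetric])
    qed (simp add: a_def)
    have init: "EX h>0. ALL s x. t < s --> s < t + h --> abs (x - z) < h --> v (s, x) <= a & a <= w (s, x)"
      if z: "abs (z - y) <= r / 2" for z
    proof (cases "z \<in> gap t")
      case True
      then obtain h where h: "0 < h" "!!s x x1 x2. t < s ==> s < t + h ==> abs (x - z) < h ==>
          z - h < x1 ==> x1 < z ==> z < x2 ==> x2 < z + h ==>
          v (s, x) <= max (v (t, x1)) (v (t, x2)) & min (v (t, x1)) (v (t, x2)) <= w (s, x)"
        using sing[OF True] unfolding singular_at_def by blast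
      define q where "q = min h (r / 2)"
      have q: "0 < q" "q <= h" "q <= r / 2" using h r by (auto simp: q_def)
      obtain x1 where x1: "z - q < x1" "x1 < z" "x1 \<notin> gap t" using finite_avoid[OF fin, of "z - q" z] q by auto
      obtain x2 where x2: "z < x2" "x2 < z + q" "x2 \<notin> gap t" using finite_avoid[OF fin, of z "z + q"] q by auto
      have "v (t, x1) = a"
      proof (rule const[OF _ _ x1(3)])
        show "y - r < x1" "x1 < y + r" using x1(1,2) z q r by linarith+
      qed
      moreover have "v (t, x2) = a"
      proof (rule const[OF _ _ x2(3)])
        show "y - r < x2" "x2 < y + r" using x2(1,2) z q r by linarith+
      qed
      moreover have "z - h < x1" "x2 < z + h" using x1 x2 q by linarith+
      ultimately have "v (s, x) <= a & a <= w (s, x)" if "t < s" "s < t + h" "abs (x - z) < h" for s x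
        using h(2)[OF that _ x1(2) x2(1)] by simp
      then show ?thesis using h(1) by blast
    next
      case False
      obtain h where h: "0 < h" "!!s y. 0 < s ==> abs (s - t) < h ==> abs (y - z) < h ==> v (s, y) = v (t, z) & w (s, y) = v (t, z)"
        using not_gap_near[OF t(1) False] by blast
      have "v (t, z) = a"
      proof (rule const[OF _ _ False])
        show "y - r < z" "z < y + r" using z r by linarith+
      qed
      then have "v (s, x) <= a & a <= w (s, x)" if "t < s" "s < t + h" "abs (x - z) < h" for s x
        using h(2)[of s x] that t(1) by simp
      then show ?thesis using h(1) by blast
    qed
    have a: "a / eps \<in> \<int>" using v_int[OF t(1)] by (simp add: a_def)
    have tt: "0 <= t" "0 < r / 2" "tau < t + c0 * (r / 2)^2" using t r by auto
    have "v (tau, y) <= a"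
    proof (rule v_plateau[OF a tt(1,2) _ t(3) tt(3)])
      fix z assume "abs (z - y) <= r / 2"
      from init[OF this] show "EX h>0. ALL s x. t < s --> s < t + h --> abs (x - z) < h --> v (s, x) <= a" by blast
    qed
    moreover have "a <= w (tau, y)"
    proof (rule w_plateau[OF a tt(1,2) _ t(3) tt(3)])
      fix z assume "abs (z - y) <= r / 2"
      from init[OF this] show "EX h>0. ALL s x. t < s --> s < t + h --> abs (x - z) < h --> a <= w (s, x)" by blast
    qed
    ultimately show False using y wv[OF tau, of y] by (simp add: gap_def)
  qed
  have fin: "finite (gap tau)"
  proof (rule finite_jumps[where N = N])
    fix F r assume F: "finite F" "F \<subseteq> gap tau" "0 < (r :: real)"
    define t where "t = max (tau / 2) (tau - c0 * (r / 2)^2 / 2)"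
    have "0 < c0 * (r / 2)^2" using c0_pos F by simp
    then have t: "0 < t" "tau - c0 * (r / 2)^2 < t" "t < tau" using tau by (auto simp: t_def)
    show "EX T. mono T & (ALL x. 0 <= T x & T x <= N) & (\<forall>y\<in>F. 1 <= T (y + r) - T (y - r))"
      using T(1-3)[OF t(1,3)] jumps[OF _ F(3) t] F(2) by (intro exI[of _ "T t"]) auto
  qed
  \<comment> \<open>Otherwise \<open>w < v (tau, x)\<close> in a neighbourhood, and since earlier
    times are unfattened, \<open>v <= v (tau, x) - eps\<close> just before \<open>tau\<close>. The
    plateau estimate carries this bound to \<open>(tau, x)\<close> itself.\<close>
  have unf: "unfattened tau" unfolding unfattened_def
  proof (intro allI impI, rule ccontr)
    fix x eta :: real assume eta: "0 < eta"
      and "~ (EX t' x'. 0 < t' & abs (t' - tau) < eta & abs (x' - x) < eta & v (tau, x) <= w (t', x'))"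
    then have no: "w (t', x') < v (tau, x)" if "0 < t'" "abs (t' - tau) < eta" "abs (x' - x) < eta" for t' x'
      using that by force
    have int: "(v (tau, x) - eps) / eps \<in> \<int>" using v_int[OF tau, of x] eps by (simp add: diff_divide_distrib)
    have small: "v (t, z) <= v (tau, x) - eps" if t: "0 < t" "t < tau" "tau - eta / 2 < t" and z: "abs (z - x) < eta / 2" for t z
    proof -
      have "unfattened t" using good[OF t(1,2)] by (simp add: good_def)
      then obtain t' x' where c: "0 < t'" "abs (t' - t) < eta / 2" "abs (x' - z) < eta / 2" "v (t, z) <= w (t', x')"
        using eta unfolding unfattened_def by (meson half_gt_zero)
      have "abs (t' - tau) < eta" "abs (x' - x) < eta" using c t z by linarith+
      from no[OF c(1) this] c(4) have "v (t, z) < v (tau, x)" by simp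
      then show ?thesis using int_multiple_le[OF eps v_int[OF t(1), of z] int] by simp
    qed
    define r where "r = eta / 4"
    have "0 < c0 * r^2" using c0_pos eta by (simp add: r_def)
    define t where "t = Max {tau / 2, tau - eta / 4, tau - c0 * r^2 / 2}"
    have "t \<in> {tau / 2, tau - eta / 4, tau - c0 * r^2 / 2}" unfolding t_def by (rule Max_in) auto
    then have t1: "t < tau" using tau eta \<open>0 < c0 * r^2\<close> by auto
    have "tau / 2 <= t" "tau - eta / 4 <= t" "tau - c0 * r^2 / 2 <= t" unfolding t_def by (auto intro!: Max_ge)
    then have t2: "0 < t" "tau - eta / 2 < t" "tau < t + c0 * r^2" using tau eta \<open>0 < c0 * r^2\<close> by auto
    have "v (tau, x) <= v (tau, x) - eps"
    proof (rule v_plateau[OF int _ _ _ t1 t2(3)])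
      show "0 <= t" "0 < r" using t2 eta by (auto simp: r_def)
      fix z assume z: "abs (z - x) <= r"
      show "EX h>0. ALL s y. t < s --> s < t + h --> abs (y - z) < h --> v (s, y) <= v (tau, x) - eps"
      proof (intro exI[of _ "min (tau - t) r"] conjI allI impI)
        show "0 < min (tau - t) r" using t1 eta by (simp add: r_def)
        fix s y assume a: "t < s" "s < t + min (tau - t) r" "abs (y - z) < min (tau - t) r"
        show "v (s, y) <= v (tau, x) - eps"
        proof (rule small)
          show "0 < s" "s < tau" "tau - eta / 2 < s" using a t2 by auto
          have "abs (y - z) < r" using a by simp
          then show "abs (y - x) < eta / 2" using z eta unfolding r_def by linarith
        qed
      qed
    qed
    then show False using eps by simp
  qed
  \<comment> \<open>\<open>Sup (LT x)\<close> is the lower limit of \<open>T t x\<close> as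
    \<open>t\<close> increases to \<open>tau\<close>. It is monotone in \<open>x\<close> and keeps
    the range, and no convergent subsequence has to be chosen.\<close>
  define LT where "LT x = {m. EX sig. 0 < sig & sig < tau & (ALL t. sig < t --> t < tau --> m <= T t x)}" for x
  have LT_iff: "m \<in> LT x \<longleftrightarrow> (EX sig. 0 < sig & sig < tau & (ALL t. sig < t --> t < tau --> m <= T t x))" for m x
    unfolding LT_def by (rule mem_Collect_eq)
  have LT0: "0 \<in> LT x" for x
  proof -
    have "ALL t. tau / 2 < t --> t < tau --> 0 <= T t x" using T(2) tau by simp
    moreover have "0 < tau / 2" "tau / 2 < tau" using tau by auto
    ultimately show ?thesis unfolding LT_iff by blast
  qed
  have LTN: "m <= N" if m: "m \<in> LT x" for m x
  proof -
    obtain sig where sig: "0 < sig" "sig < tau" "ALL t. sig < t --> t < tau --> m <= T t x"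
      using m unfolding LT_iff by blast
    define t where "t = (sig + tau) / 2"
    have t: "sig < t" "t < tau" "0 < t" using sig(1,2) by (auto simp: t_def)
    have "m <= T t x" using sig(3) t(1,2) by (elim allE[of _ t]) simp
    also have "\<dots> <= N" by (rule T(3)[OF t(3,2)])
    finally show ?thesis .
  qed
  have bdd: "bdd_above (LT x)" for x using LTN unfolding bdd_above_def by blast
  have var: "variation_by N (gap tau) (%x. v (tau, x)) (%x. Sup (LT x))"
    unfolding variation_by_def
  proof (intro conjI allI impI)
    show "mono (%x. Sup (LT x))"
    proof (rule monoI)
      fix x x' :: real assume "x <= x'"
      have "LT x \<subseteq> LT x'"
      proof
        fix m assume "m \<in> LT x"
        then obtain sig where sig: "0 < sig" "sig < tau" "!!t. sig < t ==> t < tau ==> m <= T t x" unfolding LT_iff by blast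
        have "m <= T t x'" if "sig < t" "t < tau" for t
          using sig(3)[OF that] monoD[OF T(1)[of t] \<open>x <= x'\<close>] sig(1) that by simp
        then show "m \<in> LT x'" using sig(1,2) unfolding LT_iff by blast
      qed
      then show "Sup (LT x) <= Sup (LT x')" using LT0[of x] by (intro cSup_subset_mono bdd) blast+
    qed
    show "0 <= Sup (LT x)" for x by (rule cSup_upper[OF LT0 bdd])
    show "Sup (LT x) <= N" for x
    proof (rule cSup_least)
      show "LT x ~= {}" using LT0 by blast
    qed (rule LTN)
    fix x x' assume x: "x < x'" "x \<notin> gap tau" "x' \<notin> gap tau"
    define d where "d = abs (v (tau, x') - v (tau, x)) / eps"
    have "Sup (LT x) <= Sup (LT x') - d"
    proof (rule cSup_least)
      show "LT x ~= {}" using LT0 by blast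
      fix m assume "m \<in> LT x"
      then obtain sig where sig: "0 < sig" "sig < tau" "!!t. sig < t ==> t < tau ==> m <= T t x" unfolding LT_iff by blast
      obtain h1 where h1: "0 < h1" "!!s y. 0 < s ==> abs (s - tau) < h1 ==> abs (y - x) < h1 ==> v (s, y) = v (tau, x) & w (s, y) = v (tau, x)"
        using not_gap_near[OF tau x(2)] by blast
      obtain h2 where h2: "0 < h2" "!!s y. 0 < s ==> abs (s - tau) < h2 ==> abs (y - x') < h2 ==> v (s, y) = v (tau, x') & w (s, y) = v (tau, x')"
        using not_gap_near[OF tau x(3)] by blast
      define sig' where "sig' = max sig (tau - min h1 h2)"
      have "m + d <= T t x'" if t: "sig' < t" "t < tau" for t
      proof -
        have tt: "0 < t" "sig < t" "abs (t - tau) < h1" "abs (t - tau) < h2" using t sig by (auto simp: sig'_def)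
        have e: "v (t, x) = v (tau, x)" "w (t, x) = v (tau, x)" "v (t, x') = v (tau, x')" "w (t, x') = v (tau, x')"
          using h1(2)[OF tt(1,3), of x] h2(2)[OF tt(1,4), of x'] h1(1) h2(1) by simp_all
        then have "abs (v (tau, x') - v (tau, x)) <= eps * (T t x' - T t x)"
          using T(4)[OF tt(1) t(2) x(1)] by (simp add: gap_def)
        then have "d <= T t x' - T t x" using eps by (simp add: d_def pos_divide_le_eq mult.commute)
        then show ?thesis using sig(3)[OF tt(2) t(2)] by simp
      qed
      moreover have "0 < sig'" "sig' < tau" using sig h1(1) h2(1) by (auto simp: sig'_def)
      ultimately have "m + d \<in> LT x'" unfolding LT_iff by blast
      then have "m + d <= Sup (LT x')" by (rule cSup_upper[OF _ bdd])
      then show "m <= Sup (LT x') - d" by simp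
    qed
    then have "eps * d <= eps * (Sup (LT x') - Sup (LT x))" using eps by (intro mult_left_mono) auto
    then show "abs (v (tau, x') - v (tau, x)) <= eps * (Sup (LT x') - Sup (LT x))" using eps by (simp add: d_def)
  qed
  \<comment> \<open>At time \<open>tau\<close> the value of \<open>v\<close> at \<open>y\<close> may
    exceed both side values, and that of \<open>w\<close> may lie below both.
    \<open>bump_kill\<close> for \<open>v\<close> and for \<open>- w\<close> shows that neither
    lasts.\<close>
  have sing: "singular_at tau (%x. v (tau, x)) y" if y: "y \<in> gap tau" for y
  proof -
    obtain R where R: "0 < R" "!!y y'. y \<in> gap tau ==> y' \<in> gap tau ==> y ~= y' ==> 8 * R <= abs (y - y')"
      using finite_separated[OF fin] by blast
    have ng: "x \<notin> gap tau" if "x ~= y" "abs (x - y) < 2 * R" for x using R(2)[OF _ y, of x] that R(1) by force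
    define l r where "l = v (tau, y - R)" and "r = v (tau, y + R)"
    have left: "v (tau, x) = l" if "y - R < x" "x < y" for x
    proof -
      have "v (tau, y - R) = v (tau, x)"
      proof (rule const_off_gap[OF tau])
        show "y - R <= x" using that by simp
        show "z \<notin> gap tau" if "y - R <= z" "z <= x" for z
        proof (rule ng)
          show "z ~= y" "abs (z - y) < 2 * R" using that \<open>x < y\<close> \<open>y - R < x\<close> R(1) by linarith+
        qed
      qed
      then show ?thesis by (simp add: l_def)
    qed
    have right: "v (tau, x) = r" if "y < x" "x < y + R" for x
    proof -
      have "v (tau, x) = v (tau, y + R)"
      proof (rule const_off_gap[OF tau])
        show "x <= y + R" using that by simp
        show "z \<notin> gap tau" if "x <= z" "z <= y + R" for z
        proof (rule ng)
          show "z ~= y" "abs (z - y) < 2 * R" using that \<open>y < x\<close> \<open>x < y + R\<close> R(1) by linarith+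
        qed
      qed
      then show ?thesis by (simp add: r_def)
    qed
    have near: "v (tau, x) <= max l r" "min l r <= w (tau, x)" if "x ~= y" "abs (x - y) < R" for x
    proof -
      have "v (tau, x) = l | v (tau, x) = r" using left[of x] right[of x] that by (cases "x < y") (auto simp: abs_less_iff)
      moreover have "w (tau, x) = v (tau, x)" using ng[OF that(1)] that(2) R(1) by (simp add: gap_def)
      ultimately show "v (tau, x) <= max l r" "min l r <= w (tau, x)" by auto
    qed
    have ints: "max l r / eps \<in> \<int>" "- min l r / eps \<in> \<int>"
      using v_int[OF tau, of "y - R"] v_int[OF tau, of "y + R"] by (auto simp: l_def r_def max_def min_def)
    obtain h1 where h1: "0 < h1" "!!t x. tau < t ==> t < tau + h1 ==> abs (x - y) < h1 ==> v (t, x) <= max l r"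
      using bump_kill[OF v_sub eps v_bound v_int tau ints(1) R(1) near(1)] by blast
    have neg: "- w (tau, x) <= - min l r" if "x ~= y" "abs (x - y) < R" for x using near(2)[OF that] by simp
    obtain h2 where h2: "0 < h2" "!!t x. tau < t ==> t < tau + h2 ==> abs (x - y) < h2 ==> - w (t, x) <= - min l r"
      using bump_kill[OF w_super eps neg_w tau ints(2) R(1) neg] by blast
    show ?thesis unfolding singular_at_def
    proof (intro exI[of _ "Min {h1, h2, R}"] conjI allI impI)
      show "0 < Min {h1, h2, R}" using h1(1) h2(1) R(1) by simp
      fix t x x1 x2
      assume a: "tau < t" "t < tau + Min {h1, h2, R}" "abs (x - y) < Min {h1, h2, R}" "y - Min {h1, h2, R} < x1" "x1 < y"
        "y < x2" "x2 < y + Min {h1, h2, R}"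
      have m: "Min {h1, h2, R} <= h1" "Min {h1, h2, R} <= h2" "Min {h1, h2, R} <= R" by auto
      have "v (tau, x1) = l" by (rule left) (use a m in linarith)+
      moreover have "v (tau, x2) = r" by (rule right) (use a m in linarith)+
      moreover have "v (t, x) <= max l r" by (rule h1(2)) (use a m in linarith)+
      moreover have "- w (t, x) <= - min l r" by (rule h2(2)) (use a m in linarith)+
      ultimately show "v (t, x) <= max (v (tau, x1)) (v (tau, x2))" "min (v (tau, x1)) (v (tau, x2)) <= w (t, x)" by auto
    qed
  qed
  show ?thesis unfolding good_def config_def using fin sing var unf regular_at_gap[OF tau] by blast
qed

text \<open>Times shortly after 0 are good. The infimum of the bad times would be good by
  \<open>limit_good\<close>, and the times just after it good by \<open>config_good\<close>, a
  contradiction.\<close>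

theorem no_fattening:
  assumes "config N 0 Y S" "0 < t"
  shows "unfattened t"
proof -
  have "good N s" if "0 < s" for s
  proof (rule ccontr)
    assume "~ good N s"
    define B where "B = {s. 0 < s & ~ good N s}"
    have B: "s \<in> B" using that \<open>~ good N s\<close> by (simp add: B_def)
    have bdd: "bdd_below B" by (auto simp: B_def bdd_below_def intro!: exI[of _ 0])
    obtain h where h: "0 < h" "!!t. 0 < t ==> t < h ==> good N t" using config_good[OF assms(1)] by auto
    define tau where "tau = Inf B"
    have "h <= tau" unfolding tau_def using B h(2) by (intro cInf_greatest) (auto simp: B_def not_less[symmetric])
    then have tau: "0 < tau" using h by simp
    have before: "good N t" if "0 < t" "t < tau" for t
      using that cInf_lower[OF _ bdd, of t] by (force simp: tau_def B_def)
    have g: "good N tau" by (rule limit_good[OF tau before])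
    then obtain h' where h': "0 < h'" "!!t. tau < t ==> t < tau + h' ==> good N t"
      using config_good[of N tau "gap tau" "%x. v (tau, x)"] tau by (auto simp: good_def)
    have "tau + h' <= Inf B"
    proof (rule cInf_greatest)
      show "B ~= {}" using B by blast
      fix t assume "t \<in> B"
      then have "0 < t" "~ good N t" by (auto simp: B_def)
      then show "tau + h' <= t" using before[of t] g h'(2)[of t] by (cases t tau rule: linorder_cases) (auto simp: not_less[symmetric])
    qed
    then show False using h'(1) by (simp add: tau_def)
  qed
  then show ?thesis using assms(2) by (simp add: good_def)
qed

end

section \<open>Smooth test functions\<close>

text \<open>The quadratic remainder needs the derivative to be Lipschitz only relative to the single
  point \<open>(t, x)\<close>, which differentiability of \<open>f'\<close> there supplies. The mean
  value inequality on a ball inside \<open>Q\<close> does the rest.\<close>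

lemma C2_expansion:
  assumes "C2_on Q phi" "0 < t"
  shows C2_d_t: "((%s. phi (s, x)) has_real_derivative d_t phi t x) (at t)"
    and C2_d_x: "((%y. phi (t, y)) has_real_derivative d_x phi t x) (at x)"
    and C2_taylor: "EX C>=0. EX delta>0. ALL s y. abs (s - t) < delta --> abs (y - x) < delta -->
      abs (phi (s, y) - phi (t, x) - d_t phi t x * (s - t) - d_x phi t x * (y - x)) <= C * ((s - t)^2 + (y - x)^2)"
proof -
  obtain f' f'' where f': "!!p. p \<in> Q ==> (phi has_derivative blinfun_apply (f' p)) (at p)"
    and f'': "!!p. p \<in> Q ==> (f' has_derivative blinfun_apply (f'' p)) (at p)"
    using assms(1) unfolding C2_on_def by blast
  define p where "p = (t, x)"
  have p: "p \<in> Q" using assms(2) by (simp add: p_def Q_def)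
  have lin: "f' p (a, b) = f' p (1, 0) * a + f' p (0, 1) * b" for a b
  proof -
    have "(a, b) = a *\<^sub>R (1, 0) + b *\<^sub>R (0, 1 :: real)" by simp
    then show ?thesis by (simp only: blinfun.add_right blinfun.scaleR_right) simp
  qed
  have "((%s. phi (s, x)) has_derivative (%h. f' p (h, 0))) (at t)"
    unfolding p_def
    by (rule has_derivative_compose[OF has_derivative_Pair[OF has_derivative_ident has_derivative_const] f'[OF p, unfolded p_def]])
  then have "((%s. phi (s, x)) has_real_derivative f' p (1, 0)) (at t)"
  proof -
    assume h: "((%s. phi (s, x)) has_derivative (%h. f' p (h, 0))) (at t)"
    have "(%h. f' p (h, 0)) = (*) (f' p (1, 0))"
    proof
      show "f' p (h, 0) = f' p (1, 0) * h" for h using lin[of h 0] by simp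
    qed
    with h show ?thesis unfolding has_field_derivative_def by simp
  qed
  moreover from this have "f' p (1, 0) = d_t phi t x" unfolding d_t_def by (rule DERIV_imp_deriv[symmetric])
  ultimately show dt: "((%s. phi (s, x)) has_real_derivative d_t phi t x) (at t)" by simp
  have "((%y. phi (t, y)) has_derivative (%h. f' p (0, h))) (at x)"
    unfolding p_def
    by (rule has_derivative_compose[OF has_derivative_Pair[OF has_derivative_const has_derivative_ident] f'[OF p, unfolded p_def]])
  then have "((%y. phi (t, y)) has_real_derivative f' p (0, 1)) (at x)"
  proof -
    assume h: "((%y. phi (t, y)) has_derivative (%h. f' p (0, h))) (at x)"
    have "(%h. f' p (0, h)) = (*) (f' p (0, 1))"
    proof
      show "f' p (0, h) = f' p (0, 1) * h" for h using lin[of 0 h] by simp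
    qed
    with h show ?thesis unfolding has_field_derivative_def by simp
  qed
  moreover from this have "f' p (0, 1) = d_x phi t x" unfolding d_x_def by (rule DERIV_imp_deriv[symmetric])
  ultimately show "((%y. phi (t, y)) has_real_derivative d_x phi t x) (at x)" by simp
  have part: "f' p (1, 0) = d_t phi t x" "f' p (0, 1) = d_x phi t x"
    using \<open>f' p (1, 0) = d_t phi t x\<close> \<open>f' p (0, 1) = d_x phi t x\<close> by auto
  define L where "L = norm (f'' p) + 1"
  have "0 < L" by (simp add: L_def add_nonneg_pos)
  obtain d where d: "0 < d" "!!q. norm (q - p) < d ==> norm (f' q - f' p - f'' p (q - p)) <= 1 * norm (q - p)"
    using f''[OF p] zero_less_one unfolding has_derivative_at_alt by blast
  have lip: "norm (f' q - f' p) <= L * norm (q - p)" if "norm (q - p) < d" for q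
  proof -
    have "norm (f' q - f' p) <= norm (f' q - f' p - f'' p (q - p)) + norm (f'' p (q - p))"
      using norm_triangle_ineq[of "f' q - f' p - f'' p (q - p)" "f'' p (q - p)"] by simp
    also have "\<dots> <= 1 * norm (q - p) + norm (f'' p) * norm (q - p)"
      by (intro add_mono d(2) that norm_blinfun)
    finally show ?thesis by (simp add: L_def algebra_simps)
  qed
  define delta where "delta = min d t / 2"
  have delta: "0 < delta" "2 * delta <= d" "2 * delta <= t" using d assms(2) by (auto simp: delta_def)
  have "abs (phi (s, y) - phi (t, x) - d_t phi t x * (s - t) - d_x phi t x * (y - x)) <= L * ((s - t)^2 + (y - x)^2)"
    if sy: "abs (s - t) < delta" "abs (y - x) < delta" for s y
  proof -
    define q where "q = (s, y)"
    have n: "norm (q - p) = sqrt ((s - t)^2 + (y - x)^2)" by (simp add: q_def p_def norm_Pair)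
    have "norm (q - p) <= abs (s - t) + abs (y - x)" unfolding n by (rule sqrt_sum_squares_le_sum_abs)
    then have nd: "norm (q - p) < 2 * delta" using sy by linarith
    let ?S = "cball p (norm (q - p))"
    have S: "?S \<subseteq> Q"
    proof
      fix z assume "z \<in> ?S"
      then have "norm (z - p) < 2 * delta" using nd by (simp add: dist_norm norm_minus_commute)
      moreover have "abs (fst z - t) <= norm (z - p)" using norm_fst_le[of "fst (z - p)" "snd (z - p)"] unfolding prod.collapse by (simp add: p_def)
      ultimately show "z \<in> Q" using delta by (auto simp: Q_def mem_Times_iff)
    qed
    have "norm (phi q - phi p - f' p (q - p)) <= norm (q - p) * (L * norm (q - p))"
    proof (rule differentiable_bound_linearization[where S = ?S and f' = "%z. blinfun_apply (f' z)" and ?x0.0 = p])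
      show "p + u *\<^sub>R (q - p) \<in> ?S" if "u \<in> {0..1}" for u
        using that by (simp add: dist_norm mult_left_le_one_le)
      show "(phi has_derivative blinfun_apply (f' z)) (at z within ?S)" if "z \<in> ?S" for z
        using f' S that by (meson has_derivative_at_withinI subsetD)
      show "onorm (blinfun_apply (f' z) - blinfun_apply (f' p)) <= L * norm (q - p)" if z: "z \<in> ?S" for z
      proof -
        have "norm (z - p) <= norm (q - p)" using z by (simp add: dist_norm norm_minus_commute)
        then have "norm (f' z - f' p) <= L * norm (q - p)"
          using lip[of z] nd delta(2) \<open>0 < L\<close> by (meson le_less_trans mult_left_mono order_trans less_imp_le order_less_le_trans)
        moreover have "blinfun_apply (f' z) - blinfun_apply (f' p) = blinfun_apply (f' z - f' p)"
          by (simp add: fun_eq_iff blinfun.diff_left)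
        ultimately show ?thesis by (simp add: norm_blinfun.rep_eq)
      qed
    qed simp
    also have "\<dots> = L * ((norm (q - p))^2)" by (simp add: power2_eq_square)
    also have "(norm (q - p))^2 = (s - t)^2 + (y - x)^2" unfolding n by simp
    also have "f' p (q - p) = d_t phi t x * (s - t) + d_x phi t x * (y - x)"
    proof -
      have "q - p = (s - t, y - x)" by (simp add: q_def p_def)
      then show ?thesis using lin[of "s - t" "y - x"] unfolding part by simp
    qed
    finally show ?thesis by (simp add: q_def p_def)
  qed
  then show "EX C>=0. EX delta>0. ALL s y. abs (s - t) < delta --> abs (y - x) < delta -->
      abs (phi (s, y) - phi (t, x) - d_t phi t x * (s - t) - d_x phi t x * (y - x)) <= C * ((s - t)^2 + (y - x)^2)"
    using \<open>0 < L\<close> delta(1) by (intro exI[of _ L] exI[of _ delta] conjI) auto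
qed

lemma C2_uminus:
  assumes "C2_on S f" shows "C2_on S (%p. - f p)"
proof -
  obtain f' f'' where f: "!!p. p \<in> S ==> (f has_derivative blinfun_apply (f' p)) (at p)"
    "!!p. p \<in> S ==> (f' has_derivative blinfun_apply (f'' p)) (at p)" "continuous_on S f''"
    using assms unfolding C2_on_def by blast
  have "((%p. - f p) has_derivative blinfun_apply (- f' p)) (at p)"
    "((%p. - f' p) has_derivative blinfun_apply (- f'' p)) (at p)" if "p \<in> S" for p
    using has_derivative_minus[OF f(1)[OF that]] has_derivative_minus[OF f(2)[OF that]]
    by (simp_all add: uminus_blinfun.rep_eq)
  moreover have "continuous_on S (%p. - f'' p)" using f(3) by (intro continuous_intros)
  ultimately show ?thesis unfolding C2_on_def by (intro exI[of _ "%p. - f' p"] exI[of _ "%p. - f'' p"]) auto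
qed

text \<open>By this oddness the integrals that define the principal value are eventually constant as the inner
  radius tends to \<open>0\<close>.\<close>

lemma increment_sgn:
  assumes "0 < eps" "abs (d - p * z) <= C * z^2" "0 <= C" "C * delta <= abs p" "abs p * delta + C * delta^2 <= eps" "p ~= 0" "z ~= 0" "abs z < delta"
  shows "E_upper eps d = eps / 2 * sgn (p * z)"
proof -
  have pz: "0 < abs p * abs z" using assms by simp
  have small: "C * z^2 < abs p * abs z"
  proof (cases "C = 0")
    case False
    then have "C * abs z < C * delta" using assms by (intro mult_strict_left_mono) auto
    then have "C * abs z * abs z < abs p * abs z" using assms by (intro mult_strict_right_mono) auto
    then show ?thesis by (simp add: power2_eq_square mult.assoc)
  qed (use pz in simp)
  have "abs p * abs z < abs p * delta" using assms by (intro mult_strict_left_mono) auto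
  moreover have "C * z^2 <= C * delta^2" using assms by (intro mult_left_mono) (auto simp: abs_le_square_iff[symmetric])
  ultimately have big: "abs p * abs z + C * z^2 < eps" using assms by linarith
  have apz: "abs (p * z) = abs p * abs z" by (rule abs_mult)
  show ?thesis
  proof (cases "0 < p * z")
    case True
    then have "0 <= d" "d < eps" using assms(2) small big apz by linarith+
    then have "E_upper eps d = eps / 2" using E_upper_signs(1,3)[OF assms(1), of d] by simp
    then show ?thesis using True by (simp add: sgn_pos)
  next
    case False
    then have neg: "p * z < 0" using assms by (simp add: not_less less_le)
    then have "- eps <= d" "d < 0" using assms(2) small big apz by linarith+
    then have "E_upper eps d = - eps / 2" using E_upper_signs(2,4)[OF assms(1), of d] by simp
    then show ?thesis using neg by (simp add: sgn_neg)
  qed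
qed

section \<open>Principal values and duality\<close>

lemma kint_annulus:
  assumes "0 < r" "r <= rho" "f \<in> borel_measurable borel" "!!z. abs (f z) <= B"
  shows "kint r f = (LBINT z:{-rho<..<rho} - {-r<..<r}. f z / z^2) + (LBINT z:- {-rho<..<rho}. f z / z^2)"
proof -
  have i: "set_integrable lborel {z. r <= abs z} (%z. f z / z^2)"
    by (rule kint_integrable[OF assms(1,3,4)])
  have s: "{z. r <= abs z} = ({-rho<..<rho} - {-r<..<r}) \<union> - {-rho<..<rho}"
    using assms(2) by (auto simp: abs_le_iff abs_less_iff abs_if split: if_splits)
  show ?thesis unfolding kint_def s
  proof (rule set_integral_Un)
    show "set_integrable lborel ({-rho<..<rho} - {-r<..<r}) (%z. f z / z^2)"
      by (rule set_integrable_subset[OF i]) (simp, use s in blast)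
    show "set_integrable lborel (- {-rho<..<rho}) (%z. f z / z^2)"
      by (rule set_integrable_subset[OF i]) (simp, use s in blast)
  qed auto
qed

text \<open>\<open>f\<close> joins the two integrands at \<open>rho\<close>. For small inner radii
  the truncated integral no longer changes, so the limit in the principal value is attained, and the
  two parts recombine into one \<open>kint\<close>.\<close>

lemma hamiltonian_eq_kint:
  assumes "0 < rho" and f: "f \<in> borel_measurable borel" "!!z. abs (f z) <= B"
    and inner: "!!z. abs z < rho ==> f z = e (phi (t, x + z) - phi (t, x))"
    and outer: "!!z. rho <= abs z ==> f z = e (v (t, x + z) - v (t, x))"
    and odd: "!!z. z ~= 0 ==> abs z < r1 ==> f z = c * sgn (p * z)" and "0 < r" "r < r1" "r <= rho"
  shows "hamiltonian e rho phi v t x = abs (d_x phi t x) * kint r f"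
proof -
  define far where "far = (LBINT z:- {-rho<..<rho}. f z / z^2)"
  have far: "far = (LBINT z:- {-rho<..<rho}. e (v (t, x + z) - v (t, x)) / z^2)"
    unfolding far_def
  proof (intro set_lebesgue_integral_cong allI impI)
    fix z assume "z \<in> - {-rho<..<rho}"
    then have "rho <= abs z" by (auto simp: abs_le_iff not_less)
    then show "f z / z^2 = e (v (t, x + z) - v (t, x)) / z^2" by (simp only: outer)
  qed simp
  have const: "kint s f = kint r f" if s: "0 < s" "s < r1" for s
  proof -
    have eq: "kint a f = kint b f" if "0 < a" "a <= b" "b < r1" for a b
    proof (rule order_antisym)
      have e: "f z = c * sgn (p * z)" if "a <= abs z" "abs z < b" for z
        by (rule odd) (use that \<open>0 < a\<close> \<open>b < r1\<close> in auto)
      show "kint a f <= kint b f" by (rule kint_sgn_le[OF that(1,2) f eq_refl[OF e]])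
      show "kint b f <= kint a f" by (rule kint_sgn_ge[OF that(1,2) f eq_refl[OF e[symmetric]]])
    qed
    show ?thesis
    proof (cases "s <= r")
      case True then show ?thesis by (rule eq[OF s(1) _ assms(8)])
    next
      case False then show ?thesis by (intro eq[OF assms(7) _ s(2), symmetric]) simp
    qed
  qed
  have "eventually (%s. (LBINT z:{-rho<..<rho} - {-s<..<s}. e (phi (t, x + z) - phi (t, x)) / z^2) = kint r f - far) (at_right 0)"
  proof (rule eventually_at_rightI[of 0 "min r1 rho"])
    fix s assume "s \<in> {0<..<min r1 rho}"
    then have s: "0 < s" "s < r1" "s <= rho" by auto
    have "(LBINT z:{-rho<..<rho} - {-s<..<s}. e (phi (t, x + z) - phi (t, x)) / z^2) = (LBINT z:{-rho<..<rho} - {-s<..<s}. f z / z^2)"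
    proof (intro set_lebesgue_integral_cong allI impI)
      fix z assume "z \<in> {-rho<..<rho} - {-s<..<s}"
      then have "abs z < rho" by (auto simp: abs_less_iff)
      then show "e (phi (t, x + z) - phi (t, x)) / z^2 = f z / z^2" by (simp only: inner)
    qed simp
    then show "(LBINT z:{-rho<..<rho} - {-s<..<s}. e (phi (t, x + z) - phi (t, x)) / z^2) = kint r f - far"
      using kint_annulus[OF s(1,3) f] const[OF s(1,2)] by (simp add: far_def)
  qed (use assms(1,7,8) in auto)
  then have "pv_integral rho (%z. e (phi (t, x + z) - phi (t, x)) / z^2) = kint r f - far"
    unfolding pv_integral_def by (intro tendsto_Lim tendsto_eventually) auto
  then show ?thesis unfolding hamiltonian_def far by simp
qed

definition test_jump :: "real => real => (real \<times> real => real) => (real \<times> real => real) => real => real => real => real" where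
  "test_jump eps rho phi v t x z = (if abs z < rho then E_upper eps (phi (t, x + z) - phi (t, x)) else jump eps v t x z)"

lemma hamiltonian_test_jump:
  assumes "0 < eps" "0 < rho" and phi: "C2_on Q phi" and "0 < t" and v: "(%y. v (t, y)) \<in> borel_measurable borel" "!!y. abs (v (t, y)) <= A"
    and p: "d_x phi t x ~= 0"
  obtains r1 B where "0 < r1" "test_jump eps rho phi v t x \<in> borel_measurable borel" "!!z. abs (test_jump eps rho phi v t x z) <= B"
    "!!r. 0 < r ==> r < r1 ==> hamiltonian (E_upper eps) rho phi v t x = abs (d_x phi t x) * kint r (test_jump eps rho phi v t x)"
    "!!r. 0 < r ==> r < r1 ==> hamiltonian (E_lower eps) rho (%q. - phi q) (%q. - v q) t x = - (abs (d_x phi t x) * kint r (test_jump eps rho phi v t x))"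
proof -
  define f where "f = test_jump eps rho phi v t x"
  define p where "p = d_x phi t x"
  have cont: "continuous_on UNIV (%y. phi (t, y))"
    using C2_d_x[OF phi \<open>0 < t\<close>] by (meson DERIV_isCont continuous_at_imp_continuous_on)
  have mphi: "(%y. phi (t, y)) \<in> borel_measurable borel" by (rule borel_measurable_continuous_onI[OF cont])
  have mf: "f \<in> borel_measurable borel"
    unfolding f_def test_jump_def[abs_def] jump_def
    using measurable_compose[OF _ mphi, of "%z. x + z" borel] measurable_compose[OF _ v(1), of "%z. x + z" borel]
    by measurable
  have "compact ((%y. phi (t, y)) ` {x - rho..x + rho})"
    by (intro compact_continuous_image compact_Icc continuous_on_subset[OF cont]) auto
  then have "bounded ((%y. phi (t, y)) ` {x - rho..x + rho})" by (rule compact_imp_bounded)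
  then obtain M where M': "\<forall>c\<in>(%y. phi (t, y)) ` {x - rho..x + rho}. norm c <= M" unfolding bounded_iff by blast
  then have M: "abs (phi (t, y)) <= M" if "y \<in> {x - rho..x + rho}" for y using that by force
  define B where "B = 2 * abs M + 2 * abs A + eps"
  have bf: "abs (f z) <= B" for z
  proof (cases "abs z < rho")
    case True
    then have "abs (phi (t, x + z)) <= M" "abs (phi (t, x)) <= M" using assms(2) by (auto intro!: M)
    then show ?thesis using True E_upper_bounds(3)[OF assms(1), of "phi (t, x + z) - phi (t, x)"] assms(1)
      unfolding f_def test_jump_def B_def by simp
  next
    case False
    then show ?thesis using v(2)[of "x + z"] v(2)[of x] E_upper_bounds(3)[OF assms(1), of "v (t, x + z) - v (t, x)"] assms(1)
      unfolding f_def test_jump_def B_def jump_def by simp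
  qed
  obtain C delta where C: "0 <= C" "0 < delta" "!!s y. abs (s - t) < delta ==> abs (y - x) < delta ==>
      abs (phi (s, y) - phi (t, x) - d_t phi t x * (s - t) - d_x phi t x * (y - x)) <= C * ((s - t)^2 + (y - x)^2)"
    using C2_taylor[OF phi \<open>0 < t\<close>, of x] by blast
  have p0: "p ~= 0" using p by (simp add: p_def)
  obtain delta' where delta': "0 < delta'" "delta' <= min delta rho" "abs C * delta' <= abs p" "abs p * delta' + abs C * delta'^2 <= eps"
    by (rule small_radius[OF assms(1) p0, of "min delta rho" C]) (use C assms(2) in auto)
  have odd: "f z = eps / 2 * sgn (p * z)" if "z ~= 0" "abs z < delta'" for z
  proof -
    have "abs (phi (t, x + z) - phi (t, x) - p * z) <= C * z^2" using C(3)[of t "x + z"] C(2) that delta' by (simp add: p_def)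
    then have "E_upper eps (phi (t, x + z) - phi (t, x)) = eps / 2 * sgn (p * z)"
      by (rule increment_sgn[OF assms(1) _ C(1) _ _ p0 that]) (use delta' C in auto)
    then show ?thesis using that delta' by (simp add: f_def test_jump_def)
  qed
  have dneg: "d_x (%q. - phi q) t x = - p"
    unfolding d_x_def p_def using DERIV_minus[OF C2_d_x[OF phi \<open>0 < t\<close>, of x]] by (simp add: DERIV_imp_deriv d_x_def)
  show ?thesis
  proof (rule that[OF delta'(1) mf[unfolded f_def] bf[unfolded f_def]])
    fix r assume r: "0 < r" "r < delta'"
    then have rrho: "r <= rho" using delta' by simp
    show "hamiltonian (E_upper eps) rho phi v t x = abs (d_x phi t x) * kint r (test_jump eps rho phi v t x)"
      unfolding f_def[symmetric]
      by (rule hamiltonian_eq_kint[OF assms(2) mf bf _ _ odd r rrho]) (auto simp: f_def test_jump_def jump_def)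
    have "hamiltonian (E_lower eps) rho (%q. - phi q) (%q. - v q) t x = abs (d_x (%q. - phi q) t x) * kint r (%z. - f z)"
    proof (rule hamiltonian_eq_kint[OF assms(2) _ _ _ _ _ r rrho, where c = "- eps / 2" and p = p and B = B])
      show "(%z. - f z) \<in> borel_measurable borel" using mf by simp
      show "abs (- f z) <= B" for z using bf[of z] by simp
      show "- f z = - eps / 2 * sgn (p * z)" if "z ~= 0" "abs z < delta'" for z using odd[OF that] by simp
    qed (simp_all add: f_def test_jump_def jump_def E_lower_uminus)
    then show "hamiltonian (E_lower eps) rho (%q. - phi q) (%q. - v q) t x = - (abs (d_x phi t x) * kint r (test_jump eps rho phi v t x))"
      by (simp add: dneg kint_uminus f_def p_def)
  qed
qed

text \<open>Negation exchanges the two staircases,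
  \<open>E_lower eps a = - E_upper eps (- a)\<close>, so only subsolutions need to be
  analysed.\<close>

lemma supersolution_uminus:
  assumes "0 < eps" "0 < rho"
  shows "supersolution rho eps w \<longleftrightarrow> subsolution rho eps (%q. - w q)"
proof -
  have b: "bounded ((%q. - w q) ` Q) \<longleftrightarrow> bounded (w ` Q)"
    by (auto simp: bounded_iff)
  have l: "lsc_on Q w \<longleftrightarrow> usc_on Q (%q. - w q)"
  proof -
    have e: "{p \<in> Q. a < w p} = {p \<in> Q. - w p < - a}" for a by auto
    show ?thesis unfolding lsc_on_def usc_on_def e by (metis minus_minus)
  qed
  have ham: "hamiltonian (E_lower eps) rho (%q. - phi q) w t x = - hamiltonian (E_upper eps) rho phi (%q. - w q) t x"
    if bd: "bounded (w ` Q)" and us: "usc_on Q (%q. - w q)" and "C2_on Q phi" "0 < t" "d_x phi t x ~= 0" for phi t x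
  proof -
    have "bounded ((%q. - w q) ` Q)" using b bd by blast
    then obtain A where A: "!!t x. 0 < t ==> abs (- w (t, x)) <= A" by (rule bounded_QE) blast
    show ?thesis
    proof (rule hamiltonian_test_jump[OF assms that(3,4) usc_on_slice_measurable[OF us that(4)] A[OF that(4)] that(5)])
      fix r1 B :: real
      assume r1: "0 < r1" and "!!r. 0 < r ==> r < r1 ==> hamiltonian (E_upper eps) rho phi (%q. - w q) t x = abs (d_x phi t x) * kint r (test_jump eps rho phi (%q. - w q) t x)"
        "!!r. 0 < r ==> r < r1 ==> hamiltonian (E_lower eps) rho (%q. - phi q) (%q. - (- w q)) t x = - (abs (d_x phi t x) * kint r (test_jump eps rho phi (%q. - w q) t x))"
      from this(2,3)[of "r1 / 2"] r1 show ?thesis by simp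
    qed
  qed
  have dneg: "d_x (%q. - phi q) t x = - d_x phi t x" "d_t (%q. - phi q) t x = - d_t phi t x" if "C2_on Q phi" "0 < t" for phi t x
    using DERIV_imp_deriv[OF DERIV_minus[OF C2_d_x[OF that, of x]]] DERIV_imp_deriv[OF DERIV_minus[OF C2_d_t[OF that, of x]]]
    by (simp_all add: d_x_def d_t_def)
  have quart: "(EX c g. \<forall>(s, y)\<in>Q. - phi (s, y) = c * abs (y - x) ^ 4 + g s)"
    if q: "EX c g. \<forall>(s, y)\<in>Q. phi (s, y) = c * abs (y - x) ^ 4 + g s" for phi :: "real \<times> real => real" and x
  proof -
    obtain c g where "\<forall>(s, y)\<in>Q. phi (s, y) = c * abs (y - x) ^ 4 + g s" using q by blast
    then show ?thesis by (intro exI[of _ "- c"] exI[of _ "%s. - g s"]) auto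
  qed
  show ?thesis
  proof
    assume sup: "supersolution rho eps w"
    have bd: "bounded (w ` Q)" and us: "usc_on Q (%q. - w q)" using sup l by (auto simp: supersolution_def)
    show "subsolution rho eps (%q. - w q)"
      unfolding subsolution_def
    proof (intro conjI allI impI)
      show "bounded ((%q. - w q) ` Q)" "usc_on Q (%q. - w q)" using bd us b by auto
      fix phi t x assume a: "C2_on Q phi & (t, x) \<in> Q & (\<forall>q\<in>Q. - w q - phi q <= - w (t, x) - phi (t, x))"
      then have c: "C2_on Q phi" "0 < t" by (auto simp: Q_def)
      have test: "(d_x (%q. - phi q) t x ~= 0 --> hamiltonian (E_lower eps) rho (%q. - phi q) w t x <= d_t (%q. - phi q) t x) &
        ((EX c g. \<forall>(s, y)\<in>Q. - phi (s, y) = c * abs (y - x) ^ 4 + g s) --> 0 <= d_t (%q. - phi q) t x)"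
      proof -
        have "\<forall>q\<in>Q. w (t, x) - (- phi (t, x)) <= w q - (- phi q)" using a by (simp add: algebra_simps)
        with sup C2_uminus[OF c(1)] a show ?thesis unfolding supersolution_def by blast
      qed
      show "d_t phi t x <= hamiltonian (E_upper eps) rho phi (%q. - w q) t x" if "d_x phi t x ~= 0"
        using test that ham[OF bd us c that] by (simp add: dneg[OF c])
      show "d_t phi t x <= 0" if "EX ca g. \<forall>(s, y)\<in>Q. phi (s, y) = ca * abs (y - x) ^ 4 + g s"
        using test quart[OF that] by (simp add: dneg[OF c])
    qed
  next
    assume sub: "subsolution rho eps (%q. - w q)"
    have bd: "bounded (w ` Q)" and us: "usc_on Q (%q. - w q)" using sub b by (auto simp: subsolution_def)
    show "supersolution rho eps w"
      unfolding supersolution_def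
    proof (intro conjI allI impI)
      show "bounded (w ` Q)" "lsc_on Q w" using bd us l by auto
      fix psi t x assume a: "C2_on Q psi & (t, x) \<in> Q & (\<forall>q\<in>Q. w (t, x) - psi (t, x) <= w q - psi q)"
      then have c: "C2_on Q psi" "0 < t" by (auto simp: Q_def)
      have test: "(d_x (%q. - psi q) t x ~= 0 --> d_t (%q. - psi q) t x <= hamiltonian (E_upper eps) rho (%q. - psi q) (%q. - w q) t x) &
        ((EX c g. \<forall>(s, y)\<in>Q. - psi (s, y) = c * abs (y - x) ^ 4 + g s) --> d_t (%q. - psi q) t x <= 0)"
      proof -
        have "\<forall>q\<in>Q. - w q - (- psi q) <= - w (t, x) - (- psi (t, x))" using a by (simp add: algebra_simps)
        with sub C2_uminus[OF c(1)] a show ?thesis unfolding subsolution_def by blast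
      qed
      show "hamiltonian (E_lower eps) rho psi w t x <= d_t psi t x" if "d_x psi t x ~= 0"
        using test that ham[OF bd us C2_uminus[OF c(1)] c(2), of x] by (simp add: dneg[OF c])
      show "0 <= d_t psi t x" if "EX ca g. \<forall>(s, y)\<in>Q. psi (s, y) = ca * abs (y - x) ^ 4 + g s"
        using test quart[OF that] by (simp add: dneg[OF c])
    qed
  qed
qed

text \<open>Contact from above bounds the increments of \<open>v\<close> by those of the test
  function, so its integrand dominates the jumps of \<open>v\<close>. In the flat case the
  coefficient \<open>c\<close> goes into the constant of the test, and \<open>g\<close> is expanded
  through \<open>phi\<close> along \<open>y = x\<close>.\<close>

lemma jsub_imp_subsolution:
  assumes v: "jsub eps v" and "0 < eps" "0 < rho"
  shows "subsolution rho eps v"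
  unfolding subsolution_def
proof (intro conjI allI impI)
  show bd: "bounded (v ` Q)" and us: "usc_on Q v" using v by (rule jsub_bounded, rule jsub_usc)
  obtain A where A: "!!t x. 0 < t ==> abs (v (t, x)) <= A" using bounded_QE[OF bd] by blast
  fix phi t x assume a: "C2_on Q phi & (t, x) \<in> Q & (\<forall>q\<in>Q. v q - phi q <= v (t, x) - phi (t, x))"
  then have phi: "C2_on Q phi" and t: "0 < t" by (auto simp: Q_def)
  have mx: "v (s, y) - v (t, x) <= phi (s, y) - phi (t, x)" if "0 < s" for s y
  proof -
    have "v (s, y) - phi (s, y) <= v (t, x) - phi (t, x)" using a that by (simp add: Q_def)
    then show ?thesis by linarith
  qed
  obtain C delta where C: "0 <= C" "0 < delta" "!!s y. abs (s - t) < delta ==> abs (y - x) < delta ==>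
      abs (phi (s, y) - phi (t, x) - d_t phi t x * (s - t) - d_x phi t x * (y - x)) <= C * ((s - t)^2 + (y - x)^2)"
    using C2_taylor[OF phi t, of x] by blast
  show "d_t phi t x <= hamiltonian (E_upper eps) rho phi v t x" if p: "d_x phi t x ~= 0"
  proof (rule hamiltonian_test_jump[OF assms(2,3) phi t usc_on_slice_measurable[OF us t] A[OF t] p])
    fix r1 B :: real
    assume r1: "0 < r1" "test_jump eps rho phi v t x \<in> borel_measurable borel" "!!z. abs (test_jump eps rho phi v t x z) <= B"
      "!!r. 0 < r ==> r < r1 ==> hamiltonian (E_upper eps) rho phi v t x = abs (d_x phi t x) * kint r (test_jump eps rho phi v t x)"
    have "touch v t x (d_t phi t x) (d_x phi t x) C delta"
      unfolding touch_def
    proof (intro allI impI)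
      fix s y assume h: "0 < s" "abs (s - t) < delta" "abs (y - x) < delta"
      show "v (s, y) <= v (t, x) + d_t phi t x * (s - t) + d_x phi t x * (y - x) + C * ((s - t)^2 + (y - x)^2)"
        using mx[OF h(1), of y] C(3)[OF h(2,3)] by linarith
    qed
    from jsub_weak[OF v t p C(2) r1(1) this] obtain r where
      r: "0 < r" "r < r1" "d_t phi t x <= abs (d_x phi t x) * kint r (jump eps v t x)" by blast
    have "kint r (jump eps v t x) <= kint r (test_jump eps rho phi v t x)"
    proof (rule kint_mono[OF r(1) jump_measurable[OF us t] _ r1(2,3)])
      show "abs (jump eps v t x z) <= 2 * A + eps / 2" for z by (rule jump_bound[OF assms(2) _ t]) (rule A)
      fix z
      have "jump eps v t x z <= E_upper eps (phi (t, x + z) - phi (t, x))"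
        unfolding jump_def by (rule E_upper_mono[OF assms(2) mx[OF t]])
      then show "jump eps v t x z <= test_jump eps rho phi v t x z" by (simp add: test_jump_def)
    qed
    then have "abs (d_x phi t x) * kint r (jump eps v t x) <= abs (d_x phi t x) * kint r (test_jump eps rho phi v t x)"
      by (intro mult_left_mono) auto
    then show ?thesis using r(3) r1(4)[OF r(1,2)] by simp
  qed
  show "d_t phi t x <= 0" if q: "EX c g. \<forall>(s, y)\<in>Q. phi (s, y) = c * abs (y - x) ^ 4 + g s"
  proof -
    obtain c g where cg: "!!s y. 0 < s ==> phi (s, y) = c * abs (y - x) ^ 4 + g s" using q unfolding Q_def by auto
    define eta where "eta = min delta t"
    have eta: "0 < eta" "eta <= delta" using C t by (auto simp: eta_def)
    have "touch4 v t x (d_t phi t x) (C + abs c) eta"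
      unfolding touch4_def
    proof (intro allI impI)
      fix s y assume h: "0 < s" "abs (s - t) < eta" "abs (y - x) < eta"
      have "v (s, y) - v (t, x) <= c * (y - x) ^ 4 + (g s - g t)" using mx[OF h(1), of y] cg[OF h(1), of y] cg[OF t, of x] by simp
      moreover have "g s - g t = phi (s, x) - phi (t, x)" using cg[OF h(1), of x] cg[OF t, of x] by simp
      moreover have "abs (phi (s, x) - phi (t, x) - d_t phi t x * (s - t)) <= C * (s - t)^2" using C(3)[of s x] h eta C(2) by simp
      moreover have "c * (y - x) ^ 4 <= abs c * (y - x) ^ 4" "0 <= C * (y - x) ^ 4" "0 <= abs c * (s - t)^2"
        using C(1) by (auto intro!: mult_right_mono)
      ultimately show "v (s, y) <= v (t, x) + d_t phi t x * (s - t) + (C + abs c) * ((s - t)^2 + (y - x) ^ 4)"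
        unfolding distrib_left distrib_right by linarith
    qed
    then show ?thesis by (rule jsub_flat[OF v t eta(1)])
  qed
qed

section \<open>Polynomial test functions\<close>

lemma polynomial_growth:
  fixes f :: "real => real"
  assumes "real_polynomial_function f"
  shows "EX c>=0. EX m. ALL z. abs (f z) <= c * (1 + z^2) ^ m"
  using assms
proof (induction f rule: real_polynomial_function.induct)
  case (linear f)
  then obtain c where f: "f = (%x. x * c)" using real_bounded_linear by blast
  have "abs (z * c) <= abs c * (1 + z^2) ^ 1" for z :: real
  proof -
    have "abs z <= 1 + z^2" using sum_squares_ge_zero[of "abs z - 1/2" 0] by (simp add: power2_eq_square algebra_simps)
    then have "abs c * abs z <= abs c * (1 + z^2)" by (intro mult_left_mono) auto
    then show ?thesis by (simp add: abs_mult mult.commute)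
  qed
  then show ?case unfolding f by (intro exI[of _ "abs c"] conjI exI[of _ 1]) auto
next
  case (const c)
  show ?case by (intro exI[of _ "abs c"] conjI exI[of _ 0]) auto
next
  case (add f g)
  then obtain c d m n where h: "0 <= c" "0 <= d" "!!z. abs (f z) <= c * (1 + z^2) ^ m" "!!z. abs (g z) <= d * (1 + z^2) ^ n" by blast
  have "abs (f z + g z) <= (c + d) * (1 + z^2) ^ (m + n)" for z
  proof -
    have "(1 + z^2) ^ m <= (1 + z^2) ^ (m + n)" "(1 + z^2) ^ n <= (1 + z^2) ^ (m + n)" by (intro power_increasing; simp)+
    then have "c * (1 + z^2) ^ m <= c * (1 + z^2) ^ (m + n)" "d * (1 + z^2) ^ n <= d * (1 + z^2) ^ (m + n)"
      using h by (auto intro!: mult_left_mono)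
    then show ?thesis using h(3,4)[of z] unfolding distrib_right by linarith
  qed
  then show ?case using h by (intro exI[of _ "c + d"] conjI exI[of _ "m + n"]) auto
next
  case (mult f g)
  then obtain c d m n where h: "0 <= c" "0 <= d" "!!z. abs (f z) <= c * (1 + z^2) ^ m" "!!z. abs (g z) <= d * (1 + z^2) ^ n" by blast
  have "abs (f z * g z) <= (c * d) * (1 + z^2) ^ (m + n)" for z
  proof -
    have "abs (f z) * abs (g z) <= (c * (1 + z^2) ^ m) * (d * (1 + z^2) ^ n)" using h by (intro mult_mono) auto
    then show ?thesis by (simp add: abs_mult power_add algebra_simps)
  qed
  then show ?case using h by (intro exI[of _ "c * d"] conjI exI[of _ "m + n"]) auto
qed

text \<open>Of the power \<open>M = m + k\<close>, the part \<open>m\<close> absorbs the polynomial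
  growth, while \<open>k\<close> makes \<open>(L^2 / l^2) ^ k\<close> larger than the remaining
  constant.\<close>

lemma polynomial_dominated:
  fixes f :: "real => real"
  assumes "real_polynomial_function f" "0 < b" "0 < l" "l < L"
  shows "EX M. ALL z. L <= abs z --> f z <= b * (z^2 / l^2) ^ M"
proof -
  obtain c m where c: "0 <= c" "!!z. abs (f z) <= c * (1 + z^2) ^ m" using polynomial_growth[OF assms(1)] by blast
  define D where "D = l^2 * (1 / L^2 + 1)"
  have "1 < L^2 / l^2" using assms by (simp add: power_strict_mono)
  then obtain k where k: "c * D ^ m / b < (L^2 / l^2) ^ k" using real_arch_pow by blast
  have "f z <= b * (z^2 / l^2) ^ (m + k)" if z: "L <= abs z" for z
  proof -
    have zL: "L^2 <= z^2" using power_mono[OF z, of 2] assms by simp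
    have "1 <= z^2 * (1 / L^2)" 
    proof -
      have "L^2 * (1 / L^2) = 1" using assms by simp
      moreover have "L^2 * (1 / L^2) <= z^2 * (1 / L^2)" by (rule mult_right_mono[OF zL]) simp
      ultimately show ?thesis by linarith
    qed
    then have "1 + z^2 <= z^2 * (1 / L^2 + 1)" unfolding distrib_left by linarith
    also have "\<dots> = D * (z^2 / l^2)" using assms by (simp add: D_def)
    finally have "(1 + z^2) ^ m <= (D * (z^2 / l^2)) ^ m" by (intro power_mono) auto
    then have "c * (1 + z^2) ^ m <= c * (D * (z^2 / l^2)) ^ m" using c by (intro mult_left_mono) auto
    also have "\<dots> = (c * D ^ m) * (z^2 / l^2) ^ m" by (simp only: power_mult_distrib mult.assoc)
    also have "\<dots> <= (b * (L^2 / l^2) ^ k) * (z^2 / l^2) ^ m"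
      using k assms by (intro mult_right_mono) (auto simp: pos_divide_less_eq mult.commute less_imp_le)
    also have "\<dots> <= (b * (z^2 / l^2) ^ k) * (z^2 / l^2) ^ m"
    proof -
      have "(L^2 / l^2) ^ k <= (z^2 / l^2) ^ k" by (rule power_mono[OF divide_right_mono[OF zL]]) auto
      then show ?thesis using assms by (intro mult_right_mono mult_left_mono) auto
    qed
    also have "\<dots> = b * (z^2 / l^2) ^ (m + k)" by (simp add: power_add)
    finally show ?thesis using c(2)[of z] by linarith
  qed
  then show ?thesis by blast
qed

text \<open>A polynomial majorant of a bounded continuous function that coincides with a given polynomial to
  fourth order at \<open>0\<close>: the Weierstrass theorem handles a bounded interval, and a high power of
  \<open>z / (rho + 1 / 2)\<close>, which is negligible on \<open>[-rho, rho]\<close>, the region \<open>abs z >= rho + 1\<close>.\<close>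

lemma polynomial_majorant:
  fixes g P :: "real => real"
  assumes "continuous_on UNIV g" and P: "real_polynomial_function P" and r: "0 < r" and rho: "0 < rho" and eta: "0 < eta"
  defines "theta z \<equiv> min 1 (max 0 (2 * abs z / r - 1))"
  shows "EX W. real_polynomial_function W &
    (ALL z. abs z < r / 2 --> abs z <= rho --> 0 <= W z & W z <= 3 * eta) &
    (ALL z. r / 2 <= abs z --> abs z <= rho + 1 --> (1 - theta z) * P z + theta z * (g z + eta) <= P z + z ^ 4 * W z) &
    (ALL z. r / 2 <= abs z --> abs z <= rho --> P z + z ^ 4 * W z <= (1 - theta z) * P z + theta z * (g z + eta) + 3 * eta * z ^ 4) &
    (ALL z. rho + 1 <= abs z --> K <= P z + z ^ 4 * W z)"
proof -
  \<comment> \<open>The wanted correction divided by \<open>z ^ 4\<close>, so that adding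
    \<open>z ^ 4 * W z\<close> does not disturb \<open>P\<close> near \<open>0\<close>.
    \<open>theta\<close> vanishes below \<open>r / 2\<close>, where the maximum merely avoids a
    division by zero.\<close>
  define T where "T z = theta z / (max (r / 2) (abs z)) ^ 4 * (g z + eta - P z)" for z
  have "continuous_on UNIV P" using P continuous_real_polymonial_function continuous_at_imp_continuous_on by blast
  moreover have "(max (r / 2) (abs z)) ^ 4 ~= 0" for z using r by (auto simp: max_def)
  ultimately have "continuous_on {- (rho + 1)..rho + 1} T"
    unfolding T_def theta_def using assms(1) r
    by (intro continuous_intros) (auto intro: continuous_on_subset)
  from Stone_Weierstrass_real_polynomial_function[OF compact_Icc this eta]
  obtain q where q: "real_polynomial_function q" "!!z. z \<in> {- (rho + 1)..rho + 1} ==> abs (T z - q z) < eta" by blast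
  \<comment> \<open>Strictly between \<open>rho\<close> and \<open>rho + 1\<close>: powers of
    \<open>z / l\<close> are at most one on \<open>[-rho, rho]\<close> and arbitrarily large beyond
    \<open>rho + 1\<close>.\<close>
  define l where "l = rho + 1 / 2"
  have id: "real_polynomial_function (%z :: real. z)" by (intro real_polynomial_function.intros bounded_linear_ident)
  have "real_polynomial_function (%z. K - P z - z ^ 4 * q z)"
    using P q(1) id by (intro real_polynomial_function_diff real_polynomial_function.intros(2-4) real_polynomial_function_power)
  from polynomial_dominated[OF this, of "eta * (rho + 1) ^ 4" l "rho + 1"]
  obtain M where M: "!!z. rho + 1 <= abs z ==> K - P z - z ^ 4 * q z <= eta * (rho + 1) ^ 4 * (z^2 / l^2) ^ M"
    using eta rho by (auto simp: l_def)
  define W where "W z = q z + eta + eta * (z^2 / l^2) ^ M" for z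
  have Wp: "real_polynomial_function W" unfolding W_def
    using q(1) id by (intro real_polynomial_function.intros(2-4) real_polynomial_function_power real_polynomial_function_divide)
  have pos: "0 <= eta * (z^2 / l^2) ^ M" for z using eta by simp
  have small: "eta * (z^2 / l^2) ^ M <= eta" if "abs z <= rho" for z
  proof -
    have "z^2 <= l^2" using that rho abs_le_square_iff[of z l] by (simp add: l_def)
    moreover have "0 < l^2" using rho by (simp add: l_def)
    ultimately have "(z^2 / l^2) ^ M <= 1" by (intro power_le_one) auto
    then show ?thesis using eta by (simp add: mult_left_le)
  qed
  have low: "T z <= W z" if "abs z <= rho + 1" for z
  proof -
    have "z \<in> {- (rho + 1)..rho + 1}" using that by (auto simp: abs_le_iff)
    from q(2)[OF this] pos[of z] show ?thesis unfolding W_def by linarith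
  qed
  have high: "W z <= T z + 3 * eta" if "abs z <= rho" for z
  proof -
    have "z \<in> {- (rho + 1)..rho + 1}" using that by (auto simp: abs_le_iff)
    from q(2)[OF this] small[OF that] show ?thesis unfolding W_def by linarith
  qed
  have T0: "T z = 0" if "abs z < r / 2" for z
  proof -
    have "2 * abs z / r - 1 <= 0" using that r by (simp add: divide_simps)
    then show ?thesis by (simp add: T_def theta_def)
  qed
  have T1: "P z + z ^ 4 * T z = (1 - theta z) * P z + theta z * (g z + eta)" if "r / 2 <= abs z" for z
  proof -
    have "z ~= 0" using that r by auto
    then have "z ^ 4 * T z = theta z * (g z + eta - P z)" using that by (simp add: T_def max_def)
    then show ?thesis by (simp add: algebra_simps)
  qed
  show ?thesis
  proof (intro exI[of _ W] conjI allI impI Wp)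
    show "0 <= W z" "W z <= 3 * eta" if "abs z < r / 2" "abs z <= rho" for z
      using low[of z] high[of z] T0[of z] that by simp_all
    show "(1 - theta z) * P z + theta z * (g z + eta) <= P z + z ^ 4 * W z" if "r / 2 <= abs z" "abs z <= rho + 1" for z
      unfolding T1[OF that(1), symmetric] using low[OF that(2)] by (intro add_left_mono mult_left_mono) auto
    show "P z + z ^ 4 * W z <= (1 - theta z) * P z + theta z * (g z + eta) + 3 * eta * z ^ 4" if "r / 2 <= abs z" "abs z <= rho" for z
    proof -
      have "z ^ 4 * W z <= z ^ 4 * (T z + 3 * eta)" using high[OF that(2)] by (intro mult_left_mono) auto
      then show ?thesis unfolding T1[OF that(1), symmetric] by (simp add: algebra_simps)
    qed
    show "K <= P z + z ^ 4 * W z" if "rho + 1 <= abs z" for z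
    proof -
      have "(rho + 1) ^ 4 <= abs z ^ 4" using that rho by (intro power_mono) auto
      then have "eta * (rho + 1) ^ 4 * (z^2 / l^2) ^ M <= eta * z ^ 4 * (z^2 / l^2) ^ M"
        using eta by (intro mult_right_mono mult_left_mono) auto
      moreover have "0 <= z ^ 4 * eta" using eta by simp
      ultimately show ?thesis using M[OF that] unfolding W_def by (simp add: algebra_simps)
    qed
  qed
qed

text \<open>The Lipschitz regularization from above, that is, the sup-convolution with the cone
  \<open>real k * abs z\<close>.\<close>

definition supconv :: "(real => real) => nat => real => real" where
  "supconv u k y = (SUP z. u z - real k * abs (y - z))"

lemma supconv:
  assumes A: "!!z. abs (u z) <= A"
  shows supconv_ge: "!!y. u y <= supconv u k y" and supconv_le: "!!y. supconv u k y <= A"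
    and supconv_continuous: "continuous_on UNIV (supconv u k)"
    and supconv_lim: "!!y e. (!!c. u y < c ==> EX d>0. ALL z. abs (z - y) < d --> u z < c) ==> 0 < e ==>
      eventually (%k. supconv u k y <= u y + e) sequentially"
proof -
  have le: "u z - real k * abs (y - z) <= A" for k y z
  proof -
    have "u z <= A" using A[of z] by linarith
    moreover have "0 <= real k * abs (y - z)" by simp
    ultimately show ?thesis by linarith
  qed
  have bdd: "bdd_above (range (%z. u z - real k * abs (y - z)))" for k y
    using le[of _ k y] by (auto simp: bdd_above_def)
  have ge: "u z - real k * abs (y - z) <= supconv u k y" for k y z
    unfolding supconv_def by (rule cSUP_upper[OF UNIV_I bdd])
  have least: "supconv u k y <= c" if "!!z. u z - real k * abs (y - z) <= c" for k y c
    unfolding supconv_def by (rule cSUP_least) (use that in auto)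
  show "u y <= supconv u k y" for y using ge[of y k y] by simp
  show "supconv u k y <= A" for y by (rule least[OF le])
  have lip: "supconv u k y <= supconv u k y' + real k * abs (y - y')" for y y'
  proof (rule least)
    fix z
    have "real k * abs (y' - z) <= real k * (abs (y - z) + abs (y - y'))" by (intro mult_left_mono) auto
    then show "u z - real k * abs (y - z) <= supconv u k y' + real k * abs (y - y')"
      using ge[of z k y'] unfolding distrib_left by linarith
  qed
  show "continuous_on UNIV (supconv u k)"
    unfolding continuous_on_iff
  proof (intro ballI allI impI)
    fix y e :: real assume "0 < e"
    show "EX d>0. \<forall>y'\<in>UNIV. dist y' y < d --> dist (supconv u k y') (supconv u k y) < e"
    proof (intro exI[of _ "e / (real k + 1)"] conjI ballI impI)
      fix y' assume "dist y' y < e / (real k + 1)"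
      then have "(real k + 1) * abs (y' - y) < e" by (simp add: dist_real_def field_simps)
      then have "real k * abs (y' - y) < e" by (simp add: algebra_simps)
      then show "dist (supconv u k y') (supconv u k y) < e"
        using lip[of y y'] lip[of y' y] by (simp add: dist_real_def abs_minus_commute abs_less_iff)
    qed (use \<open>0 < e\<close> in simp)
  qed
  fix y e :: real
  assume usc: "!!c. u y < c ==> EX d>0. ALL z. abs (z - y) < d --> u z < c" and e: "0 < e"
  obtain d where d: "0 < d" "!!z. abs (z - y) < d ==> u z < u y + e" using usc[of "u y + e"] e by auto
  obtain n :: nat where n: "2 * A / d <= real n" using real_arch_simple by blast
  show "eventually (%k. supconv u k y <= u y + e) sequentially"
  proof (rule eventually_sequentiallyI[of n])
    fix k assume "n <= k"
    then have k: "2 * A <= real k * d" using n d(1) by (simp add: pos_divide_le_eq) (meson mult_right_mono of_nat_le_iff order_trans less_imp_le)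
    show "supconv u k y <= u y + e"
    proof (rule least)
      fix z
      show "u z - real k * abs (y - z) <= u y + e"
      proof (cases "abs (z - y) < d")
        case True
        then have "u z < u y + e" by (rule d(2))
        moreover have "0 <= real k * abs (y - z)" by simp
        ultimately show ?thesis by linarith
      next
        case False
        then have "real k * d <= real k * abs (y - z)" by (intro mult_left_mono) auto
        then show ?thesis using k A[of z] A[of y] e by linarith
      qed
    qed
  qed
qed

text \<open>A tube lemma for a compact space interval: \<open>uniform_start\<close> is applied with
  the radius \<open>sig\<close> of the time interval in the place of time.\<close>

lemma usc_below_continuous:
  assumes v: "usc_on Q v" and t: "0 < t" and H: "continuous_on {a..b} H" and "a <= b"
    and less: "!!y. a <= y ==> y <= b ==> v (t, y) < H y"
  shows "EX d>0. ALL s y. 0 < s --> abs (s - t) < d --> a <= y --> y <= b --> v (s, y) < H y"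
proof -
  have "EX h>0. ALL sig y. 0 < sig --> sig < 0 + h --> a <= y --> y <= b --> (ALL s. 0 < s --> abs (s - t) < sig --> a <= y --> y <= b --> v (s, y) < H y)"
  proof (rule uniform_start[OF \<open>a <= b\<close>])
    fix x assume x: "a <= x" "x <= b"
    define c where "c = (v (t, x) + H x) / 2"
    have c: "v (t, x) < c" "c < H x" using less[OF x] by (auto simp: c_def)
    obtain d1 where d1: "0 < d1" "!!s y. 0 < s ==> abs (s - t) < d1 ==> abs (y - x) < d1 ==> v (s, y) < c"
      using usc_onD[OF v t c(1)] by blast
    have "EX d>0. \<forall>y\<in>{a..b}. dist y x < d --> dist (H y) (H x) < H x - c"
      using H x c(2) unfolding continuous_on_iff by auto
    then obtain d2 where d2: "0 < d2" "!!y. y \<in> {a..b} ==> dist y x < d2 ==> dist (H y) (H x) < H x - c" by blast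
    show "EX d>0. ALL sig y. 0 < sig --> sig < 0 + d --> abs (y - x) < d --> (ALL s. 0 < s --> abs (s - t) < sig --> a <= y --> y <= b --> v (s, y) < H y)"
    proof (intro exI[of _ "min d1 d2"] conjI allI impI)
      show "0 < min d1 d2" using d1 d2 by simp
      fix sig y s assume h: "0 < sig" "sig < 0 + min d1 d2" "abs (y - x) < min d1 d2" "0 < s" "abs (s - t) < sig" "a <= y" "y <= b"
      have "v (s, y) < c" using h by (intro d1(2)) auto
      moreover have "dist (H y) (H x) < H x - c" using h by (intro d2(2)) (auto simp: dist_real_def)
      ultimately show "v (s, y) < H y" unfolding dist_real_def by linarith
    qed
  qed
  then obtain h where h: "0 < h" "!!sig y s. 0 < sig ==> sig < h ==> a <= y ==> y <= b ==> 0 < s ==> abs (s - t) < sig ==> v (s, y) < H y"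
    by auto
  have "v (s, y) < H y" if "0 < s" "abs (s - t) < h / 2" "a <= y" "y <= b" for s y
    using h(2)[of "h / 2" y s] h(1) that by simp
  then show ?thesis using h(1) by (intro exI[of _ "h / 2"]) auto
qed

section \<open>From local contact to global smooth tests\<close>

lemma C2_separated:
  assumes h: "!!y. (h has_real_derivative h' y) (at y)" and h': "!!y. (h' has_real_derivative h'' y) (at y)"
    and h'': "continuous_on UNIV h''"
  shows "C2_on Q (%(s, y). h y + alpha * (s - t) + N * (s - t)^2)"
    and "d_t (%(s, y). h y + alpha * (s - t) + N * (s - t)^2) t x = alpha"
    and "d_x (%(s, y). h y + alpha * (s - t) + N * (s - t)^2) t x = h' x"
proof -
  let ?phi = "%(s, y). h y + alpha * (s - t) + N * (s - t)^2"
  let ?F = "fst_blinfun :: (real \<times> real) \<Rightarrow>\<^sub>L real" and ?G = "snd_blinfun :: (real \<times> real) \<Rightarrow>\<^sub>L real"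
  define f1 where "f1 p = (alpha + 2 * N * (fst p - t)) *\<^sub>R ?F + h' (snd p) *\<^sub>R ?G" for p :: "real \<times> real"
  define f2 where "f2 p = (2 * N) *\<^sub>R (blinfun_scaleR_left ?F o\<^sub>L ?F) + h'' (snd p) *\<^sub>R (blinfun_scaleR_left ?G o\<^sub>L ?G)" for p :: "real \<times> real"
  have hs: "((%p. k (snd p)) has_derivative (%d. k' (snd p) * snd d)) (at p)"
    if "!!y. (k has_real_derivative k' y) (at y)" for k k' :: "real => real" and p :: "real \<times> real"
    using has_derivative_compose[OF has_derivative_snd[OF has_derivative_ident] that[of "snd p", unfolded has_field_derivative_def]]
    by simp
  show "C2_on Q ?phi"
    unfolding C2_on_def
  proof (intro exI[of _ f1] exI[of _ f2] conjI ballI)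
    fix p :: "real \<times> real"
    have "((%p. h (snd p) + alpha * (fst p - t) + N * (fst p - t)^2) has_derivative
        (%d. h' (snd p) * snd d + alpha * fst d + N * (2 * (fst p - t) * fst d))) (at p)"
      by (auto intro!: derivative_eq_intros hs[OF h])
    moreover have "(%p. h (snd p) + alpha * (fst p - t) + N * (fst p - t)^2) = ?phi" by auto
    moreover have "(%d. h' (snd p) * snd d + alpha * fst d + N * (2 * (fst p - t) * fst d)) = blinfun_apply (f1 p)"
      unfolding f1_def fun_eq_iff blinfun.add_left blinfun.scaleR_left by (simp add: algebra_simps snd_blinfun.rep_eq)
    ultimately show "(?phi has_derivative blinfun_apply (f1 p)) (at p)" by simp
    have "(f1 has_derivative (%d. (2 * N * fst d) *\<^sub>R ?F + (h'' (snd p) * snd d) *\<^sub>R ?G)) (at p)"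
      unfolding f1_def[abs_def] by (auto intro!: derivative_eq_intros hs[OF h'])
    moreover have "(%d. (2 * N * fst d) *\<^sub>R ?F + (h'' (snd p) * snd d) *\<^sub>R ?G) = blinfun_apply (f2 p)"
      by (simp add: f2_def fun_eq_iff blinfun.add_left blinfun.scaleR_left snd_blinfun.rep_eq)
    ultimately show "(f1 has_derivative blinfun_apply (f2 p)) (at p)" by simp
  next
    have "continuous_on Q (%p. h'' (snd p))"
      by (rule continuous_on_compose2[OF h'']) (auto intro!: continuous_intros)
    then show "continuous_on Q f2" unfolding f2_def[abs_def] by (intro continuous_intros)
  qed
  show "d_t ?phi t x = alpha" unfolding d_t_def by (rule DERIV_imp_deriv) (auto intro!: derivative_eq_intros)
  show "d_x ?phi t x = h' x" unfolding d_x_def by (rule DERIV_imp_deriv) (auto intro!: derivative_eq_intros h)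
qed

lemma time_penalty:
  fixes alpha delta A N0 :: real
  assumes "0 < delta" "0 <= A"
  obtains N where "N0 <= N" "0 <= N" "!!tau. delta <= abs tau ==> 2 * A <= alpha * tau + N * tau^2"
proof
  let ?N = "max (max 0 N0) ((2 * A / delta + abs alpha) / delta)"
  show "N0 <= ?N" "0 <= ?N" by auto
  fix tau :: real assume tau: "delta <= abs tau"
  have "(2 * A / delta + abs alpha) / delta * delta <= ?N * abs tau" using assms tau by (intro mult_mono) auto
  then have "2 * A / delta + abs alpha <= ?N * abs tau" using assms by simp
  then have "(2 * A / delta) * abs tau <= (?N * abs tau - abs alpha) * abs tau" by (intro mult_right_mono) auto
  moreover have "(2 * A / delta) * delta <= (2 * A / delta) * abs tau" using assms tau by (intro mult_left_mono) auto
  moreover have "(2 * A / delta) * delta = 2 * A" using assms by simp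
  moreover have "(?N * abs tau - abs alpha) * abs tau = ?N * tau^2 - abs (alpha * tau)"
    by (simp add: left_diff_distrib power2_eq_square abs_mult mult.assoc)
  moreover have "- (alpha * tau) <= abs (alpha * tau)" by (rule abs_ge_minus_self)
  ultimately show "2 * A <= alpha * tau + ?N * tau^2" by argo
qed

text \<open>A local flat contact becomes a global maximum once the coefficients \<open>C'\<close>
  and \<open>N\<close> are so large that the test function exceeds the oscillation
  \<open>2 * A\<close> outside the contact box. It stays in the class
  \<open>c * abs (y - x) ^ 4 + g s\<close>.\<close>

lemma subsolution_flat:
  assumes sub: "subsolution rho eps v" and t: "0 < t" and delta: "0 < delta" and touch: "touch4 v t x alpha C delta"
  shows "alpha <= 0"
proof -
  obtain A where A: "0 < A" "!!t x. 0 < t ==> abs (v (t, x)) <= A"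
    using sub bounded_QE[of v] unfolding subsolution_def by blast
  define C' where "C' = max (abs C) ((2 * A + abs alpha * delta) / delta ^ 4)"
  have C': "C <= C'" "0 <= C'" by (auto simp: C'_def)
  obtain N where N: "C <= N" "0 <= N" "!!tau. delta <= abs tau ==> 2 * A <= alpha * tau + N * tau^2"
    using time_penalty[OF delta less_imp_le[OF A(1)]] by blast
  let ?h = "%y. C' * (y - x) ^ 4"
  let ?phi = "%(s, y). ?h y + alpha * (s - t) + N * (s - t)^2"
  have h: "(?h has_real_derivative 4 * C' * (y - x) ^ 3) (at y)" for y by (auto intro!: derivative_eq_intros)
  have h': "((%y. 4 * C' * (y - x) ^ 3) has_real_derivative 12 * C' * (y - x)^2) (at y)" for y by (auto intro!: derivative_eq_intros)
  have h'': "continuous_on UNIV (%y. 12 * C' * (y - x)^2)" by (intro continuous_intros)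
  have "C2_on Q ?phi" by (rule C2_separated(1)[OF h h' h''])
  moreover have "(t, x) \<in> Q" using t by (simp add: Q_def)
  moreover have "\<forall>q\<in>Q. v q - ?phi q <= v (t, x) - ?phi (t, x)"
  proof
    fix q assume "q \<in> Q"
    then obtain s y where q: "q = (s, y)" "0 < s" by (auto simp: Q_def)
    have b: "v (s, y) - v (t, x) <= 2 * A" using A(2)[OF q(2), of y] A(2)[OF t, of x] by linarith
    have N0: "0 <= N * (s - t)^2" and C0: "0 <= C' * (y - x) ^ 4" using N(2) C'(2) by auto
    have "v (s, y) - v (t, x) <= C' * (y - x) ^ 4 + alpha * (s - t) + N * (s - t)^2"
    proof (cases "delta <= abs (s - t)")
      case True
      then show ?thesis using N(3)[OF True] b C0 by linarith
    next
      case ds: False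
      show ?thesis
      proof (cases "delta <= abs (y - x)")
        case True
        have "(2 * A + abs alpha * delta) / delta ^ 4 * delta ^ 4 <= C' * abs (y - x) ^ 4"
          using True delta A C'(2) by (intro mult_mono power_mono) (auto simp: C'_def)
        then have "2 * A + abs alpha * delta <= C' * (y - x) ^ 4" using delta by simp
        moreover have "abs (alpha * (s - t)) <= abs alpha * delta" unfolding abs_mult using ds by (intro mult_left_mono) auto
        ultimately show ?thesis using b N0 by linarith
      next
        case False
        then have "v (s, y) <= v (t, x) + alpha * (s - t) + C * ((s - t)^2 + (y - x) ^ 4)"
          using touch ds q(2) by (simp add: touch4_def)
        moreover have "C * (s - t)^2 <= N * (s - t)^2" "C * (y - x) ^ 4 <= C' * (y - x) ^ 4"
          using N C' by (auto intro!: mult_right_mono)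
        ultimately show ?thesis unfolding distrib_left by linarith
      qed
    qed
    then show "v q - ?phi q <= v (t, x) - ?phi (t, x)" by (simp add: q)
  qed
  moreover have "EX c g. \<forall>(s, y)\<in>Q. ?phi (s, y) = c * abs (y - x) ^ 4 + g s"
    by (intro exI[of _ C'] exI[of _ "%s. alpha * (s - t) + N * (s - t)^2"]) auto
  ultimately have "d_t ?phi t x <= 0" using sub unfolding subsolution_def by blast
  then show ?thesis unfolding C2_separated(2)[OF h h' h''] .
qed

lemma polynomial_derivatives:
  fixes H :: "real => real"
  assumes "real_polynomial_function H"
  obtains H' H'' where "!!z. (H has_real_derivative H' z) (at z)" "!!z. (H' has_real_derivative H'' z) (at z)" "continuous_on UNIV H''"
proof -
  obtain H' where H': "real_polynomial_function H'" "!!z. (H has_real_derivative H' z) (at z)"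
    using has_real_derivative_polynomial_function[OF assms] by blast
  obtain H'' where H'': "real_polynomial_function H''" "!!z. (H' has_real_derivative H'' z) (at z)"
    using has_real_derivative_polynomial_function[OF H'(1)] by blast
  have "continuous_on UNIV H''"
    using continuous_real_polymonial_function[OF H''(1)] by (simp add: continuous_at_imp_continuous_on)
  with H'(2) H''(2) that show ?thesis by blast
qed

text \<open>The definition puts the test function, not \<open>v\<close>, into the integral over
  \<open>B_rho\<close>. So global test functions are needed whose slices at time \<open>t\<close>
  approximate \<open>v\<close> from above on most of \<open>B_rho\<close> and yet touch only at
  \<open>(t, x)\<close> with the prescribed derivatives; in the limit their integrands give back the
  jumps of \<open>v\<close>.\<close>

lemma subsolution_strong:
  assumes sub: "subsolution rho eps v" and eps: "0 < eps" and rho: "0 < rho" and t: "0 < t" and p: "p ~= 0"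
    and delta0: "0 < delta0" and r0: "0 < r0" and touch: "touch v t x alpha p C0 delta0"
  shows "EX r. 0 < r & r < r0 & alpha <= abs p * kint r (jump eps v t x)"
proof -
  have us: "usc_on Q v" using sub by (simp add: subsolution_def)
  obtain A where A: "0 < A" "!!t x. 0 < t ==> abs (v (t, x)) <= A"
    using sub bounded_QE[of v] unfolding subsolution_def by blast
  define C where "C = abs C0"
  define V where "V = v (t, x)"
  define u where "u z = v (t, x + z)" for z
  have uA: "abs (u z) <= A" for z unfolding u_def by (rule A(2)[OF t])
  have VA: "abs V <= A" unfolding V_def by (rule A(2)[OF t])
  have uus: "EX d>0. ALL z'. abs (z' - z) < d --> u z' < c" if "u z < c" for z c
  proof -
    obtain d where d: "0 < d" "!!s y. 0 < s ==> abs (s - t) < d ==> abs (y - (x + z)) < d ==> v (s, y) < c"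
      using usc_onD[OF us t \<open>u z < c\<close>[unfolded u_def]] by blast
    have "u z' < c" if "abs (z' - z) < d" for z' unfolding u_def by (rule d(2)[OF t]) (use that d(1) in auto)
    then show ?thesis using d(1) by blast
  qed
  obtain delta where delta: "0 < delta" "delta <= min (min delta0 rho) 1" "abs (C + 4) * delta <= abs p" "abs p * delta + abs (C + 4) * delta^2 <= eps"
    by (rule small_radius[OF eps p, of "min (min delta0 rho) 1" "C + 4"]) (use delta0 rho in auto)
  have deltale: "delta <= delta0" "delta <= rho" "delta <= 1" using delta(2) by auto
  have C0: "0 <= C" "abs (C + 4) = C + 4" by (auto simp: C_def)
  define r where "r = min delta r0 / 2"
  have r: "0 < r" "r < delta" "r < r0" using delta r0 by (auto simp: r_def)
  define P where "P z = V + p * z + (C + 1) * z^2" for z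
  have tch: "v (s, x + z) <= V + alpha * (s - t) + p * z + C * ((s - t)^2 + z^2)"
    if "0 < s" "abs (s - t) < delta0" "abs z < delta0" for s z
  proof -
    have "v (s, x + z) <= V + alpha * (s - t) + p * z + C0 * ((s - t)^2 + z^2)"
      using touch[unfolded touch_def, rule_format, of s "x + z"] that by (simp add: V_def)
    moreover have "C0 * ((s - t)^2 + z^2) <= C * ((s - t)^2 + z^2)" by (intro mult_right_mono) (auto simp: C_def)
    ultimately show ?thesis by linarith
  qed
  have near: "u z + z^2 <= P z" if "abs z < delta" for z
    using tch[of t z] t that deltale delta0 unfolding P_def u_def by (simp add: algebra_simps)
  \<comment> \<open>In \<open>P\<close> the coefficient \<open>C + 1\<close> leaves room
    \<open>z^2\<close> above \<open>v\<close>. The further \<open>3 * z^2\<close> here absorbs the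
    polynomial correction \<open>z ^ 4 * W\<close>, as \<open>W\<close> is at most \<open>3\<close>
    near \<open>0\<close>.\<close>
  define Pu where "Pu z = V + p * z + (C + 4) * z^2" for z
  have Pu: "P z + 3 * z ^ 4 <= Pu z" if "abs z < delta" for z
  proof -
    have "abs z ^ 4 <= abs z^2" using that deltale by (intro power_decreasing) auto
    then show ?thesis by (simp add: P_def Pu_def algebra_simps)
  qed
  have EPu: "E_upper eps (Pu z - V) = eps / 2 * sgn (p * z)" if "z ~= 0" "abs z < delta" for z
    by (rule increment_sgn[OF eps _ _ _ _ p that, of _ "C + 4"]) (use delta C0 in \<open>auto simp: Pu_def\<close>)
  \<comment> \<open>The test function follows the parabola for \<open>abs z < r / 2\<close> and the
    regularization of \<open>v\<close> for \<open>r <= abs z\<close>, with an interpolation in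
    between.\<close>
  define theta where "theta z = min 1 (max 0 (2 * abs z / r - 1))" for z
  have theta: "0 <= theta z" "theta z <= 1" for z by (auto simp: theta_def)
  have theta1: "theta z = 1" if "r <= abs z" for z
  proof -
    have "1 <= 2 * abs z / r - 1" using that r(1) by (simp add: le_divide_eq)
    then show ?thesis by (simp add: theta_def)
  qed
  define eta where "eta k = 1 / (real k + 1)" for k :: nat
  have eta: "0 < eta k" "eta k <= 1" for k by (auto simp: eta_def)
  define g where "g k = supconv u k" for k
  have id: "real_polynomial_function (%z :: real. z)" by (intro real_polynomial_function.intros bounded_linear_ident)
  have Ppoly: "real_polynomial_function P" unfolding P_def[abs_def]
    by (intro real_polynomial_function.intros(2-4) real_polynomial_function_power id)
  have "ALL k. EX W. real_polynomial_function W &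
    (ALL z. abs z < r / 2 --> abs z <= rho --> 0 <= W z & W z <= 3 * eta k) &
    (ALL z. r / 2 <= abs z --> abs z <= rho + 1 --> (1 - theta z) * P z + theta z * (g k z + eta k) <= P z + z ^ 4 * W z) &
    (ALL z. r / 2 <= abs z --> abs z <= rho --> P z + z ^ 4 * W z <= (1 - theta z) * P z + theta z * (g k z + eta k) + 3 * eta k * z ^ 4) &
    (ALL z. rho + 1 <= abs z --> A + 1 <= P z + z ^ 4 * W z)" (is "ALL k. EX W. ?maj k W")
  proof
    fix k
    have gc: "continuous_on UNIV (g k)" unfolding g_def by (rule supconv_continuous[OF uA])
    show "EX W. ?maj k W"
      by (rule polynomial_majorant[OF gc Ppoly r(1) rho eta(1)[of k], of "A + 1", folded theta_def])
  qed
  then obtain W where W_all: "ALL k. ?maj k (W k)" by (rule choice[THEN exE])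
  define H where "H k z = P z + z ^ 4 * W k z" for k z
  note W_k = W_all[THEN spec] and c2 = conjunct2
  note Wp = W_k[THEN conjunct1] and W1 = W_k[THEN c2, THEN conjunct1, rule_format]
    and W2 = W_k[THEN c2, THEN c2, THEN conjunct1, rule_format, folded H_def]
    and W3 = W_k[THEN c2, THEN c2, THEN c2, THEN conjunct1, rule_format, folded H_def]
    and W4 = W_k[THEN c2, THEN c2, THEN c2, THEN c2, rule_format, folded H_def]
  have inner: "P z <= H k z" "H k z <= Pu z" if "abs z < r / 2" for k z
  proof -
    have "abs z <= rho" "abs z < delta" using that r deltale by auto
    then have W: "0 <= W k z" "W k z <= 3 * eta k" using W1[OF that] by blast+
    have "0 <= z ^ 4 * W k z" using W(1) by simp
    then show "P z <= H k z" unfolding H_def by linarith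
    have "z ^ 4 * W k z <= z ^ 4 * 3" using W eta(2)[of k] by (intro mult_left_mono) auto
    then show "H k z <= Pu z" using Pu[OF \<open>abs z < delta\<close>] unfolding H_def by linarith
  qed
  have low: "(1 - theta z) * P z + theta z * (g k z + eta k) <= H k z" if "r / 2 <= abs z" "abs z <= rho + 1" for k z
    by (rule W2[OF that])
  have high: "H k z <= (1 - theta z) * P z + theta z * (g k z + eta k) + 3 * eta k * z ^ 4" if "r / 2 <= abs z" "abs z <= rho" for k z
    by (rule W3[OF that])
  have far: "A + 1 <= H k z" if "rho + 1 <= abs z" for k z
    by (rule W4[OF that])
  \<comment> \<open>A uniform distance between the slice of \<open>v\<close> and the test function
    away from the contact point; it pays for the variation of \<open>v\<close> in a short time
    interval.\<close>
  define mu where "mu k = min ((r / 2)^2) (eta k)" for k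
  have mu: "0 < mu k" for k using r eta by (simp add: mu_def)
  have gu: "u z <= g k z" "g k z <= A" for k z unfolding g_def by (rule supconv_ge[OF uA], rule supconv_le[OF uA])
  have middle: "u z + mu k <= H k z" if z: "r / 2 <= abs z" "abs z <= rho + 1" for k z
  proof -
    have g1: "u z + mu k <= g k z + eta k" using gu(1)[of z k] by (simp add: mu_def)
    have "u z + mu k <= (1 - theta z) * P z + theta z * (g k z + eta k)"
    proof (cases "r <= abs z")
      case True
      then show ?thesis using g1 theta1 by simp
    next
      case False
      have "(r / 2)^2 <= abs z^2" using z r by (intro power_mono) auto
      then have "u z + mu k <= P z" using near[of z] False r by (simp add: mu_def)
      then have "(1 - theta z) * (u z + mu k) <= (1 - theta z) * P z" using theta[of z] by (intro mult_left_mono) auto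
      moreover have "theta z * (u z + mu k) <= theta z * (g k z + eta k)" using g1 theta[of z] by (intro mult_left_mono) auto
      moreover have "(1 - theta z) * (u z + mu k) + theta z * (u z + mu k) = u z + mu k" by (simp add: algebra_simps)
      ultimately show ?thesis by linarith
    qed
    then show ?thesis using low[OF z, of k] by linarith
  qed
  have ge: "- A <= H k z" for k z
  proof -
    consider "abs z < r / 2" | "r / 2 <= abs z" "abs z <= rho + 1" | "rho + 1 <= abs z" by linarith
    then show ?thesis
    proof cases
      case 1
      then have "u z + z^2 <= P z" using r by (intro near) simp
      moreover have "0 <= z^2" by simp
      ultimately show ?thesis using inner(1)[OF 1, of k] uA[of z] by linarith
    next
      case 2 then show ?thesis using middle[OF 2, of k] uA[of z] mu[of k] by linarith
    next
      case 3 then show ?thesis using far[OF 3, of k] A(1) by linarith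
    qed
  qed
  have H0: "H k 0 = V" for k by (simp add: H_def P_def)
  define Bd where "Bd = A + abs p * rho + (C + 1) * rho^2 + A + 1 + 3 * rho ^ 4"
  have le: "H k z <= Bd" if z: "abs z <= rho" for k z
  proof -
    have z2: "z^2 <= rho^2" "z ^ 4 <= rho ^ 4" using power_mono[OF z, of 2] power_mono[OF z, of 4] by auto
    have "p * z <= abs p * rho" using mult_left_mono[OF z, of "abs p"] abs_ge_self[of "p * z"] by (simp add: abs_mult)
    moreover have "(C + 1) * z^2 <= (C + 1) * rho^2" using z2 C0 by (intro mult_left_mono) auto
    moreover have "0 <= abs p * rho" "0 <= (C + 1) * rho^2" using rho C0 by auto
    ultimately have P: "P z <= A + abs p * rho + (C + 1) * rho^2" "0 <= abs p * rho + (C + 1) * rho^2" using VA unfolding P_def by linarith+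
    show ?thesis
    proof (cases "abs z < r / 2")
      case True
      then have "W k z <= 3 * eta k" using W1[OF _ z] by blast
      then have "z ^ 4 * W k z <= z ^ 4 * 3" using eta(2)[of k] by (intro mult_left_mono) auto
      then show ?thesis using P z2 A(1) unfolding H_def Bd_def by linarith
    next
      case False
      have "(1 - theta z) * P z <= (1 - theta z) * (A + abs p * rho + (C + 1) * rho^2 + 1)" using P theta[of z] by (intro mult_left_mono) auto
      moreover have "theta z * (g k z + eta k) <= theta z * (A + abs p * rho + (C + 1) * rho^2 + 1)"
        using gu(2)[of k z] eta(2)[of k] P(2) theta[of z] by (intro mult_left_mono) auto
      moreover have "3 * eta k * z ^ 4 <= 3 * 1 * rho ^ 4" using eta[of k] z2 by (intro mult_mono) auto
      moreover have "(1 - theta z) * (A + abs p * rho + (C + 1) * rho^2 + 1) + theta z * (A + abs p * rho + (C + 1) * rho^2 + 1)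
          = A + abs p * rho + (C + 1) * rho^2 + 1" by (simp add: algebra_simps)
      ultimately show ?thesis using high[of z k] False z A(1) unfolding Bd_def by linarith
    qed
  qed
  have "EX phi. C2_on Q phi & d_t phi t x = alpha & d_x phi t x = p & (ALL z. phi (t, x + z) = H k z) &
      (\<forall>q\<in>Q. v q - phi q <= v (t, x) - phi (t, x))" for k
  proof -
    have Hp: "real_polynomial_function (H k)" unfolding H_def[abs_def]
      by (intro real_polynomial_function.intros(2-4) real_polynomial_function_power id Ppoly Wp)
    obtain H' H'' where H': "!!z. (H k has_real_derivative H' z) (at z)" "!!z. (H' has_real_derivative H'' z) (at z)" "continuous_on UNIV H''"
      by (rule polynomial_derivatives[OF Hp]) (rule that)
    obtain W' where W': "(W k has_real_derivative W') (at 0)"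
      using has_real_derivative_polynomial_function[OF Wp] by blast
    have "(H k has_real_derivative p) (at 0)"
      unfolding H_def[abs_def] P_def by (auto intro!: derivative_eq_intros W')
    then have H'0: "H' 0 = p" using H'(1) DERIV_unique by blast
    define h where "h y = H k (y - x)" for y
    have h: "(h has_real_derivative H' (y - x)) (at y)" for y
      unfolding h_def[abs_def] using DERIV_shift[of "H k" "H' (y - x)" y "- x"] H'(1)[of "y - x"] by simp
    have h': "((%y. H' (y - x)) has_real_derivative H'' (y - x)) (at y)" for y
      using DERIV_shift[of H' "H'' (y - x)" y "- x"] H'(2)[of "y - x"] by simp
    have h'': "continuous_on UNIV (%y. H'' (y - x))"
      by (rule continuous_on_compose2[OF H'(3)]) (auto intro!: continuous_intros)
    have hc: "continuous_on S h" for S using h by (meson DERIV_isCont continuous_at_imp_continuous_on)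
    have tube: "EX d>0. ALL s y. 0 < s --> abs (s - t) < d --> a <= y --> y <= b --> v (s, y) < h y - mu k / 2"
      if "a <= b" "!!y. a <= y ==> y <= b ==> r / 2 <= abs (y - x) & abs (y - x) <= rho + 1" for a b
    proof (rule usc_below_continuous[OF us t _ that(1)])
      show "continuous_on {a..b} (%y. h y - mu k / 2)" by (intro continuous_intros hc)
      fix y assume "a <= y" "y <= b"
      then show "v (t, y) < h y - mu k / 2" using middle[of "y - x" k] that(2)[of y] mu[of k] unfolding h_def u_def by simp
    qed
    have "x - (rho + 1) <= x - r / 2" "x + r / 2 <= x + (rho + 1)" using r deltale by auto
    note ab = this
    have in1: "r / 2 <= abs (y - x) & abs (y - x) <= rho + 1" if "x - (rho + 1) <= y" "y <= x - r / 2" for y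
      using that r(1) by linarith
    have in2: "r / 2 <= abs (y - x) & abs (y - x) <= rho + 1" if "x + r / 2 <= y" "y <= x + (rho + 1)" for y
      using that r(1) by linarith
    obtain d1 where d1: "0 < d1" "!!s y. 0 < s ==> abs (s - t) < d1 ==> x - (rho + 1) <= y ==> y <= x - r / 2 ==> v (s, y) < h y - mu k / 2"
      using tube[OF ab(1) in1] by blast
    obtain d2 where d2: "0 < d2" "!!s y. 0 < s ==> abs (s - t) < d2 ==> x + r / 2 <= y ==> y <= x + (rho + 1) ==> v (s, y) < h y - mu k / 2"
      using tube[OF ab(2) in2] by blast
    \<comment> \<open>Within time \<open>d\<close> the linear term \<open>alpha * (s - t)\<close>
      uses at most half of \<open>mu k\<close>; for larger times the coefficient \<open>N\<close>
      takes over.\<close>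
    define d where "d = Min {d1, d2, delta0, mu k / (2 * (abs alpha + 1)), 1 / (abs alpha + 1)}"
    have d: "0 < d" using d1(1) d2(1) delta0 mu[of k] by (auto simp: d_def intro!: divide_pos_pos)
    have dle: "d <= d1" "d <= d2" "d <= delta0" "d <= mu k / (2 * (abs alpha + 1))" "d <= 1 / (abs alpha + 1)"
      unfolding d_def by (rule Min_le; simp)+
    have alphad: "abs alpha * d <= mu k / 2" "abs alpha * d <= 1"
    proof -
      have "(abs alpha + 1) * d <= mu k / 2" using dle(4) by (simp add: field_simps)
      moreover have "(abs alpha + 1) * d <= 1" using dle(5) by (simp add: field_simps)
      ultimately show "abs alpha * d <= mu k / 2" "abs alpha * d <= 1" using d unfolding distrib_right by linarith+
    qed
    obtain N where N: "C <= N" "0 <= N" "!!tau. d <= abs tau ==> 2 * A <= alpha * tau + N * tau^2"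
      using time_penalty[OF d less_imp_le[OF A(1)]] by blast
    let ?phi = "%(s, y). h y + alpha * (s - t) + N * (s - t)^2"
    have "v q - ?phi q <= v (t, x) - ?phi (t, x)" if "q \<in> Q" for q
    proof -
      obtain s y where q: "q = (s, y)" "0 < s" using \<open>q \<in> Q\<close> by (auto simp: Q_def)
      have N0: "0 <= N * (s - t)^2" using N(2) by simp
      have "v (s, y) <= h y + alpha * (s - t) + N * (s - t)^2"
      proof (cases "d <= abs (s - t)")
        case True
        then show ?thesis using N(3)[OF True] ge[of k "y - x"] A(2)[OF q(2), of y] unfolding h_def by linarith
      next
        case ds: False
        have as: "abs (alpha * (s - t)) <= abs alpha * d" unfolding abs_mult using ds by (intro mult_left_mono) auto
        consider "abs (y - x) < r / 2" | "rho + 1 <= abs (y - x)" | "x - (rho + 1) <= y" "y <= x - r / 2" | "x + r / 2 <= y" "y <= x + (rho + 1)"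
          by linarith
        then show ?thesis
        proof cases
          case 1
          have "v (s, x + (y - x)) <= V + alpha * (s - t) + p * (y - x) + C * ((s - t)^2 + (y - x)^2)"
            by (rule tch[OF q(2)]) (use ds dle 1 r deltale in linarith)+
          moreover have "x + (y - x) = y" by simp
          ultimately have "v (s, y) <= V + alpha * (s - t) + p * (y - x) + C * ((s - t)^2 + (y - x)^2)" by (simp only:)
          moreover have "P (y - x) <= h y" unfolding h_def by (rule inner(1)[OF 1])
          moreover have "C * (s - t)^2 <= N * (s - t)^2" using N by (intro mult_right_mono) auto
          moreover have "0 <= (y - x)^2" by simp
          ultimately show ?thesis unfolding P_def distrib_left distrib_right by linarith
        next
          case 2
          then show ?thesis using far[OF 2, of k] A(2)[OF q(2), of y] as alphad(2) N0 unfolding h_def by linarith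
        next
          case 3
          have "v (s, y) < h y - mu k / 2" by (rule d1(2)[OF q(2) _ 3]) (use ds dle in linarith)
          then show ?thesis using as alphad(1) N0 by linarith
        next
          case 4
          have "v (s, y) < h y - mu k / 2" by (rule d2(2)[OF q(2) _ 4]) (use ds dle in linarith)
          then show ?thesis using as alphad(1) N0 by linarith
        qed
      qed
      moreover have "h x = v (t, x)" using H0[of k] by (simp add: h_def V_def)
      ultimately show ?thesis by (simp add: q)
    qed
    moreover have "C2_on Q ?phi" "d_t ?phi t x = alpha" "d_x ?phi t x = p"
      using C2_separated(1)[OF h h' h''] C2_separated(2)[OF h h' h''] C2_separated(3)[OF h h' h''] H'0 by simp_all
    moreover have "?phi (t, x + z) = H k z" for z by (simp add: h_def)
    ultimately show ?thesis by (intro exI[of _ ?phi]) blast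
  qed
  then have "EX Phi. ALL k. C2_on Q (Phi k) & d_t (Phi k) t x = alpha & d_x (Phi k) t x = p & (ALL z. Phi k (t, x + z) = H k z) &
      (\<forall>q\<in>Q. v q - Phi k q <= v (t, x) - Phi k (t, x))"
    by (intro choice allI)
  then obtain Phi where Phi: "!!k. C2_on Q (Phi k)" "!!k. d_t (Phi k) t x = alpha" "!!k. d_x (Phi k) t x = p"
    "!!k z. Phi k (t, x + z) = H k z" "!!k. \<forall>q\<in>Q. v q - Phi k q <= v (t, x) - Phi k (t, x)" by blast
  define f where "f k = test_jump eps rho (Phi k) v t x" for k
  have fz: "f k z = (if abs z < rho then E_upper eps (H k z - V) else jump eps v t x z)" for k z
    using Phi(4)[of k 0] by (simp add: f_def test_jump_def Phi(4) H0)
  have Bd0: "0 <= Bd" using rho A(1) C0(1) by (simp add: Bd_def)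
  define Bf where "Bf = Bd + 2 * A + eps / 2"
  have fB: "abs (f k z) <= Bf" for k z
  proof (cases "abs z < rho")
    case True
    have "H k z <= Bd" by (rule le) (use True in simp)
    then have "abs (H k z - V) <= Bd + 2 * A" using ge[of k z] VA Bd0 by linarith
    then show ?thesis using E_upper_bounds(3)[OF eps, of "H k z - V"] True by (simp add: fz Bf_def)
  next
    case False
    have "abs (jump eps v t x z) <= 2 * A + eps / 2" by (rule jump_bound[OF eps _ t]) (rule A(2))
    then show ?thesis using False Bd0 by (simp add: fz Bf_def)
  qed
  have fm: "f k \<in> borel_measurable borel" and fk: "alpha <= abs p * kint (r / 2) (f k)" for k
  proof -
    have p': "d_x (Phi k) t x ~= 0" using p Phi(3) by simp
    show m: "f k \<in> borel_measurable borel" unfolding f_def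
      by (rule hamiltonian_test_jump[OF eps rho Phi(1) t usc_on_slice_measurable[OF us t] A(2)[OF t] p'])
    show "alpha <= abs p * kint (r / 2) (f k)"
    proof (rule hamiltonian_test_jump[OF eps rho Phi(1) t usc_on_slice_measurable[OF us t] A(2)[OF t] p'])
      fix r1 :: real
      assume r1: "0 < r1" "!!r. 0 < r ==> r < r1 ==>
        hamiltonian (E_upper eps) rho (Phi k) v t x = abs (d_x (Phi k) t x) * kint r (test_jump eps rho (Phi k) v t x)"
      define s where "s = min (r1 / 2) (r / 2)"
      have s: "0 < s" "s < r1" "s <= r / 2" using r1(1) r(1) by (auto simp: s_def)
      have "(t, x) \<in> Q" using t by (simp add: Q_def)
      then have "d_t (Phi k) t x <= hamiltonian (E_upper eps) rho (Phi k) v t x"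
        using sub Phi(1,5) p' unfolding subsolution_def by blast
      also have "\<dots> = abs p * kint s (f k)" unfolding r1(2)[OF s(1,2)] by (simp add: Phi(3) f_def)
      also have "\<dots> <= abs p * kint (r / 2) (f k)"
      proof (rule mult_left_mono[OF kint_sgn_le[OF s(1,3) m fB]])
        fix z assume z: "s <= abs z" "abs z < r / 2"
        have "f k z = E_upper eps (H k z - V)" using z r deltale by (simp add: fz)
        also have "\<dots> <= E_upper eps (Pu z - V)" using inner(2)[OF z(2), of k] by (intro E_upper_mono[OF eps]) simp
        also have "\<dots> = eps / 2 * sgn (p * z)" using z s r by (intro EPu) auto
        finally show "f k z <= eps / 2 * sgn (p * z)" .
      qed simp
      finally show ?thesis by (simp add: Phi(2))
    qed
  qed
  \<comment> \<open>An upper bound for the upper limit of the integrands \<open>f k\<close>: the odd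
    function inside \<open>r\<close>, which integrates to zero, and the jumps of \<open>v\<close>
    outside.\<close>
  define G where "G z = (if abs z < r then eps / 2 * sgn (p * z) else jump eps v t x z)" for z
  have jm: "jump eps v t x \<in> borel_measurable borel" by (rule jump_measurable[OF us t])
  have jb: "abs (jump eps v t x z) <= 2 * A + eps / 2" for z by (rule jump_bound[OF eps _ t]) (rule A(2))
  have Gm: "G \<in> borel_measurable borel" unfolding G_def[abs_def] using jm by measurable
  have GB: "abs (G z) <= Bf" for z
  proof (cases "abs z < r")
    case True
    have "abs (eps / 2 * sgn (p * z)) <= eps / 2 * 1" unfolding abs_mult using eps by (intro mult_mono) (auto simp: sgn_if)
    then show ?thesis using True Bd0 A(1) by (simp add: G_def Bf_def)
  next
    case False
    then show ?thesis using jb[of z] Bd0 by (simp add: G_def Bf_def)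
  qed
  have eta0: "(%k. eta k * c) \<longlonglongrightarrow> 0" for c
  proof -
    have "eta \<longlonglongrightarrow> 0" unfolding eta_def using LIMSEQ_inverse_real_of_nat by (simp add: inverse_eq_divide add.commute)
    then show ?thesis using tendsto_mult_left_zero by blast
  qed
  have lim: "eventually (%k. H k z <= (1 - theta z) * P z + theta z * (u z + e) + e) sequentially"
    if z: "r / 2 <= abs z" "abs z <= rho" and e: "0 < e" for z e
  proof -
    have "eventually (%k. g k z <= u z + e / 2) sequentially"
      unfolding g_def by (rule supconv_lim[OF uA uus]) (use e in auto)
    moreover have "eventually (%k. eta k * 1 < e / 2) sequentially" by (rule order_tendstoD(2)[OF eta0]) (use e in simp)
    moreover have "eventually (%k. eta k * (3 * z ^ 4) < e) sequentially" by (rule order_tendstoD(2)[OF eta0 e])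
    ultimately show ?thesis
    proof eventually_elim
      case (elim k)
      have "theta z * (g k z + eta k) <= theta z * (u z + e)" using elim theta[of z] by (intro mult_left_mono) auto
      then show ?case using high[OF z, of k] elim(3) by (simp add: algebra_simps)
    qed
  qed
  have fG: "eventually (%k. f k z <= G z + e) sequentially" if z: "r / 2 < abs z" and e: "0 < e" for z e
  proof (cases "abs z < rho")
    case zrho: True
    show ?thesis
    proof (cases "abs z < r")
      case True
      have z0: "0 < z^2" using z r by auto
      define e1 where "e1 = min (z^2) (3 * z ^ 4)"
      have e1: "0 < e1" "e1 <= z^2" "e1 <= 3 * z ^ 4" using z r by (auto simp: e1_def)
      have "u z + e1 <= P z" using near[of z] True r e1 by linarith
      then have "theta z * (u z + e1) <= theta z * P z" using theta by (intro mult_left_mono) auto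
      then have bound: "(1 - theta z) * P z + theta z * (u z + e1) + e1 <= Pu z"
        using Pu[of z] True r e1(3) by (simp add: algebra_simps)
      have "eventually (%k. H k z <= Pu z) sequentially"
        using lim[of z e1] z zrho e1(1) by (auto elim!: eventually_mono intro: order_trans[OF _ bound])
      then show ?thesis
      proof eventually_elim
        case (elim k)
        then have "f k z <= E_upper eps (Pu z - V)" using zrho by (simp add: fz E_upper_mono[OF eps])
        also have "\<dots> = eps / 2 * sgn (p * z)" using z r True by (intro EPu) auto
        finally show ?case using True e by (simp add: G_def)
      qed
    next
      case False
      obtain xi where xi: "0 < xi" "!!b. b < u z - V + xi ==> E_upper eps b <= E_upper eps (u z - V)"
        by (rule E_upper_usc[OF eps, of "u z - V"]) (rule that)
      have "eventually (%k. H k z <= (1 - theta z) * P z + theta z * (u z + xi / 3) + xi / 3) sequentially"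
        by (rule lim) (use z zrho xi in auto)
      then show ?thesis
      proof eventually_elim
        case (elim k)
        then have "H k z - V < u z - V + xi" using theta1[of z] False xi(1) by simp
        from xi(2)[OF this] show ?case using False zrho e by (simp add: fz G_def jump_def u_def V_def)
      qed
    qed
  next
    case False
    then have "f k z <= G z + e" for k using e r deltale by (simp add: fz G_def)
    then show ?thesis by simp
  qed
  have r2: "0 < r / 2" using r by simp
  have "alpha <= abs p * kint (r / 2) G"
  proof (rule field_le_epsilon)
    fix e :: real assume e: "0 < e"
    have "0 < e / abs p" using e p by simp
    from kint_limsup[OF r2 fm fB Gm GB fG this]
    obtain k where "kint (r / 2) (f k) <= kint (r / 2) G + e / abs p"
      using eventually_sequentially by auto
    then have "abs p * kint (r / 2) (f k) <= abs p * (kint (r / 2) G + e / abs p)" by (intro mult_left_mono) auto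
    also have "\<dots> = abs p * kint (r / 2) G + e" using p by (simp add: distrib_left)
    finally show "alpha <= abs p * kint (r / 2) G + e" using fk[of k] by linarith
  qed
  also have "\<dots> <= abs p * kint r (jump eps v t x)"
  proof (rule mult_left_mono)
    have "kint (r / 2) G <= kint r G"
      by (rule kint_sgn_le[OF r2 _ Gm GB, of _ "eps / 2" p]) (use r in \<open>auto simp: G_def\<close>)
    also have "\<dots> = kint r (jump eps v t x)" by (rule kint_cong) (simp add: G_def)
    finally show "kint (r / 2) G <= kint r (jump eps v t x)" .
  qed simp
  finally show ?thesis using r by blast
qed

text \<open>As \<open>jsub\<close> does not mention \<open>rho\<close>, this also contains the
  independence of the notion of solution from \<open>rho\<close>.\<close>

theorem subsolution_iff_jsub:
  assumes "0 < eps" "0 < rho"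
  shows "subsolution rho eps v \<longleftrightarrow> jsub eps v"
proof
  assume sub: "subsolution rho eps v"
  have "bounded (v ` Q)" "usc_on Q v" using sub unfolding subsolution_def by blast+
  then show "jsub eps v" unfolding jsub_def using subsolution_strong[OF sub assms] subsolution_flat[OF sub] by blast
qed (rule jsub_imp_subsolution[OF _ assms])

section \<open>Existence and uniqueness\<close>

lemma Limsup_ereal_eqI:
  fixes u :: "'a => real"
  assumes "!!c. a < c ==> eventually (%q. u q < c) F" "!!c. c < a ==> frequently (%q. c < u q) F"
  shows "Limsup F (%q. ereal (u q)) = ereal a"
proof (rule order_antisym; rule ccontr)
  assume "~ Limsup F (%q. ereal (u q)) <= ereal a"
  then obtain c where c: "ereal a < ereal c" "ereal c < Limsup F (%q. ereal (u q))"
    using ereal_dense2[of "ereal a"] by (auto simp: not_le)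
  from assms(1)[of c] c(1) have "eventually (%q. ereal (u q) <= ereal c) F"
    by (auto elim: eventually_mono)
  then have "Limsup F (%q. ereal (u q)) <= ereal c" by (rule Limsup_bounded)
  with c(2) show False by simp
next
  assume "~ ereal a <= Limsup F (%q. ereal (u q))"
  then obtain c where c: "Limsup F (%q. ereal (u q)) < ereal c" "ereal c < ereal a"
    using ereal_dense2[of _ "ereal a"] by (auto simp: not_le)
  from Limsup_lessD[OF c(1)] have "eventually (%q. ~ c < u q) F" by (rule eventually_mono) auto
  moreover have "frequently (%q. c < u q) F" using assms(2) c(2) by simp
  ultimately show False by (simp add: frequently_def)
qed

text \<open>For \<open>t = 0\<close> the condition \<open>0 < s\<close> turns the boxes into
  one-sided neighbourhoods, so one description serves interior and initial points.\<close>

lemma eventually_Q: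
  "eventually P (inf (nhds (t, x)) (principal Q)) \<longleftrightarrow>
    (EX d>0. ALL s y. 0 < s --> abs (s - t) < d --> abs (y - x) < d --> P (s, y))" (is "_ \<longleftrightarrow> ?R")
proof
  assume "eventually P (inf (nhds (t, x)) (principal Q))"
  then obtain d where d: "0 < d" "!!q. dist q (t, x) < d ==> q \<in> Q ==> P q"
    unfolding eventually_inf_principal eventually_nhds_metric by blast
  have "P (s, y)" if "0 < s" "abs (s - t) < d / 2" "abs (y - x) < d / 2" for s y
  proof (rule d(2))
    have "dist (s, y) (t, x) <= abs (s - t) + abs (y - x)"
      unfolding dist_Pair_Pair dist_real_def by (rule order_trans[OF sqrt_sum_squares_le_sum_abs]) simp
    then show "dist (s, y) (t, x) < d" using that by linarith
  qed (use that in \<open>simp add: Q_def\<close>)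
  then show ?R using d(1) by (intro exI[of _ "d / 2"]) auto
next
  assume ?R
  then obtain d where d: "0 < d" "!!s y. 0 < s ==> abs (s - t) < d ==> abs (y - x) < d ==> P (s, y)" by blast
  have "P q" if "dist q (t, x) < d" "q \<in> Q" for q
  proof -
    obtain s y where q: "q = (s, y)" by (cases q)
    have "abs (s - t) < d" "abs (y - x) < d"
      using dist_fst_le[of q "(t, x)"] dist_snd_le[of q "(t, x)"] that(1) by (auto simp: q dist_real_def)
    then show ?thesis using d(2) that(2) by (simp add: q Q_def)
  qed
  then show "eventually P (inf (nhds (t, x)) (principal Q))"
    unfolding eventually_inf_principal eventually_nhds_metric using d(1) by blast
qed

lemma usc_envelope_Q_eqI:
  assumes "!!c. a < c ==> EX d>0. ALL s y. 0 < s --> abs (s - t) < d --> abs (y - x) < d --> u (s, y) < c"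
    and "!!c d. c < a ==> 0 < d ==> EX s y. 0 < s & abs (s - t) < d & abs (y - x) < d & c < u (s, y)"
  shows "usc_envelope Q u (t, x) = ereal a"
  unfolding usc_envelope_def
proof (rule Limsup_ereal_eqI)
  show "eventually (%q. u q < c) (inf (nhds (t, x)) (principal Q))" if "a < c" for c
    unfolding eventually_Q using assms(1)[OF that] .
  show "frequently (%q. c < u q) (inf (nhds (t, x)) (principal Q))" if "c < a" for c
    unfolding frequently_def eventually_Q using assms(2)[OF that] by (metis)
qed

lemma usc_envelope_Q_less:
  assumes "usc_envelope Q u (t, x) = ereal a" "a < c"
  shows "EX d>0. ALL s y. 0 < s --> abs (s - t) < d --> abs (y - x) < d --> u (s, y) < c"
proof -
  have "Limsup (inf (nhds (t, x)) (principal Q)) (%q. ereal (u q)) < ereal c"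
    using assms by (simp add: usc_envelope_def)
  from Limsup_lessD[OF this] show ?thesis by (simp add: eventually_Q)
qed

lemma lsc_envelope_uminus: "lsc_envelope S u p = - usc_envelope S (%q. - u q) p"
  unfolding lsc_envelope_def usc_envelope_def by (simp add: ereal_Limsup_uminus flip: uminus_ereal.simps)

lemma usc_envelope_ge:
  assumes "usc_envelope Q u (t, x) = ereal a" "0 < t"
  shows "u (t, x) <= a"
proof (rule ccontr)
  assume "~ u (t, x) <= a"
  then obtain d where "0 < d" "ALL s y. 0 < s --> abs (s - t) < d --> abs (y - x) < d --> u (s, y) < u (t, x)"
    using usc_envelope_Q_less[OF assms(1), of "u (t, x)"] by auto
  then have "u (t, x) < u (t, x)" using assms(2) by (metis abs_zero cancel_comm_monoid_add_class.diff_cancel)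
  then show False by simp
qed

text \<open>A bound for \<open>v\<close> near \<open>(0, x)\<close> holds around every point close
  by and so passes to the envelope there; the slack between \<open>c'\<close> and \<open>c\<close>
  keeps the inequality strict.\<close>

lemma starts_below_envelope:
  assumes v: "!!x. usc_envelope Q v (0, x) = ereal (g x)" and V: "!!t x. 0 < t ==> usc_envelope Q v (t, x) = ereal (V (t, x))"
  shows "starts_below V g"
  unfolding starts_below_def
proof (intro allI impI)
  fix x c assume "g x < c"
  then obtain c' where c': "g x < c'" "c' < c" using dense by blast
  obtain d where d: "0 < d" "!!s y. 0 < s ==> abs (s - 0) < d ==> abs (y - x) < d ==> v (s, y) < c'"
    using usc_envelope_Q_less[OF v c'(1)] by blast
  have "V (t, y) < c" if h: "0 < t" "t < d" "abs (y - x) < d" for t y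
  proof (rule ccontr)
    assume "~ V (t, y) < c"
    then have "c' < V (t, y)" using c'(2) by simp
    have "Limsup (inf (nhds (t, y)) (principal Q)) (%q. ereal (v q)) <= ereal c'"
    proof (rule Limsup_bounded)
      define k where "k = min t (min (d - t) (d - abs (y - x)))"
      have k: "0 < k" "k <= d - t" "k <= d - abs (y - x)" using h by (auto simp: k_def)
      have "v (s, z) < c'" if "0 < s" "abs (s - t) < k" "abs (z - y) < k" for s z
        using that k by (intro d(2)) linarith+
      then show "eventually (%q. ereal (v q) <= ereal c') (inf (nhds (t, y)) (principal Q))"
        unfolding eventually_Q using k(1) by (intro exI[of _ k]) (auto simp: less_imp_le)
    qed
    then show False using V[OF h(1), of y] \<open>c' < V (t, y)\<close> by (simp add: usc_envelope_def)
  qed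
  then show "EX d>0. ALL t y. 0 < t --> t < d --> abs (y - x) < d --> V (t, y) < c" using d(1) by blast
qed

text \<open>\<open>S\<close> is a step function, \<open>Sm\<close> its left limit and \<open>T\<close> bounds its variation.\<close>

locale step_datum =
  fixes eps G B :: real and S Sm T :: "real => real" and Y :: "real set"
  assumes eps: "0 < eps" and G0: "0 <= G" and G_int: "G / eps \<in> \<int>"
    and S_bound: "!!x. abs (S x) <= G" "!!x. abs (Sm x) <= G" and S_int: "!!x. S x / eps \<in> \<int>" "!!x. Sm x / eps \<in> \<int>"
    and sides: "!!x. EX r>0. ALL y. (x - r <= y --> y < x --> S y = Sm x & Sm y = Sm x) &
      (x < y --> y <= x + r --> S y = S x & Sm y = S x)"
    and finY: "finite Y" and no_jump: "!!x. x \<notin> Y ==> Sm x = S x"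
    and T: "mono T" "!!x. 0 <= T x" "!!x. T x <= B" "!!x x'. x < x' ==> abs (S x' - S x) <= eps * (T x' - T x)"
begin

definition g where "g x = max (Sm x) (S x)"
definition l where "l x = min (Sm x) (S x)"

text \<open>The symmetry of the datum under negation, which lets statements about supersolutions be
  read off from those about subsolutions.\<close>

lemma uminus: "step_datum eps G B (%x. - S x) (%x. - Sm x) T Y"
proof
  show "abs (- S x) <= G" "abs (- Sm x) <= G" for x using S_bound by simp_all
  show "- S x / eps \<in> \<int>" "- Sm x / eps \<in> \<int>" for x using S_int Ints_minus by (simp_all flip: minus_divide_left)
  show "EX r>0. ALL y. (x - r <= y --> y < x --> - S y = - Sm x & - Sm y = - Sm x) &
      (x < y --> y <= x + r --> - S y = - S x & - Sm y = - S x)" for x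
    using sides[of x] by simp
  show "abs (- S x' - - S x) <= eps * (T x' - T x)" if "x < x'" for x x' using T(4)[OF that] by (simp add: abs_minus_commute)
qed (use eps G0 G_int finY no_jump T in auto)

lemma near:
  obtains r where "0 < r" "!!y. x - r <= y ==> y < x ==> S y = Sm x & Sm y = Sm x"
    "!!y. x < y ==> y <= x + r ==> S y = S x & Sm y = S x"
  using sides[of x] by blast

lemma g_usc: "EX r>0. ALL y. abs (y - x) <= r --> g y <= g x"
  and l_lsc: "EX r>0. ALL y. abs (y - x) <= r --> l x <= l y"
proof -
  obtain r where r: "0 < r" "!!y. x - r <= y ==> y < x ==> S y = Sm x & Sm y = Sm x"
    "!!y. x < y ==> y <= x + r ==> S y = S x & Sm y = S x" by (rule near[where x = x]) (rule that)
  have "g y <= g x & l x <= l y" if "abs (y - x) <= r" for y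
    using r(2)[of y] r(3)[of y] that by (cases y x rule: linorder_cases) (auto simp: g_def l_def)
  then show "EX r>0. ALL y. abs (y - x) <= r --> g y <= g x" "EX r>0. ALL y. abs (y - x) <= r --> l x <= l y"
    using r(1) by blast+
qed

lemma perron_g: "perron eps G g"
proof
  show "abs (g x) <= G" for x using S_bound[of x] by (simp add: g_def max_def)
  show "g x / eps \<in> \<int>" for x using S_int[of x] by (simp add: g_def max_def)
qed (use eps G0 G_int g_usc in auto)

lemma perron_l: "perron eps G (%x. - l x)"
proof
  show "abs (- l x) <= G" for x using S_bound[of x] by (simp add: l_def min_def)
  show "- l x / eps \<in> \<int>" for x using S_int[of x] Ints_minus by (simp add: l_def min_def flip: minus_divide_left)
  show "EX r>0. ALL y. abs (y - x) <= r --> - l y <= - l x" for x using l_lsc[of x] by simp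
qed (use eps G0 G_int in auto)

definition U where "U = max_sub eps G g"
text \<open>Since \<open>W'\<close> is the maximal subsolution below \<open>- l\<close>, the
  function \<open>- W'\<close> is the minimal supersolution above \<open>l\<close>.\<close>

definition W' where "W' = max_sub eps G (%x. - l x)"

lemma U_facts: "jsub eps U" "starts_below U g" "0 < t ==> abs (U (t, x)) <= G" "0 < t ==> U (t, x) / eps \<in> \<int>"
    "v \<in> perron_class eps G g ==> 0 < t ==> v (t, x) <= U (t, x)"
  unfolding U_def by (fact perron.max_sub_jsub[OF perron_g] perron.max_sub_starts[OF perron_g] perron.max_sub_bound[OF perron_g]
      perron.max_sub_int[OF perron_g] perron.max_sub_upper[OF perron_g])+

lemma W'_facts: "jsub eps W'" "starts_below W' (%x. - l x)" "0 < t ==> abs (W' (t, x)) <= G" "0 < t ==> W' (t, x) / eps \<in> \<int>"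
    "v \<in> perron_class eps G (%x. - l x) ==> 0 < t ==> v (t, x) <= W' (t, x)"
  unfolding W'_def by (fact perron.max_sub_jsub[OF perron_l] perron.max_sub_starts[OF perron_l] perron.max_sub_bound[OF perron_l]
      perron.max_sub_int[OF perron_l] perron.max_sub_upper[OF perron_l])+

text \<open>The bump construction for \<open>U\<close> produces the subsolution \<open>N\<close>
  with \<open>- U <= N\<close>. It starts below \<open>- l\<close>, hence lies below the largest
  such function \<open>W'\<close>.\<close>

lemma ordered:
  assumes "0 < t" shows "- W' (t, x) <= U (t, x)"
proof -
  interpret perron eps G g by (rule perron_g)
  have lb: "abs (l x) <= G" "l x <= g x" for x using S_bound[of x] by (auto simp: l_def g_def min_def)
  have "N \<in> perron_class eps G (%x. - l x)"
    unfolding perron_class_def using N_jsub N_bound N_starts_below[OF lb l_lsc] by blast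
  then have "N (t, x) <= W' (t, x)" by (rule W'_facts(5)[OF _ assms])
  moreover have "- U (t, x) <= N (t, x)" unfolding U_def by (rule N_ge[OF assms])
  ultimately show ?thesis by simp
qed

lemma start_near:
  assumes "0 < e"
  shows "EX h>0. ALL t y. 0 < t --> t < h --> abs (y - x) < h --> U (t, y) < g x + e & - W' (t, y) > l x - e"
proof -
  obtain h1 where h1: "0 < h1" "!!t y. 0 < t ==> t < h1 ==> abs (y - x) < h1 ==> U (t, y) < g x + e"
    using starts_belowD[OF U_facts(2), of x "g x + e"] assms by auto
  obtain h2 where h2: "0 < h2" "!!t y. 0 < t ==> t < h2 ==> abs (y - x) < h2 ==> W' (t, y) < - l x + e"
    using starts_belowD[OF W'_facts(2), of x "- l x + e"] assms by auto
  have "U (t, y) < g x + e & - W' (t, y) > l x - e" if "0 < t" "t < min h1 h2" "abs (y - x) < min h1 h2" for t y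
    using h1(2)[of t y] h2(2)[of t y] that by simp
  then show ?thesis using h1(1) h2(1) by (intro exI[of _ "min h1 h2"]) simp
qed

lemma start_int:
  "EX h>0. ALL t y. 0 < t --> t < h --> abs (y - x) < h --> U (t, y) <= g x & l x <= - W' (t, y)"
proof -
  obtain h where h: "0 < h" "!!t y. 0 < t ==> t < h ==> abs (y - x) < h ==> U (t, y) < g x + eps & - W' (t, y) > l x - eps"
    using start_near[OF eps, of x] by blast
  have "U (t, y) <= g x & l x <= - W' (t, y)" if th: "0 < t" "t < h" "abs (y - x) < h" for t y
  proof -
    have "U (t, y) <= g x"
      by (rule int_multiple_le[OF eps U_facts(4)[OF th(1)] perron.g_int[OF perron_g]]) (use h(2)[OF th] in simp)
    moreover have "W' (t, y) <= - l x"
      by (rule int_multiple_le[OF eps W'_facts(4)[OF th(1)] perron.g_int[OF perron_l]]) (use h(2)[OF th] in simp)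
    ultimately show ?thesis by simp
  qed
  then show ?thesis using h(1) by blast
qed

text \<open>By integrality, \<open>U <= g\<close> and \<open>l <= - W'\<close> hold exactly for a
  short time near each point, and \<open>g = l\<close> off \<open>Y\<close>. This is the
  configuration from which \<open>no_fattening\<close> starts.\<close>

lemma no_gap:
  assumes "0 < t" "0 < eta"
  shows "EX t' x'. 0 < t' & abs (t' - t) < eta & abs (x' - x) < eta & U (t, x) <= - W' (t', x')"
proof -
  interpret P: ordered_pair eps G U "%q. - W' q"
  proof
    show "jsub eps (%q. - (- W' q))" using W'_facts(1) by simp
    show "abs (- W' (t, x)) <= G" if "0 < t" for t x using W'_facts(3)[OF that] by simp
    show "- W' (t, x) / eps \<in> \<int>" if "0 < t" for t x using Ints_minus[OF W'_facts(4)[OF that, of x]] by simp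
  qed (use eps U_facts ordered in auto)
  have reg: "P.regular_at 0 S x" if "x \<notin> Y" for x
  proof -
    obtain r where r: "0 < r" "!!y. x - r <= y ==> y < x ==> S y = Sm x & Sm y = Sm x"
      "!!y. x < y ==> y <= x + r ==> S y = S x & Sm y = S x" by (rule near[where x = x]) (rule that)
    obtain h where h: "0 < h" "!!t y. 0 < t ==> t < h ==> abs (y - x) < h ==> U (t, y) <= g x & l x <= - W' (t, y)"
      using start_int by blast
    have gl: "g x = S x" "l x = S x" using no_jump[OF that] by (auto simp: g_def l_def)
    show ?thesis unfolding P.regular_at_def
    proof (intro exI[of _ "min r h"] conjI allI impI)
      show "0 < min r h" using r h by simp
      fix y assume y: "abs (y - x) < min r h"
      show "S y = S x" using r(2)[of y] r(3)[of y] y no_jump[OF that] by (cases y x rule: linorder_cases) auto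
      fix t :: real assume "0 < t" "t < 0 + min r h"
      then show "U (t, y) <= S x" "S x <= - W' (t, y)" using h(2)[of t y] y gl by auto
    qed
  qed
  have sing: "P.singular_at 0 S y" for y
  proof -
    obtain r where r: "0 < r" "!!z. y - r <= z ==> z < y ==> S z = Sm y & Sm z = Sm y"
      "!!z. y < z ==> z <= y + r ==> S z = S y & Sm z = S y" by (rule near[where x = y]) (rule that)
    obtain h where h: "0 < h" "!!t z. 0 < t ==> t < h ==> abs (z - y) < h ==> U (t, z) <= g y & l y <= - W' (t, z)"
      using start_int by blast
    show ?thesis unfolding P.singular_at_def
    proof (intro exI[of _ "min r h"] conjI allI impI)
      show "0 < min r h" using r h by simp
      fix t x x1 x2
      assume a: "0 < t" "t < 0 + min r h" "abs (x - y) < min r h" "y - min r h < x1" "x1 < y" "y < x2" "x2 < y + min r h"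
      have "S x1 = Sm y" "S x2 = S y" using r(2)[of x1] r(3)[of x2] a by auto
      then show "U (t, x) <= max (S x1) (S x2)" "min (S x1) (S x2) <= - W' (t, x)"
        using h(2)[of t x] a by (auto simp: g_def l_def)
    qed
  qed
  have "P.config B 0 Y S"
    unfolding P.config_def P.variation_by_def using reg sing finY T by blast
  from P.no_fattening[OF this assms(1)] show ?thesis
    unfolding P.unfattened_def using assms(2) by blast
qed

text \<open>For the negated datum the roles of \<open>U\<close> and \<open>W'\<close> are
  exchanged.\<close>

lemma no_gap':
  assumes "0 < t" "0 < eta"
  shows "EX t' x'. 0 < t' & abs (t' - t) < eta & abs (x' - x) < eta & U (t', x') <= - W' (t, x)"
proof -
  interpret neg: step_datum eps G B "%x. - S x" "%x. - Sm x" T Y by (rule uminus)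
  have "neg.g = (%x. - l x)" "neg.l = (%x. - g x)"
    by (auto simp: neg.g_def neg.l_def g_def l_def fun_eq_iff max_def min_def)
  then have "neg.U = W'" "neg.W' = U" by (simp_all add: neg.U_def neg.W'_def U_def W'_def)
  with neg.no_gap[OF assms, of x] show ?thesis by force
qed

text \<open>Any solution lies between \<open>-W'\<close> and \<open>U\<close> by maximality, and the two statements above leave its
  envelopes no choice.\<close>

lemma solution_envelopes:
  assumes rho: "0 < rho" and sol: "viscosity_solution rho eps v"
    and init: "!!x. usc_envelope Q v (0, x) = ereal (g x)" "!!x. lsc_envelope Q v (0, x) = ereal (l x)" and "0 < t"
  shows "usc_envelope Q v (t, x) = ereal (U (t, x))" "lsc_envelope Q v (t, x) = ereal (- W' (t, x))"
proof -
  obtain V where V: "!!p. p \<in> Q ==> usc_envelope Q v p = ereal (V p)" "subsolution rho eps V"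
    using sol unfolding viscosity_solution_def by blast
  obtain L where L: "!!p. p \<in> Q ==> lsc_envelope Q v p = ereal (L p)" "supersolution rho eps L"
    using sol unfolding viscosity_solution_def by blast
  have V': "usc_envelope Q v (t, x) = ereal (V (t, x))" if "0 < t" for t x using V(1) that by (simp add: Q_def)
  have L': "usc_envelope Q (%q. - v q) (t, x) = ereal (- L (t, x))" if "0 < t" for t x
  proof -
    have "- usc_envelope Q (%q. - v q) (t, x) = ereal (L (t, x))"
      using L(1)[of "(t, x)"] that unfolding lsc_envelope_uminus by (simp add: Q_def)
    then show ?thesis by (metis ereal_uminus_uminus uminus_ereal.simps(1))
  qed
  have l0: "usc_envelope Q (%q. - v q) (0, x) = ereal (- l x)" for x
    using init(2)[of x] unfolding lsc_envelope_uminus by (metis ereal_uminus_uminus uminus_ereal.simps(1))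
  have jV: "jsub eps V" using V(2) subsolution_iff_jsub[OF eps rho] by simp
  have jL: "jsub eps (%q. - L q)" using L(2) supersolution_uminus[OF eps rho] subsolution_iff_jsub[OF eps rho] by simp
  have sV: "starts_below V g" by (rule starts_below_envelope[OF init(1) V'])
  have sL: "starts_below (%q. - L q) (%x. - l x)" by (rule starts_below_envelope[OF l0 L'])
  have LvV: "L (t, x) <= v (t, x)" "v (t, x) <= V (t, x)" if "0 < t" for t x
    using usc_envelope_ge[OF V'[OF that] that] usc_envelope_ge[OF L'[OF that] that] by simp_all
  have gG: "g y <= G" "- l y <= G" for y using perron.g_bound[OF perron_g, of y] perron.g_bound[OF perron_l, of y] by auto
  have VG: "V (t, x) <= G" if "0 < t" for t x by (rule starts_below_bound[OF jV eps sV gG(1) that])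
  have LG: "- L (t, x) <= G" if "0 < t" for t x by (rule starts_below_bound[OF jL eps sL gG(2) that])
  have bV: "abs (V (t, x)) <= G" "abs (- L (t, x)) <= G" if "0 < t" for t x
    using VG[OF that, of x] LG[OF that, of x] LvV[OF that, of x] by linarith+
  have VU: "V (t, x) <= U (t, x)" if "0 < t" for t x
    by (rule U_facts(5)[OF _ that]) (use jV bV sV in \<open>auto simp: perron_class_def\<close>)
  have LW: "- L (t, x) <= W' (t, x)" if "0 < t" for t x
    by (rule W'_facts(5)[OF _ that, of "%q. - L q"]) (use jL bV(2) sL in \<open>auto simp: perron_class_def\<close>)
  \<comment> \<open>Otherwise \<open>v < U (t, x)\<close> near \<open>(t, x)\<close>. But
    \<open>no_gap\<close> finds a nearby point where \<open>- W'\<close> is at least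
    \<open>U (t, x)\<close>, and there \<open>- W' <= L <= v\<close>.\<close>
  have "U (t, x) <= V (t, x)"
  proof (rule ccontr)
    assume "~ U (t, x) <= V (t, x)"
    then have "V (t, x) < U (t, x)" by simp
    from usc_envelope_Q_less[OF V'[OF \<open>0 < t\<close>] this] obtain d where
      d: "0 < d" "!!s y. 0 < s ==> abs (s - t) < d ==> abs (y - x) < d ==> v (s, y) < U (t, x)" by blast
    obtain s y where s: "0 < s" "abs (s - t) < d" "abs (y - x) < d" "U (t, x) <= - W' (s, y)"
      using no_gap[OF \<open>0 < t\<close> d(1)] by blast
    show False using d(2)[OF s(1-3)] s(4) LW[OF s(1), of y] LvV(1)[OF s(1), of y] by linarith
  qed
  with VU[OF \<open>0 < t\<close>] show "usc_envelope Q v (t, x) = ereal (U (t, x))"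
    by (simp add: V'[OF \<open>0 < t\<close>] order_antisym)
  have "W' (t, x) <= - L (t, x)"
  proof (rule ccontr)
    assume "~ W' (t, x) <= - L (t, x)"
    then have "- L (t, x) < W' (t, x)" by simp
    from usc_envelope_Q_less[OF L'[OF \<open>0 < t\<close>] this] obtain d where
      d: "0 < d" "!!s y. 0 < s ==> abs (s - t) < d ==> abs (y - x) < d ==> - v (s, y) < W' (t, x)" by blast
    obtain s y where s: "0 < s" "abs (s - t) < d" "abs (y - x) < d" "U (s, y) <= - W' (t, x)"
      using no_gap'[OF \<open>0 < t\<close> d(1)] by blast
    show False using d(2)[OF s(1-3)] s(4) VU[OF s(1), of y] LvV(2)[OF s(1), of y] by linarith
  qed
  with LW[OF \<open>0 < t\<close>, of x] have "- L (t, x) = W' (t, x)" by simp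
  then have "L (t, x) = - W' (t, x)" by simp
  then show "lsc_envelope Q v (t, x) = ereal (- W' (t, x))" using L(1)[of "(t, x)"] \<open>0 < t\<close> by (simp add: Q_def)
qed

section \<open>The maximal subsolution is a solution\<close>

lemma U_usc_envelope:
  assumes "0 < t" shows "usc_envelope Q U (t, x) = ereal (U (t, x))"
proof (rule usc_envelope_Q_eqI)
  show "EX d>0. ALL s y. 0 < s --> abs (s - t) < d --> abs (y - x) < d --> U (s, y) < c" if "U (t, x) < c" for c
    by (rule usc_onD[OF jsub_usc[OF U_facts(1)] assms that]) blast
  show "EX s y. 0 < s & abs (s - t) < d & abs (y - x) < d & c < U (s, y)" if "c < U (t, x)" "0 < d" for c d
    using assms that by (intro exI[of _ t] exI[of _ x]) simp
qed

lemma U_lsc_envelope: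
  assumes "0 < t" shows "lsc_envelope Q U (t, x) = ereal (- W' (t, x))"
proof -
  have "usc_envelope Q (%q. - U q) (t, x) = ereal (W' (t, x))"
  proof (rule usc_envelope_Q_eqI)
    show "EX d>0. ALL s y. 0 < s --> abs (s - t) < d --> abs (y - x) < d --> - U (s, y) < c" if c: "W' (t, x) < c" for c
    proof -
      obtain d where d: "0 < d" "!!s y. 0 < s ==> abs (s - t) < d ==> abs (y - x) < d ==> W' (s, y) < c"
        using usc_onD[OF jsub_usc[OF W'_facts(1)] assms c] by blast
      have "- U (s, y) < c" if "0 < s" "abs (s - t) < d" "abs (y - x) < d" for s y
        using d(2)[OF that] ordered[OF that(1), of y] by linarith
      then show ?thesis using d(1) by blast
    qed
    show "EX s y. 0 < s & abs (s - t) < d & abs (y - x) < d & c < - U (s, y)" if cd: "c < W' (t, x)" "0 < d" for c d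
    proof -
      obtain s y where s: "0 < s" "abs (s - t) < d" "abs (y - x) < d" "U (s, y) <= - W' (t, x)"
        using no_gap'[OF assms cd(2)] by blast
      then have "c < - U (s, y)" using cd(1) by linarith
      with s(1-3) show ?thesis by blast
    qed
  qed
  then show ?thesis by (simp add: lsc_envelope_uminus)
qed

lemma U_usc_initial: "usc_envelope Q U (0, x) = ereal (g x)"
proof (rule usc_envelope_Q_eqI)
  show "EX d>0. ALL s y. 0 < s --> abs (s - 0) < d --> abs (y - x) < d --> U (s, y) < c" if c: "g x < c" for c
  proof -
    obtain d where d: "0 < d" "!!t y. 0 < t ==> t < d ==> abs (y - x) < d ==> U (t, y) < c"
      using starts_belowD[OF U_facts(2) c] by blast
    then show ?thesis by (intro exI[of _ d]) simp
  qed
  show "EX s y. 0 < s & abs (s - 0) < d & abs (y - x) < d & c < U (s, y)" if "c < g x" "0 < d" for c d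
  proof -
    obtain r where r: "0 < r" "!!y. x - r <= y ==> y < x ==> S y = Sm x & Sm y = Sm x"
      "!!y. x < y ==> y <= x + r ==> S y = S x & Sm y = S x" by (rule near[where x = x]) (rule that)
    define q where "q = min r d / 2"
    have q: "0 < q" "q <= r" "q < d" using r(1) that(2) by (auto simp: q_def)
    \<comment> \<open>A step to the side of \<open>x\<close> on which the datum takes its larger
      value: there \<open>l y = g x\<close>, and \<open>l y <= - W' <= U\<close> shortly after time
      0.\<close>
    define y where "y = (if Sm x <= S x then x + q else x - q)"
    have y: "abs (y - x) < d" "l y = g x" using q r(2)[of y] r(3)[of y] by (auto simp: y_def l_def g_def)
    obtain h where h: "0 < h" "!!t z. 0 < t ==> t < h ==> abs (z - y) < h ==> U (t, z) <= g y & l y <= - W' (t, z)"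
      using start_int by blast
    define s where "s = min h d / 2"
    have s: "0 < s" "s < h" "s < d" using h(1) that(2) by (auto simp: s_def)
    have "l y <= - W' (s, y)" using h(2)[of s y] s h(1) by simp
    then have "c < U (s, y)" using ordered[OF s(1), of y] that(1) y(2) by linarith
    then show ?thesis using s y(1) by (intro exI[of _ s] exI[of _ y]) simp
  qed
qed

lemma U_lsc_initial: "lsc_envelope Q U (0, x) = ereal (l x)"
proof -
  have "usc_envelope Q (%q. - U q) (0, x) = ereal (- l x)"
  proof (rule usc_envelope_Q_eqI)
    show "EX d>0. ALL s y. 0 < s --> abs (s - 0) < d --> abs (y - x) < d --> - U (s, y) < c" if c: "- l x < c" for c
    proof -
      obtain d where d: "0 < d" "!!t y. 0 < t ==> t < d ==> abs (y - x) < d ==> W' (t, y) < c"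
        using starts_belowD[OF W'_facts(2) c] by blast
      have "- U (s, y) < c" if "0 < s" "abs (s - 0) < d" "abs (y - x) < d" for s y
        using d(2)[of s y] ordered[OF that(1), of y] that by simp
      then show ?thesis using d(1) by blast
    qed
    show "EX s y. 0 < s & abs (s - 0) < d & abs (y - x) < d & c < - U (s, y)" if "c < - l x" "0 < d" for c d
    proof -
      obtain r where r: "0 < r" "!!y. x - r <= y ==> y < x ==> S y = Sm x & Sm y = Sm x"
        "!!y. x < y ==> y <= x + r ==> S y = S x & Sm y = S x" by (rule near[where x = x]) (rule that)
      define q where "q = min r d / 2"
      have q: "0 < q" "q <= r" "q < d" using r(1) that(2) by (auto simp: q_def)
      define y where "y = (if Sm x <= S x then x - q else x + q)"
      have y: "abs (y - x) < d" "g y = l x" using q r(2)[of y] r(3)[of y] by (auto simp: y_def l_def g_def)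
      obtain h where h: "0 < h" "!!t z. 0 < t ==> t < h ==> abs (z - y) < h ==> U (t, z) <= g y & l y <= - W' (t, z)"
        using start_int by blast
      define s where "s = min h d / 2"
      have s: "0 < s" "s < h" "s < d" using h(1) that(2) by (auto simp: s_def)
      have "U (s, y) <= g y" using h(2)[of s y] s h(1) by simp
      then have "c < - U (s, y)" using that(1) y(2) by linarith
      then show ?thesis using s y(1) by (intro exI[of _ s] exI[of _ y]) simp
    qed
  qed
  then show ?thesis by (simp add: lsc_envelope_uminus)
qed

lemma U_solution:
  assumes "0 < rho" shows "viscosity_solution rho eps U"
  unfolding viscosity_solution_def
proof
  show "EX V. (\<forall>p\<in>Q. usc_envelope Q U p = ereal (V p)) & subsolution rho eps V"
    using U_usc_envelope U_facts(1) subsolution_iff_jsub[OF eps assms] by (intro exI[of _ U]) (auto simp: Q_def)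
  have "supersolution rho eps (%q. - W' q)"
    using W'_facts(1) by (simp add: supersolution_uminus[OF eps assms] subsolution_iff_jsub[OF eps assms])
  then show "EX L. (\<forall>p\<in>Q. lsc_envelope Q U p = ereal (L p)) & supersolution rho eps L"
    using U_lsc_envelope by (intro exI[of _ "%q. - W' q"]) (auto simp: Q_def)
qed

lemma usc_envelope_datum: "usc_envelope UNIV S x = ereal (g x)"
  unfolding usc_envelope_def
proof (rule Limsup_ereal_eqI)
  obtain r where r: "0 < r" "!!y. x - r <= y ==> y < x ==> S y = Sm x & Sm y = Sm x"
    "!!y. x < y ==> y <= x + r ==> S y = S x & Sm y = S x" by (rule near[where x = x]) (rule that)
  show "eventually (%y. S y < c) (inf (nhds x) (principal UNIV))" if "g x < c" for c
  proof -
    have "S y < c" if "dist y x < r" for y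
      using r(2)[of y] r(3)[of y] that \<open>g x < c\<close> by (cases y x rule: linorder_cases) (auto simp: g_def dist_real_def)
    then show ?thesis using r(1) by (simp add: eventually_nhds_metric) blast
  qed
  show "frequently (%y. c < S y) (inf (nhds x) (principal UNIV))" if "c < g x" for c
    unfolding frequently_def
  proof
    assume "eventually (%y. ~ c < S y) (inf (nhds x) (principal UNIV))"
    then obtain d where d: "0 < d" "!!y. dist y x < d ==> ~ c < S y" by (auto simp: eventually_nhds_metric)
    define q where "q = min r d / 2"
    have q: "0 < q" "q <= r" "q < d" using r(1) d(1) by (auto simp: q_def)
    have "~ c < S x" "~ c < S (x - q)" using d q by (auto simp: dist_real_def)
    moreover have "S (x - q) = Sm x" using r(2)[of "x - q"] q by simp
    ultimately show False using that by (auto simp: g_def)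
  qed
qed

end

lemma (in step_datum) lsc_envelope_datum: "lsc_envelope UNIV S x = ereal (l x)"
proof -
  interpret neg: step_datum eps G B "%x. - S x" "%x. - Sm x" T Y by (rule uminus)
  have "neg.g x = - l x" by (auto simp: neg.g_def l_def max_def min_def)
  with neg.usc_envelope_datum[of x] show ?thesis by (simp add: lsc_envelope_uminus)
qed

text \<open>\<open>T\<close> counts the points up to \<open>y\<close> regardless of their sign, so
  it bounds the variation in units of \<open>1 / real n\<close> and has range in
  \<open>[0, n]\<close>. Coefficients of modulus at most one give \<open>G = 1\<close>.\<close>

lemma initial_datum_step:
  fixes n :: nat and x :: "nat => real" and b :: "nat => int"
  assumes "0 < n" and b: "b \<in> {1..n} \<rightarrow> {-1, 0, 1}"
  defines "Sm \<equiv> %y. 1 / real n * (\<Sum>i=1..n. real_of_int (b i) * (if x i < y then 1 else 0))"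
    and "T \<equiv> %y. \<Sum>i=1..n. if x i <= y then 1 else 0 :: real"
  shows "step_datum (1 / real n) 1 (real n) (initial_datum n x b) Sm T (x ` {1..n})"
proof
  let ?S = "initial_datum n x b"
  have S: "?S y = 1 / real n * (\<Sum>i=1..n. real_of_int (b i) * (if x i <= y then 1 else 0))" for y
    by (simp add: initial_datum_def heaviside_def)
  have b1: "abs (real_of_int (b i)) <= 1" if "i \<in> {1..n}" for i
  proof -
    have "b i \<in> {-1, 0, 1}" using b that by blast
    then show ?thesis by auto
  qed
  have bound: "abs (1 / real n * (\<Sum>i=1..n. real_of_int (b i) * c i)) <= 1 / real n * (\<Sum>i=1..n. c i)"
    if "!!i. 0 <= c i" for c :: "nat => real"
  proof -
    have "abs (\<Sum>i=1..n. real_of_int (b i) * c i) <= (\<Sum>i=1..n. (abs (real_of_int (b i) * c i)))" by (rule sum_abs)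
    also have "\<dots> <= (\<Sum>i=1..n. c i)"
    proof (rule sum_mono)
      fix i assume "i \<in> {1..n}"
      from mult_right_mono[OF b1[OF this] that[of i]] show "abs (real_of_int (b i) * c i) <= c i"
        using that[of i] by (simp add: abs_mult)
    qed
    finally show ?thesis using \<open>0 < n\<close> by (simp add: abs_mult divide_right_mono)
  qed
  have count: "(\<Sum>i=1..n. if P i then 1 else 0 :: real) <= real n" for P
  proof -
    have "(\<Sum>i=1..n. if P i then 1 else 0 :: real) <= (\<Sum>i=1..n. 1)" by (rule sum_mono) simp
    then show ?thesis by simp
  qed
  have bound1: "abs (1 / real n * (\<Sum>i=1..n. real_of_int (b i) * (if P i then 1 else 0))) <= 1" for P
  proof -
    have "1 / real n * (\<Sum>i=1..n. if P i then 1 else 0 :: real) <= 1 / real n * real n"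
      by (rule mult_left_mono[OF count]) simp
    also have "\<dots> = 1" using \<open>0 < n\<close> by simp
    finally show ?thesis by (intro order_trans[OF bound]) auto
  qed
  show "0 < 1 / real n" "0 <= (1 :: real)" "1 / (1 / real n) \<in> \<int>" using \<open>0 < n\<close> by auto
  show "abs (?S y) <= 1" "abs (Sm y) <= 1" for y unfolding S Sm_def by (rule bound1)+
  have int: "1 / real n * (\<Sum>i=1..n. real_of_int (b i) * (if P i then 1 else 0)) / (1 / real n) \<in> \<int>" for P
    using \<open>0 < n\<close> by (auto intro!: Ints_sum Ints_mult)
  show "?S y / (1 / real n) \<in> \<int>" "Sm y / (1 / real n) \<in> \<int>" for y unfolding S Sm_def by (rule int)+
  show "EX r>0. ALL y. (z - r <= y --> y < z --> ?S y = Sm z & Sm y = Sm z) &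
      (z < y --> y <= z + r --> ?S y = ?S z & Sm y = ?S z)" for z
  proof -
    have "finite (insert z (x ` {1..n}))" by simp
    then obtain R where R: "0 < R" "!!y y'. y \<in> insert z (x ` {1..n}) ==> y' \<in> insert z (x ` {1..n}) ==> y ~= y' ==> 8 * R <= abs (y - y')"
      by (rule finite_separated) blast
    have sep: "x i = z | 8 * R <= abs (x i - z)" if "i \<in> {1..n}" for i using R(2)[of "x i" z] that by blast
    have left: "?S y = Sm z & Sm y = Sm z" if "z - R <= y" "y < z" for y
    proof -
      have "(x i <= y) = (x i < z) & (x i < y) = (x i < z)" if "i \<in> {1..n}" for i
        using sep[OF that] R(1) \<open>z - R <= y\<close> \<open>y < z\<close> by linarith
      then show ?thesis unfolding S Sm_def by (auto intro!: arg_cong[where f = "%s. s / real n"] sum.cong)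
    qed
    have right: "?S y = ?S z & Sm y = ?S z" if "z < y" "y <= z + R" for y
    proof -
      have "(x i <= y) = (x i <= z) & (x i < y) = (x i <= z)" if "i \<in> {1..n}" for i
        using sep[OF that] R(1) \<open>z < y\<close> \<open>y <= z + R\<close> by linarith
      then show ?thesis unfolding S Sm_def by (auto intro!: arg_cong[where f = "%s. s / real n"] sum.cong)
    qed
    show ?thesis using R(1) left right by blast
  qed
  show "finite (x ` {1..n})" by simp
  show "Sm y = ?S y" if "y \<notin> x ` {1..n}" for y
  proof -
    have "(x i < y) = (x i <= y)" if "i \<in> {1..n}" for i using \<open>y \<notin> x ` {1..n}\<close> that by (auto simp: less_le)
    then show ?thesis unfolding S Sm_def by (auto intro!: arg_cong[where f = "%s. s / real n"] sum.cong)
  qed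
  show "mono T" unfolding T_def by (intro monoI sum_mono) auto
  show "0 <= T y" for y unfolding T_def by (intro sum_nonneg) auto
  show "T y <= real n" for y unfolding T_def by (rule count)
  show "abs (?S y' - ?S y) <= 1 / real n * (T y' - T y)" if "y < y'" for y y'
  proof -
    define c where "c i = (if y < x i & x i <= y' then 1 else 0 :: real)" for i
    have c: "c i = (if x i <= y' then 1 else 0) - (if x i <= y then 1 else 0)" for i using that by (auto simp: c_def)
    have "?S y' - ?S y = 1 / real n * (\<Sum>i=1..n. real_of_int (b i) * c i)"
      unfolding S c right_diff_distrib sum_subtractf by (rule refl)
    moreover have "T y' - T y = (\<Sum>i=1..n. c i)" unfolding T_def c sum_subtractf by (rule refl)
    ultimately show ?thesis using bound[of c] by (simp add: c_def)
  qed
qed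

theorem proposition4p5:
  fixes n :: nat and x :: "nat \<Rightarrow> real" and b :: "nat \<Rightarrow> int" and \<rho> :: real
  assumes "n \<ge> 2" and "(x, b) \<in> state_space n" and "\<rho> > 0"
  shows "(\<exists>v. viscosity_solution \<rho> (1 / real n) v \<and> has_initial_datum v (initial_datum n x b)) \<and>
    (\<forall>v w. viscosity_solution \<rho> (1 / real n) v \<and> has_initial_datum v (initial_datum n x b) \<and>
           viscosity_solution \<rho> (1 / real n) w \<and> has_initial_datum w (initial_datum n x b) \<longrightarrow>
       (\<forall>p\<in>Q. usc_envelope Q v p = usc_envelope Q w p \<and> lsc_envelope Q v p = lsc_envelope Q w p))"
proof -
  have "0 < n" "b \<in> {1..n} \<rightarrow> {-1, 0, 1}" using assms by (auto simp: state_space_def)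
  from initial_datum_step[OF this, of x]
  interpret step_datum "1 / real n" 1 "real n" "initial_datum n x b"
    "%y. 1 / real n * (\<Sum>i=1..n. real_of_int (b i) * (if x i < y then 1 else 0))"
    "%y. \<Sum>i=1..n. if x i <= y then 1 else 0" "x ` {1..n}" .
  have init: "has_initial_datum v (initial_datum n x b) \<longleftrightarrow>
      (ALL y. usc_envelope Q v (0, y) = ereal (g y) & lsc_envelope Q v (0, y) = ereal (l y))" for v
    by (simp add: has_initial_datum_def usc_envelope_datum lsc_envelope_datum)
  \<comment> \<open>Every solution has the envelopes of one fixed function, so two solutions are
    never compared with each other.\<close>
  have unique: "usc_envelope Q v p = ereal (U p) & lsc_envelope Q v p = ereal (- W' p)"
    if "viscosity_solution \<rho> (1 / real n) v" "has_initial_datum v (initial_datum n x b)" "p \<in> Q" for v p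
  proof -
    obtain t y where p: "p = (t, y)" "0 < t" using \<open>p \<in> Q\<close> by (auto simp: Q_def)
    have "usc_envelope Q v (0, y) = ereal (g y)" "lsc_envelope Q v (0, y) = ereal (l y)" for y
      using that(2) unfolding init by blast+
    from solution_envelopes[OF assms(3) that(1) this p(2)] show ?thesis by (simp add: p(1))
  qed
  have hU: "has_initial_datum U (initial_datum n x b)"
    unfolding init using U_usc_initial U_lsc_initial by blast
  show ?thesis
  proof (intro conjI exI[of _ U] allI impI ballI U_solution[OF assms(3)] hU)
    fix v w p
    assume vw: "viscosity_solution \<rho> (1 / real n) v & has_initial_datum v (initial_datum n x b) &
      viscosity_solution \<rho> (1 / real n) w & has_initial_datum w (initial_datum n x b)" and p: "p \<in> Q"
    show "usc_envelope Q v p = usc_envelope Q w p" "lsc_envelope Q v p = lsc_envelope Q w p"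
      using unique[OF _ _ p, of v] unique[OF _ _ p, of w] vw by simp_all
  qed
qed

end
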